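(* Let $\mathbb K$ be an algebraically closed field of characteristic $3$. Let $\mathfrak e_8=\mathfrak g(A)$ with purely even Cartan matrix $$A=\begin{pmatrix}2&0&-1&0&0&0&0&0\\0&2&0&-1&0&0&0&0\\-1&0&2&-1&0&0&0&0\\0&-1&-1&2&-1&0&0&0\\0&0&0&-1&2&-1&0&0\\0&0&0&0&-1&2&-1&0\\0&0&0&0&0&-1&2&-1\\0&0&0&0&0&0&-1&2\end{pmatrix}.$$ Let $\mathfrak g(3,6)=\mathfrak g(\widetilde A)$ be the Elduque and Cunha Lie superalgebra with Cartan matrix $$\widetilde A=\begin{pmatrix}0&-1&0&0\\-1&0&-1&0\\0&-1&0&-2\\0&0&-1&2\end{pmatrix}$$ in which indices $1,2,3$ are odd and index $4$ is even. Then the semisimplification of $\mathfrak e_8$, as an object in $\mathrm{Rep}\,\alpha_3$ under the adjoint action of $e_1+e_2+e_6+e_8$, is (isomorphic as a Lie superalgebra to) $\mathfrak g(3,6)$.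
   Context: **Contragredient Lie superalgebras.** Lie superalgebras in characteristic $3$ are required to satisfy $[x,[x,x]]=0$ for odd $x$. Let $A=(a_{ij})$ be an $n\times n$ integer matrix (a Cartan matrix) with a parity $\mathrm{par}(i)\in\mathbb Z/2$ for each index; let $\overline A=(\overline a_{ij})$ be its reduction mod $3$, of rank $s$. Let $\widetilde{\mathfrak h}$ be a $\mathbb K$-vector space of dimension $2n-s$ with linearly independent $h_1,\dots,h_n\in\widetilde{\mathfrak h}$ and linearly independent $\alpha_1,\dots,\alpha_n\in\widetilde{\mathfrak h}^*$ such that $\alpha_j(h_i)=\overline a_{ij}$. $\widetilde{\mathfrak g}(A)$ is the Lie superalgebra generated by $\widetilde{\mathfrak h}$ (even) and $e_i,f_i$ ($1\le i\le n$) of parity $\mathrm{par}(i)$, with relations $[e_i,f_j]=\delta_{ij}h_i$, $[h,e_j]=\alpha_j(h)e_j$, $[h,f_j]=-\alpha_j(h)f_j$, $[\widetilde{\mathfrak h},\widetilde{\mathfrak h}]=0$. It is graded by the free abelian group $Q=\bigoplus_k\mathbb Z\alpha_k$ with $\deg e_i=\alpha_i$, $\deg f_i=-\alpha_i$, $\deg h=0$. $\mathfrak g(A)=\widetilde{\mathfrak g}(A)/\mathfrak r$, where $\mathfrak r$ is the largest $Q$-graded ideal meeting $\widetilde{\mathfrak h}$ trivially; images of $e_i,f_i,h_i$ keep their names. If all parities are $0$, $\mathfrak g(A)$ is a Lie algebra. **Semisimplification.** $\mathrm{Rep}\,\alpha_3$ (representations of the Frobenius kernel of $\mathbb G_a$)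 is the symmetric tensor category of finite-dimensional $\mathbb K[t]/(t^3)$-modules, with $t$ acting on $V\otimes W$ by $t\otimes1+1\otimes t$ and the flip as braiding. Its indecomposables are $J_1,J_2,J_3$, where $t$ acts on $J_n=\mathbb K^n$ as one nilpotent Jordan block. A Lie algebra $\mathfrak g$ with a derivation $d$, $d^3=0$, is a Lie algebra in $\mathrm{Rep}\,\alpha_3$ with $t$ acting by $d$; "under the adjoint action of $x$" means $d=\mathrm{ad}\,x$. The semisimplification functor $V\mapsto\overline V$ is the quotient of $\mathrm{Rep}\,\alpha_3$ by negligible morphisms ($u:V\to W$ with $\mathrm{tr}(u\circ v)=0$ for all $v:W\to V$), with target the Verlinde category $\mathrm{Ver}_3$, whose simple objects are $L_1=\overline{J_1}$, $L_2=\overline{J_2}$ ($\overline{J_3}=0$); $\mathrm{Ver}_3$ is identified with super vector spaces, $L_1$ being an even line and $L_2$ an odd line, so $\overline{\mathfrak g}$ is a Lie superalgebra. Explicitly, decompose $\mathfrak g$ into Jordan blocks $x_i$ ($i\le n_1$), $x_i\mapsto x_i'$ ($n_1<i\le n_1+n_2$), and blocks $x_i\mapsto x_i'\mapsto x_i''$ (arrows are the action of $d$). Then $\overline{\mathfrak g}$ has basis $y_i$ ($i\le n_1+n_2$), even for $i\le n_1$ and odd for $i>n_1$; the coefficient of $y_k$ in $[y_i,y_j]$ is the coefficient of $x_k$ in $[x_i,x_j]$ if the parities of $y_i,y_j,y_k$ are compatible and $y_i,y_j$ are not both odd; it is the coefficient of $x_k$ in $-[x_i,x_j']+[x_i',x_j]$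 if $i,j>n_1$, $k\le n_1$; and $0$ otherwise. *)

theory Defs
  imports
    "HOL-Analysis.Analysis"
    "HOL-Computational_Algebra.Polynomial"
    "HOL-Library.Poly_Mapping"
    "HOL-Library.Z2"
begin

section \<open>Superalgebras, ideals and quotients\<close>

text \<open>
  A structure with the operations of a (not necessarily associative) superalgebra over a field.
  The subspace \<open>part A p\<close> is the homogeneous component of parity \<open>p \<in> \<int>/2\<close>.
\<close>

record ('k, 'a) superalgebra =
  carrier :: "'a set"
  zero :: 'a ("\<zero>\<index>")
  add :: "'a \<Rightarrow> 'a \<Rightarrow> 'a" (infixl "\<oplus>\<index>" 65)
  scale :: "'k \<Rightarrow> 'a \<Rightarrow> 'a" (infixr "\<odot>\<index>" 75)
  bracket :: "'a \<Rightarrow> 'a \<Rightarrow> 'a"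
  part :: "bit \<Rightarrow> 'a set"

definition subspace_of :: "('k, 'a) superalgebra \<Rightarrow> 'a set \<Rightarrow> bool" where
  "subspace_of A S \<longleftrightarrow> S \<subseteq> carrier A \<and> zero A \<in> S \<and>
     (\<forall>x\<in>S. \<forall>y\<in>S. add A x y \<in> S) \<and> (\<forall>c. \<forall>x\<in>S. scale A c x \<in> S)"

definition span_of :: "('k, 'a) superalgebra \<Rightarrow> 'a set \<Rightarrow> 'a set" where
  "span_of A S = \<Inter>{T. subspace_of A T \<and> S \<subseteq> T}"

definition ideal_of :: "('k, 'a) superalgebra \<Rightarrow> 'a set \<Rightarrow> bool" where
  "ideal_of A I \<longleftrightarrow> subspace_of A I \<and>
     (\<forall>x\<in>carrier A. \<forall>y\<in>I. bracket A x y \<in> I \<and> bracket A y x \<in> I)"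

definition ideal_generated_by :: "('k, 'a) superalgebra \<Rightarrow> 'a set \<Rightarrow> 'a set" where
  "ideal_generated_by A S = \<Inter>{I. ideal_of A I \<and> S \<subseteq> I}"

definition coset :: "('k, 'a) superalgebra \<Rightarrow> 'a set \<Rightarrow> 'a \<Rightarrow> 'a set" where
  "coset A I x = (\<lambda>i. add A x i) ` I"

definition quotient :: "('k, 'a) superalgebra \<Rightarrow> 'a set \<Rightarrow> ('k, 'a set) superalgebra" where
  "quotient A I =
     \<lparr> carrier = coset A I ` carrier A,
       zero = coset A I (zero A),
       add = (\<lambda>X Y. \<Union>x\<in>X. \<Union>y\<in>Y. coset A I (add A x y)),
       scale = (\<lambda>c X. \<Union>x\<in>X. coset A I (scale A c x)),
       bracket = (\<lambda>X Y. \<Union>x\<in>X. \<Union>y\<in>Y. coset A I (bracket A x y)),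
       part = (\<lambda>p. coset A I ` part A p) \<rparr>"

definition superalgebra_iso ::
  "('k, 'a) superalgebra \<Rightarrow> ('k, 'b) superalgebra \<Rightarrow> ('a \<Rightarrow> 'b) \<Rightarrow> bool" where
  "superalgebra_iso A B \<phi> \<longleftrightarrow> bij_betw \<phi> (carrier A) (carrier B) \<and>
     (\<forall>x\<in>carrier A. \<forall>y\<in>carrier A. \<phi> (add A x y) = add B (\<phi> x) (\<phi> y)) \<and>
     (\<forall>c. \<forall>x\<in>carrier A. \<phi> (scale A c x) = scale B c (\<phi> x)) \<and>
     (\<forall>x\<in>carrier A. \<forall>y\<in>carrier A. \<phi> (bracket A x y) = bracket B (\<phi> x) (\<phi> y)) \<and>
     (\<forall>p. \<phi> ` part A p = part B p)"

definition superalgebra_isomorphic ::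
  "('k, 'a) superalgebra \<Rightarrow> ('k, 'b) superalgebra \<Rightarrow> bool" where
  "superalgebra_isomorphic A B \<longleftrightarrow> (\<exists>\<phi>. superalgebra_iso A B \<phi>)"


section \<open>Realizations of a Cartan matrix\<close>

text \<open>
  The space \<open>\<hh>\<close> carrying the \<open>h i\<close> is the whole type \<open>'v\<close>, with scalar multiplication \<open>sc\<close>.
  As \<open>2n - s \<ge> n \<ge> 1\<close>, the dimension condition forces \<open>'v\<close> to be finite-dimensional.
\<close>

locale realization = vector_space sc
  for sc :: "'k::field \<Rightarrow> 'v::ab_group_add \<Rightarrow> 'v" +
  fixes A :: "int ^ 'n ^ 'n" and h :: "'n::finite \<Rightarrow> 'v" and \<alpha> :: "'n \<Rightarrow> 'v \<Rightarrow> 'k"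
  assumes dim_cartan: "vector_space.dim sc UNIV = 2 * CARD('n) - rank ((\<chi> i j. of_int (A $ i $ j)) :: 'k ^ 'n ^ 'n)"
    and h_independent: "(\<Sum>i\<in>UNIV. sc (c i) (h i)) = 0 \<Longrightarrow> c i = 0"
    and \<alpha>_linear: "Vector_Spaces.linear sc (*) (\<alpha> i)"
    and \<alpha>_independent: "(\<And>v. (\<Sum>i\<in>UNIV. c i * \<alpha> i v) = 0) \<Longrightarrow> c i = 0"
    and \<alpha>_h: "\<alpha> j (h i) = of_int (A $ i $ j)"


section \<open>Contragredient Lie superalgebras\<close>

datatype ('v, 'n) generator = Cartan 'v | Pos 'n | Neg 'n

datatype 'g word = Gen 'g | Br "'g word" "'g word"

fun gen_parity :: "('n \<Rightarrow> bit) \<Rightarrow> ('v, 'n) generator \<Rightarrow> bit" where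
  "gen_parity par (Cartan v) = 0"
| "gen_parity par (Pos i) = par i"
| "gen_parity par (Neg i) = par i"

primrec word_parity :: "('n \<Rightarrow> bit) \<Rightarrow> ('v, 'n) generator word \<Rightarrow> bit" where
  "word_parity par (Gen g) = gen_parity par g"
| "word_parity par (Br s t) = word_parity par s + word_parity par t"

fun gen_degree :: "('v, 'n::finite) generator \<Rightarrow> int ^ 'n" where
  "gen_degree (Cartan v) = 0"
| "gen_degree (Pos i) = axis i 1"
| "gen_degree (Neg i) = - axis i 1"

primrec word_degree :: "('v, 'n::finite) generator word \<Rightarrow> int ^ 'n" where
  "word_degree (Gen g) = gen_degree g"
| "word_degree (Br s t) = word_degree s + word_degree t"

text \<open>The free nonassociative superalgebra: linear combinations of bracketed words.\<close>

type_synonym ('k, 'v, 'n) free_elem = "('v, 'n) generator word \<Rightarrow>\<^sub>0 'k"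

definition free_scale :: "'k::field \<Rightarrow> ('g word \<Rightarrow>\<^sub>0 'k) \<Rightarrow> ('g word \<Rightarrow>\<^sub>0 'k)" where
  "free_scale c x = Poly_Mapping.map ((*) c) x"

definition free_bracket ::
  "('g word \<Rightarrow>\<^sub>0 'k::field) \<Rightarrow> ('g word \<Rightarrow>\<^sub>0 'k) \<Rightarrow> ('g word \<Rightarrow>\<^sub>0 'k)" where
  "free_bracket x y =
     (\<Sum>s\<in>Poly_Mapping.keys x. \<Sum>t\<in>Poly_Mapping.keys y.
        Poly_Mapping.single (Br s t) (Poly_Mapping.lookup x s * Poly_Mapping.lookup y t))"

definition free_superalgebra ::
  "('n \<Rightarrow> bit) \<Rightarrow> ('k::field, ('k, 'v, 'n) free_elem) superalgebra" where
  "free_superalgebra par =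
     \<lparr> carrier = UNIV, zero = 0, add = (+), scale = free_scale, bracket = free_bracket,
       part = (\<lambda>p. {x. \<forall>w\<in>Poly_Mapping.keys x. word_parity par w = p}) \<rparr>"

abbreviation gen :: "('v, 'n) generator \<Rightarrow> ('k::field, 'v, 'n) free_elem" where
  "gen g \<equiv> Poly_Mapping.single (Gen g) 1"

definition koszul_sign :: "bit \<Rightarrow> bit \<Rightarrow> 'k::field" where
  "koszul_sign p q = (if p = 1 \<and> q = 1 then - 1 else 1)"

text \<open>
  The first two rules make \<open>v \<mapsto> gen (Cartan v)\<close> linear, the next three are the axioms of a Lie
  superalgebra in characteristic 3, and the others are the defining relations.
\<close>

inductive_set relators ::
  "('n \<Rightarrow> bit) \<Rightarrow> ('k::field \<Rightarrow> 'v::ab_group_add \<Rightarrow> 'v) \<Rightarrow> ('n \<Rightarrow> 'v) \<Rightarrow> ('n \<Rightarrow> 'v \<Rightarrow> 'k)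
     \<Rightarrow> ('k, 'v, 'n) free_elem set"
  for par sc h \<alpha>
where
  cartan_add: "gen (Cartan (u + v)) - gen (Cartan u) - gen (Cartan v) \<in> relators par sc h \<alpha>"
| cartan_scale: "gen (Cartan (sc c v)) - free_scale c (gen (Cartan v)) \<in> relators par sc h \<alpha>"
| antisymmetry:
    "\<lbrakk> x \<in> part (free_superalgebra par) p; y \<in> part (free_superalgebra par) q \<rbrakk> \<Longrightarrow>
     free_bracket x y + free_scale (koszul_sign p q) (free_bracket y x) \<in> relators par sc h \<alpha>"
| jacobi:
    "\<lbrakk> x \<in> part (free_superalgebra par) p; y \<in> part (free_superalgebra par) q;
       z \<in> part (free_superalgebra par) r \<rbrakk> \<Longrightarrow>
     free_bracket x (free_bracket y z) - free_bracket (free_bracket x y) z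
       - free_scale (koszul_sign p q) (free_bracket y (free_bracket x z)) \<in> relators par sc h \<alpha>"
| odd_cube:
    "x \<in> part (free_superalgebra par) 1 \<Longrightarrow> free_bracket x (free_bracket x x) \<in> relators par sc h \<alpha>"
| pos_neg_same: "free_bracket (gen (Pos i)) (gen (Neg i)) - gen (Cartan (h i)) \<in> relators par sc h \<alpha>"
| pos_neg_diff: "i \<noteq> j \<Longrightarrow> free_bracket (gen (Pos i)) (gen (Neg j)) \<in> relators par sc h \<alpha>"
| cartan_pos:
    "free_bracket (gen (Cartan v)) (gen (Pos j)) - free_scale (\<alpha> j v) (gen (Pos j))
       \<in> relators par sc h \<alpha>"
| cartan_neg:
    "free_bracket (gen (Cartan v)) (gen (Neg j)) + free_scale (\<alpha> j v) (gen (Neg j))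
       \<in> relators par sc h \<alpha>"
| cartan_cartan: "free_bracket (gen (Cartan u)) (gen (Cartan v)) \<in> relators par sc h \<alpha>"

text \<open>
  In the following, the Cartan matrix \<open>A\<close> enters through a realization \<open>(sc, h, \<alpha>)\<close> of it:
  \<open>gtilde par sc h \<alpha>\<close> is the algebra generated by the Cartan subalgebra, the \<open>e i\<close> and the \<open>f i\<close>,
  and \<open>contragredient par sc h \<alpha>\<close> is its quotient by the largest graded ideal \<open>gradical\<close> that
  meets the Cartan subalgebra trivially.
\<close>

context
  fixes par :: "'n::finite \<Rightarrow> bit"
    and sc :: "'k::field \<Rightarrow> 'v::ab_group_add \<Rightarrow> 'v"
    and h :: "'n \<Rightarrow> 'v"
    and \<alpha> :: "'n \<Rightarrow> 'v \<Rightarrow> 'k"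
begin

definition gtilde_class :: "('k, 'v, 'n) free_elem \<Rightarrow> ('k, 'v, 'n) free_elem set" where
  "gtilde_class =
     coset (free_superalgebra par) (ideal_generated_by (free_superalgebra par) (relators par sc h \<alpha>))"

definition gtilde :: "('k, ('k, 'v, 'n) free_elem set) superalgebra" where
  "gtilde = quotient (free_superalgebra par)
     (ideal_generated_by (free_superalgebra par) (relators par sc h \<alpha>))"

definition gtilde_cartan :: "('k, 'v, 'n) free_elem set set" where
  "gtilde_cartan = range (\<lambda>v. gtilde_class (gen (Cartan v)))"

definition gtilde_grade :: "int ^ 'n \<Rightarrow> ('k, 'v, 'n) free_elem set set" where
  "gtilde_grade q = gtilde_class ` {x. \<forall>w\<in>Poly_Mapping.keys x. word_degree w = q}"

definition graded_ideal :: "('k, 'v, 'n) free_elem set set \<Rightarrow> bool" where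
  "graded_ideal J \<longleftrightarrow> ideal_of gtilde J \<and> J = span_of gtilde (\<Union>q. J \<inter> gtilde_grade q)"

definition gradical :: "('k, 'v, 'n) free_elem set set" where
  "gradical = (GREATEST J. graded_ideal J \<and> J \<inter> gtilde_cartan = {zero gtilde})"

definition contragredient :: "('k, ('k, 'v, 'n) free_elem set set) superalgebra" where
  "contragredient = quotient gtilde gradical"

definition e_gen :: "'n \<Rightarrow> ('k, 'v, 'n) free_elem set set" where
  "e_gen i = coset gtilde gradical (gtilde_class (gen (Pos i)))"

end


section \<open>Semisimplification\<close>

primrec lincomb :: "('k, 'a) superalgebra \<Rightarrow> 'k list \<Rightarrow> 'a list \<Rightarrow> 'a" where
  "lincomb A cs [] = zero A"
| "lincomb A cs (v # vs) = add A (scale A (hd cs) v) (lincomb A (tl cs) vs)"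

definition is_basis :: "('k, 'a) superalgebra \<Rightarrow> 'a list \<Rightarrow> bool" where
  "is_basis A vs \<longleftrightarrow> set vs \<subseteq> carrier A \<and>
     (\<forall>v\<in>carrier A. \<exists>!cs. length cs = length vs \<and> lincomb A cs vs = v)"

definition coordinate :: "('k, 'a) superalgebra \<Rightarrow> 'a list \<Rightarrow> 'a \<Rightarrow> nat \<Rightarrow> 'k" where
  "coordinate A vs v k = (THE cs. length cs = length vs \<and> lincomb A cs vs = v) ! k"

text \<open>A finite-dimensional, purely even algebra regarded as an algebra in \<open>Rep \<alpha>\<^sub>3\<close> through \<open>d\<close>.\<close>

definition alpha3_algebra :: "('k, 'a) superalgebra \<Rightarrow> ('a \<Rightarrow> 'a) \<Rightarrow> bool" where
  "alpha3_algebra A d \<longleftrightarrow>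
     part A 0 = carrier A \<and> (\<exists>vs. is_basis A vs) \<and>
     (\<forall>x\<in>carrier A. d x \<in> carrier A) \<and>
     (\<forall>x\<in>carrier A. \<forall>y\<in>carrier A. d (add A x y) = add A (d x) (d y)) \<and>
     (\<forall>c. \<forall>x\<in>carrier A. d (scale A c x) = scale A c (d x)) \<and>
     (\<forall>x\<in>carrier A. \<forall>y\<in>carrier A.
        d (bracket A x y) = add A (bracket A (d x) y) (bracket A x (d y))) \<and>
     (\<forall>x\<in>carrier A. d (d (d x)) = zero A)"

text \<open>
  A Jordan decomposition is given by the lists \<open>xs\<close>, \<open>ys\<close>, \<open>zs\<close> of the leading vectors of the
  blocks of size 1, 2 and 3. The heads \<open>xs @ ys\<close> come first in the basis, so that the coordinate
  at such a head \<open>x\<^sub>k\<close> is the one at position \<open>k\<close>.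
\<close>

definition jordan_basis :: "('a \<Rightarrow> 'a) \<Rightarrow> 'a list \<Rightarrow> 'a list \<Rightarrow> 'a list \<Rightarrow> 'a list" where
  "jordan_basis d xs ys zs = xs @ ys @ map d ys @ zs @ map d zs @ map (\<lambda>z. d (d z)) zs"

definition jordan_decomposition ::
  "('k, 'a) superalgebra \<Rightarrow> ('a \<Rightarrow> 'a) \<Rightarrow> 'a list \<Rightarrow> 'a list \<Rightarrow> 'a list \<Rightarrow> bool" where
  "jordan_decomposition A d xs ys zs \<longleftrightarrow> is_basis A (jordan_basis d xs ys zs) \<and>
     (\<forall>x\<in>set xs. d x = zero A) \<and>
     (\<forall>y\<in>set ys. d (d y) = zero A) \<and>
     (\<forall>z\<in>set zs. d (d (d z)) = zero A)"

context
  fixes A :: "('k::field, 'a) superalgebra" and d :: "'a \<Rightarrow> 'a" and xs ys zs :: "'a list"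
begin

definition head_parity :: "nat \<Rightarrow> bit" where
  "head_parity i = (if i < length xs then 0 else 1)"

text \<open>
  The formula for two odd heads comes from the embedding \<open>1 \<mapsto> - v \<otimes> t v + t v \<otimes> v\<close> of \<open>J\<^sub>1\<close> as a
  direct summand of \<open>J\<^sub>2 \<otimes> J\<^sub>2\<close>, where \<open>v\<close> generates \<open>J\<^sub>2\<close>; the complement \<open>J\<^sub>3\<close> is negligible.
\<close>

definition structure_const :: "nat \<Rightarrow> nat \<Rightarrow> nat \<Rightarrow> 'k" where
  "structure_const i j k =
     (let b = xs @ ys; coeff = (\<lambda>v. coordinate A (jordan_basis d xs ys zs) v k) in
      if head_parity k \<noteq> head_parity i + head_parity j then 0
      else if head_parity i = 1 \<and> head_parity j = 1
        then coeff (add A (scale A (- 1) (bracket A (b ! i) (d (b ! j)))) (bracket A (d (b ! i)) (b ! j)))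
      else coeff (bracket A (b ! i) (b ! j)))"

text \<open>An element is given by its coefficients in the basis \<open>y\<^sub>0, y\<^sub>1, \<dots>\<close>.\<close>

definition semisimplification :: "('k, nat \<Rightarrow> 'k) superalgebra" where
  "semisimplification =
     (let N = length xs + length ys; V = {c. \<forall>k\<ge>N. c k = 0} in
      \<lparr> carrier = V,
        zero = (\<lambda>k. 0),
        add = (\<lambda>a b k. a k + b k),
        scale = (\<lambda>c a k. c * a k),
        bracket = (\<lambda>a b k. if k < N
           then (\<Sum>i<N. \<Sum>j<N. a i * b j * structure_const i j k) else 0),
        part = (\<lambda>p. {c \<in> V. \<forall>k. c k \<noteq> 0 \<longrightarrow> head_parity k = p}) \<rparr>)"

end


section \<open>The Cartan matrices\<close>

text \<open>In the index types \<open>8\<close> and \<open>4\<close>, the last index is \<open>8 = 0\<close> and \<open>4 = 0\<close> respectively.\<close>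

definition e8_matrix :: "int ^ 8 ^ 8" where
  "e8_matrix = vector
     [vector [ 2,  0, -1,  0,  0,  0,  0,  0],
      vector [ 0,  2,  0, -1,  0,  0,  0,  0],
      vector [-1,  0,  2, -1,  0,  0,  0,  0],
      vector [ 0, -1, -1,  2, -1,  0,  0,  0],
      vector [ 0,  0,  0, -1,  2, -1,  0,  0],
      vector [ 0,  0,  0,  0, -1,  2, -1,  0],
      vector [ 0,  0,  0,  0,  0, -1,  2, -1],
      vector [ 0,  0,  0,  0,  0,  0, -1,  2]]"

definition e8_parity :: "8 \<Rightarrow> bit" where
  "e8_parity i = 0"

definition g36_matrix :: "int ^ 4 ^ 4" where
  "g36_matrix = vector
     [vector [ 0, -1,  0,  0],
      vector [-1,  0, -1,  0],
      vector [ 0, -1,  0, -2],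
      vector [ 0,  0, -1,  2]]"

definition g36_parity :: "4 \<Rightarrow> bit" where
  "g36_parity i = (if i \<in> {1, 2, 3} then 1 else 0)"

end

theory Submission
  imports Defs "HOL-Library.Function_Algebras"
begin

text \<open>
  The algebra \<open>\<ee>\<^sub>8\<close> is realized on the sum of the Cartan subalgebra and the functions on
  the root system, with the Frenkel-Kac signs. It is identified with the contragredient algebra by a
  recognition theorem: a graded Lie superalgebra with Chevalley generators satisfying the relations
  is contragredient as soon as its degree zero part is the Cartan subalgebra and every nonzero
  homogeneous element of nonzero degree is moved towards degree zero, without being killed, by some
  generator.

  The summands of \<open>e\<^sub>1 + e\<^sub>2 + e\<^sub>6 + e\<^sub>8\<close> commute, and \<open>d\<close> preserves the grading by
  the coefficients of \<open>\<alpha>\<^sub>3, \<alpha>\<^sub>4, \<alpha>\<^sub>5, \<alpha>\<^sub>7\<close>. The component of a nonzero degree is zero or a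
  tensor power of \<open>J\<^sub>2\<close> with at most three factors. As \<open>J\<^sub>2 \<otimes> J\<^sub>2\<close> is \<open>J\<^sub>1 + J\<^sub>3\<close> and
  \<open>J\<^sub>2 \<otimes> J\<^sub>2 \<otimes> J\<^sub>2\<close> is \<open>J\<^sub>2 + 2 J\<^sub>3\<close>, it contributes a line to the semisimplification,
  whose parity is that of the number of factors. The degree zero component contributes the common
  kernel of \<open>\<alpha>\<^sub>1, \<alpha>\<^sub>2, \<alpha>\<^sub>6, \<alpha>\<^sub>8\<close> in the Cartan subalgebra. Brackets of the simple lines give the
  Cartan matrix of \<open>\<gg>(3,6)\<close>, and a computation over the 36 pairs of opposite nonzero degrees
  shows that the recognition theorem applies again.
\<close>

section \<open>The free nonassociative superalgebra\<close>

text \<open>Every Jordan decomposition has to be treated, while the structure constants depend on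
  its heads. Hence the brackets of the semisimplification are shown to be computable on arbitrary
  representatives: elements of the kernel of \<open>d\<close> modulo exact ones in the even part,
  and elements killed by \<open>d\<close> twice, modulo kernel and image of \<open>d\<close>, in the
  odd part. The cube identity for odd elements does not follow from the Jacobi identity in
  characteristic 3; the grading supplies it, because three times a degree is never a degree. Nodes
  3, 4, 5, 7 carry the degrees because the nilpotent element is supported on the other four. They
  have 1, 1, 1, 2 neighbours among the nodes 1, 2, 6, 8, whence the parities odd, odd, odd, even.
  Both Cartan matrices are invertible modulo 3, so the \<open>h i\<close> form a basis of each
  Cartan subalgebra. To identify the largest graded ideal it is enough to know that degree 0 of the
  algebra given by generators and relations consists of Cartan elements; this needs only the
  spanning half of the triangular decomposition.\<close>

lemma lookup_free_scale [simp]: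
  "Poly_Mapping.lookup (free_scale c x) w = c * Poly_Mapping.lookup x w"
  by (simp add: free_scale_def map.rep_eq when_def)

lemma free_scale_vector_space: "vector_space (free_scale :: 'k::field \<Rightarrow> ('g word \<Rightarrow>\<^sub>0 'k) \<Rightarrow> _)"
  by unfold_locales (auto intro!: poly_mapping_eqI simp: lookup_add algebra_simps)

interpretation free: vector_space "free_scale :: 'k::field \<Rightarrow> ('g word \<Rightarrow>\<^sub>0 'k) \<Rightarrow> _"
  by (rule free_scale_vector_space)

lemma keys_free_scale: "Poly_Mapping.keys (free_scale c x) \<subseteq> Poly_Mapping.keys x"
  by (auto simp: in_keys_iff)

lemma poly_mapping_sum_singles:
  fixes x :: "'b \<Rightarrow>\<^sub>0 'k::comm_monoid_add"
  shows "x = (\<Sum>w\<in>Poly_Mapping.keys x. Poly_Mapping.single w (Poly_Mapping.lookup x w))"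
proof (rule poly_mapping_eqI)
  fix k
  have "Poly_Mapping.lookup (\<Sum>w\<in>Poly_Mapping.keys x. Poly_Mapping.single w (Poly_Mapping.lookup x w)) k
      = (\<Sum>w\<in>Poly_Mapping.keys x. if w = k then Poly_Mapping.lookup x w else 0)"
    by (simp add: lookup_sum lookup_single when_def)
  also have "\<dots> = Poly_Mapping.lookup x k" by (simp add: in_keys_iff)
  finally show "Poly_Mapping.lookup x k = Poly_Mapping.lookup (\<Sum>w\<in>Poly_Mapping.keys x. Poly_Mapping.single w (Poly_Mapping.lookup x w)) k" ..
qed

text \<open>The monomial case ranges only over the support of the given \<open>x\<close>, so that
  homogeneity of \<open>x\<close> can be used there although the sums in the induction are
  arbitrary.\<close>

lemma poly_mapping_linear_induct:
  fixes x :: "'b \<Rightarrow>\<^sub>0 'k::comm_monoid_add"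
  assumes "P 0" and "\<And>x y. P x \<Longrightarrow> P y \<Longrightarrow> P (x + y)"
    and "\<And>w c. w \<in> Poly_Mapping.keys x \<Longrightarrow> P (Poly_Mapping.single w c)"
  shows "P x"
proof -
  have "P (\<Sum>w\<in>A. Poly_Mapping.single w (Poly_Mapping.lookup x w))"
    if "A \<subseteq> Poly_Mapping.keys x" "finite A" for A
    using that(2,1) by (induction A rule: finite_induct) (auto intro: assms)
  from this[OF subset_refl] show ?thesis
    using poly_mapping_sum_singles[of x] by simp
qed

text \<open>The definition sums over the exact supports, which shrink under cancellation. Enlarging
  them to common finite sets turns bilinearity into a termwise matter.\<close>

lemma free_bracket_superset:
  assumes "finite A" "finite B" "Poly_Mapping.keys x \<subseteq> A" "Poly_Mapping.keys y \<subseteq> B"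
  shows "free_bracket x y =
     (\<Sum>s\<in>A. \<Sum>t\<in>B. Poly_Mapping.single (Br s t) (Poly_Mapping.lookup x s * Poly_Mapping.lookup y t))"
proof -
  have "(\<Sum>s\<in>A. \<Sum>t\<in>B. Poly_Mapping.single (Br s t) (Poly_Mapping.lookup x s * Poly_Mapping.lookup y t))
     = (\<Sum>s\<in>Poly_Mapping.keys x. \<Sum>t\<in>B. Poly_Mapping.single (Br s t) (Poly_Mapping.lookup x s * Poly_Mapping.lookup y t))"
    by (rule sum.mono_neutral_right) (use assms in \<open>auto simp: in_keys_iff\<close>)
  also have "\<dots> = free_bracket x y" unfolding free_bracket_def
    by (intro sum.cong refl sum.mono_neutral_right) (use assms in \<open>auto simp: in_keys_iff\<close>)
  finally show ?thesis ..
qed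

lemma free_bracket_add_left: "free_bracket (x + y) z = free_bracket x z + free_bracket y z"
proof -
  let ?A = "Poly_Mapping.keys x \<union> Poly_Mapping.keys y"
  have "Poly_Mapping.keys (x + y) \<subseteq> ?A" by (rule keys_add)
  then show ?thesis
    by (simp add: free_bracket_superset[where A = ?A and B = "Poly_Mapping.keys z"] lookup_add
        distrib_right single_add sum.distrib)
qed

lemma free_bracket_add_right: "free_bracket z (x + y) = free_bracket z x + free_bracket z y"
proof -
  let ?A = "Poly_Mapping.keys x \<union> Poly_Mapping.keys y"
  have "Poly_Mapping.keys (x + y) \<subseteq> ?A" by (rule keys_add)
  then show ?thesis
    by (simp add: free_bracket_superset[where B = ?A and A = "Poly_Mapping.keys z"] lookup_add
        distrib_left single_add sum.distrib)
qed

lemma free_scale_single: "free_scale c (Poly_Mapping.single w a) = Poly_Mapping.single w (c * a)"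
  by (rule poly_mapping_eqI) (simp add: lookup_single when_def)

lemma free_bracket_scale_left: "free_bracket (free_scale c x) y = free_scale c (free_bracket x y)"
  using keys_free_scale[of c x]
  by (simp add: free_bracket_superset[where A = "Poly_Mapping.keys x" and B = "Poly_Mapping.keys y"]
      free.scale_sum_right free_scale_single mult.assoc)

lemma free_bracket_scale_right: "free_bracket x (free_scale c y) = free_scale c (free_bracket x y)"
  using keys_free_scale[of c y]
  by (simp add: free_bracket_superset[where A = "Poly_Mapping.keys x" and B = "Poly_Mapping.keys y"]
      free.scale_sum_right free_scale_single mult.left_commute)

lemma free_bracket_zero [simp]: "free_bracket 0 x = 0" "free_bracket x 0 = 0"
  by (simp_all add: free_bracket_def)

lemma free_bracket_diff_left: "free_bracket (x - y) z = free_bracket x z - free_bracket y z"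
  using free_bracket_add_left[of "x - y" y z] by simp

lemma free_bracket_diff_right: "free_bracket z (x - y) = free_bracket z x - free_bracket z y"
  using free_bracket_add_right[of z "x - y" y] by simp

lemma free_bracket_single:
  "free_bracket (Poly_Mapping.single s a) (Poly_Mapping.single t b)
     = Poly_Mapping.single (Br s t) (a * b)"
  by (subst free_bracket_superset[where A = "{s}" and B = "{t}"]) auto

lemma keys_free_bracket:
  "w \<in> Poly_Mapping.keys (free_bracket x y) \<Longrightarrow>
     \<exists>s\<in>Poly_Mapping.keys x. \<exists>t\<in>Poly_Mapping.keys y. w = Br s t"
proof -
  assume "w \<in> Poly_Mapping.keys (free_bracket x y)"
  then have "w \<in> (\<Union>s\<in>Poly_Mapping.keys x. \<Union>t\<in>Poly_Mapping.keys y.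
      Poly_Mapping.keys (Poly_Mapping.single (Br s t) (Poly_Mapping.lookup x s * Poly_Mapping.lookup y t)))"
    unfolding free_bracket_def by (blast dest: keys_sum[THEN subsetD])
  then show ?thesis by (auto split: if_splits)
qed

definition free_homogeneous :: "int ^ 'n \<Rightarrow> ('k::field, 'v, 'n::finite) free_elem set" where
  "free_homogeneous q = {x. \<forall>w\<in>Poly_Mapping.keys x. word_degree w = q}"

lemma free_homogeneous_bracket:
  "x \<in> free_homogeneous p \<Longrightarrow> y \<in> free_homogeneous q \<Longrightarrow> free_bracket x y \<in> free_homogeneous (p + q)"
  unfolding free_homogeneous_def by (auto dest!: keys_free_bracket)

lemma free_superalgebra_simps [simp]:
  "carrier (free_superalgebra par) = UNIV" "zero (free_superalgebra par) = 0"
  "add (free_superalgebra par) = (+)" "scale (free_superalgebra par) = free_scale"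
  "bracket (free_superalgebra par) = free_bracket"
  by (simp_all add: free_superalgebra_def)

lemma part_free_superalgebra:
  "x \<in> part (free_superalgebra par) p \<longleftrightarrow> (\<forall>w\<in>Poly_Mapping.keys x. word_parity par w = p)"
  by (simp add: free_superalgebra_def)

lemma single_in_part: "Poly_Mapping.single w a \<in> part (free_superalgebra par) (word_parity par w)"
  by (auto simp: part_free_superalgebra)


section \<open>Quotients of the free superalgebra\<close>

locale free_ideal =
  fixes K :: "('k::field, 'v, 'n) free_elem set"
  assumes zero_mem: "0 \<in> K" and add_mem: "x \<in> K \<Longrightarrow> y \<in> K \<Longrightarrow> x + y \<in> K"
    and scale_mem: "x \<in> K \<Longrightarrow> free_scale c x \<in> K"
    and bracket_mem_right: "y \<in> K \<Longrightarrow> free_bracket x y \<in> K"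
    and bracket_mem_left: "x \<in> K \<Longrightarrow> free_bracket x y \<in> K"
begin

lemma uminus_mem: "x \<in> K \<Longrightarrow> - x \<in> K"
  using scale_mem[of x "- 1"] by (simp add: free.scale_minus_left)

lemma diff_commute: "x - y \<in> K \<longleftrightarrow> y - x \<in> K"
  using uminus_mem[of "x - y"] uminus_mem[of "y - x"] by auto

lemma trans: "x - y \<in> K \<Longrightarrow> y - z \<in> K \<Longrightarrow> x - z \<in> K"
  using add_mem[of "x - y" "y - z"] by simp

lemma add_cong: "x - x' \<in> K \<Longrightarrow> y - y' \<in> K \<Longrightarrow> (x + y) - (x' + y') \<in> K"
  using add_mem[of "x - x'" "y - y'"] by (simp add: algebra_simps)

lemma scale_cong: "x - x' \<in> K \<Longrightarrow> free_scale c x - free_scale c x' \<in> K"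
  using scale_mem[of "x - x'" c] by (simp add: free.scale_right_diff_distrib)

lemma bracket_cong: "x - x' \<in> K \<Longrightarrow> y - y' \<in> K \<Longrightarrow> free_bracket x y - free_bracket x' y' \<in> K"
  using add_mem[OF bracket_mem_left[of "x - x'" y] bracket_mem_right[of "y - y'" x']]
  by (simp add: free_bracket_diff_left free_bracket_diff_right)

end

text \<open>A quotient of the free superalgebra is described by its projection \<open>cl\<close> and
  the kernel \<open>K\<close> of the projection. The contragredient algebra is a quotient of a
  quotient, with sets of sets as elements; this description lets both stages be handled by
  representatives in the free superalgebra.\<close>

locale presented = free_ideal K
  for K :: "('k::field, 'v, 'n) free_elem set" +
  fixes par :: "'n \<Rightarrow> bit" and A :: "('k, 'a) superalgebra" and cl :: "('k, 'v, 'n) free_elem \<Rightarrow> 'a"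
  assumes cl_eq_iff: "cl x = cl y \<longleftrightarrow> x - y \<in> K"
    and carrier_cl: "carrier A = range cl"
    and zero_cl: "zero A = cl 0"
    and add_cl: "add A (cl x) (cl y) = cl (x + y)"
    and scale_cl: "scale A c (cl x) = cl (free_scale c x)"
    and bracket_cl: "bracket A (cl x) (cl y) = cl (free_bracket x y)"
    and part_cl: "part A p = cl ` part (free_superalgebra par) p"
begin

lemma coset_cl: "coset A (cl ` L) (cl x) = {cl (x + i) | i. i \<in> L}"
proof -
  have "coset A (cl ` L) (cl x) = (\<lambda>i. cl (x + i)) ` L"
    by (simp add: coset_def add_cl image_image)
  then show ?thesis by auto
qed

text \<open>The third isomorphism theorem in terms of representatives. Starting from the trivial
  presentation with kernel 0, it is applied first to the ideal of relations and then to the kernel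
  of an evaluation map.\<close>

lemma presented_quotient:
  assumes L: "free_ideal L" and KL: "K \<subseteq> L"
  shows "presented L par (quotient A (cl ` L)) (\<lambda>x. coset A (cl ` L) (cl x))"
proof -
  interpret L: free_ideal L by fact
  have eq: "coset A (cl ` L) (cl x) = coset A (cl ` L) (cl y) \<longleftrightarrow> x - y \<in> L" for x y
  proof
    assume "coset A (cl ` L) (cl x) = coset A (cl ` L) (cl y)"
    moreover have "cl x \<in> coset A (cl ` L) (cl x)"
      unfolding coset_cl using L.zero_mem by force
    ultimately obtain i where i: "i \<in> L" "cl x = cl (y + i)" unfolding coset_cl by auto
    then have "x - y - i \<in> L" using KL cl_eq_iff[of x "y + i"] by (auto simp: algebra_simps)
    then show "x - y \<in> L" using L.add_mem[OF _ i(1), of "x - y - i"] by simp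
  next
    assume xy: "x - y \<in> L"
    have "{cl (x + i) | i. i \<in> L} \<subseteq> {cl (y + i) | i. i \<in> L}" if "x - y \<in> L" for x y
    proof clarify
      fix i assume "i \<in> L"
      then have "x - y + i \<in> L" using that L.add_mem by blast
      moreover have "cl (x + i) = cl (y + (x - y + i))" by simp
      ultimately show "\<exists>j. cl (x + i) = cl (y + j) \<and> j \<in> L" by blast
    qed
    from this[OF xy] this[of y x] xy show "coset A (cl ` L) (cl x) = coset A (cl ` L) (cl y)"
      unfolding coset_cl using L.diff_commute by blast
  qed
  have mem: "X \<in> coset A (cl ` L) (cl x) \<Longrightarrow> \<exists>i\<in>L. X = cl (x + i)" for X x
    unfolding coset_cl by auto
  have self: "cl x \<in> coset A (cl ` L) (cl x)" for x
    unfolding coset_cl using L.zero_mem by force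
  \<comment> \<open>The operations of a quotient are unions over all pairs of representatives.
    Compatibility with \<open>L\<close> makes all members of such a union the same coset, and the
    union is not empty.\<close>
  have un2: "(\<Union>X\<in>coset A (cl ` L) (cl x). \<Union>Y\<in>coset A (cl ` L) (cl y). coset A (cl ` L) (op X Y))
       = coset A (cl ` L) (cl (f x y))"
    if "\<And>x y. op (cl x) (cl y) = cl (f x y)"
      and "\<And>x x' y y'. x - x' \<in> L \<Longrightarrow> y - y' \<in> L \<Longrightarrow> f x y - f x' y' \<in> L" for op f x y
  proof -
    have "coset A (cl ` L) (op X Y) = coset A (cl ` L) (cl (f x y))"
      if XY: "X \<in> coset A (cl ` L) (cl x)" "Y \<in> coset A (cl ` L) (cl y)" for X Y
    proof -
      from mem[OF XY(1)] mem[OF XY(2)] obtain i j where ij: "i \<in> L" "j \<in> L" "X = cl (x + i)" "Y = cl (y + j)"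
        by blast
      then show ?thesis
        using eq that by (auto simp: \<open>\<And>x y. op (cl x) (cl y) = cl (f x y)\<close>
            intro!: \<open>\<And>x x' y y'. x - x' \<in> L \<Longrightarrow> y - y' \<in> L \<Longrightarrow> f x y - f x' y' \<in> L\<close>)
    qed
    then show ?thesis using self by blast
  qed
  have un1: "(\<Union>X\<in>coset A (cl ` L) (cl x). coset A (cl ` L) (scale A c X))
       = coset A (cl ` L) (cl (free_scale c x))" for c x
  proof -
    have "coset A (cl ` L) (scale A c X) = coset A (cl ` L) (cl (free_scale c x))"
      if X: "X \<in> coset A (cl ` L) (cl x)" for X
    proof -
      from mem[OF X] obtain i where "i \<in> L" "X = cl (x + i)" by blast
      then show ?thesis by (auto simp: eq scale_cl intro!: L.scale_cong)
    qed
    then show ?thesis using self by blast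
  qed
  show ?thesis
  proof unfold_locales
    fix x y :: "('k, 'v, 'n) free_elem" and c :: 'k and p
    show "coset A (cl ` L) (cl x) = coset A (cl ` L) (cl y) \<longleftrightarrow> x - y \<in> L" by (rule eq)
    show "carrier (quotient A (cl ` L)) = range (\<lambda>x. coset A (cl ` L) (cl x))"
      by (auto simp: quotient_def carrier_cl)
    show "zero (quotient A (cl ` L)) = coset A (cl ` L) (cl 0)"
      by (simp add: quotient_def zero_cl)
    show "add (quotient A (cl ` L)) (coset A (cl ` L) (cl x)) (coset A (cl ` L) (cl y))
        = coset A (cl ` L) (cl (x + y))"
      by (simp add: quotient_def) (rule un2, simp_all add: add_cl L.add_cong)
    show "bracket (quotient A (cl ` L)) (coset A (cl ` L) (cl x)) (coset A (cl ` L) (cl y))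
        = coset A (cl ` L) (cl (free_bracket x y))"
      by (simp add: quotient_def) (rule un2, simp_all add: bracket_cl L.bracket_cong)
    show "scale (quotient A (cl ` L)) c (coset A (cl ` L) (cl x)) = coset A (cl ` L) (cl (free_scale c x))"
      by (simp add: quotient_def un1)
    show "part (quotient A (cl ` L)) p = (\<lambda>x. coset A (cl ` L) (cl x)) ` part (free_superalgebra par) p"
      by (auto simp: quotient_def part_cl)
  qed
qed

end

lemma presented_free: "presented {0} par (free_superalgebra par) (\<lambda>x. x)"
  by unfold_locales (auto simp: free_superalgebra_def)

lemma free_ideal_iff: "ideal_of (free_superalgebra par) K \<longleftrightarrow> free_ideal K"
  by (auto simp: ideal_of_def subspace_of_def free_ideal_def)

lemma free_ideal_generated: "free_ideal (ideal_generated_by (free_superalgebra par) S)"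
  unfolding free_ideal_iff[of par, symmetric] ideal_generated_by_def
  by (auto simp: ideal_of_def subspace_of_def)

lemma generators_mem: "x \<in> S \<Longrightarrow> x \<in> ideal_generated_by A S"
  by (auto simp: ideal_generated_by_def)

section \<open>Triangular decomposition\<close>

primrec word_length :: "'g word \<Rightarrow> nat" where
  "word_length (Gen g) = 1"
| "word_length (Br s t) = word_length s + word_length t"

lemma word_length_pos: "word_length w > 0"
  by (induction w) auto

primrec pos_word :: "('v, 'n) generator word \<Rightarrow> bool" where
  "pos_word (Gen g) = (\<exists>i. g = Pos i)"
| "pos_word (Br s t) = (pos_word s \<and> pos_word t)"

primrec neg_word :: "('v, 'n) generator word \<Rightarrow> bool" where
  "neg_word (Gen g) = (\<exists>i. g = Neg i)"
| "neg_word (Br s t) = (neg_word s \<and> neg_word t)"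

definition cartan_word :: "('v, 'n) generator word \<Rightarrow> bool" where
  "cartan_word w \<longleftrightarrow> (\<exists>v. w = Gen (Cartan v))"

definition standard_word :: "('v, 'n) generator word \<Rightarrow> bool" where
  "standard_word w \<longleftrightarrow> pos_word w \<or> neg_word w \<or> cartan_word w"

definition height_sum :: "int ^ 'n::finite \<Rightarrow> int" where
  "height_sum q = (\<Sum>i\<in>UNIV. q $ i)"

lemma height_sum_simps [simp]:
  "height_sum (p + q) = height_sum p + height_sum q" "height_sum (- p) = - height_sum p"
  "height_sum 0 = 0" "height_sum (axis i 1) = 1"
  by (simp_all add: height_sum_def sum.distrib sum_negf axis_def)

lemma height_pos_word: "pos_word w \<Longrightarrow> height_sum (word_degree w) = int (word_length w)"
  by (induction w) auto

lemma height_neg_word: "neg_word w \<Longrightarrow> height_sum (word_degree w) = - int (word_length w)"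
  by (induction w) auto

definition standard_elems :: "int ^ 'n \<Rightarrow> ('k::field, 'v, 'n::finite) free_elem set" where
  "standard_elems q = {x. \<forall>w\<in>Poly_Mapping.keys x. word_degree w = q \<and> standard_word w}"

abbreviation wd :: "'g word \<Rightarrow> ('g word \<Rightarrow>\<^sub>0 'k::field)" where
  "wd w \<equiv> Poly_Mapping.single w 1"

lemma single_eq_scale: "Poly_Mapping.single w c = free_scale c (wd w)"
  by (simp add: free_scale_single)

lemma bracket_wd: "free_bracket (wd s) (wd t) = wd (Br s t)"
  by (simp add: free_bracket_single)

lemma standard_elems_zero: "0 \<in> standard_elems q"
  by (simp add: standard_elems_def)

lemma standard_elems_add: "x \<in> standard_elems q \<Longrightarrow> y \<in> standard_elems q \<Longrightarrow> x + y \<in> standard_elems q"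
  unfolding standard_elems_def using keys_add[of x y] by auto

lemma standard_elems_scale: "x \<in> standard_elems q \<Longrightarrow> free_scale c x \<in> standard_elems q"
  unfolding standard_elems_def using keys_free_scale[of c x] by auto

lemma standard_elems_wd: "standard_word w \<Longrightarrow> wd w \<in> standard_elems (word_degree w)"
  by (simp add: standard_elems_def)

section \<open>Spanning by standard words modulo the relations\<close>

locale contragredient_relations =
  fixes par :: "'n::finite \<Rightarrow> bit"
    and sc :: "'k::field \<Rightarrow> 'v::ab_group_add \<Rightarrow> 'v"
    and h :: "'n \<Rightarrow> 'v"
    and \<alpha> :: "'n \<Rightarrow> 'v \<Rightarrow> 'k"
begin

definition rel_ideal :: "('k, 'v, 'n) free_elem set" where
  "rel_ideal = ideal_generated_by (free_superalgebra par) (relators par sc h \<alpha>)"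

lemma rel_mem: "x \<in> relators par sc h \<alpha> \<Longrightarrow> x \<in> rel_ideal"
  unfolding rel_ideal_def by (rule generators_mem)

sublocale rel: free_ideal rel_ideal
  unfolding rel_ideal_def by (rule free_ideal_generated)

text \<open>The weak form of the triangular decomposition: standard words span, with no claim of
  independence. The degree is kept because the height of a standard word determines its length, and
  lengths drive the induction below.\<close>

definition reducible :: "int ^ 'n \<Rightarrow> ('k, 'v, 'n) free_elem set" where
  "reducible q = {x. \<exists>y\<in>standard_elems q. x - y \<in> rel_ideal}"

lemma reducible_standard: "x \<in> standard_elems q \<Longrightarrow> x \<in> reducible q"
  unfolding reducible_def using rel.zero_mem by (auto intro!: bexI[of _ x])

lemma reducible_zero: "0 \<in> reducible q"
  by (rule reducible_standard) (rule standard_elems_zero)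

lemma reducible_add: "x \<in> reducible q \<Longrightarrow> y \<in> reducible q \<Longrightarrow> x + y \<in> reducible q"
  unfolding reducible_def using standard_elems_add rel.add_cong by blast

lemma reducible_scale: "x \<in> reducible q \<Longrightarrow> free_scale c x \<in> reducible q"
  unfolding reducible_def using standard_elems_scale rel.scale_cong by blast

lemma reducible_diff: "x \<in> reducible q \<Longrightarrow> y \<in> reducible q \<Longrightarrow> x - y \<in> reducible q"
  using reducible_add[OF _ reducible_scale[of y q "- 1"], of x] by (simp add: free.scale_minus_left)

lemma reducible_cong: "x \<in> reducible q \<Longrightarrow> x' - x \<in> rel_ideal \<Longrightarrow> x' \<in> reducible q"
  unfolding reducible_def using rel.trans by blast

lemma reducible_bracket:
  assumes x: "\<forall>s\<in>Poly_Mapping.keys x. \<forall>t\<in>Poly_Mapping.keys y. wd (Br s t) \<in> reducible q"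
  shows "free_bracket x y \<in> reducible q"
proof (rule poly_mapping_linear_induct[where x = "free_bracket x y"])
  fix w c assume "w \<in> Poly_Mapping.keys (free_bracket x y)"
  then obtain s t where "s \<in> Poly_Mapping.keys x" "t \<in> Poly_Mapping.keys y" "w = Br s t"
    using keys_free_bracket by blast
  then show "Poly_Mapping.single w c \<in> reducible q"
    using x reducible_scale by (subst single_eq_scale) blast
qed (auto intro: reducible_zero reducible_add)

lemma antisymmetry_word:
  "wd (Br s t) + free_scale (koszul_sign (word_parity par s) (word_parity par t)) (wd (Br t s)) \<in> rel_ideal"
  using rel_mem[OF relators.antisymmetry[OF single_in_part[of s 1 par] single_in_part[of t 1 par]]]
  by (simp add: bracket_wd)

lemma jacobi_word:
  "wd (Br s (Br t u)) - wd (Br (Br s t) u)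
    - free_scale (koszul_sign (word_parity par s) (word_parity par t)) (wd (Br t (Br s u))) \<in> rel_ideal"
  using rel_mem[OF relators.jacobi[OF single_in_part[of s 1 par] single_in_part[of t 1 par] single_in_part[of u 1 par]]]
  by (simp add: bracket_wd)

lemma reducible_swap: "wd (Br s t) \<in> reducible q \<Longrightarrow> wd (Br t s) \<in> reducible q"
proof -
  assume a: "wd (Br s t) \<in> reducible q"
  let ?c = "koszul_sign (word_parity par t) (word_parity par s) :: 'k"
  have "free_scale (- ?c) (wd (Br s t)) \<in> reducible q" by (rule reducible_scale[OF a])
  then show ?thesis
    by (rule reducible_cong) (use antisymmetry_word[of t s] in \<open>simp add: free.scale_minus_left\<close>)
qed

lemma reducible_jacobi_left:
  assumes "wd (Br s (Br t u)) \<in> reducible q" "wd (Br t (Br s u)) \<in> reducible q"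
  shows "wd (Br (Br s t) u) \<in> reducible q"
proof -
  let ?c = "koszul_sign (word_parity par s) (word_parity par t) :: 'k"
  have "wd (Br s (Br t u)) - free_scale ?c (wd (Br t (Br s u))) \<in> reducible q"
    by (intro reducible_diff reducible_scale assms)
  then show ?thesis
    by (rule reducible_cong)
      (use rel.uminus_mem[OF jacobi_word[of s t u]] in \<open>simp add: algebra_simps\<close>)
qed

lemma reducible_jacobi_right:
  assumes "wd (Br (Br s t) u) \<in> reducible q" "wd (Br t (Br s u)) \<in> reducible q"
  shows "wd (Br s (Br t u)) \<in> reducible q"
proof -
  let ?c = "koszul_sign (word_parity par s) (word_parity par t) :: 'k"
  have "wd (Br (Br s t) u) + free_scale ?c (wd (Br t (Br s u))) \<in> reducible q"
    by (intro reducible_add reducible_scale assms)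
  then show ?thesis
    by (rule reducible_cong)
      (use jacobi_word[of s t u] in \<open>simp add: algebra_simps\<close>)
qed

text \<open>An even element acts as a derivation on words, so the scalars of the two factors of a
  bracket add up.\<close>

lemma cartan_acts:
  assumes "pos_word w \<or> neg_word w"
  shows "\<exists>c. wd (Br (Gen (Cartan v)) w) - free_scale c (wd w) \<in> rel_ideal"
  using assms
proof (induction w)
  case (Gen g)
  then consider i where "g = Pos i" | i where "g = Neg i" by auto
  then show ?case
  proof cases
    case 1
    then show ?thesis using rel_mem[OF relators.cartan_pos[of v i \<alpha> par sc h]] by (auto simp: bracket_wd)
  next
    case 2
    then show ?thesis using rel_mem[OF relators.cartan_neg[of v i \<alpha> par sc h]]
      by (intro exI[of _ "- \<alpha> i v"]) (simp add: bracket_wd free.scale_minus_left)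
  qed
next
  case (Br s t)
  let ?v = "Gen (Cartan v) :: ('v, 'n) generator word"
  from Br obtain a where a: "wd (Br ?v s) - free_scale a (wd s) \<in> rel_ideal" by auto
  from Br obtain b where b: "wd (Br ?v t) - free_scale b (wd t) \<in> rel_ideal" by auto
  have "wd (Br (Br ?v s) t) - free_scale a (wd (Br s t)) \<in> rel_ideal"
    using rel.bracket_mem_left[OF a, of "wd t"]
    by (simp add: free_bracket_diff_left free_bracket_scale_left bracket_wd)
  moreover have "wd (Br s (Br ?v t)) - free_scale b (wd (Br s t)) \<in> rel_ideal"
    using rel.bracket_mem_right[OF b, of "wd s"]
    by (simp add: free_bracket_diff_right free_bracket_scale_right bracket_wd)
  moreover have "wd (Br ?v (Br s t)) - (wd (Br (Br ?v s) t) + wd (Br s (Br ?v t))) \<in> rel_ideal"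
    using jacobi_word[of ?v s t] by (simp add: koszul_sign_def algebra_simps)
  ultimately have "wd (Br ?v (Br s t)) - (free_scale a (wd (Br s t)) + free_scale b (wd (Br s t))) \<in> rel_ideal"
    using rel.trans rel.add_cong by blast
  then show ?case by (auto simp: free.scale_left_distrib[symmetric])
qed

lemma reducible_cartan:
  assumes "cartan_word s" "standard_word t"
  shows "wd (Br s t) \<in> reducible (word_degree s + word_degree t)"
proof -
  from assms(1) obtain v where s: "s = Gen (Cartan v)" by (auto simp: cartan_word_def)
  show ?thesis
  proof (cases "cartan_word t")
    case True
    then obtain u where t: "t = Gen (Cartan u)" by (auto simp: cartan_word_def)
    have "wd (Br s t) \<in> rel_ideal"
      using rel_mem[OF relators.cartan_cartan[of v u par sc h \<alpha>]] by (simp add: s t bracket_wd)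
    then show ?thesis by (intro reducible_cong[OF reducible_zero]) auto
  next
    case False
    then obtain c where "wd (Br s t) - free_scale c (wd t) \<in> rel_ideal"
      using cartan_acts assms by (auto simp: s standard_word_def)
    then show ?thesis
      using reducible_cong[OF reducible_scale[OF reducible_standard[OF standard_elems_wd[OF assms(2)]], of c]]
      by (simp add: s)
  qed
qed

text \<open>Induction on the total length. The Jacobi identity distributes \<open>t\<close> over the
  factors of a compound \<open>s\<close>; if \<open>s\<close> is a generator, \<open>t\<close> is
  split instead; two generators are settled by the relators.\<close>

lemma reducible_pos_neg:
  assumes "pos_word s" "neg_word t"
  shows "wd (Br s t) \<in> reducible (word_degree s + word_degree t)"
  using assms
proof (induction "word_length s + word_length t" arbitrary: s t rule: less_induct)
  case less
  have pp: "wd (Br a b) \<in> reducible (word_degree a + word_degree b)"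
    if "pos_word a" "pos_word b" for a b
    using reducible_standard[OF standard_elems_wd[of "Br a b"]] that by (simp add: standard_word_def)
  have nn: "wd (Br a b) \<in> reducible (word_degree a + word_degree b)"
    if "neg_word a" "neg_word b" for a b
    using reducible_standard[OF standard_elems_wd[of "Br a b"]] that by (simp add: standard_word_def)
  \<comment> \<open>The inner bracket is shorter and reduces to some \<open>y\<close>. A negative
    word in \<open>y\<close> has, by its height, the length of \<open>t'\<close> minus that of
    \<open>b\<close>, so its bracket with \<open>a\<close> is covered by the induction hypothesis as
    well. Positive words stay positive, and Cartan words act by scalars.\<close>
  have step_pos: "wd (Br a (Br b t')) \<in> reducible (word_degree a + (word_degree b + word_degree t'))"
    if *: "pos_word a" "pos_word b" "neg_word t'" and le: "word_length a + word_length b + word_length t' \<le> word_length s + word_length t"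
    for a b t'
  proof -
    have "wd (Br b t') \<in> reducible (word_degree b + word_degree t')"
      by (rule less.hyps) (use * le word_length_pos[of a] in auto)
    then obtain y where y: "y \<in> standard_elems (word_degree b + word_degree t')" "wd (Br b t') - y \<in> rel_ideal"
      by (auto simp: reducible_def)
    have "free_bracket (wd a) y \<in> reducible (word_degree a + (word_degree b + word_degree t'))"
    proof (rule reducible_bracket, clarsimp)
      fix u assume u: "u \<in> Poly_Mapping.keys y"
      then have du: "word_degree u = word_degree b + word_degree t'" "standard_word u"
        using y by (auto simp: standard_elems_def)
      have "wd (Br a u) \<in> reducible (word_degree a + word_degree u)"
      proof -
        consider "pos_word u" | "neg_word u" | "cartan_word u" using du by (auto simp: standard_word_def)
        then show ?thesis
        proof cases
          case 1 then show ?thesis using pp * by blast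
        next
          case 2
          have "int (word_length u) = int (word_length t') - int (word_length b)"
            using height_neg_word[OF 2] height_neg_word[OF *(3)] height_pos_word[OF *(2)] du(1) by simp
          then show ?thesis using 2 * le word_length_pos[of b] by (intro less.hyps) auto
        next
          case 3 then show ?thesis
            using reducible_swap[OF reducible_cartan[OF 3, of a]] * by (simp add: standard_word_def add.commute)
        qed
      qed
      then show "wd (Br a u) \<in> reducible (word_degree a + (word_degree b + word_degree t'))" by (simp add: du)
    qed
    then show ?thesis
      by (rule reducible_cong)
        (use rel.bracket_mem_right[OF y(2), of "wd a"] in \<open>simp add: free_bracket_diff_right bracket_wd\<close>)
  qed
  \<comment> \<open>The mirror image: now the positive words in the reduction have become shorter by
    the length of \<open>b\<close>.\<close>
  have step_neg: "wd (Br a (Br s' b)) \<in> reducible (word_degree a + (word_degree s' + word_degree b))"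
    if *: "neg_word a" "neg_word b" "pos_word s'" and le: "word_length a + word_length b + word_length s' \<le> word_length s + word_length t"
    for a b s'
  proof -
    have "wd (Br s' b) \<in> reducible (word_degree s' + word_degree b)"
      by (rule less.hyps) (use * le word_length_pos[of a] in auto)
    then obtain y where y: "y \<in> standard_elems (word_degree s' + word_degree b)" "wd (Br s' b) - y \<in> rel_ideal"
      by (auto simp: reducible_def)
    have "free_bracket (wd a) y \<in> reducible (word_degree a + (word_degree s' + word_degree b))"
    proof (rule reducible_bracket, clarsimp)
      fix u assume u: "u \<in> Poly_Mapping.keys y"
      then have du: "word_degree u = word_degree s' + word_degree b" "standard_word u"
        using y by (auto simp: standard_elems_def)
      have "wd (Br a u) \<in> reducible (word_degree a + word_degree u)"
      proof -
        consider "pos_word u" | "neg_word u" | "cartan_word u" using du by (auto simp: standard_word_def)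
        then show ?thesis
        proof cases
          case 2 then show ?thesis using nn * by blast
        next
          case 1
          have "int (word_length u) = int (word_length s') - int (word_length b)"
            using height_pos_word[OF 1] height_neg_word[OF *(2)] height_pos_word[OF *(3)] du(1) by simp
          then have "wd (Br u a) \<in> reducible (word_degree u + word_degree a)"
            using 1 * le word_length_pos[of b] by (intro less.hyps) auto
          then show ?thesis using reducible_swap by (metis add.commute)
        next
          case 3 then show ?thesis
            using reducible_swap[OF reducible_cartan[OF 3, of a]] * by (simp add: standard_word_def add.commute)
        qed
      qed
      then show "wd (Br a u) \<in> reducible (word_degree a + (word_degree s' + word_degree b))" by (simp add: du)
    qed
    then show ?thesis
      by (rule reducible_cong)
        (use rel.bracket_mem_right[OF y(2), of "wd a"] in \<open>simp add: free_bracket_diff_right bracket_wd\<close>)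
  qed
  show ?case
  proof (cases s)
    case (Br a b)
    have "wd (Br a (Br b t)) \<in> reducible (word_degree s + word_degree t)"
      using step_pos[of a b t] less.prems by (simp add: Br add.assoc)
    moreover have "wd (Br b (Br a t)) \<in> reducible (word_degree s + word_degree t)"
      using step_pos[of b a t] less.prems by (simp add: Br add_ac)
    ultimately show ?thesis unfolding Br by (rule reducible_jacobi_left)
  next
    case s: (Gen g)
    then obtain i where g: "g = Pos i" using less.prems by auto
    show ?thesis
    proof (cases t)
      case (Br a b)
      have "wd (Br a (Br s b)) \<in> reducible (word_degree s + word_degree t)"
        using step_neg[of a b s] less.prems by (simp add: Br add_ac)
      moreover have "wd (Br b (Br s a)) \<in> reducible (word_degree s + word_degree t)"
        using step_neg[of b a s] less.prems by (simp add: Br add_ac)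
      then have "wd (Br (Br s a) b) \<in> reducible (word_degree s + word_degree t)"
        by (rule reducible_swap)
      ultimately show ?thesis unfolding Br by (rule reducible_jacobi_right[rotated])
    next
      case t: (Gen g')
      then obtain j where g': "g' = Neg j" using less.prems by auto
      show ?thesis
      proof (cases "i = j")
        case True
        have "wd (Br s t) - gen (Cartan (h i)) \<in> rel_ideal"
          using rel_mem[OF relators.pos_neg_same[where i = i and par = par and sc = sc and h = h and \<alpha> = \<alpha>]] by (simp add: s t g g' True bracket_wd)
        moreover have "gen (Cartan (h i)) \<in> reducible (word_degree s + word_degree t)"
          using reducible_standard[OF standard_elems_wd[of "Gen (Cartan (h i))"]]
          by (simp add: s t g g' True standard_word_def cartan_word_def)
        ultimately show ?thesis using reducible_cong by blast
      next
        case False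
        have "wd (Br s t) \<in> rel_ideal"
          using rel_mem[OF relators.pos_neg_diff[OF False, where par = par and sc = sc and h = h and \<alpha> = \<alpha>]] by (simp add: s t g g' bracket_wd)
        then show ?thesis by (intro reducible_cong[OF reducible_zero]) auto
      qed
    qed
  qed
qed

lemma reducible_standard_bracket:
  assumes "standard_word s" "standard_word t"
  shows "wd (Br s t) \<in> reducible (word_degree s + word_degree t)"
proof -
  consider "cartan_word s" | "cartan_word t" | "pos_word s" "pos_word t" | "neg_word s" "neg_word t"
    | "pos_word s" "neg_word t" | "neg_word s" "pos_word t"
    using assms by (auto simp: standard_word_def)
  then show ?thesis
  proof cases
    case 1 then show ?thesis using reducible_cartan assms by blast
  next
    case 2 then show ?thesis using reducible_swap[OF reducible_cartan[OF 2 assms(1)]] by (simp add: add.commute)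
  next
    case 3 then show ?thesis
      using reducible_standard[OF standard_elems_wd[of "Br s t"]] by (simp add: standard_word_def)
  next
    case 4 then show ?thesis
      using reducible_standard[OF standard_elems_wd[of "Br s t"]] by (simp add: standard_word_def)
  next
    case 5 then show ?thesis by (rule reducible_pos_neg)
  next
    case 6 then show ?thesis using reducible_swap[OF reducible_pos_neg[OF 6(2,1)]] by (simp add: add.commute)
  qed
qed

lemma word_reducible: "wd w \<in> reducible (word_degree w)"
proof (induction w)
  case (Gen g)
  show ?case
    by (rule reducible_standard, rule standard_elems_wd) (cases g; simp add: standard_word_def cartan_word_def)
next
  case (Br s t)
  then obtain x y where x: "x \<in> standard_elems (word_degree s)" "wd s - x \<in> rel_ideal"
    and y: "y \<in> standard_elems (word_degree t)" "wd t - y \<in> rel_ideal"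
    by (auto simp: reducible_def)
  have "free_bracket x y \<in> reducible (word_degree (Br s t))"
  proof (rule reducible_bracket, intro ballI)
    fix u w assume "u \<in> Poly_Mapping.keys x" "w \<in> Poly_Mapping.keys y"
    then have "word_degree u = word_degree s" "standard_word u" "word_degree w = word_degree t" "standard_word w"
      using x y by (auto simp: standard_elems_def)
    then show "wd (Br u w) \<in> reducible (word_degree (Br s t))"
      using reducible_standard_bracket[of u w] by simp
  qed
  then show ?case
    by (rule reducible_cong) (use rel.bracket_cong[OF x(2) y(2)] in \<open>simp add: bracket_wd\<close>)
qed

lemma cartan_zero_mem: "gen (Cartan 0) \<in> rel_ideal"
  using rel_mem[OF relators.cartan_add[of 0 0 par sc h \<alpha>]] rel.uminus_mem by fastforce

text \<open>Positive and negative standard words have nonzero height, so in degree 0 only Cartan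
  words remain, and the linearity relators combine them into a single one.\<close>

lemma degree_zero_is_cartan:
  assumes "x \<in> free_homogeneous 0"
  shows "\<exists>v. x - gen (Cartan v) \<in> rel_ideal"
proof -
  have "x \<in> reducible 0"
  proof (rule poly_mapping_linear_induct[where x = x])
    fix w c assume "w \<in> Poly_Mapping.keys x"
    then have "word_degree w = 0" using assms by (simp add: free_homogeneous_def)
    then show "Poly_Mapping.single w c \<in> reducible 0"
      using reducible_scale[OF word_reducible[of w], of c] by (simp add: free_scale_single)
  qed (auto intro: reducible_zero reducible_add)
  then obtain y where y: "y \<in> standard_elems 0" "x - y \<in> rel_ideal" by (auto simp: reducible_def)
  have "\<exists>v. y - gen (Cartan v) \<in> rel_ideal"
  proof (rule poly_mapping_linear_induct[where x = y])
    show "\<exists>v. 0 - gen (Cartan v) \<in> rel_ideal"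
      using rel.uminus_mem[OF cartan_zero_mem] by auto
  next
    fix x y assume "\<exists>v. x - gen (Cartan v) \<in> rel_ideal" "\<exists>v. y - gen (Cartan v) \<in> rel_ideal"
    then obtain u v where "x - gen (Cartan u) \<in> rel_ideal" "y - gen (Cartan v) \<in> rel_ideal" by blast
    from rel.add_cong[OF this] have "x + y - (gen (Cartan u) + gen (Cartan v)) \<in> rel_ideal" .
    moreover have "gen (Cartan u) + gen (Cartan v) - gen (Cartan (u + v)) \<in> rel_ideal"
      using rel.uminus_mem[OF rel_mem[OF relators.cartan_add[of u v par sc h \<alpha>]]] by (simp add: algebra_simps)
    ultimately show "\<exists>v. x + y - gen (Cartan v) \<in> rel_ideal" using rel.trans by blast
  next
    fix w c assume "w \<in> Poly_Mapping.keys y"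
    then have w: "word_degree w = 0" "standard_word w" using y by (auto simp: standard_elems_def)
    have "cartan_word w"
      using w height_pos_word[of w] height_neg_word[of w] word_length_pos[of w] by (auto simp: standard_word_def)
    then obtain v where v: "w = Gen (Cartan v)" by (auto simp: cartan_word_def)
    have "free_scale c (wd w) - gen (Cartan (sc c v)) \<in> rel_ideal"
      using rel.uminus_mem[OF rel_mem[OF relators.cartan_scale[of sc c v par h \<alpha>]]] by (simp add: v)
    then show "\<exists>v. Poly_Mapping.single w c - gen (Cartan v) \<in> rel_ideal"
      using single_eq_scale[of w c] by auto
  qed
  then show ?thesis using y(2) rel.trans by blast
qed

end


section \<open>A recognition theorem for contragredient superalgebras\<close>

text \<open>The l1 norm, unlike the signed height, measures the distance from degree 0; it is the
  measure for descent from both sides.\<close>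

definition abs_height :: "int ^ 'n::finite \<Rightarrow> nat" where
  "abs_height q = (\<Sum>i\<in>UNIV. nat \<bar>q $ i\<bar>)"

text \<open>Addition is that of the type and bilinearity is required on the whole type; only closure
  refers to the carrier. Thus linear algebra applies to \<open>scale M\<close> directly.\<close>

locale linear_superalgebra =
  fixes M :: "('k::field, 'a::ab_group_add) superalgebra"
  assumes add_M [simp]: "add M = (+)" and zero_M [simp]: "zero M = 0"
    and vector_space_M: "vector_space (scale M)"
    and carrier_subspace: "subspace_of M (carrier M)"
    and bracket_add_left: "bracket M (x + y) z = bracket M x z + bracket M y z"
    and bracket_add_right: "bracket M z (x + y) = bracket M z x + bracket M z y"
    and bracket_scale_left: "bracket M (scale M c x) y = scale M c (bracket M x y)"
    and bracket_scale_right: "bracket M x (scale M c y) = scale M c (bracket M x y)"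
    and bracket_closed: "x \<in> carrier M \<Longrightarrow> y \<in> carrier M \<Longrightarrow> bracket M x y \<in> carrier M"
begin

sublocale vector_space "scale M" by (rule vector_space_M)

lemma bracket_zero [simp]: "bracket M 0 x = 0" "bracket M x 0 = 0"
  using bracket_add_left[of 0 0 x] bracket_add_right[of x 0 0] by simp_all

lemma bracket_minus: "bracket M (- x) y = - bracket M x y" "bracket M x (- y) = - bracket M x y"
  using bracket_add_left[of x "- x" y] bracket_add_right[of x y "- y"]
  by (simp_all add: eq_neg_iff_add_eq_0 add.commute)

lemma bracket_diff: "bracket M (x - y) z = bracket M x z - bracket M y z"
  "bracket M z (x - y) = bracket M z x - bracket M z y"
  using bracket_add_left[of x "- y" z] bracket_add_right[of z x "- y"] by (simp_all add: bracket_minus)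

lemma subspace_of_iff: "subspace_of M S \<longleftrightarrow> S \<subseteq> carrier M \<and> subspace S"
  by (auto simp: subspace_of_def subspace_def)

lemma subspace_carrier: "subspace (carrier M)"
  using carrier_subspace by (simp add: subspace_of_iff)

end

locale lie_superalgebra = linear_superalgebra +
  assumes part_subspace: "subspace_of M (part M p)"
    and part_decomp: "x \<in> carrier M \<Longrightarrow> \<exists>a\<in>part M 0. \<exists>b\<in>part M 1. x = a + b"
    and part_disjoint: "x \<in> part M 0 \<Longrightarrow> x \<in> part M 1 \<Longrightarrow> x = 0"
    and bracket_part: "x \<in> part M p \<Longrightarrow> y \<in> part M q \<Longrightarrow> bracket M x y \<in> part M (p + q)"
    and antisymmetry: "x \<in> part M p \<Longrightarrow> y \<in> part M q \<Longrightarrow>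
      bracket M x y + scale M (koszul_sign p q) (bracket M y x) = 0"
    and jacobi: "x \<in> part M p \<Longrightarrow> y \<in> part M q \<Longrightarrow> z \<in> part M r \<Longrightarrow>
      bracket M x (bracket M y z) - bracket M (bracket M x y) z
        - scale M (koszul_sign p q) (bracket M y (bracket M x z)) = 0"
    and odd_cube: "x \<in> part M 1 \<Longrightarrow> bracket M x (bracket M x x) = 0"

text \<open>An isomorphism in the sense of \<open>superalgebra_iso\<close> says nothing about
  closure of the source under its operations. The additional clauses make it possible to invert the
  map and to transport brackets of brackets.\<close>

definition superalgebra_morphism_iso ::
  "('k, 'c) superalgebra \<Rightarrow> ('k, 'd) superalgebra \<Rightarrow> ('c \<Rightarrow> 'd) \<Rightarrow> bool" where
  "superalgebra_morphism_iso A B \<phi> \<longleftrightarrow> superalgebra_iso A B \<phi> \<and> \<phi> (zero A) = zero B \<and> zero A \<in> carrier A \<and>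
     (\<forall>x\<in>carrier A. \<forall>y\<in>carrier A. add A x y \<in> carrier A \<and> bracket A x y \<in> carrier A) \<and>
     (\<forall>c. \<forall>x\<in>carrier A. scale A c x \<in> carrier A)"

text \<open>\<open>descent\<close> stands in for the condition that no nonzero graded ideal meets
  the Cartan subalgebra trivially: iterated, it leads from a nonzero homogeneous element to a
  nonzero element of degree 0, and \<open>G_zero\<close> places that in the Cartan subalgebra.
  \<open>G_independent\<close> expresses directness of the sum of the pieces by finite sums
  only.\<close>

locale contragredient_model = lie_superalgebra M + contragredient_relations par sc h \<alpha>
  for M :: "('k::field, 'a::ab_group_add) superalgebra"
    and par :: "'n::finite \<Rightarrow> bit" and sc :: "'k \<Rightarrow> 'v::ab_group_add \<Rightarrow> 'v"
    and h :: "'n \<Rightarrow> 'v" and \<alpha> :: "'n \<Rightarrow> 'v \<Rightarrow> 'k" +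
  fixes E F :: "'n \<Rightarrow> 'a" and H :: "'v \<Rightarrow> 'a" and G :: "int ^ 'n \<Rightarrow> 'a set"
  assumes H_add: "H (u + v) = H u + H v" and H_scale: "H (sc c v) = scale M c (H v)"
    and H_inj: "H v = 0 \<Longrightarrow> v = 0"
    and E_part: "E i \<in> part M (par i)" and F_part: "F i \<in> part M (par i)" and H_part: "H v \<in> part M 0"
    and EF_same: "bracket M (E i) (F i) = H (h i)"
    and EF_diff: "i \<noteq> j \<Longrightarrow> bracket M (E i) (F j) = 0"
    and HE: "bracket M (H v) (E i) = scale M (\<alpha> i v) (E i)"
    and HF: "bracket M (H v) (F i) = - scale M (\<alpha> i v) (F i)"
    and HH: "bracket M (H u) (H v) = 0"
    and G_subspace: "subspace (G q)"
    and E_G: "E i \<in> G (axis i 1)" and F_G: "F i \<in> G (- axis i 1)" and H_G: "H v \<in> G 0"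
    and bracket_G: "x \<in> G p \<Longrightarrow> y \<in> G q \<Longrightarrow> bracket M x y \<in> G (p + q)"
    and G_independent: "finite Q \<Longrightarrow> (\<And>q. q \<in> Q \<Longrightarrow> g q \<in> G q) \<Longrightarrow> (\<Sum>q\<in>Q. g q) = 0 \<Longrightarrow> q \<in> Q \<Longrightarrow> g q = 0"
    and G_zero: "G 0 \<subseteq> range H"
    and generated: "subspace T \<Longrightarrow> (\<And>x y. x \<in> T \<Longrightarrow> y \<in> T \<Longrightarrow> bracket M x y \<in> T) \<Longrightarrow>
      range E \<subseteq> T \<Longrightarrow> range F \<subseteq> T \<Longrightarrow> range H \<subseteq> T \<Longrightarrow> carrier M \<subseteq> T"
    and descent: "x \<in> G q \<Longrightarrow> x \<noteq> 0 \<Longrightarrow> q \<noteq> 0 \<Longrightarrow>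
      \<exists>i. bracket M (E i) x \<noteq> 0 \<and> abs_height (q + axis i 1) < abs_height q
        \<or> bracket M (F i) x \<noteq> 0 \<and> abs_height (q - axis i 1) < abs_height q"
begin

section \<open>Evaluation of words in a model and its kernel\<close>

fun gen_image :: "('v, 'n) generator \<Rightarrow> 'a" where
  "gen_image (Cartan v) = H v"
| "gen_image (Pos i) = E i"
| "gen_image (Neg i) = F i"

primrec word_image :: "('v, 'n) generator word \<Rightarrow> 'a" where
  "word_image (Gen g) = gen_image g"
| "word_image (Br s t) = bracket M (word_image s) (word_image t)"

definition eval_free :: "('k, 'v, 'n) free_elem \<Rightarrow> 'a" where
  "eval_free x = (\<Sum>w\<in>Poly_Mapping.keys x. scale M (Poly_Mapping.lookup x w) (word_image w))"

lemma eval_superset: "finite A \<Longrightarrow> Poly_Mapping.keys x \<subseteq> A \<Longrightarrow>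
    eval_free x = (\<Sum>w\<in>A. scale M (Poly_Mapping.lookup x w) (word_image w))"
  unfolding eval_free_def by (rule sum.mono_neutral_left) (auto simp: in_keys_iff)

lemma eval_add: "eval_free (x + y) = eval_free x + eval_free y"
  using keys_add[of x y]
  by (simp add: eval_superset[where A = "Poly_Mapping.keys x \<union> Poly_Mapping.keys y"] lookup_add
      scale_left_distrib sum.distrib)

lemma eval_scale: "eval_free (free_scale c x) = scale M c (eval_free x)"
  using keys_free_scale[of c x]
  by (simp add: eval_superset[where A = "Poly_Mapping.keys x"] scale_sum_right)

lemma eval_zero [simp]: "eval_free 0 = 0"
  by (simp add: eval_free_def)

lemma eval_single: "eval_free (Poly_Mapping.single w c) = scale M c (word_image w)"
  by (subst eval_superset[where A = "{w}"]) auto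

lemma eval_diff: "eval_free (x - y) = eval_free x - eval_free y"
  using eval_add[of "x - y" y] by simp

lemma eval_sum: "eval_free (\<Sum>i\<in>A. f i) = (\<Sum>i\<in>A. eval_free (f i))"
  by (induction A rule: infinite_finite_induct) (auto simp: eval_add)

lemma bracket_sum_left: "bracket M (\<Sum>i\<in>A. f i) y = (\<Sum>i\<in>A. bracket M (f i) y)"
  by (induction A rule: infinite_finite_induct) (auto simp: bracket_add_left)

lemma bracket_sum_right: "bracket M y (\<Sum>i\<in>A. f i) = (\<Sum>i\<in>A. bracket M y (f i))"
  by (induction A rule: infinite_finite_induct) (auto simp: bracket_add_right)

lemma eval_bracket: "eval_free (free_bracket x y) = bracket M (eval_free x) (eval_free y)"
  unfolding free_bracket_def eval_sum eval_single
  unfolding eval_free_def bracket_sum_left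
  unfolding bracket_sum_right
  by (simp add: bracket_scale_left bracket_scale_right mult.commute)

lemma part_closed:
  "0 \<in> part M p" "x \<in> part M p \<Longrightarrow> y \<in> part M p \<Longrightarrow> x + y \<in> part M p"
  "x \<in> part M p \<Longrightarrow> scale M c x \<in> part M p" "x \<in> part M p \<Longrightarrow> x \<in> carrier M"
  using part_subspace[of p] by (auto simp: subspace_of_def)

lemma word_image_part: "word_image w \<in> part M (word_parity par w)"
proof (induction w)
  case (Gen g) then show ?case by (cases g) (auto simp: E_part F_part H_part)
next
  case (Br s t) then show ?case by (simp only: word_image.simps word_parity.simps bracket_part)
qed

lemma eval_part: "x \<in> part (free_superalgebra par) p \<Longrightarrow> eval_free x \<in> part M p"
  by (rule poly_mapping_linear_induct[where x = x])
    (auto simp: eval_add eval_single part_closed part_free_superalgebra word_image_part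
      intro!: part_closed)

lemma eval_carrier: "eval_free x \<in> carrier M"
proof (rule poly_mapping_linear_induct[where x = x])
  show "eval_free (Poly_Mapping.single w c) \<in> carrier M" for w c
    unfolding eval_single by (rule subspace_scale[OF subspace_carrier part_closed(4)[OF word_image_part]])
qed (auto simp: eval_add intro: subspace_add subspace_0 subspace_carrier)

lemma word_image_G: "word_image w \<in> G (word_degree w)"
proof (induction w)
  case (Gen g) then show ?case by (cases g) (auto simp: E_G F_G H_G)
next
  case (Br s t) then show ?case by (simp add: bracket_G)
qed

lemma eval_G: "x \<in> free_homogeneous q \<Longrightarrow> eval_free x \<in> G q"
proof (rule poly_mapping_linear_induct[where x = x])
  fix w c assume "x \<in> free_homogeneous q" "w \<in> Poly_Mapping.keys x"
  then have "word_image w \<in> G q" using word_image_G[of w] by (simp add: free_homogeneous_def)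
  then show "eval_free (Poly_Mapping.single w c) \<in> G q"
    unfolding eval_single by (rule subspace_scale[OF G_subspace])
qed (auto simp: eval_add intro: subspace_add subspace_0 G_subspace)

definition eval_kernel :: "('k, 'v, 'n) free_elem set" where
  "eval_kernel = {x. eval_free x = 0}"

sublocale kernel: free_ideal eval_kernel
  by unfold_locales (auto simp: eval_kernel_def eval_add eval_scale eval_bracket)

lemma relators_kernel: "relators par sc h \<alpha> \<subseteq> eval_kernel"
proof
  fix x assume "x \<in> relators par sc h \<alpha>"
  then have "eval_free x = 0"
  proof cases
    case (antisymmetry x p y q)
    then show ?thesis
      using lie_superalgebra.antisymmetry[OF lie_superalgebra_axioms eval_part eval_part]
      by (simp add: eval_add eval_scale eval_bracket)
  next
    case (jacobi x p y q z r)
    then show ?thesis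
      using lie_superalgebra.jacobi[OF lie_superalgebra_axioms eval_part eval_part eval_part]
      by (simp add: eval_diff eval_scale eval_bracket)
  next
    case (odd_cube x)
    then show ?thesis
      using lie_superalgebra.odd_cube[OF lie_superalgebra_axioms eval_part] by (simp add: eval_bracket)
  qed (simp_all add: eval_add eval_diff eval_scale eval_bracket eval_single H_add H_scale EF_same EF_diff HE HF HH)
  then show "x \<in> eval_kernel" by (simp add: eval_kernel_def)
qed

lemma rel_ideal_kernel: "rel_ideal \<subseteq> eval_kernel"
  unfolding rel_ideal_def ideal_generated_by_def
  using relators_kernel kernel.free_ideal_axioms by (auto simp: free_ideal_iff)

abbreviation cl :: "('k, 'v, 'n) free_elem \<Rightarrow> ('k, 'v, 'n) free_elem set" where
  "cl \<equiv> gtilde_class par sc h \<alpha>"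

sublocale gt: presented rel_ideal par "gtilde par sc h \<alpha>" cl
proof -
  interpret p: presented "{0}" par "free_superalgebra par" "\<lambda>x. x" by (rule presented_free)
  have "cl = (\<lambda>x. coset (free_superalgebra par) ((\<lambda>x. x) ` rel_ideal) x)"
    by (rule ext) (simp add: gtilde_class_def rel_ideal_def)
  moreover have "gtilde par sc h \<alpha> = quotient (free_superalgebra par) ((\<lambda>x. x) ` rel_ideal)"
    by (simp add: gtilde_def rel_ideal_def)
  ultimately show "presented rel_ideal par (gtilde par sc h \<alpha>) cl"
    using p.presented_quotient[OF rel.free_ideal_axioms] rel.zero_mem by simp
qed

lemma cl_in_kernel: "cl x \<in> cl ` eval_kernel \<longleftrightarrow> eval_free x = 0"
proof
  assume "cl x \<in> cl ` eval_kernel"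
  then obtain y where "cl x = cl y" "eval_free y = 0" by (auto simp: eval_kernel_def)
  then have "eval_free (x - y) = 0" using gt.cl_eq_iff[of x y] rel_ideal_kernel by (auto simp: eval_kernel_def)
  then show "eval_free x = 0" using \<open>eval_free y = 0\<close> by (simp add: eval_diff)
qed (auto simp: eval_kernel_def)

lemma ideal_kernel: "ideal_of (gtilde par sc h \<alpha>) (cl ` eval_kernel)"
  unfolding ideal_of_def subspace_of_def
  by (auto simp: gt.carrier_cl gt.zero_cl gt.add_cl gt.scale_cl gt.bracket_cl cl_in_kernel
      eval_add eval_scale eval_bracket eval_kernel_def)

text \<open>The homogeneous components of a kernel element are evaluated in independent pieces, and
  their values add up to zero; so each component is in the kernel.\<close>

lemma graded_kernel: "graded_ideal par sc h \<alpha> (cl ` eval_kernel)"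
proof -
  let ?J = "cl ` eval_kernel" and ?g = "gtilde par sc h \<alpha>"
  let ?U = "\<Union>q. ?J \<inter> gtilde_grade par sc h \<alpha> q"
  have "span_of ?g ?U \<subseteq> ?J"
    using ideal_kernel by (auto simp: span_of_def ideal_of_def)
  moreover have "?J \<subseteq> span_of ?g ?U"
  proof
    fix X assume "X \<in> ?J"
    then obtain x where x: "X = cl x" "eval_free x = 0" by (auto simp: eval_kernel_def)
    define comp where "comp q = (\<Sum>w\<in>{w \<in> Poly_Mapping.keys x. word_degree w = q}.
        Poly_Mapping.single w (Poly_Mapping.lookup x w))" for q
    let ?Q = "word_degree ` Poly_Mapping.keys x"
    have sum: "(\<Sum>q\<in>?Q. comp q) = x"
      unfolding comp_def by (subst sum.group) (auto simp: poly_mapping_sum_singles[symmetric])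
    have hom: "comp q \<in> free_homogeneous q" for q
      unfolding free_homogeneous_def comp_def by (auto dest!: keys_sum[THEN subsetD] split: if_splits)
    have "eval_free (comp q) = 0" if "q \<in> ?Q" for q
      by (rule G_independent[of ?Q "\<lambda>q. eval_free (comp q)"])
        (use that in \<open>auto simp: eval_sum[symmetric] sum x intro!: eval_G hom\<close>)
    then have U: "cl (comp q) \<in> ?U" if "q \<in> ?Q" for q
      using hom[of q] that by (auto simp: gtilde_grade_def free_homogeneous_def cl_in_kernel)
    have "cl (\<Sum>q\<in>A. comp q) \<in> T" if "finite A" "A \<subseteq> ?Q" "subspace_of ?g T" "?U \<subseteq> T" for A T
      using that
    proof (induction A rule: finite_induct)
      case empty then show ?case by (auto simp: subspace_of_def gt.zero_cl)
    next
      case (insert q A)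
      have "cl (comp q) \<in> ?U" by (rule U) (use insert.prems in simp)
      with insert have "cl (comp q) \<in> T" "cl (\<Sum>q\<in>A. comp q) \<in> T" by (simp_all add: subset_iff)
      with insert.prems have "add ?g (cl (comp q)) (cl (\<Sum>q\<in>A. comp q)) \<in> T"
        by (simp add: subspace_of_def)
      then show ?case using insert by (simp add: gt.add_cl)
    qed
    from this[of ?Q] show "X \<in> span_of ?g ?U" by (auto simp: span_of_def x sum)
  qed
  ultimately show ?thesis using ideal_kernel unfolding graded_ideal_def by blast
qed

lemma cartan_kernel: "cl ` eval_kernel \<inter> gtilde_cartan par sc h \<alpha> = {zero (gtilde par sc h \<alpha>)}"
proof -
  have "X = cl 0" if "X \<in> cl ` eval_kernel" "X \<in> gtilde_cartan par sc h \<alpha>" for X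
  proof -
    from that obtain v where v: "X = cl (gen (Cartan v))" by (auto simp: gtilde_cartan_def)
    with that have "v = 0" by (intro H_inj) (simp add: cl_in_kernel eval_single)
    then show ?thesis using cartan_zero_mem by (simp add: v gt.cl_eq_iff)
  qed
  moreover have "cl 0 = cl (gen (Cartan 0))"
    using cartan_zero_mem rel.diff_commute[of 0] by (simp add: gt.cl_eq_iff)
  moreover have "cl 0 \<in> cl ` eval_kernel" by (simp add: cl_in_kernel)
  moreover have "cl 0 \<in> gtilde_cartan par sc h \<alpha>" unfolding gtilde_cartan_def \<open>cl 0 = _\<close> by blast
  ultimately show ?thesis unfolding gt.zero_cl by blast
qed

text \<open>Nonzero homogeneous elements can be pushed down to degree 0, where only the Cartan subalgebra lives.\<close>

lemma ideal_in_kernel: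
  assumes J: "graded_ideal par sc h \<alpha> J" and triv: "J \<inter> gtilde_cartan par sc h \<alpha> = {zero (gtilde par sc h \<alpha>)}"
  shows "J \<subseteq> cl ` eval_kernel"
proof -
  let ?g = "gtilde par sc h \<alpha>"
  have ideal: "ideal_of ?g J" using J by (simp add: graded_ideal_def)
  have br: "cl (free_bracket y x) \<in> J" if "cl x \<in> J" for x y
    using ideal that by (auto simp: ideal_of_def gt.carrier_cl gt.bracket_cl[symmetric])
  have hom: "eval_free x = 0" if "x \<in> free_homogeneous q" "cl x \<in> J" for x q
    using that
  proof (induction "abs_height q" arbitrary: x q rule: less_induct)
    case less
    show ?case
    proof (cases "q = 0")
      case True
      then obtain v where v: "x - gen (Cartan v) \<in> rel_ideal" using degree_zero_is_cartan less.prems by blast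
      then have "cl x = cl (gen (Cartan v))" by (simp add: gt.cl_eq_iff)
      then have "cl x \<in> J \<inter> gtilde_cartan par sc h \<alpha>" using less.prems by (auto simp: gtilde_cartan_def)
      then have "cl x = cl 0" using triv by (simp add: gt.zero_cl)
      then show ?thesis using rel_ideal_kernel by (auto simp: gt.cl_eq_iff eval_kernel_def)
    next
      case False
      show ?thesis
      proof (rule ccontr)
        assume "eval_free x \<noteq> 0"
        from descent[OF eval_G[OF less.prems(1)] this False] obtain i where
          "bracket M (E i) (eval_free x) \<noteq> 0 \<and> abs_height (q + axis i 1) < abs_height q
            \<or> bracket M (F i) (eval_free x) \<noteq> 0 \<and> abs_height (q - axis i 1) < abs_height q" ..
        then show False
        proof (elim disjE conjE)
          assume *: "bracket M (E i) (eval_free x) \<noteq> 0" "abs_height (q + axis i 1) < abs_height q"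
          have "free_bracket (gen (Pos i)) x \<in> free_homogeneous (q + axis i 1)"
            using free_homogeneous_bracket[of "gen (Pos i)" "axis i 1" x q] less.prems
            by (simp add: free_homogeneous_def add.commute)
          from less.hyps[OF *(2) this br] * less.prems show False
            by (simp add: eval_bracket eval_single)
        next
          assume *: "bracket M (F i) (eval_free x) \<noteq> 0" "abs_height (q - axis i 1) < abs_height q"
          have "free_bracket (gen (Neg i)) x \<in> free_homogeneous (q - axis i 1)"
            using free_homogeneous_bracket[of "gen (Neg i)" "- axis i 1" x q] less.prems
            by (simp add: free_homogeneous_def add.commute)
          from less.hyps[OF *(2) this br] * less.prems show False
            by (simp add: eval_bracket eval_single)
        qed
      qed
    qed
  qed
  have "subspace_of ?g (cl ` eval_kernel)" using ideal_kernel by (simp add: ideal_of_def)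
  moreover have "(\<Union>q. J \<inter> gtilde_grade par sc h \<alpha> q) \<subseteq> cl ` eval_kernel"
    using hom by (auto simp: gtilde_grade_def free_homogeneous_def cl_in_kernel)
  moreover have "J = span_of ?g (\<Union>q. J \<inter> gtilde_grade par sc h \<alpha> q)" using J by (simp add: graded_ideal_def)
  ultimately show ?thesis by (auto simp: span_of_def)
qed

text \<open>\<open>GREATEST\<close> is meaningful only once a greatest candidate is known. The
  kernel of evaluation is a candidate and contains all others.\<close>

lemma gradical_eq: "gradical par sc h \<alpha> = cl ` eval_kernel"
  unfolding gradical_def
  by (rule Greatest_equality) (use graded_kernel cartan_kernel ideal_in_kernel in auto)

definition ccl :: "('k, 'v, 'n) free_elem \<Rightarrow> ('k, 'v, 'n) free_elem set set" where
  "ccl x = coset (gtilde par sc h \<alpha>) (gradical par sc h \<alpha>) (cl x)"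

sublocale cg: presented eval_kernel par "contragredient par sc h \<alpha>" ccl
  using gt.presented_quotient[OF kernel.free_ideal_axioms rel_ideal_kernel]
  by (simp add: contragredient_def gradical_eq ccl_def[abs_def])

lemma eval_surj: "carrier M = range eval_free"
proof
  show "carrier M \<subseteq> range eval_free"
  proof (rule generated)
    show "subspace (range eval_free)"
      unfolding subspace_def using eval_add[symmetric] eval_scale[symmetric]
      by (auto intro: range_eqI[of _ _ 0])
    show "bracket M x y \<in> range eval_free" if "x \<in> range eval_free" "y \<in> range eval_free" for x y
      using that eval_bracket[symmetric] by auto
    have "E i = eval_free (gen (Pos i))" for i by (simp add: eval_single)
    then show "range E \<subseteq> range eval_free" by auto
    have "F i = eval_free (gen (Neg i))" for i by (simp add: eval_single)
    then show "range F \<subseteq> range eval_free" by auto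
    have "H i = eval_free (gen (Cartan i))" for i by (simp add: eval_single)
    then show "range H \<subseteq> range eval_free" by auto
  qed
qed (use eval_carrier in auto)

text \<open>A preimage of a homogeneous element splits by parity of words. The part of the wrong
  parity is mapped to an element that is both even and odd, hence to zero.\<close>

lemma eval_part_surj: "eval_free ` part (free_superalgebra par) p = part M p"
proof
  show "part M p \<subseteq> eval_free ` part (free_superalgebra par) p"
  proof
    fix m assume m: "m \<in> part M p"
    then have "m \<in> carrier M" using part_closed by blast
    then obtain x where x: "m = eval_free x" using eval_surj by auto
    define c where "c r = (\<Sum>w\<in>{w \<in> Poly_Mapping.keys x. word_parity par w = r}.
        Poly_Mapping.single w (Poly_Mapping.lookup x w))" for r
    have "(\<Sum>r\<in>{0, 1}. c r) = x"
      unfolding c_def by (subst sum.group) (use bit_not_zero_iff in \<open>auto simp: poly_mapping_sum_singles[symmetric]\<close>)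
    then have sum: "c 0 + c 1 = x" by simp
    have c: "c r \<in> part (free_superalgebra par) r" for r
      unfolding part_free_superalgebra c_def by (auto dest!: keys_sum[THEN subsetD] split: if_splits)
    have c': "eval_free (c r) \<in> part M r" for r by (rule eval_part[OF c])
    have m': "m = eval_free (c 0) + eval_free (c 1)" by (simp add: x sum[symmetric] eval_add)
    have pd: "a - b \<in> part M r" if "a \<in> part M r" "b \<in> part M r" for a b r
      using part_subspace[of r] that by (auto simp: subspace_of_iff intro: subspace_diff)
    consider "p = 0" | "p = 1" using bit_not_zero_iff by blast
    then have "m = eval_free (c p)"
    proof cases
      case 1
      have "m - eval_free (c 0) \<in> part M 0" using pd[OF m[unfolded 1] c'] .
      then have "eval_free (c 1) = 0" using part_disjoint[OF _ c'] m' by simp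
      then show ?thesis by (simp add: m' 1)
    next
      case 2
      have "m - eval_free (c 1) \<in> part M 1" using pd[OF m[unfolded 2] c'] .
      then have "eval_free (c 0) = 0" using part_disjoint[OF c'] m' by simp
      then show ?thesis by (simp add: m' 2)
    qed
    then show "m \<in> eval_free ` part (free_superalgebra par) p" using c by blast
  qed
qed (use eval_part in auto)

theorem contragredient_iso:
  "\<exists>\<phi>. superalgebra_morphism_iso (contragredient par sc h \<alpha>) M \<phi> \<and>
     (\<forall>i. e_gen par sc h \<alpha> i \<in> carrier (contragredient par sc h \<alpha>) \<and> \<phi> (e_gen par sc h \<alpha> i) = E i)"
proof -
  \<comment> \<open>Two representatives of the same class differ by an element of
    \<open>eval_kernel\<close>, so the arbitrary choice does not affect the value.\<close>
  define \<phi> where "\<phi> X = eval_free (SOME x. X = ccl x)" for X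
  have \<phi>: "\<phi> (ccl x) = eval_free x" for x
  proof -
    have "ccl x = ccl (SOME y. ccl x = ccl y)" by (rule someI[of "\<lambda>y. ccl x = ccl y" x]) simp
    then have "eval_free (x - (SOME y. ccl x = ccl y)) = 0" unfolding cg.cl_eq_iff by (simp add: eval_kernel_def)
    then show ?thesis by (simp add: \<phi>_def eval_diff)
  qed
  have "bij_betw \<phi> (carrier (contragredient par sc h \<alpha>)) (carrier M)"
    unfolding bij_betw_def
  proof
    show "inj_on \<phi> (carrier (contragredient par sc h \<alpha>))"
      by (auto simp: inj_on_def cg.carrier_cl \<phi> cg.cl_eq_iff eval_kernel_def eval_diff)
    show "\<phi> ` carrier (contragredient par sc h \<alpha>) = carrier M"
      by (simp add: cg.carrier_cl image_image \<phi> eval_surj)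
  qed
  then have "superalgebra_morphism_iso (contragredient par sc h \<alpha>) M \<phi>"
    unfolding superalgebra_morphism_iso_def superalgebra_iso_def
    by (auto simp: cg.zero_cl cg.carrier_cl cg.add_cl cg.scale_cl cg.bracket_cl \<phi> eval_add eval_scale eval_bracket
        cg.part_cl image_image eval_part_surj)
  moreover have "\<phi> (e_gen par sc h \<alpha> i) = E i" "e_gen par sc h \<alpha> i \<in> carrier (contragredient par sc h \<alpha>)" for i
    using \<phi>[of "gen (Pos i)"] by (simp_all add: e_gen_def ccl_def[symmetric] eval_single cg.carrier_cl)
  ultimately show ?thesis by blast
qed

end

section \<open>The Lie algebra of a simply laced root system\<close>

lemma sum_fun_apply [simp]: "(\<Sum>i\<in>A. f i) x = (\<Sum>i\<in>A. f i x)"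
  by (induction A rule: infinite_finite_induct) auto

text \<open>
  The integral bilinear form \<open>cform\<close> with matrix \<open>K\<close> is a half of the even form with matrix \<open>A\<close>;
  the signs \<open>cocycle\<close> are those of the Frenkel-Kac construction.
\<close>

locale simply_laced = realization sc A h \<alpha>
  for sc :: "'k::field \<Rightarrow> 'v::ab_group_add \<Rightarrow> 'v" and A :: "int ^ 'n ^ 'n"
    and h :: "'n::finite \<Rightarrow> 'v" and \<alpha> :: "'n \<Rightarrow> 'v \<Rightarrow> 'k" +
  fixes K :: "int ^ 'n ^ 'n"
  assumes A_K: "A $ i $ j = K $ i $ j + K $ j $ i"
    and A_diag: "A $ i $ i = 2" and A_offdiag: "i \<noteq> j \<Longrightarrow> A $ i $ j \<le> 0"
    and positive: "x \<noteq> 0 \<Longrightarrow> 0 < (\<Sum>i\<in>UNIV. \<Sum>j\<in>UNIV. x $ i * x $ j * K $ i $ j)"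
    and finite_norm2: "finite {g. (\<Sum>i\<in>UNIV. \<Sum>j\<in>UNIV. g $ i * g $ j * K $ i $ j) = 1}"
begin

section \<open>Inner products of roots and the sign cocycle\<close>

definition cform :: "int ^ 'n \<Rightarrow> int ^ 'n \<Rightarrow> int" where
  "cform x y = (\<Sum>i\<in>UNIV. \<Sum>j\<in>UNIV. x $ i * y $ j * K $ i $ j)"

definition form :: "int ^ 'n \<Rightarrow> int ^ 'n \<Rightarrow> int" where
  "form x y = cform x y + cform y x"

definition cocycle :: "int ^ 'n \<Rightarrow> int ^ 'n \<Rightarrow> 'k" where
  "cocycle x y = (if even (cform x y) then 1 else - 1)"

definition roots :: "(int ^ 'n) set" where
  "roots = {g. form g g = 2}"

lemma cform_bilinear:
  "cform (x + y) z = cform x z + cform y z" "cform z (x + y) = cform z x + cform z y"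
  "cform (- x) z = - cform x z" "cform z (- x) = - cform z x"
  "cform (x - y) z = cform x z - cform y z" "cform z (x - y) = cform z x - cform z y"
  "cform 0 z = 0" "cform z 0 = 0"
  by (simp_all add: cform_def algebra_simps sum.distrib sum_negf sum_subtractf)

lemma form_bilinear:
  "form (x + y) z = form x z + form y z" "form z (x + y) = form z x + form z y"
  "form (- x) z = - form x z" "form z (- x) = - form z x"
  "form (x - y) z = form x z - form y z" "form z (x - y) = form z x - form z y"
  "form 0 z = 0" "form z 0 = 0"
  by (simp_all add: form_def cform_bilinear)

lemma form_commute: "form x y = form y x"
  by (simp add: form_def)

lemma form_self: "form x x = 2 * cform x x"
  by (simp add: form_def)

lemma form_nonneg: "form x x \<ge> 0"
  using positive[of x] by (cases "x = 0") (auto simp: form_self cform_def)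

lemma form_pos: "form x x \<le> 0 \<Longrightarrow> x = 0"
  using positive[of x] by (cases "x = 0") (auto simp: form_self cform_def)

lemma roots_cform: "g \<in> roots \<longleftrightarrow> cform g g = 1"
  by (simp add: roots_def form_self)

lemma finite_roots: "finite roots"
  using finite_norm2 by (rule rev_finite_subset) (auto simp: roots_cform cform_def)

lemma zero_not_root [simp]: "0 \<notin> roots"
  by (simp add: roots_def form_bilinear)

lemma neg_root [simp]: "- g \<in> roots \<longleftrightarrow> g \<in> roots"
  by (simp add: roots_def form_bilinear)

lemma root_self: "g \<in> roots \<Longrightarrow> form g g = 2"
  by (simp add: roots_def)

text \<open>The norm of \<open>g - d\<close> is 4 minus twice the inner product, and the form is
  positive definite.\<close>

lemma form_upper:
  assumes "g \<in> roots" "d \<in> roots"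
  shows "form g d \<le> 2" "form g d = 2 \<longleftrightarrow> d = g"
proof -
  have "form (g - d) (g - d) = 4 - 2 * form g d"
    using assms by (simp add: form_bilinear root_self form_commute[of d g])
  then show "form g d \<le> 2" "form g d = 2 \<longleftrightarrow> d = g"
    using form_nonneg[of "g - d"] form_pos[of "g - d"] assms by (auto simp: root_self)
qed

lemma form_lower:
  assumes "g \<in> roots" "d \<in> roots"
  shows "form g d \<ge> - 2" "form g d = - 2 \<longleftrightarrow> d = - g"
  using form_upper[of g "- d"] assms by (auto simp: form_bilinear)

lemma add_root_iff:
  assumes "g \<in> roots" "d \<in> roots"
  shows "g + d \<in> roots \<longleftrightarrow> form g d = - 1"
proof -
  have "form (g + d) (g + d) = 4 + 2 * form g d"
    using assms by (simp add: form_bilinear root_self form_commute[of d g])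
  then show ?thesis by (auto simp: roots_def)
qed

lemma cocycle_bimult:
  "cocycle (x + y) z = cocycle x z * cocycle y z" "cocycle z (x + y) = cocycle z x * cocycle z y"
  "cocycle (- x) z = cocycle x z" "cocycle z (- x) = cocycle z x"
  "cocycle (x - y) z = cocycle x z * cocycle y z" "cocycle z (x - y) = cocycle z x * cocycle z y"
  by (auto simp: cocycle_def cform_bilinear)

lemma cocycle_square [simp]: "cocycle x y * cocycle x y = 1" "cocycle x y * (cocycle x y * z) = z"
  by (auto simp: cocycle_def)

lemma cocycle_nonzero [simp]: "cocycle x y \<noteq> 0"
  by (auto simp: cocycle_def)

lemma cocycle_swap: "cocycle y x = (if even (form x y) then 1 else - 1) * cocycle x y"
  by (auto simp: cocycle_def form_def)

lemma cocycle_self: "g \<in> roots \<Longrightarrow> cocycle g g = - 1"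
  by (simp add: cocycle_def roots_cform)

abbreviation simple :: "'n \<Rightarrow> int ^ 'n" where
  "simple i \<equiv> axis i 1"

lemma axis_component: "simple i $ j = (if i = j then 1 else 0)"
  by (simp add: axis_def)

lemma cform_simple_left: "cform (simple i) y = (\<Sum>j\<in>UNIV. y $ j * K $ i $ j)"
proof -
  have "cform (simple i) y = (\<Sum>k\<in>UNIV. if i = k then (\<Sum>j\<in>UNIV. y $ j * K $ k $ j) else 0)"
    unfolding cform_def axis_component by (rule sum.cong) simp_all
  then show ?thesis by simp
qed

lemma cform_simple: "cform (simple i) (simple j) = K $ i $ j"
  by (simp add: cform_simple_left axis_component if_distrib[of "\<lambda>x. x * _"] cong: if_cong)

lemma form_simple: "form (simple i) (simple j) = A $ i $ j"
  by (simp add: form_def cform_simple A_K)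

lemma simple_root [simp]: "simple i \<in> roots"
  by (simp add: roots_def form_simple A_diag)

lemma cform_expand: "cform x y = (\<Sum>i\<in>UNIV. x $ i * cform (simple i) y)"
  by (simp add: cform_simple_left) (simp add: cform_def sum_distrib_left mult.assoc)

lemma cform_expand_right: "cform y x = (\<Sum>i\<in>UNIV. x $ i * cform y (simple i))"
proof -
  have "cform y (simple i) = (\<Sum>j\<in>UNIV. y $ j * K $ j $ i)" for i
    by (simp add: cform_def axis_component if_distrib[of "\<lambda>x. x * _"] if_distrib[of "\<lambda>x. _ * x"] cong: if_cong)
  then show ?thesis unfolding cform_def
    by (subst sum.swap) (simp add: sum_distrib_left mult.assoc mult.left_commute)
qed

lemma form_expand: "form x y = (\<Sum>i\<in>UNIV. x $ i * form (simple i) y)"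
  by (simp add: form_def cform_expand[of x] cform_expand_right[of y x] sum.distrib distrib_left)

definition coroot :: "int ^ 'n \<Rightarrow> 'v" where
  "coroot g = (\<Sum>i\<in>UNIV. sc (of_int (g $ i)) (h i))"

definition weight :: "int ^ 'n \<Rightarrow> 'v \<Rightarrow> 'k" where
  "weight g v = (\<Sum>i\<in>UNIV. of_int (g $ i) * \<alpha> i v)"

lemma \<alpha>_simps: "\<alpha> i (u + v) = \<alpha> i u + \<alpha> i v" "\<alpha> i (sc c v) = c * \<alpha> i v" "\<alpha> i 0 = 0" "\<alpha> i (- v) = - \<alpha> i v"
proof -
  interpret l: Vector_Spaces.linear sc "(*)" "\<alpha> i" by (rule \<alpha>_linear)
  show "\<alpha> i (u + v) = \<alpha> i u + \<alpha> i v" "\<alpha> i (sc c v) = c * \<alpha> i v" "\<alpha> i 0 = 0" "\<alpha> i (- v) = - \<alpha> i v"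
    by (simp_all add: l.add l.scale l.zero l.neg)
qed

lemma \<alpha>_sum: "\<alpha> i (\<Sum>j\<in>J. g j) = (\<Sum>j\<in>J. \<alpha> i (g j))"
  by (induction J rule: infinite_finite_induct) (auto simp: \<alpha>_simps)

lemma weight_simps [simp]:
  "weight g (u + v) = weight g u + weight g v" "weight g (sc c v) = c * weight g v"
  "weight g 0 = 0" "weight g (- v) = - weight g v"
  "weight (g + d) v = weight g v + weight d v" "weight (- g) v = - weight g v"
  "weight (g - d) v = weight g v - weight d v" "weight 0 v = 0"
  by (simp_all add: weight_def \<alpha>_simps algebra_simps sum.distrib sum_distrib_left sum_negf sum_subtractf)

lemma weight_simple [simp]: "weight (simple i) v = \<alpha> i v"
  by (simp add: weight_def axis_component if_distrib[of of_int] if_distrib[of "\<lambda>x. x * _"] cong: if_cong)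

lemma coroot_simps [simp]:
  "coroot (g + d) = coroot g + coroot d" "coroot (- g) = - coroot g" "coroot 0 = 0"
  "coroot (g - d) = coroot g - coroot d"
  by (simp_all add: coroot_def scale_left_distrib scale_left_diff_distrib sum.distrib sum_negf sum_subtractf)

lemma coroot_simple [simp]: "coroot (simple i) = h i"
  by (simp add: coroot_def axis_component if_distrib[of of_int] if_distrib[of "\<lambda>x. sc x _"] cong: if_cong)

lemma weight_coroot: "weight g (coroot d) = of_int (form g d)"
proof -
  have "weight g (coroot d) = (\<Sum>i\<in>UNIV. \<Sum>j\<in>UNIV. of_int (g $ i * d $ j * A $ j $ i))"
    by (simp add: weight_def coroot_def \<alpha>_sum \<alpha>_simps \<alpha>_h sum_distrib_left mult.assoc)
  also have "\<dots> = of_int (\<Sum>i\<in>UNIV. \<Sum>j\<in>UNIV. g $ i * d $ j * A $ j $ i)" by simp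
  also have "(\<Sum>i\<in>UNIV. \<Sum>j\<in>UNIV. g $ i * d $ j * A $ j $ i) = form g d"
    by (subst form_expand, subst form_commute, subst form_expand)
      (simp add: form_simple sum_distrib_left mult.assoc)
  finally show ?thesis .
qed

text \<open>Otherwise all terms of (g,g), expanded in the coefficients of \<open>g\<close>, would be
  at most 0. The result serves three times: for generation, for descent, and for enumerating the
  degrees.\<close>

lemma root_descent:
  assumes "g \<in> roots"
  shows "\<exists>i. 0 < g $ i \<and> 0 < form g (simple i) \<or> g $ i < 0 \<and> form g (simple i) < 0"
proof (rule ccontr)
  assume "\<not> ?thesis"
  then have "g $ i * form (simple i) g \<le> 0" for i
    by (auto simp: mult_le_0_iff form_commute[of g] not_less)
  then have "form g g \<le> 0" by (subst form_expand) (rule sum_nonpos)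
  then show False using assms by (simp add: root_self)
qed

lemma abs_height_add: "g $ i < 0 \<Longrightarrow> abs_height (g + simple i) < abs_height g"
  unfolding abs_height_def by (rule sum_strict_mono_ex1) (auto simp: axis_component intro!: bexI[of _ i])

lemma abs_height_diff: "g $ i > 0 \<Longrightarrow> abs_height (g - simple i) < abs_height g"
  unfolding abs_height_def by (rule sum_strict_mono_ex1) (auto simp: axis_component intro!: bexI[of _ i])


section \<open>The root algebra and the brackets of its basis vectors\<close>

definition smult :: "'k \<Rightarrow> 'v \<times> (int ^ 'n \<Rightarrow> 'k) \<Rightarrow> 'v \<times> (int ^ 'n \<Rightarrow> 'k)" where
  "smult c x = (sc c (fst x), \<lambda>g. c * snd x g)"

text \<open>The first component is the Cartan part, the second the function on the root system. The
  minus sign is the value of the cocycle at a pair of opposite roots, which equals its value -1 at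
  (g,g). All sums are restricted to roots, so bilinearity holds on the whole type.\<close>

definition root_bracket ::
  "'v \<times> (int ^ 'n \<Rightarrow> 'k) \<Rightarrow> 'v \<times> (int ^ 'n \<Rightarrow> 'k) \<Rightarrow> 'v \<times> (int ^ 'n \<Rightarrow> 'k)" where
  "root_bracket x y =
     (- (\<Sum>g\<in>roots. sc (snd x g * snd y (- g)) (coroot g)),
      \<lambda>d. if d \<in> roots
        then weight d (fst x) * snd y d - weight d (fst y) * snd x d
          + (\<Sum>g\<in>roots. if d - g \<in> roots then cocycle g (d - g) * snd x g * snd y (d - g) else 0)
        else 0)"

definition root_algebra :: "('k, 'v \<times> (int ^ 'n \<Rightarrow> 'k)) superalgebra" where
  "root_algebra =
     \<lparr> carrier = {x. \<forall>g. g \<notin> roots \<longrightarrow> snd x g = 0}, zero = 0, add = (+), scale = smult,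
       bracket = root_bracket,
       part = (\<lambda>p. if p = 0 then {x. \<forall>g. g \<notin> roots \<longrightarrow> snd x g = 0} else {0}) \<rparr>"

lemma root_algebra_simps [simp]:
  "zero root_algebra = 0" "add root_algebra = (+)"
  "scale root_algebra = smult" "bracket root_algebra = root_bracket"
  "part root_algebra 0 = carrier root_algebra" "part root_algebra 1 = {0}"
  by (simp_all add: root_algebra_def)

lemma in_carrier: "x \<in> carrier root_algebra \<longleftrightarrow> (\<forall>g. g \<notin> roots \<longrightarrow> snd x g = 0)"
  by (simp add: root_algebra_def)

lemma smult_vector_space: "vector_space smult"
  by unfold_locales
    (auto simp: smult_def prod_eq_iff fun_eq_iff scale_right_distrib scale_left_distrib algebra_simps)

lemma root_bracket_bilinear:
  "root_bracket (x + y) z = root_bracket x z + root_bracket y z"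
  "root_bracket z (x + y) = root_bracket z x + root_bracket z y"
  "root_bracket (smult c x) y = smult c (root_bracket x y)"
  "root_bracket x (smult c y) = smult c (root_bracket x y)"
proof -
  have d: "(if P then a else (0::'k)) + (if P then b else 0) = (if P then a + b else 0)" for P a b by simp
  have e: "c * (if P then a else (0::'k)) = (if P then c * a else 0)" for P a by simp
  show "root_bracket (x + y) z = root_bracket x z + root_bracket y z"
    by (auto simp: root_bracket_def prod_eq_iff fun_eq_iff algebra_simps scale_left_distrib
        sum.distrib[symmetric] d intro!: sum.cong)
  show "root_bracket z (x + y) = root_bracket z x + root_bracket z y"
    by (auto simp: root_bracket_def prod_eq_iff fun_eq_iff algebra_simps scale_left_distrib
        sum.distrib[symmetric] d intro!: sum.cong)
  show "root_bracket (smult c x) y = smult c (root_bracket x y)"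
    by (auto simp: root_bracket_def smult_def prod_eq_iff fun_eq_iff algebra_simps
        sum_distrib_left scale_sum_right e intro!: sum.cong)
  show "root_bracket x (smult c y) = smult c (root_bracket x y)"
    by (auto simp: root_bracket_def smult_def prod_eq_iff fun_eq_iff algebra_simps
        sum_distrib_left scale_sum_right e intro!: sum.cong)
qed

sublocale L: linear_superalgebra root_algebra
proof unfold_locales
  show "subspace_of root_algebra (carrier root_algebra)"
    by (auto simp: subspace_of_def in_carrier smult_def)
  show "bracket root_algebra x y \<in> carrier root_algebra" for x y
    by (auto simp: in_carrier root_bracket_def)
qed (use smult_vector_space in \<open>auto simp: root_bracket_bilinear vector_space_def module_def\<close>)

definition cvec :: "'v \<Rightarrow> 'v \<times> (int ^ 'n \<Rightarrow> 'k)" where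
  "cvec v = (v, \<lambda>_. 0)"

lemma cvec_simps [simp]:
  "fst (cvec v) = v" "snd (cvec v) g = 0" "cvec (u + v) = cvec u + cvec v" "cvec (- v) = - cvec v"
  "cvec (u - v) = cvec u - cvec v" "cvec (sc c v) = smult c (cvec v)" "cvec 0 = 0"
  "cvec u = cvec v \<longleftrightarrow> u = v" "cvec v = 0 \<longleftrightarrow> v = 0"
  by (auto simp: cvec_def smult_def prod_eq_iff fun_eq_iff)

definition rvec :: "int ^ 'n \<Rightarrow> 'v \<times> (int ^ 'n \<Rightarrow> 'k)" where
  "rvec g = (0, \<lambda>d. if d = g then 1 else 0)"

lemma rvec_simps [simp]: "fst (rvec g) = 0" "snd (rvec g) d = (if d = g then 1 else 0)"
  by (simp_all add: rvec_def)

lemma rvec_carrier [simp]: "g \<in> roots \<Longrightarrow> rvec g \<in> carrier root_algebra"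
  by (auto simp: in_carrier)

lemma cvec_carrier [simp]: "cvec v \<in> carrier root_algebra"
  by (auto simp: in_carrier)

text \<open>Since there are finitely many roots, Cartan vectors and root vectors span; multilinear
  identities can be checked on them.\<close>

lemma root_algebra_induct [consumes 1, case_names cartan root add scale]:
  assumes x: "x \<in> carrier root_algebra"
    and c: "\<And>v. P (cvec v)" and r: "\<And>g. g \<in> roots \<Longrightarrow> P (rvec g)"
    and add: "\<And>x y. P x \<Longrightarrow> P y \<Longrightarrow> P (x + y)" and scale: "\<And>c x. P x \<Longrightarrow> P (smult c x)"
  shows "P x"
proof -
  have "P (\<Sum>g\<in>S. smult (snd x g) (rvec g))" if "S \<subseteq> roots" "finite S" for S
    using that(2,1) c[of 0] by (induction S) (auto intro!: add scale r)
  from add[OF c[of "fst x"] this[OF subset_refl finite_roots]]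
  have "P (cvec (fst x) + (\<Sum>g\<in>roots. smult (snd x g) (rvec g)))" .
  also have "cvec (fst x) + (\<Sum>g\<in>roots. smult (snd x g) (rvec g)) = x"
  proof -
    have "snd (\<Sum>g\<in>roots. smult (snd x g) (rvec g)) d = snd x d" for d
      using x finite_roots
      by (simp add: snd_sum smult_def in_carrier if_distrib[of "\<lambda>t. _ * t"] cong: if_cong)
    moreover have "fst (\<Sum>g\<in>roots. smult (snd x g) (rvec g)) = 0"
      by (simp add: fst_sum smult_def)
    ultimately show ?thesis by (auto simp: prod_eq_iff fun_eq_iff)
  qed
  finally show ?thesis .
qed

lemma bracket_cc [simp]: "root_bracket (cvec u) (cvec v) = 0"
  by (auto simp: root_bracket_def prod_eq_iff fun_eq_iff cong: if_cong)

lemma bracket_cr [simp]: "g \<in> roots \<Longrightarrow> root_bracket (cvec v) (rvec g) = smult (weight g v) (rvec g)"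
  by (auto simp: root_bracket_def smult_def prod_eq_iff fun_eq_iff cong: if_cong)

lemma bracket_rc [simp]: "g \<in> roots \<Longrightarrow> root_bracket (rvec g) (cvec v) = smult (- weight g v) (rvec g)"
  by (auto simp: root_bracket_def smult_def prod_eq_iff fun_eq_iff cong: if_cong)

lemma bracket_rr:
  assumes "a \<in> roots" "b \<in> roots"
  shows "root_bracket (rvec a) (rvec b) =
     (if form a b = - 1 then smult (cocycle a b) (rvec (a + b))
      else if b = - a then cvec (- coroot a) else 0)"
proof -
  have 1: "(\<Sum>g\<in>roots. sc ((if g = a then 1 else 0) * (if - g = b then 1 else 0)) (coroot g))
      = (if b = - a then coroot a else 0)"
  proof -
    have "(\<Sum>g\<in>roots. sc ((if g = a then 1 else 0) * (if - g = b then 1 else 0)) (coroot g))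
      = (\<Sum>g\<in>roots. if g = a then (if - a = b then coroot a else 0) else 0)"
      by (intro sum.cong) auto
    then show ?thesis using assms finite_roots by auto
  qed
  have 2: "(\<Sum>g\<in>roots. if d - g \<in> roots then cocycle g (d - g) * (if g = a then 1 else 0) * (if d - g = b then 1 else 0) else 0)
      = (if d = a + b then cocycle a b else 0)" for d
  proof -
    have "(\<Sum>g\<in>roots. if d - g \<in> roots then cocycle g (d - g) * (if g = a then 1 else 0) * (if d - g = b then 1 else 0) else 0)
      = (\<Sum>g\<in>roots. if g = a then (if d = a + b then cocycle a b else 0) else 0)"
      using assms by (intro sum.cong) (auto simp: algebra_simps)
    then show ?thesis using assms finite_roots by auto
  qed
  have "form a (- a) = - 2" using assms by (simp add: form_bilinear root_self)
  then show ?thesis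
    using 1 2 add_root_iff[OF assms]
    by (auto simp: root_bracket_def smult_def prod_eq_iff fun_eq_iff cong: if_cong)
qed

lemma bracket_rr_opposite: "a \<in> roots \<Longrightarrow> root_bracket (rvec a) (rvec (- a)) = cvec (- coroot a)"
  by (simp add: bracket_rr form_bilinear root_self)

lemma bracket_rr_opposite': "a \<in> roots \<Longrightarrow> root_bracket (rvec (- a)) (rvec a) = cvec (coroot a)"
  using bracket_rr_opposite[of "- a"] by simp

lemma double_root_nonzero [simp]: "a \<in> roots \<Longrightarrow> 2 * a \<noteq> 0"
proof
  assume "a \<in> roots" "2 * a = 0"
  then have "a = 0" by (simp add: vec_eq_iff)
  with \<open>a \<in> roots\<close> show False by simp
qed

lemma bracket_rr_add: "a \<in> roots \<Longrightarrow> b \<in> roots \<Longrightarrow> form a b = - 1 \<Longrightarrow>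
    root_bracket (rvec a) (rvec b) = smult (cocycle a b) (rvec (a + b))"
  by (simp add: bracket_rr)

lemma bracket_rr_zero: "a \<in> roots \<Longrightarrow> b \<in> roots \<Longrightarrow> form a b \<noteq> - 1 \<Longrightarrow> form a b \<noteq> - 2 \<Longrightarrow>
    root_bracket (rvec a) (rvec b) = 0"
  using form_lower(2)[of a b] by (simp add: bracket_rr)

end

section \<open>Antisymmetry and the Jacobi identity\<close>

context simply_laced
begin

interpretation smult: vector_space smult by (rule smult_vector_space)

lemma bracket_linear [simp]:
  "root_bracket (x + y) z = root_bracket x z + root_bracket y z"
  "root_bracket z (x + y) = root_bracket z x + root_bracket z y"
  "root_bracket (smult c x) y = smult c (root_bracket x y)"
  "root_bracket x (smult c y) = smult c (root_bracket x y)"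
  "root_bracket 0 x = 0" "root_bracket x 0 = 0"
  "root_bracket (- x) y = - root_bracket x y" "root_bracket x (- y) = - root_bracket x y"
  using L.bracket_zero L.bracket_minus by (simp_all add: root_bracket_bilinear)

lemma antisymmetric:
  assumes "x \<in> carrier root_algebra" "y \<in> carrier root_algebra"
  shows "root_bracket y x = - root_bracket x y"
  using assms(1)
proof (induction rule: root_algebra_induct)
  case (cartan v)
  show ?case using assms(2)
    by (induction rule: root_algebra_induct) (auto simp: smult.scale_right_distrib smult.scale_minus_left)
next
  case (root a)
  show ?case using assms(2)
  proof (induction rule: root_algebra_induct)
    case (root b)
    have "form b a = form a b" by (simp add: form_commute)
    then show ?case using \<open>a \<in> roots\<close> root
      by (auto simp: bracket_rr cocycle_swap[of b a] add.commute cvec_simps smult.scale_minus_left)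
  qed (auto simp: \<open>a \<in> roots\<close> smult.scale_right_distrib smult.scale_minus_left)
qed (auto simp: smult.scale_right_distrib)

definition jac where
  "jac x y z = root_bracket x (root_bracket y z) + root_bracket y (root_bracket z x)
     + root_bracket z (root_bracket x y)"

lemma jac_rotate: "jac x y z = jac y z x"
  by (simp add: jac_def algebra_simps)

lemma jac_add: "jac (x + x') y z = jac x y z + jac x' y z"
  by (simp add: jac_def algebra_simps)

lemma jac_scale: "jac (smult c x) y z = smult c (jac x y z)"
  by (simp add: jac_def smult.scale_right_distrib)

lemma jac_ccc: "jac (cvec u) (cvec v) (cvec w) = 0"
  by (simp add: jac_def)

lemma jac_ccr: "a \<in> roots \<Longrightarrow> jac (cvec u) (cvec v) (rvec a) = 0"
  by (simp add: jac_def smult.scale_minus_left mult.commute)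

lemma jac_crr:
  assumes "a \<in> roots" "b \<in> roots"
  shows "jac (cvec v) (rvec a) (rvec b) = 0"
proof -
  have ba: "root_bracket (rvec b) (rvec a) = - root_bracket (rvec a) (rvec b)"
    by (rule antisymmetric) (use assms in simp_all)
  consider "form a b = - 1" | "b = - a" | "form a b \<noteq> - 1" "b \<noteq> - a" by blast
  then show ?thesis
  proof cases
    case 1
    then have "a + b \<in> roots" using add_root_iff assms by blast
    let ?c = "cocycle a b" and ?r = "rvec (a + b)"
    have ab: "root_bracket (rvec a) (rvec b) = smult ?c ?r" using 1 assms by (simp add: bracket_rr_add)
    have "root_bracket (cvec v) (root_bracket (rvec a) (rvec b)) = smult (?c * (weight a v + weight b v)) ?r"
      using \<open>a + b \<in> roots\<close> by (simp add: ab)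
    moreover have "root_bracket (rvec a) (root_bracket (rvec b) (cvec v)) = smult (- (?c * weight b v)) ?r"
      using assms by (simp add: ab mult.commute)
    moreover have "root_bracket (rvec b) (root_bracket (cvec v) (rvec a)) = smult (- (?c * weight a v)) ?r"
      using assms by (simp add: ba ab smult.scale_minus_left[symmetric] smult.scale_minus_right[symmetric] mult.commute del: smult.scale_minus_left smult.scale_minus_right)
    ultimately show ?thesis
      by (simp only: jac_def smult.scale_left_distrib[symmetric]) (simp add: algebra_simps)
  next
    case 2
    with assms show ?thesis
      by (simp add: jac_def ba) (simp add: bracket_rr_opposite bracket_rr_opposite' smult.scale_minus_left)
  next
    case 3
    then have "root_bracket (rvec a) (rvec b) = 0" using assms by (simp add: bracket_rr)
    with assms show ?thesis by (simp add: jac_def ba)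
  qed
qed

text \<open>The third term multiplies \<open>rvec g\<close> by (g,a). For the values 2 and -2,
  \<open>g\<close> is \<open>a\<close> or its negative; for 1 and -1 exactly one other term
  survives, and the required sign comes from the cocycle value -1 at (a,a).\<close>

lemma jac_opposite:
  assumes a: "a \<in> roots" and g: "g \<in> roots"
  shows "jac (rvec a) (rvec (- a)) (rvec g) = 0"
proof -
  have last: "root_bracket (rvec g) (root_bracket (rvec a) (rvec (- a))) = smult (of_int (form g a)) (rvec g)"
    using assms by (simp add: bracket_rr_opposite weight_coroot)
  have aa: "form a a = 2" "form (- a) a = - 2" "form a (- a) = - 2"
    using a by (simp_all add: root_self form_bilinear)
  have fc: "form a g = form g a" by (rule form_commute)
  have up: "form g a \<le> 2" "form g a \<ge> - 2" using form_upper(1)[OF g a] form_lower(1)[OF g a] .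
  then consider "form g a = 2" | "form g a = 1" | "form g a = 0" | "form g a = - 1" | "form g a = - 2"
    by linarith
  then show ?thesis
  proof cases
    case 1
    then have "a = g" using form_upper(2)[OF g a] by simp
    then show ?thesis using a 1 aa
      by (simp add: jac_def last)
        (simp add: bracket_rr form_bilinear weight_coroot smult.scale_minus_left)
  next
    case 5
    then have "g = - a" using form_lower(2)[OF g a] by (simp add: minus_equation_iff)
    then show ?thesis using a 5 aa
      by (simp add: jac_def last)
        (simp add: bracket_rr form_bilinear weight_coroot smult.scale_minus_left)
  next
    case 3
    have "g \<noteq> a" "g \<noteq> - a" using 3 a by (auto simp: root_self form_bilinear)
    moreover from this have "a \<noteq> - g" by auto
    ultimately show ?thesis using a g 3 fc
      by (simp add: jac_def last) (simp add: bracket_rr form_bilinear)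
  next
    case 4
    have "g \<noteq> a" "g \<noteq> - a" using 4 a by (auto simp: root_self form_bilinear)
    have r: "g + a \<in> roots" using add_root_iff[OF g a] 4 by simp
    have f: "form (- a) (g + a) = - 1" using 4 fc aa by (simp add: form_bilinear)
    have "cocycle g a * cocycle (- a) (g + a) = 1"
      using 4 by (simp add: cocycle_bimult cocycle_self[OF a] cocycle_swap[of a g])
    then show ?thesis using a g 4 fc r f \<open>g \<noteq> a\<close> \<open>g \<noteq> - a\<close>
      by (simp add: jac_def last) (simp add: bracket_rr form_bilinear smult.scale_left_distrib[symmetric])
  next
    case 2
    have ne: "g \<noteq> a" "g \<noteq> - a" "a \<noteq> - g" using 2 a by (auto simp: root_self form_bilinear)
    have r: "- a + g \<in> roots" using add_root_iff[of "- a" g] a g 2 fc by (simp add: form_bilinear)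
    have f: "form a (- a + g) = - 1" using 2 fc aa by (simp add: form_bilinear)
    have "cocycle (- a) g * cocycle a (- a + g) = - 1"
      using 2 by (simp add: cocycle_bimult cocycle_self[OF a] mult.left_commute)
    then show ?thesis using a g 2 fc r f ne
      by (simp add: jac_def last) (simp add: bracket_rr form_bilinear smult.scale_left_distrib[symmetric])
  qed
qed

lemma nested_bracket:
  assumes "a \<in> roots" "b \<in> roots" "g \<in> roots" "form b g \<noteq> - 2"
  shows "root_bracket (rvec a) (root_bracket (rvec b) (rvec g)) =
    (if form b g = - 1 \<and> form a b + form a g = - 1 then smult (cocycle b g * cocycle a (b + g)) (rvec (a + (b + g)))
     else if form b g = - 1 \<and> form a b + form a g = - 2 then smult (cocycle b g) (cvec (- coroot a)) else 0)"
proof (cases "form b g = - 1")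
  case True
  then have r: "b + g \<in> roots" using add_root_iff assms by blast
  have f: "form a (b + g) = form a b + form a g" by (simp add: form_bilinear)
  have "form a (b + g) = - 2 \<longleftrightarrow> b + g = - a" using form_lower(2)[OF assms(1) r] .
  then show ?thesis using True assms r
    by (auto simp: bracket_rr_add bracket_rr_opposite f bracket_rr bracket_rr_zero)
next
  case False
  then show ?thesis using assms by (simp add: bracket_rr_zero)
qed

text \<open>Once no pair is opposite, all three inner products are at least -1, and the norm of
  \<open>a + b + g\<close> bounds their sum below by -3. Sum -3 forces \<open>a + b + g = 0\<close>;
  sum -2 means that one pair is orthogonal while the other two products are -1; from -1 on, every
  double bracket vanishes.\<close>

lemma jac_rrr:
  assumes a: "a \<in> roots" and b: "b \<in> roots" and g: "g \<in> roots"
  shows "jac (rvec a) (rvec b) (rvec g) = 0"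
proof -
  note comm = form_commute[of b a] form_commute[of g a] form_commute[of g b]
  \<comment> \<open>Two double brackets survive, in the same root space. Their signs are opposite:
    exchanging \<open>g\<close> and \<open>a\<close> changes the sign of the cocycle since (a,g) is
    odd, exchanging \<open>a\<close> and \<open>b\<close> does not since (a,b) is even.\<close>
  have adj: "jac (rvec a) (rvec b) (rvec g) = 0"
    if "a \<in> roots" "b \<in> roots" "g \<in> roots" "form b g = - 1" "form a g = - 1" "form a b = 0" for a b g
  proof -
    note comm = form_commute[of b a] form_commute[of g a] form_commute[of g b]
    have "cocycle b g * cocycle a (b + g) + cocycle g a * cocycle b (g + a) = 0"
      using that comm by (simp add: cocycle_bimult cocycle_swap[of g a] cocycle_swap[of b a])
    moreover have "b + (g + a) = a + (b + g)" by (simp add: algebra_simps)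
    moreover have "jac (rvec a) (rvec b) (rvec g) = smult (cocycle b g * cocycle a (b + g)) (rvec (a + (b + g)))
        + smult (cocycle g a * cocycle b (g + a)) (rvec (b + (g + a)))"
      using that comm by (simp add: jac_def nested_bracket)
    ultimately show ?thesis
      by (simp only: smult.scale_left_distrib[symmetric]) simp
  qed
  show ?thesis
  proof (cases "form a b = - 2 \<or> form b g = - 2 \<or> form a g = - 2")
    case True
    then consider "b = - a" | "g = - b" | "a = - g"
      using form_lower(2)[OF a b] form_lower(2)[OF b g] form_lower(2)[OF a g] by (auto simp: minus_equation_iff)
    then show ?thesis
    proof cases
      case 1 then show ?thesis using jac_opposite a g by simp
    next
      case 2 then show ?thesis using jac_opposite[OF b a] jac_rotate[of "rvec a"] by simp
    next
      case 3 then show ?thesis using jac_opposite[OF g b] jac_rotate[of "rvec g"] by simp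
    qed
  next
    case False
    then have ge: "form a b \<ge> - 1" "form b g \<ge> - 1" "form a g \<ge> - 1"
      using form_lower(1)[OF a b] form_lower(1)[OF b g] form_lower(1)[OF a g] by linarith+
    have norm: "form (a + b + g) (a + b + g) = 6 + 2 * (form a b + form b g + form a g)"
      using a b g comm by (simp add: form_bilinear root_self)
    then have "form a b + form b g + form a g \<ge> - 3" using form_nonneg[of "a + b + g"] unfolding norm by simp
    then consider "form a b = - 1" "form b g = - 1" "form a g = - 1"
      | "form a b = 0" "form b g = - 1" "form a g = - 1"
      | "form a b = - 1" "form b g = 0" "form a g = - 1"
      | "form a b = - 1" "form b g = - 1" "form a g = 0"
      | "form a b + form b g + form a g \<ge> - 1"
      using ge by linarith
    then show ?thesis
    proof cases
      case 1
      \<comment> \<open>In this case all double brackets are coroots with one common sign, and the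
        three coroots add up to zero.\<close>
      then have "a + b + g = 0" using form_pos[of "a + b + g"] norm by simp
      then have g_eq: "g = - (a + b)" using minus_unique[of "a + b" g] by simp
      have "cocycle b g = cocycle a b" "cocycle g a = cocycle a b"
        using 1 by (simp_all add: g_eq cocycle_bimult cocycle_self[OF a] cocycle_self[OF b] cocycle_swap[of b a])
      then show ?thesis using 1 a b g comm
        by (simp add: jac_def nested_bracket scale_right_diff_distrib[symmetric] scale_right_distrib[symmetric]) (simp add: g_eq smult.scale_right_diff_distrib algebra_simps)
    next
      case 2 then show ?thesis using adj a b g by blast
    next
      case 3 then show ?thesis using adj[of b g a] a b g comm jac_rotate[of "rvec a"] by simp
    next
      case 4 then show ?thesis using adj[of g a b] a b g comm jac_rotate[of "rvec g"] by simp
    next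
      case 5
      have nz: "form a b \<noteq> - 2" "form b g \<noteq> - 2" "form g a \<noteq> - 2" using False comm by auto
      have "root_bracket (rvec a) (root_bracket (rvec b) (rvec g)) = 0"
        using 5 by (subst nested_bracket[OF a b g nz(2)]) auto
      moreover have "root_bracket (rvec b) (root_bracket (rvec g) (rvec a)) = 0"
        using 5 comm by (subst nested_bracket[OF b g a nz(3)]) auto
      moreover have "root_bracket (rvec g) (root_bracket (rvec a) (rvec b)) = 0"
        using 5 comm by (subst nested_bracket[OF g a b nz(1)]) auto
      ultimately show ?thesis by (simp add: jac_def)
    qed
  qed
qed

definition basis_vectors :: "('v \<times> (int ^ 'n \<Rightarrow> 'k)) set" where
  "basis_vectors = range cvec \<union> rvec ` roots"

lemma jac_basis:
  assumes "x \<in> basis_vectors" "y \<in> basis_vectors" "z \<in> basis_vectors"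
  shows "jac x y z = 0"
proof -
  have rot: "jac x y z = jac y z x" "jac x y z = jac z x y" by (metis jac_rotate)+
  show ?thesis
    using assms unfolding basis_vectors_def
  proof (elim UnE imageE, goal_cases)
    case (1 u v w) then show ?case by (simp add: jac_ccc)
  next
    case (2 u v c) then show ?case by (simp add: jac_ccr)
  next
    case (3 u b w) then show ?case unfolding rot(2) by (simp add: jac_ccr)
  next
    case (4 u b c) then show ?case by (simp add: jac_crr)
  next
    case (5 a v w) then show ?case unfolding rot(1) by (simp add: jac_ccr)
  next
    case (6 a v c) then show ?case unfolding rot(1) by (simp add: jac_crr)
  next
    case (7 a b w) then show ?case unfolding rot(2) by (simp add: jac_crr)
  next
    case (8 a b c) then show ?case by (simp add: jac_rrr)
  qed
qed

lemma jac_zero: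
  assumes "x \<in> carrier root_algebra" "y \<in> carrier root_algebra" "z \<in> carrier root_algebra"
  shows "jac x y z = 0"
proof -
  have basis: "cvec v \<in> basis_vectors" "g \<in> roots \<Longrightarrow> rvec g \<in> basis_vectors" for v g
    by (auto simp: basis_vectors_def)
  have 1: "jac x y z = 0"
    if "x \<in> carrier root_algebra" "y \<in> basis_vectors" "z \<in> basis_vectors" for x y z
    using that(1) by (induction rule: root_algebra_induct)
      (use that in \<open>simp_all add: jac_add jac_scale jac_basis basis\<close>)
  have 2: "jac x y z = 0"
    if "x \<in> carrier root_algebra" "y \<in> carrier root_algebra" "z \<in> basis_vectors" for x y z
    using that(1)
  proof (induction rule: root_algebra_induct)
    case (cartan v) then show ?case using that 1[of y z "cvec v"] basis jac_rotate[of "cvec v"] by simp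
  next
    case (root g) then show ?case using that 1[of y z "rvec g"] basis jac_rotate[of "rvec g"] by simp
  qed (simp_all add: jac_add jac_scale)
  show ?thesis
    using assms(1)
  proof (induction rule: root_algebra_induct)
    case (cartan v) then show ?case using assms 2[of y z "cvec v"] basis jac_rotate[of "cvec v"] by simp
  next
    case (root g) then show ?case using assms 2[of y z "rvec g"] basis jac_rotate[of "rvec g"] by simp
  qed (simp_all add: jac_add jac_scale)
qed

lemma lie_root_algebra: "lie_superalgebra root_algebra"
proof unfold_locales
  fix x y z p q r
  have part: "part root_algebra p = (if p = 0 then carrier root_algebra else {0})" for p
    by (simp add: root_algebra_def)
  note L.carrier_subspace
  then show "subspace_of root_algebra (part root_algebra p)" for p
    by (auto simp: part subspace_of_def)
  show "x \<in> carrier root_algebra \<Longrightarrow> \<exists>a\<in>part root_algebra 0. \<exists>b\<in>part root_algebra 1. x = a + b"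
    by simp
  show "x \<in> part root_algebra 0 \<Longrightarrow> x \<in> part root_algebra 1 \<Longrightarrow> x = 0" by simp
  show "x \<in> part root_algebra 1 \<Longrightarrow> bracket root_algebra x (bracket root_algebra x x) = 0" by simp
  have z: "0 \<in> part root_algebra p" for p by (auto simp: part in_carrier)
  {
    assume a: "x \<in> part root_algebra p" "y \<in> part root_algebra q"
    show "bracket root_algebra x y \<in> part root_algebra (p + q)"
    proof (cases "p = 0 \<and> q = 0")
      case True
      then show ?thesis using a L.bracket_closed[of x y] by (simp add: part)
    next
      case False
      then have "x = 0 \<or> y = 0" using a by (auto simp: part split: if_splits)
      then show ?thesis using z[of "p + q"] by (auto simp only: root_algebra_simps bracket_linear)
    qed
    show "bracket root_algebra x y + scale root_algebra (koszul_sign p q) (bracket root_algebra y x) = 0"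
    proof (cases "p = 0 \<and> q = 0")
      case True
      then show ?thesis using a antisymmetric[of x y] by (simp add: part koszul_sign_def)
    next
      case False
      then have "x = 0 \<or> y = 0" using a by (auto simp: part split: if_splits)
      then show ?thesis by auto
    qed
    assume b: "z \<in> part root_algebra r"
    show "bracket root_algebra x (bracket root_algebra y z) - bracket root_algebra (bracket root_algebra x y) z
        - scale root_algebra (koszul_sign p q) (bracket root_algebra y (bracket root_algebra x z)) = 0"
    proof (cases "p = 0 \<and> q = 0 \<and> r = 0")
      case True
      then have c: "x \<in> carrier root_algebra" "y \<in> carrier root_algebra" "z \<in> carrier root_algebra"
        using a b by (auto simp: part)
      have "root_bracket (root_bracket x y) z = - root_bracket z (root_bracket x y)"
        by (rule antisymmetric) (use c L.bracket_closed[of x y] in simp_all)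
      moreover have "root_bracket x z = - root_bracket z x"
        by (rule antisymmetric) (use c in simp_all)
      ultimately show ?thesis using True jac_zero[OF c] by (simp add: jac_def koszul_sign_def algebra_simps)
    next
      case False
      then have "x = 0 \<or> y = 0 \<or> z = 0" using a b by (auto simp: part split: if_splits)
      then show ?thesis by auto
    qed
  }
qed

section \<open>The root algebra as a contragredient model\<close>

definition root_grade :: "int ^ 'n \<Rightarrow> ('v \<times> (int ^ 'n \<Rightarrow> 'k)) set" where
  "root_grade q = {x \<in> carrier root_algebra. (q \<noteq> 0 \<longrightarrow> fst x = 0) \<and> (\<forall>g. g \<noteq> q \<longrightarrow> snd x g = 0)}"

lemma root_grade_cases:
  assumes "x \<in> root_grade q"
  obtains (cartan) v where "q = 0" "x = cvec v" | (root) c where "q \<in> roots" "x = smult c (rvec q)" | (zero) "x = 0"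
proof (cases "q = 0")
  case True
  then have "x = cvec (fst x)"
    using assms by (auto simp: root_grade_def in_carrier prod_eq_iff fun_eq_iff) (metis zero_not_root)
  then show ?thesis using True cartan by blast
next
  case False
  then have x: "x = smult (snd x q) (rvec q)"
    using assms by (auto simp: root_grade_def smult_def prod_eq_iff fun_eq_iff)
  show ?thesis
  proof (cases "q \<in> roots")
    case True then show ?thesis using x root by blast
  next
    case False
    then have "snd x q = 0" using assms by (auto simp: root_grade_def in_carrier)
    then show ?thesis using x zero by simp
  qed
qed

lemma root_grade_intros [simp]:
  "cvec v \<in> root_grade 0" "g \<in> roots \<Longrightarrow> rvec g \<in> root_grade g" "0 \<in> root_grade q"
  by (auto simp: root_grade_def in_carrier)

lemma root_grade_subspace: "smult.subspace (root_grade q)"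
  by (auto simp: smult.subspace_def root_grade_def in_carrier smult_def)

lemma root_grade_smult: "x \<in> root_grade q \<Longrightarrow> smult c x \<in> root_grade q"
  using root_grade_subspace smult.subspace_scale by blast

lemma root_grade_uminus [simp]: "- x \<in> root_grade q \<longleftrightarrow> x \<in> root_grade q"
  using root_grade_smult[of x q "- 1"] root_grade_smult[of "- x" q "- 1"] by (auto simp: smult.scale_minus_left)

lemma root_grade_bracket:
  assumes "x \<in> root_grade p" "y \<in> root_grade q"
  shows "root_bracket x y \<in> root_grade (p + q)"
  using assms(1)
proof (cases rule: root_grade_cases)
  case (cartan v)
  from assms(2) show ?thesis
    by (cases rule: root_grade_cases) (auto simp: cartan root_grade_smult)
next
  case (root c)
  from assms(2) show ?thesis
  proof (cases rule: root_grade_cases)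
    case (cartan v) then show ?thesis by (simp add: root root_grade_smult)
  next
    case r: (root d)
    have "root_bracket (rvec p) (rvec q) \<in> root_grade (p + q)"
      using root r add_root_iff[of p q] by (auto simp: bracket_rr root_grade_smult)
    then show ?thesis by (simp add: root r root_grade_smult)
  next
    case zero then show ?thesis by simp
  qed
next
  case zero then show ?thesis by simp
qed

lemma rvec_neq_zero [simp]: "rvec g \<noteq> 0"
  by (auto simp: rvec_def zero_prod_def fun_eq_iff)

lemma h_nonzero: "h i \<noteq> 0"
proof
  assume "h i = 0"
  then have "(\<Sum>j\<in>UNIV. sc (if j = i then 1 else 0) (h j)) = 0" by (simp add: if_distrib[of "\<lambda>x. sc x _"] cong: if_cong)
  from h_independent[OF this, of i] show False by simp
qed

text \<open>By integrality (g,\<alpha>_i) is -1 unless \<open>g\<close> is the negative simple root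
  itself. The nonvanishing claim is used for \<open>descent\<close>, the recovery of
  \<open>rvec g\<close> from its neighbour for \<open>generated\<close>; \<open>descent_down\<close>
  is the mirror image.\<close>

lemma descent_up:
  assumes "g \<in> roots" "g $ i < 0" "form g (simple i) < 0"
  shows "root_bracket (rvec (simple i)) (rvec g) \<noteq> 0" "g \<noteq> - simple i \<Longrightarrow> g + simple i \<in> roots \<and>
     rvec g = smult (cocycle (simple i) g) (root_bracket (- rvec (- simple i)) (rvec (g + simple i)))"
proof -
  have "form g (simple i) = - 1 \<or> g = - simple i"
    using form_lower[of g "simple i"] assms by (force simp: minus_equation_iff)
  moreover have "form (simple i) g = form g (simple i)" by (rule form_commute)
  ultimately show "root_bracket (rvec (simple i)) (rvec g) \<noteq> 0"
    using assms by (auto simp: bracket_rr_add bracket_rr_opposite h_nonzero)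
  assume "g \<noteq> - simple i"
  then have f: "form g (simple i) = - 1" using \<open>form g (simple i) = - 1 \<or> g = - simple i\<close> by simp
  then have r: "g + simple i \<in> roots" using assms by (simp add: add_root_iff)
  have "form (- simple i) (g + simple i) = - 1"
    using f by (simp add: form_bilinear form_commute[of "simple i" g] root_self)
  then show "g + simple i \<in> roots \<and>
     rvec g = smult (cocycle (simple i) g) (root_bracket (- rvec (- simple i)) (rvec (g + simple i)))"
    using r by (simp add: bracket_rr_add cocycle_bimult cocycle_self smult.scale_minus_left)
qed

lemma descent_down:
  assumes "g \<in> roots" "g $ i > 0" "form g (simple i) > 0"
  shows "root_bracket (- rvec (- simple i)) (rvec g) \<noteq> 0" "g \<noteq> simple i \<Longrightarrow> g - simple i \<in> roots \<and>
     rvec g = smult (- cocycle (simple i) g) (root_bracket (rvec (simple i)) (rvec (g - simple i)))"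
proof -
  have "form g (simple i) = 1 \<or> g = simple i"
    using form_upper[of g "simple i"] assms by force
  moreover have "form (simple i) g = form g (simple i)" by (rule form_commute)
  ultimately show "root_bracket (- rvec (- simple i)) (rvec g) \<noteq> 0"
    using assms by (auto simp: bracket_rr_add bracket_rr_opposite' form_bilinear h_nonzero)
  assume "g \<noteq> simple i"
  then have f: "form g (simple i) = 1" using \<open>form g (simple i) = 1 \<or> g = simple i\<close> by simp
  then have r: "g - simple i \<in> roots" using assms add_root_iff[of g "- simple i"] by (simp add: form_bilinear)
  have "form (simple i) (g - simple i) = - 1"
    using f by (simp add: form_bilinear form_commute[of "simple i" g] root_self)
  moreover have "cocycle (simple i) (g - simple i) = - cocycle (simple i) g"
    using cocycle_bimult(2)[of "simple i" g "- simple i"] by (simp add: cocycle_bimult(4) cocycle_self)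
  ultimately show "g - simple i \<in> roots \<and>
     rvec g = smult (- cocycle (simple i) g) (root_bracket (rvec (simple i)) (rvec (g - simple i)))"
    using r by (simp add: bracket_rr_add)
qed

text \<open>The lowering generators carry a minus sign because the bracket of opposite root vectors
  is minus the coroot. Generation goes by induction on \<open>abs_height\<close>: unless a root is
  plus or minus a simple root, its vector is a multiple of a bracket of a generator with a root
  vector closer to zero.\<close>

lemma root_model:
  "contragredient_model root_algebra (\<lambda>_. 0) sc h \<alpha> (\<lambda>i. rvec (simple i)) (\<lambda>i. - rvec (- simple i))
     cvec root_grade"
proof -
  interpret lie_superalgebra root_algebra by (rule lie_root_algebra)
  have neg: "- x \<in> carrier root_algebra" if "x \<in> carrier root_algebra" for x
    using that by (simp add: in_carrier)
  show ?thesis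
  proof (unfold_locales, unfold root_algebra_simps)
    fix i j u v x y p q c
    show "cvec (u + v) = cvec u + cvec v" "cvec (sc c v) = smult c (cvec v)" "cvec v = 0 \<Longrightarrow> v = 0"
      by simp_all
    show "rvec (simple i) \<in> carrier root_algebra" "- rvec (- simple i) \<in> carrier root_algebra"
      "cvec v \<in> carrier root_algebra" by (simp_all add: neg)
    show "root_bracket (rvec (simple i)) (- rvec (- simple i)) = cvec (h i)"
      by (simp add: bracket_rr_opposite)
    show "i \<noteq> j \<Longrightarrow> root_bracket (rvec (simple i)) (- rvec (- simple j)) = 0"
    proof -
      assume "i \<noteq> j"
      then have "simple i \<noteq> simple j" by (simp add: vec_eq_iff axis_component) blast
      moreover have "form (simple i) (- simple j) \<noteq> - 1"
        using A_offdiag[OF \<open>i \<noteq> j\<close>] by (simp add: form_bilinear form_simple)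
      ultimately show ?thesis by (simp add: bracket_rr)
    qed
    show "root_bracket (cvec v) (rvec (simple i)) = smult (\<alpha> i v) (rvec (simple i))" by simp
    show "root_bracket (cvec v) (- rvec (- simple i)) = - smult (\<alpha> i v) (- rvec (- simple i))"
      by (simp add: smult.scale_minus_left)
    show "root_bracket (cvec u) (cvec v) = 0" by simp
    show "smult.subspace (root_grade q)" by (rule root_grade_subspace)
    show "rvec (simple i) \<in> root_grade (simple i)" "- rvec (- simple i) \<in> root_grade (- simple i)"
      "cvec v \<in> root_grade 0" by simp_all
    show "x \<in> root_grade p \<Longrightarrow> y \<in> root_grade q \<Longrightarrow> root_bracket x y \<in> root_grade (p + q)"
      by (rule root_grade_bracket)
    show "root_grade 0 \<subseteq> range cvec"
      by (auto elim!: root_grade_cases intro: range_eqI[of _ _ 0])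
  next
    fix Q :: "(int ^ 'n) set" and g q
    assume Q: "finite Q" and g: "\<And>q. q \<in> Q \<Longrightarrow> g q \<in> root_grade q" and 0: "(\<Sum>q\<in>Q. g q) = 0" and q: "q \<in> Q"
    have "snd (g q) d = 0" for d
    proof (cases "d = q")
      case True
      have "0 = (\<Sum>r\<in>Q. snd (g r) q)" using 0 by (simp add: prod_eq_iff fun_eq_iff snd_sum)
      also have "\<dots> = (\<Sum>r\<in>Q. if r = q then snd (g q) q else 0)"
        using g by (intro sum.cong) (auto simp: root_grade_def)
      finally show ?thesis using Q q True by simp
    qed (use g[OF q] in \<open>simp add: root_grade_def\<close>)
    moreover have "fst (g q) = 0"
    proof (cases "q = 0")
      case True
      have "0 = (\<Sum>r\<in>Q. fst (g r))" using 0 by (simp add: prod_eq_iff fst_sum)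
      also have "\<dots> = (\<Sum>r\<in>Q. if r = q then fst (g q) else 0)"
        using g True by (intro sum.cong) (auto simp: root_grade_def)
      finally show ?thesis using Q q by simp
    qed (use g[OF q] in \<open>simp add: root_grade_def\<close>)
    ultimately show "g q = 0" by (simp add: prod_eq_iff fun_eq_iff)
  next
    fix T assume T: "smult.subspace T" and br: "\<And>x y. x \<in> T \<Longrightarrow> y \<in> T \<Longrightarrow> root_bracket x y \<in> T"
      and E: "range (\<lambda>i. rvec (simple i)) \<subseteq> T" and F: "range (\<lambda>i. - rvec (- simple i)) \<subseteq> T"
      and H: "range cvec \<subseteq> T"
    have r: "rvec g \<in> T" if "g \<in> roots" for g
      using that
    proof (induction "abs_height g" arbitrary: g rule: less_induct)
      case less
      from root_descent[OF less.prems] obtain i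
        where "0 < g $ i \<and> 0 < form g (simple i) \<or> g $ i < 0 \<and> form g (simple i) < 0" ..
      then show ?case
      proof (elim disjE conjE)
        assume i: "0 < g $ i" "0 < form g (simple i)"
        show ?thesis
        proof (cases "g = simple i")
          case False
          note d = descent_down(2)[OF less.prems i False]
          then have "rvec (g - simple i) \<in> T" using less.hyps abs_height_diff[OF i(1)] by blast
          then have "root_bracket (rvec (simple i)) (rvec (g - simple i)) \<in> T" using E by (intro br) auto
          then show ?thesis using d smult.subspace_scale[OF T] by metis
        qed (use E in auto)
      next
        assume i: "g $ i < 0" "form g (simple i) < 0"
        show ?thesis
        proof (cases "g = - simple i")
          case True
          have "- rvec (- simple i) \<in> T" using F by auto
          then show ?thesis using smult.subspace_neg[OF T] True by fastforce
        next
          case False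
          note d = descent_up(2)[OF less.prems i False]
          then have "rvec (g + simple i) \<in> T" using less.hyps abs_height_add[OF i(1)] by blast
          then have "root_bracket (- rvec (- simple i)) (rvec (g + simple i)) \<in> T" using F by (intro br) auto
          then show ?thesis using d smult.subspace_scale[OF T] by metis
        qed
      qed
    qed
    show "carrier root_algebra \<subseteq> T"
    proof
      fix x assume "x \<in> carrier root_algebra"
      then show "x \<in> T"
        by (induction rule: root_algebra_induct)
          (use H r T in \<open>auto intro: smult.subspace_add smult.subspace_scale\<close>)
    qed
  next
    fix x q assume x: "x \<in> root_grade q" "x \<noteq> 0" "q \<noteq> 0"
    then obtain c where c: "q \<in> roots" "x = smult c (rvec q)" by (auto elim!: root_grade_cases)
    then have "c \<noteq> 0" using x by auto
    from root_descent[OF c(1)] obtain i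
      where "0 < q $ i \<and> 0 < form q (simple i) \<or> q $ i < 0 \<and> form q (simple i) < 0" ..
    then show "\<exists>i. root_bracket (rvec (simple i)) x \<noteq> 0 \<and> abs_height (q + simple i) < abs_height q
        \<or> root_bracket (- rvec (- simple i)) x \<noteq> 0 \<and> abs_height (q - simple i) < abs_height q"
    proof (elim disjE conjE)
      assume i: "0 < q $ i" "0 < form q (simple i)"
      show ?thesis
        using abs_height_diff[OF i(1)] descent_down(1)[OF c(1) i] \<open>c \<noteq> 0\<close>
        by (intro exI[of _ i] disjI2) (simp add: c smult.scale_eq_0_iff)
    next
      assume i: "q $ i < 0" "form q (simple i) < 0"
      show ?thesis
        using abs_height_add[OF i(1)] descent_up(1)[OF c(1) i] \<open>c \<noteq> 0\<close>
        by (intro exI[of _ i] disjI1) (simp add: c smult.scale_eq_0_iff)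
    qed
  qed
qed

end

section \<open>Coordinates in a Jordan basis\<close>

context linear_superalgebra
begin

lemma carrier_closed [simp]:
  "0 \<in> carrier M" "x \<in> carrier M \<Longrightarrow> y \<in> carrier M \<Longrightarrow> x + y \<in> carrier M"
  "x \<in> carrier M \<Longrightarrow> scale M c x \<in> carrier M" "x \<in> carrier M \<Longrightarrow> - x \<in> carrier M"
  "x \<in> carrier M \<Longrightarrow> y \<in> carrier M \<Longrightarrow> x - y \<in> carrier M"
  "x \<in> carrier M \<Longrightarrow> y \<in> carrier M \<Longrightarrow> bracket M x y \<in> carrier M"
  using subspace_carrier
  by (auto intro: subspace_0 subspace_add subspace_scale subspace_neg subspace_diff bracket_closed)

lemma carrier_sum [simp]: "(\<And>i. i \<in> I \<Longrightarrow> f i \<in> carrier M) \<Longrightarrow> (\<Sum>i\<in>I. f i) \<in> carrier M"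
  by (induction I rule: infinite_finite_induct) auto

lemma lincomb_sum: "length cs = length vs \<Longrightarrow>
    lincomb M cs vs = (\<Sum>i<length vs. scale M (cs ! i) (vs ! i))"
proof (induction vs arbitrary: cs)
  case (Cons v vs)
  then show ?case by (cases cs) (auto simp: sum.lessThan_Suc_shift simp del: sum.lessThan_Suc)
qed simp

text \<open>Unique coefficient lists are replaced by spanning and independence with coefficient
  functions; by subtraction, uniqueness at 0 gives uniqueness everywhere.\<close>

lemma is_basis_iff: "is_basis M vs \<longleftrightarrow> set vs \<subseteq> carrier M \<and>
    (\<forall>v\<in>carrier M. \<exists>c. v = (\<Sum>i<length vs. scale M (c i) (vs ! i))) \<and>
    (\<forall>c. (\<Sum>i<length vs. scale M (c i) (vs ! i)) = 0 \<longrightarrow> (\<forall>i<length vs. c i = 0))"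
  (is "_ \<longleftrightarrow> _ \<and> ?span \<and> ?indep")
proof
  assume b: "is_basis M vs"
  have ?span
  proof
    fix v assume "v \<in> carrier M"
    then obtain cs where "length cs = length vs" "lincomb M cs vs = v"
      using b unfolding is_basis_def by blast
    then show "\<exists>c. v = (\<Sum>i<length vs. scale M (c i) (vs ! i))"
      by (auto simp: lincomb_sum intro!: exI[of _ "\<lambda>i. cs ! i"])
  qed
  moreover have ?indep
  proof (intro allI impI)
    fix c i assume c: "(\<Sum>i<length vs. scale M (c i) (vs ! i)) = 0" and i: "i < length vs"
    let ?cs = "map c [0..<length vs]" and ?os = "map (\<lambda>_. 0) [0..<length vs]"
    have "length ?cs = length vs \<and> lincomb M ?cs vs = 0" "length ?os = length vs \<and> lincomb M ?os vs = 0"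
      using c by (simp_all add: lincomb_sum)
    moreover have "\<exists>!cs. length cs = length vs \<and> lincomb M cs vs = 0"
      using b by (simp add: is_basis_def)
    ultimately have "?cs = ?os" by blast
    then have "?cs ! i = ?os ! i" by (rule arg_cong)
    then show "c i = 0" using i by simp
  qed
  ultimately show "set vs \<subseteq> carrier M \<and> ?span \<and> ?indep" using b by (auto simp: is_basis_def)
next
  assume a: "set vs \<subseteq> carrier M \<and> ?span \<and> ?indep"
  show "is_basis M vs"
    unfolding is_basis_def
  proof (intro conjI ballI)
    fix v assume "v \<in> carrier M"
    then obtain c where c: "v = (\<Sum>i<length vs. scale M (c i) (vs ! i))" using a by blast
    show "\<exists>!cs. length cs = length vs \<and> lincomb M cs vs = v"
    proof (rule ex1I)
      show "length (map c [0..<length vs]) = length vs \<and> lincomb M (map c [0..<length vs]) vs = v"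
        by (simp add: lincomb_sum c)
      fix cs assume cs: "length cs = length vs \<and> lincomb M cs vs = v"
      then have "(\<Sum>i<length vs. scale M (cs ! i) (vs ! i)) = v" using lincomb_sum[of cs vs] by simp
      then have "(\<Sum>i<length vs. scale M (cs ! i - c i) (vs ! i)) = 0"
        by (simp only: scale_left_diff_distrib sum_subtractf c[symmetric]) simp
      then have "\<forall>i<length vs. cs ! i - c i = 0" using a by (elim conjE) (erule allE, erule mp)
      then show "cs = map c [0..<length vs]" using cs by (auto intro: nth_equalityI)
    qed
  qed (use a in auto)
qed

end

locale basis_superalgebra = linear_superalgebra M
  for M :: "('k::field, 'a::ab_group_add) superalgebra" +
  fixes vs :: "'a list"
  assumes basis: "is_basis M vs"
begin

lemma basis_carrier [simp]: "i < length vs \<Longrightarrow> vs ! i \<in> carrier M"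
  using basis by (auto simp: is_basis_def)

abbreviation "coord \<equiv> coordinate M vs"

lemma coord_unique:
  assumes "v = (\<Sum>i<length vs. scale M (c i) (vs ! i))" "k < length vs"
  shows "coord v k = c k"
proof -
  have v: "v \<in> carrier M" unfolding assms(1) by (rule carrier_sum) simp
  let ?P = "\<lambda>cs. length cs = length vs \<and> lincomb M cs vs = v"
  have ex: "\<exists>!cs. ?P cs" using basis v by (auto simp: is_basis_def)
  have "?P (map c [0..<length vs])" using assms by (simp add: lincomb_sum)
  then have "(THE cs. ?P cs) = map c [0..<length vs]" using ex by (intro the1_equality)
  then show ?thesis using assms(2) by (simp add: coordinate_def)
qed

lemma coord_sum_basis: "v \<in> carrier M \<Longrightarrow> v = (\<Sum>i<length vs. scale M (coord v i) (vs ! i))"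
proof -
  assume "v \<in> carrier M"
  then obtain c where c: "v = (\<Sum>i<length vs. scale M (c i) (vs ! i))"
    using basis by (auto simp: is_basis_iff)
  also have "\<dots> = (\<Sum>i<length vs. scale M (coord v i) (vs ! i))"
    by (rule sum.cong) (use coord_unique[OF c] in auto)
  finally show ?thesis .
qed

lemma coord_add: "v \<in> carrier M \<Longrightarrow> w \<in> carrier M \<Longrightarrow> k < length vs \<Longrightarrow> coord (v + w) k = coord v k + coord w k"
  by (rule coord_unique) (simp_all add: scale_left_distrib sum.distrib flip: coord_sum_basis)

lemma coord_scale: "v \<in> carrier M \<Longrightarrow> k < length vs \<Longrightarrow> coord (scale M c v) k = c * coord v k"
  by (rule coord_unique) (simp_all flip: coord_sum_basis scale_scale scale_sum_right)

lemma coord_zero: "k < length vs \<Longrightarrow> coord 0 k = 0"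
  by (rule coord_unique) simp_all

lemma coord_sum: "k < length vs \<Longrightarrow> (\<And>i. i \<in> I \<Longrightarrow> f i \<in> carrier M) \<Longrightarrow>
    coord (\<Sum>i\<in>I. f i) k = (\<Sum>i\<in>I. coord (f i) k)"
  by (induction I rule: infinite_finite_induct) (auto simp: coord_add coord_zero)

end

lemma sum_nth_append:
  fixes f :: "nat \<Rightarrow> 'a \<Rightarrow> 'b::comm_monoid_add"
  shows "(\<Sum>i<length (us @ vs). f i ((us @ vs) ! i))
    = (\<Sum>i<length us. f i (us ! i)) + (\<Sum>i<length vs. f (length us + i) (vs ! i))"
proof -
  have "(\<Sum>i<length us + m. f i ((us @ vs) ! i))
     = (\<Sum>i<length us. f i (us ! i)) + (\<Sum>i<m. f (length us + i) (vs ! i))" if "m \<le> length vs" for m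
    using that
  proof (induction m)
    case 0 show ?case by (auto simp: nth_append intro!: sum.cong)
  next
    case (Suc m) then show ?case by (simp add: nth_append add.assoc)
  qed
  then show ?thesis by simp
qed

section \<open>Derivations of cube zero in characteristic 3\<close>

locale alpha3_lie = lie_superalgebra M
  for M :: "('k::field, 'a::ab_group_add) superalgebra" +
  fixes d :: "'a \<Rightarrow> 'a"
  assumes char3: "CHAR('k) = 3"
    and even: "part M 0 = carrier M"
    and d_add: "d (x + y) = d x + d y" and d_scale: "d (scale M c x) = scale M c (d x)"
    and d_closed [simp]: "x \<in> carrier M \<Longrightarrow> d x \<in> carrier M"
    and derivation: "x \<in> carrier M \<Longrightarrow> y \<in> carrier M \<Longrightarrow>
      d (bracket M x y) = bracket M (d x) y + bracket M x (d y)"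
    and d_cube: "x \<in> carrier M \<Longrightarrow> d (d (d x)) = 0"
begin

lemma d_zero [simp]: "d 0 = 0"
  using d_add[of 0 0] by simp

lemma d_minus: "d (- x) = - d x"
  using d_add[of x "- x"] by (simp add: eq_neg_iff_add_eq_0 add.commute)

lemma d_diff: "d (x - y) = d x - d y"
  using d_add[of x "- y"] by (simp add: d_minus)

lemma d_sum: "d (\<Sum>i\<in>I. f i) = (\<Sum>i\<in>I. d (f i))"
  by (induction I rule: infinite_finite_induct) (auto simp: d_add)

lemma three [simp]: "(3 :: 'k) = 0"
  using of_nat_CHAR[where 'a = 'k] unfolding char3 by simp

lemma two: "(2 :: 'k) = - 1"
proof -
  have "(2 :: 'k) + 1 = 0" using three by (simp only: one_plus_numeral numeral_plus_one) simp
  then show ?thesis by (rule eq_neg_iff_add_eq_0[THEN iffD2])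
qed

lemma triple: "x + x + x = (0 :: 'a)"
proof -
  have "x + x + x = scale M (1 + 1 + 1) x" by (simp only: scale_left_distrib scale_one)
  also have "1 + 1 + 1 = (0 :: 'k)" using three by simp
  finally show ?thesis by simp
qed

lemma anti: "x \<in> carrier M \<Longrightarrow> y \<in> carrier M \<Longrightarrow> bracket M y x = - bracket M x y"
proof -
  assume "x \<in> carrier M" "y \<in> carrier M"
  then have "bracket M y x + bracket M x y = 0"
    using antisymmetry[of y 0 x 0] unfolding even by (simp add: koszul_sign_def)
  then show ?thesis by (rule eq_neg_iff_add_eq_0[THEN iffD2])
qed

lemma leibniz: "x \<in> carrier M \<Longrightarrow> y \<in> carrier M \<Longrightarrow> z \<in> carrier M \<Longrightarrow>
   bracket M x (bracket M y z) = bracket M (bracket M x y) z + bracket M y (bracket M x z)"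
proof -
  assume "x \<in> carrier M" "y \<in> carrier M" "z \<in> carrier M"
  then have "bracket M x (bracket M y z) - bracket M (bracket M x y) z - bracket M y (bracket M x z) = 0"
    using jacobi[of x 0 y 0 z 0] unfolding even by (simp add: koszul_sign_def)
  then show ?thesis by (simp add: diff_eq_eq add.commute)
qed

definition "kerd = {v \<in> carrier M. d v = 0}"

definition "kerdd = {v \<in> carrier M. d (d v) = 0}"

lemma kerd_D [simp]: "x \<in> kerd \<Longrightarrow> x \<in> carrier M" "x \<in> kerd \<Longrightarrow> d x = 0"
  by (auto simp: kerd_def)

lemma kerdd_D [simp]: "x \<in> kerdd \<Longrightarrow> x \<in> carrier M" "x \<in> kerdd \<Longrightarrow> d (d x) = 0"
  by (auto simp: kerdd_def)

lemma kerd_I: "x \<in> carrier M \<Longrightarrow> d x = 0 \<Longrightarrow> x \<in> kerd"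
  by (auto simp only: kerd_def)

lemma kerdd_I: "x \<in> carrier M \<Longrightarrow> d (d x) = 0 \<Longrightarrow> x \<in> kerdd"
  by (auto simp only: kerdd_def)

text \<open>This is the combination used for two odd heads. On \<open>kerdd\<close> it is
  annihilated by \<open>d\<close>, because the two mixed terms \<open>bracket M (d x) (d y)\<close>
  cancel.\<close>

definition odd_bracket :: "'a \<Rightarrow> 'a \<Rightarrow> 'a" where
  "odd_bracket x y = bracket M (d x) y - bracket M x (d y)"

lemma bracket_kerd [simp]: "x \<in> kerd \<Longrightarrow> y \<in> kerd \<Longrightarrow> bracket M x y \<in> kerd"
  by (rule kerd_I) (simp_all add: derivation)

lemma bracket_kerd_kerdd [simp]: "x \<in> kerd \<Longrightarrow> y \<in> kerdd \<Longrightarrow> bracket M x y \<in> kerdd"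
    "x \<in> kerd \<Longrightarrow> y \<in> kerdd \<Longrightarrow> bracket M y x \<in> kerdd"
  by (rule kerdd_I; simp add: derivation)+

lemma odd_bracket_kerd [simp]: "x \<in> kerdd \<Longrightarrow> y \<in> kerdd \<Longrightarrow> odd_bracket x y \<in> kerd"
  by (rule kerd_I) (simp_all add: odd_bracket_def derivation d_diff)

definition list_sum :: "'a list \<Rightarrow> (nat \<Rightarrow> 'k) \<Rightarrow> 'a" where
  "list_sum us c = (\<Sum>i<length us. scale M (c i) (us ! i))"

lemma jordan_sum: "(\<Sum>i<length (jordan_basis d xs ys zs). scale M (c i) (jordan_basis d xs ys zs ! i))
   = list_sum xs c + list_sum ys (\<lambda>i. c (length xs + i)) + d (list_sum ys (\<lambda>i. c (length xs + length ys + i)))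
     + list_sum zs (\<lambda>i. c (length xs + 2 * length ys + i))
     + d (list_sum zs (\<lambda>i. c (length xs + 2 * length ys + length zs + i)))
     + d (d (list_sum zs (\<lambda>i. c (length xs + 2 * length ys + 2 * length zs + i))))"
proof -
  have m2: "2 * m = m + m" for m :: nat by simp
  show ?thesis unfolding jordan_basis_def
    by (subst sum_nth_append)+ (simp add: list_sum_def d_sum d_scale add.assoc m2)
qed

end

locale jordan_lie = alpha3_lie +
  fixes xs ys zs :: "'b list"
  assumes jordan: "jordan_decomposition M d xs ys zs"
begin

abbreviation "jb \<equiv> jordan_basis d xs ys zs"
abbreviation "n1 \<equiv> length xs"
abbreviation "n2 \<equiv> length ys"
abbreviation "n3 \<equiv> length zs"
abbreviation "N \<equiv> length xs + length ys"

sublocale basis_superalgebra M jb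
  using jordan by unfold_locales (simp add: jordan_decomposition_def)

lemma length_jb [simp]: "length jb = n1 + 2 * n2 + 3 * n3"
  by (simp add: jordan_basis_def)

lemma heads_carrier: "set xs \<subseteq> carrier M" "set ys \<subseteq> carrier M" "set zs \<subseteq> carrier M"
  using jordan by (auto simp: jordan_decomposition_def is_basis_def jordan_basis_def)

lemma heads_d: "x \<in> set xs \<Longrightarrow> d x = 0" "x \<in> set ys \<Longrightarrow> d (d x) = 0"
  using jordan by (auto simp: jordan_decomposition_def)

lemma heads_nth [simp]:
  "i < n1 \<Longrightarrow> xs ! i \<in> carrier M" "i < n2 \<Longrightarrow> ys ! i \<in> carrier M" "i < n3 \<Longrightarrow> zs ! i \<in> carrier M"
  "i < n1 \<Longrightarrow> d (xs ! i) = 0" "i < n2 \<Longrightarrow> d (d (ys ! i)) = 0"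
  using heads_carrier heads_d nth_mem by blast+

abbreviation "xsum \<equiv> list_sum xs"
abbreviation "ysum \<equiv> list_sum ys"
abbreviation "zsum \<equiv> list_sum zs"
lemmas xsum_def = list_sum_def[of xs] and ysum_def = list_sum_def[of ys] and zsum_def = list_sum_def[of zs]

lemma sums_carrier [simp]: "xsum c \<in> carrier M" "ysum c \<in> carrier M" "zsum c \<in> carrier M"
  unfolding xsum_def ysum_def zsum_def by (rule carrier_sum; simp)+

lemma sums_d [simp]: "d (xsum c) = 0" "d (d (ysum c)) = 0"
  by (simp_all add: xsum_def ysum_def d_sum d_scale)

text \<open>The heads of all blocks receive 0. A shift by \<open>n2\<close> leads from the images of
  \<open>ys\<close> back to \<open>ys\<close>, and a shift by \<open>n3\<close> leads from the
  middles and bottoms of the blocks of size 3 to the layer above them.\<close>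

definition dcoeff :: "(nat \<Rightarrow> 'a) \<Rightarrow> nat \<Rightarrow> 'a" where
  "dcoeff c k = (if k < N then 0 else if k < n1 + 2 * n2 then c (k - n2)
     else if k < n1 + 2 * n2 + n3 then 0 else c (k - n3))"

lemma coord_d:
  assumes "v \<in> carrier M" "k < length jb"
  shows "coord (d v) k = dcoeff (coord v) k"
proof (rule coord_unique)
  show "d v = (\<Sum>i<length jb. scale M (dcoeff (coord v) i) (jb ! i))"
    unfolding jordan_sum
    by (subst coord_sum_basis[OF assms(1)], unfold jordan_sum)
      (simp add: d_add d_cube xsum_def[of "dcoeff _"] ysum_def[of "\<lambda>i. dcoeff _ (_ i)"] zsum_def[of "\<lambda>i. dcoeff _ (_ i)"] dcoeff_def
        ysum_def zsum_def d_sum d_scale, simp add: add_ac)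
qed (use assms in simp)

end

section \<open>The semisimplification\<close>

context jordan_lie
begin

text \<open>
  The even and odd parts of the semisimplification are the quotients of the kernels of \<open>d\<close> and of
  \<open>d\<^sup>2\<close> by the image of \<open>d\<close> and by the sum of this image and the kernel of \<open>d\<close>;
  \<open>ev\<close> and \<open>od\<close> are the corresponding projections.
\<close>

definition ev :: "'b \<Rightarrow> nat \<Rightarrow> 'a" where
  "ev v k = (if k < n1 then coord v k else 0)"

definition od :: "'b \<Rightarrow> nat \<Rightarrow> 'a" where
  "od v k = (if n1 \<le> k \<and> k < N then coord v k else 0)"

abbreviation "S \<equiv> semisimplification M d xs ys zs"

lemma ev_linear:
  "v \<in> carrier M \<Longrightarrow> w \<in> carrier M \<Longrightarrow> ev (v + w) = ev v + ev w"
  "v \<in> carrier M \<Longrightarrow> ev (scale M c v) = (\<lambda>k. c * ev v k)" "ev 0 = 0"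
  by (auto simp: ev_def fun_eq_iff coord_add coord_scale coord_zero)

lemma od_linear:
  "v \<in> carrier M \<Longrightarrow> w \<in> carrier M \<Longrightarrow> od (v + w) = od v + od w"
  "v \<in> carrier M \<Longrightarrow> od (scale M c v) = (\<lambda>k. c * od v k)" "od 0 = 0"
  by (auto simp: od_def fun_eq_iff coord_add coord_scale coord_zero)

lemma ev_uminus: "v \<in> carrier M \<Longrightarrow> ev (- v) = - ev v"
  using ev_linear(1)[of v "- v"] by (simp add: ev_linear(3) eq_neg_iff_add_eq_0 add.commute)

lemma od_uminus: "v \<in> carrier M \<Longrightarrow> od (- v) = - od v"
  using od_linear(1)[of v "- v"] by (simp add: od_linear(3) eq_neg_iff_add_eq_0 add.commute)

lemma ev_diff: "v \<in> carrier M \<Longrightarrow> w \<in> carrier M \<Longrightarrow> ev (v - w) = ev v - ev w"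
  using ev_linear(1)[of v "- w"] by (simp add: ev_uminus)

lemma od_diff: "v \<in> carrier M \<Longrightarrow> w \<in> carrier M \<Longrightarrow> od (v - w) = od v - od w"
  using od_linear(1)[of v "- w"] by (simp add: od_uminus)

lemma ev_d [simp]: "v \<in> carrier M \<Longrightarrow> ev (d v) = 0"
  by (auto simp: ev_def fun_eq_iff coord_d dcoeff_def)

lemma od_d [simp]: "v \<in> carrier M \<Longrightarrow> od (d v) = 0"
  by (auto simp: od_def fun_eq_iff coord_d dcoeff_def)

lemma coord_sum_jordan:
  assumes "v \<in> carrier M"
  shows "v = xsum (coord v) + ysum (\<lambda>i. coord v (n1 + i)) + d (ysum (\<lambda>i. coord v (n1 + n2 + i)))
     + zsum (\<lambda>i. coord v (n1 + 2 * n2 + i)) + d (zsum (\<lambda>i. coord v (n1 + 2 * n2 + n3 + i)))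
     + d (d (zsum (\<lambda>i. coord v (n1 + 2 * n2 + 2 * n3 + i))))"
  using coord_sum_basis[OF assms] by (simp only: jordan_sum)

lemma kerd_coord:
  assumes "v \<in> kerd"
  shows "i < n2 \<Longrightarrow> coord v (n1 + i) = 0" "i < n3 \<Longrightarrow> coord v (n1 + 2 * n2 + i) = 0"
    "i < n3 \<Longrightarrow> coord v (n1 + 2 * n2 + n3 + i) = 0"
proof -
  have z: "dcoeff (coord v) k = 0" if "k < length jb" for k
    using coord_d[of v k] assms that by (simp add: coord_zero)
  show "i < n2 \<Longrightarrow> coord v (n1 + i) = 0" using z[of "n1 + n2 + i"] by (simp add: dcoeff_def)
  show "i < n3 \<Longrightarrow> coord v (n1 + 2 * n2 + i) = 0"
    using z[of "n1 + 2 * n2 + n3 + i"] by (simp add: dcoeff_def) (simp add: add.assoc)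
  show "i < n3 \<Longrightarrow> coord v (n1 + 2 * n2 + n3 + i) = 0"
  proof -
    assume i: "i < n3"
    define K where "K = n1 + 2 * n2 + 2 * n3 + i"
    have "coord v (K - n3) = 0" using i z[of K] by (simp add: dcoeff_def K_def split: if_splits)
    moreover have "K - n3 = n1 + 2 * n2 + n3 + i" by (simp add: K_def)
    ultimately show ?thesis by (simp only:)
  qed
qed

lemma sums_zero: "(\<And>i. i < n1 \<Longrightarrow> c i = 0) \<Longrightarrow> xsum c = 0" "(\<And>i. i < n2 \<Longrightarrow> c i = 0) \<Longrightarrow> ysum c = 0"
    "(\<And>i. i < n3 \<Longrightarrow> c i = 0) \<Longrightarrow> zsum c = 0"
  by (simp_all add: xsum_def ysum_def zsum_def)

lemma od_kerd: "v \<in> kerd \<Longrightarrow> od v = 0"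
proof
  fix k assume v: "v \<in> kerd"
  show "od v k = 0 k"
    using kerd_coord(1)[OF v, of "k - n1"] by (auto simp: od_def)
qed

text \<open>A vector of the kernel involves only the blocks of size 1 and the bottoms of the other
  blocks, and these bottoms are exact.\<close>

lemma kerd_split: "v \<in> kerd \<Longrightarrow> \<exists>u\<in>carrier M. v = xsum (coord v) + d u"
proof -
  assume v: "v \<in> kerd"
  let ?u = "ysum (\<lambda>i. coord v (n1 + n2 + i)) + d (zsum (\<lambda>i. coord v (n1 + 2 * n2 + 2 * n3 + i)))"
  have "ysum (\<lambda>i. coord v (n1 + i)) = 0" "zsum (\<lambda>i. coord v (n1 + 2 * n2 + i)) = 0"
    "zsum (\<lambda>i. coord v (n1 + 2 * n2 + n3 + i)) = 0"
    using kerd_coord[OF v] by (auto intro: sums_zero)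
  then have "v = xsum (coord v) + d ?u"
    using coord_sum_jordan[of v] v by (simp add: d_add add.assoc)
  then show ?thesis by (rule bexI) simp
qed

lemma ev_zero_kerd: "v \<in> kerd \<Longrightarrow> ev v = 0 \<Longrightarrow> \<exists>u\<in>carrier M. v = d u"
proof -
  assume v: "v \<in> kerd" and 0: "ev v = 0"
  have "coord v i = 0" if "i < n1" for i using fun_cong[OF 0, of i] that by (simp add: ev_def)
  then have "xsum (coord v) = 0" by (rule sums_zero)
  then show ?thesis using kerd_split[OF v] by auto
qed

lemma kerdd_coord:
  assumes "v \<in> kerdd"
  shows "i < n3 \<Longrightarrow> coord v (n1 + 2 * n2 + i) = 0"
proof -
  have "d v \<in> kerd" by (rule kerd_I) (use assms in simp_all)
  then show "i < n3 \<Longrightarrow> coord v (n1 + 2 * n2 + i) = 0"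
    using kerd_coord(3)[of "d v" i] assms by (simp add: coord_d dcoeff_def) (simp add: add.assoc)
qed

lemma kerdd_split: "v \<in> kerdd \<Longrightarrow> \<exists>k\<in>kerd. \<exists>u\<in>carrier M. v = ysum (\<lambda>i. coord v (n1 + i)) + k + d u"
proof -
  assume v: "v \<in> kerdd"
  let ?k = "xsum (coord v)"
  let ?u = "ysum (\<lambda>i. coord v (n1 + n2 + i)) + zsum (\<lambda>i. coord v (n1 + 2 * n2 + n3 + i))
      + d (zsum (\<lambda>i. coord v (n1 + 2 * n2 + 2 * n3 + i)))"
  have "zsum (\<lambda>i. coord v (n1 + 2 * n2 + i)) = 0"
    using kerdd_coord[OF v] by (auto intro: sums_zero)
  then have "v = ysum (\<lambda>i. coord v (n1 + i)) + ?k + d ?u"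
    using coord_sum_jordan[of v] v by (simp add: d_add add_ac)
  moreover have "?k \<in> kerd" "?u \<in> carrier M" by (rule kerd_I) simp_all
  ultimately show ?thesis by blast
qed

lemma od_zero_kerdd: "v \<in> kerdd \<Longrightarrow> od v = 0 \<Longrightarrow> \<exists>k\<in>kerd. \<exists>u\<in>carrier M. v = k + d u"
proof -
  assume v: "v \<in> kerdd" and 0: "od v = 0"
  have "coord v (n1 + i) = 0" if "i < n2" for i using fun_cong[OF 0, of "n1 + i"] that by (simp add: od_def)
  then have "ysum (\<lambda>i. coord v (n1 + i)) = 0" by (intro sums_zero)
  then show ?thesis using kerdd_split[OF v] by auto
qed

definition heads :: "(nat \<Rightarrow> 'a) \<Rightarrow> 'b" where
  "heads c = (\<Sum>i<N. scale M (c i) ((xs @ ys) ! i))"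

lemma heads_nth_carrier [simp]: "i < N \<Longrightarrow> (xs @ ys) ! i \<in> carrier M"
  by (simp add: nth_append)

lemma heads_split: "heads c = xsum c + ysum (\<lambda>i. c (n1 + i))"
  using sum_nth_append[of "\<lambda>i v. scale M (c i) v" xs ys] by (simp add: heads_def xsum_def ysum_def)

lemma heads_ev: "heads (ev v) = xsum (coord v)"
  by (simp add: heads_split sums_zero) (simp add: xsum_def ysum_def ev_def)

lemma heads_od: "heads (od v) = ysum (\<lambda>i. coord v (n1 + i))"
  by (simp add: heads_split sums_zero) (simp add: xsum_def ysum_def od_def)

lemma coord_heads: "k < N \<Longrightarrow> coord (heads c) k = c k"
proof -
  assume "k < N"
  let ?c = "\<lambda>i. if i < N then c i else 0"
  have "heads c = (\<Sum>i<length jb. scale M (?c i) (jb ! i))"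
    unfolding jordan_sum heads_split by (simp add: xsum_def ysum_def zsum_def)
  from coord_unique[OF this, of k] \<open>k < N\<close> show ?thesis by simp
qed

lemma ev_heads: "ev (heads c) = (\<lambda>k. if k < n1 then c k else 0)"
  by (auto simp: ev_def coord_heads)

lemma od_heads: "od (heads c) = (\<lambda>k. if n1 \<le> k \<and> k < N then c k else 0)"
  by (auto simp: od_def coord_heads)

section \<open>The bracket of the semisimplification on representatives\<close>

lemma S_simps:
  "carrier S = {c. \<forall>k\<ge>N. c k = 0}" "zero S = 0" "add S = (+)"
  "scale S = (\<lambda>c a k. c * a k)"
  "part S p = {c. (\<forall>k\<ge>N. c k = 0) \<and> (\<forall>k. c k \<noteq> 0 \<longrightarrow> head_parity xs k = p)}"
  by (auto simp: semisimplification_def Let_def fun_eq_iff)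

lemma part_S_even: "part S 0 = ev ` kerd"
proof
  show "part S 0 \<subseteq> ev ` kerd"
  proof
    fix c assume c: "c \<in> part S 0"
    then have z: "c k = 0" if "k \<ge> n1" for k using that by (auto simp: S_simps head_parity_def not_less)
    have "heads c = xsum c" using z by (simp add: heads_split sums_zero)
    then have "heads c \<in> kerd" by (intro kerd_I) simp_all
    moreover have "c = ev (heads c)" using z by (auto simp: ev_heads fun_eq_iff)
    ultimately show "c \<in> ev ` kerd" by blast
  qed
qed (auto simp: S_simps ev_def head_parity_def)

lemma part_S_odd: "part S 1 = od ` kerdd"
proof
  show "part S 1 \<subseteq> od ` kerdd"
  proof
    fix c assume c: "c \<in> part S 1"
    then have z: "c k = 0" if "k < n1 \<or> k \<ge> N" for k using that by (auto simp: S_simps head_parity_def)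
    have "heads c = ysum (\<lambda>i. c (n1 + i))" using z by (simp add: heads_split sums_zero)
    then have "heads c \<in> kerdd" by (intro kerdd_I) simp_all
    moreover have "c = od (heads c)" using z by (auto simp: od_heads fun_eq_iff not_less)
    ultimately show "c \<in> od ` kerdd" by blast
  qed
qed (auto simp: S_simps od_def head_parity_def)

lemma bilinear_expand:
  "bracket M (heads a) (f (heads b)) = (\<Sum>i<N. \<Sum>j<N. scale M (a i * b j) (bracket M ((xs @ ys) ! i) (f ((xs @ ys) ! j))))"
  if "\<And>x y. f (x + y) = f x + f y" "\<And>c x. f (scale M c x) = scale M c (f x)" for f
proof -
  have f0: "f 0 = 0" using that(2)[of 0 0] by simp
  have fs: "f (\<Sum>i\<in>I. g i) = (\<Sum>i\<in>I. f (g i))" for I :: "nat set" and g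
    by (induction I rule: infinite_finite_induct) (auto simp: that(1) f0)
  have bl: "bracket M (\<Sum>i\<in>I. g i) y = (\<Sum>i\<in>I. bracket M (g i) y)" for I :: "nat set" and g y
    by (induction I rule: infinite_finite_induct) (auto simp: bracket_add_left)
  have br: "bracket M y (\<Sum>i\<in>I. g i) = (\<Sum>i\<in>I. bracket M y (g i))" for I :: "nat set" and g y
    by (induction I rule: infinite_finite_induct) (auto simp: bracket_add_right)
  show ?thesis
    unfolding heads_def fs bl unfolding br that(2) bracket_scale_left bracket_scale_right by (simp add: mult.commute)
qed

lemma coord_bilinear:
  assumes "k < N" and f: "\<And>i j. i < N \<Longrightarrow> j < N \<Longrightarrow> g i j \<in> carrier M"
  shows "coord (\<Sum>i<N. \<Sum>j<N. scale M (c i j) (g i j)) k = (\<Sum>i<N. \<Sum>j<N. c i j * coord (g i j) k)"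
proof -
  have k: "k < length jb" using assms by simp
  have "coord (\<Sum>i<N. \<Sum>j<N. scale M (c i j) (g i j)) k = (\<Sum>i<N. coord (\<Sum>j<N. scale M (c i j) (g i j)) k)"
    by (rule coord_sum[OF k]) (rule carrier_sum, use f in simp)
  also have "\<dots> = (\<Sum>i<N. \<Sum>j<N. c i j * coord (g i j) k)"
  proof (rule sum.cong[OF refl])
    fix i assume "i \<in> {..<N}"
    then show "coord (\<Sum>j<N. scale M (c i j) (g i j)) k = (\<Sum>j<N. c i j * coord (g i j) k)"
      using f k by (subst coord_sum[OF k]) (auto simp: coord_scale)
  qed
  finally show ?thesis .
qed

lemma S_bracket: "bracket S a b k = (if k < N then (\<Sum>i<N. \<Sum>j<N. a i * b j *
    structure_const M d xs ys zs i j k) else 0)"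
  by (simp add: semisimplification_def Let_def)

lemma structure_const_simps:
  "head_parity xs i = 1 \<Longrightarrow> head_parity xs j = 1 \<Longrightarrow> structure_const M d xs ys zs i j k =
     (if head_parity xs k = 0 then coord (bracket M (d ((xs @ ys) ! i)) ((xs @ ys) ! j)
        + - bracket M ((xs @ ys) ! i) (d ((xs @ ys) ! j))) k else 0)"
  "head_parity xs i = 0 \<or> head_parity xs j = 0 \<Longrightarrow> structure_const M d xs ys zs i j k =
     (if head_parity xs k = head_parity xs i + head_parity xs j
       then coord (bracket M ((xs @ ys) ! i) ((xs @ ys) ! j)) k else 0)"
  by (auto simp: structure_const_def Let_def scale_minus_left add.commute)

text \<open>In this and the next three cases the bracket is computed on the canonical
  representatives, which are combinations of heads. Coefficients outside the relevant parity vanish,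
  so the case distinction in the structure constants collapses.\<close>

lemma S_bracket_even_even: "bracket S (ev v) (ev w) = ev (bracket M (heads (ev v)) (heads (ev w)))"
proof
  fix k
  have t: "ev v i * ev w j * structure_const M d xs ys zs i j k
     = ev v i * ev w j * (if k < n1 then coord (bracket M ((xs @ ys) ! i) ((xs @ ys) ! j)) k else 0)" for i j
    by (cases "i < n1"; cases "j < n1") (auto simp: ev_def structure_const_simps head_parity_def)
  have r: "ev (bracket M (heads (ev v)) (heads (ev w))) k
     = (if k < n1 then (\<Sum>i<N. \<Sum>j<N. ev v i * ev w j * coord (bracket M ((xs @ ys) ! i) ((xs @ ys) ! j)) k) else 0)"
    using bilinear_expand[of "\<lambda>x. x" "ev v" "ev w"] by (simp add: ev_def[of "sum _ _"] coord_bilinear)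
  show "bracket S (ev v) (ev w) k = ev (bracket M (heads (ev v)) (heads (ev w))) k"
    unfolding S_bracket t r by simp
qed

lemma S_bracket_even_odd: "bracket S (ev v) (od w) = od (bracket M (heads (ev v)) (heads (od w)))"
proof
  fix k
  have t: "ev v i * od w j * structure_const M d xs ys zs i j k
     = ev v i * od w j * (if k < n1 then 0 else coord (bracket M ((xs @ ys) ! i) ((xs @ ys) ! j)) k)" for i j
    by (cases "i < n1"; cases "j < n1") (auto simp: ev_def od_def structure_const_simps head_parity_def)
  have r: "od (bracket M (heads (ev v)) (heads (od w))) k
     = (if n1 \<le> k \<and> k < N then (\<Sum>i<N. \<Sum>j<N. ev v i * od w j * coord (bracket M ((xs @ ys) ! i) ((xs @ ys) ! j)) k) else 0)"
    using bilinear_expand[of "\<lambda>x. x" "ev v" "od w"] by (simp add: od_def[of "sum _ _"] coord_bilinear)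
  show "bracket S (ev v) (od w) k = od (bracket M (heads (ev v)) (heads (od w))) k"
    unfolding S_bracket t r by simp
qed

lemma S_bracket_odd_even: "bracket S (od v) (ev w) = od (bracket M (heads (od v)) (heads (ev w)))"
proof
  fix k
  have t: "od v i * ev w j * structure_const M d xs ys zs i j k
     = od v i * ev w j * (if k < n1 then 0 else coord (bracket M ((xs @ ys) ! i) ((xs @ ys) ! j)) k)" for i j
    by (cases "i < n1"; cases "j < n1") (auto simp: ev_def od_def structure_const_simps head_parity_def)
  have r: "od (bracket M (heads (od v)) (heads (ev w))) k
     = (if n1 \<le> k \<and> k < N then (\<Sum>i<N. \<Sum>j<N. od v i * ev w j * coord (bracket M ((xs @ ys) ! i) ((xs @ ys) ! j)) k) else 0)"
    using bilinear_expand[of "\<lambda>x. x" "od v" "ev w"] by (simp add: od_def[of "sum _ _"] coord_bilinear)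
  show "bracket S (od v) (ev w) k = od (bracket M (heads (od v)) (heads (ev w))) k"
    unfolding S_bracket t r by simp
qed

lemma odd_bracket_commute: "x \<in> carrier M \<Longrightarrow> y \<in> carrier M \<Longrightarrow> odd_bracket y x = odd_bracket x y"
  unfolding odd_bracket_def using anti[of x "d y"] anti[of "d x" y] by simp

lemma odd_bracket_linear:
  "odd_bracket x (y + z) = odd_bracket x y + odd_bracket x z"
  "odd_bracket (x + y) z = odd_bracket x z + odd_bracket y z"
  "odd_bracket x (y - z) = odd_bracket x y - odd_bracket x z"
  "odd_bracket (x - y) z = odd_bracket x z - odd_bracket y z"
  by (simp_all add: odd_bracket_def bracket_add_left bracket_add_right bracket_diff d_add d_diff)

lemma odd_bracket_carrier [simp]: "x \<in> carrier M \<Longrightarrow> y \<in> carrier M \<Longrightarrow> odd_bracket x y \<in> carrier M"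
  by (simp add: odd_bracket_def)

lemma S_bracket_odd_odd: "bracket S (od v) (od w) = ev (odd_bracket (heads (od v)) (heads (od w)))"
proof
  fix k
  let ?g = "\<lambda>i j. odd_bracket ((xs @ ys) ! i) ((xs @ ys) ! j)"
  have t: "od v i * od w j * structure_const M d xs ys zs i j k
     = od v i * od w j * (if k < n1 then coord (?g i j) k else 0)" for i j
    by (cases "i < n1"; cases "j < n1")
      (auto simp: od_def structure_const_simps head_parity_def odd_bracket_def)
  have "odd_bracket (heads a) (heads b) = (\<Sum>i<N. \<Sum>j<N. scale M (a i * b j) (?g i j))" for a b
  proof -
    have bl: "bracket M (\<Sum>i\<in>I. g i) y = (\<Sum>i\<in>I. bracket M (g i) y)" for I :: "nat set" and g y
      by (induction I rule: infinite_finite_induct) (auto simp: bracket_add_left)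
    have br: "bracket M y (\<Sum>i\<in>I. g i) = (\<Sum>i\<in>I. bracket M y (g i))" for I :: "nat set" and g y
      by (induction I rule: infinite_finite_induct) (auto simp: bracket_add_right)
    have "bracket M (d (heads a)) (heads b)
       = (\<Sum>i<N. \<Sum>j<N. scale M (a i * b j) (bracket M (d ((xs @ ys) ! i)) ((xs @ ys) ! j)))"
      unfolding heads_def d_sum bl unfolding br d_scale bracket_scale_left bracket_scale_right by (simp add: mult.commute)
    then show ?thesis
      by (simp add: odd_bracket_def bilinear_expand[of d, OF d_add d_scale] scale_right_diff_distrib sum_subtractf)
  qed
  then have r: "ev (odd_bracket (heads (od v)) (heads (od w))) k
     = (if k < n1 then (\<Sum>i<N. \<Sum>j<N. od v i * od w j * coord (?g i j) k) else 0)"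
    by (simp add: ev_def[of "sum _ _"] coord_bilinear)
  show "bracket S (od v) (od w) k = ev (odd_bracket (heads (od v)) (heads (od w))) k"
    unfolding S_bracket t r by simp
qed

lemma ev_bracket_image: "a \<in> kerd \<Longrightarrow> w \<in> carrier M \<Longrightarrow> ev (bracket M a (d w)) = 0"
    "a \<in> kerd \<Longrightarrow> w \<in> carrier M \<Longrightarrow> ev (bracket M (d w) a) = 0"
proof -
  assume a: "a \<in> kerd" "w \<in> carrier M"
  have "bracket M a (d w) = d (bracket M a w)" "bracket M (d w) a = d (bracket M w a)"
    using a by (simp_all add: derivation)
  then show "ev (bracket M a (d w)) = 0" "ev (bracket M (d w) a) = 0" using a by simp_all
qed

text \<open>The sum of \<open>bracket M (d u) b\<close> and \<open>bracket M u (d b)\<close> is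
  exact and their difference lies in the kernel of \<open>d\<close>. Both are killed by
  \<open>od\<close>, and 2 is invertible.\<close>

lemma od_bracket_image: "u \<in> kerdd \<Longrightarrow> b \<in> kerdd \<Longrightarrow> od (bracket M (d u) b) = 0"
    "u \<in> kerdd \<Longrightarrow> b \<in> kerdd \<Longrightarrow> od (bracket M b (d u)) = 0"
proof -
  assume u: "u \<in> kerdd" and b: "b \<in> kerdd"
  have c: "u \<in> carrier M" "b \<in> carrier M" using u b by simp_all
  have "bracket M (d u) b + bracket M u (d b) = d (bracket M u b)" using c by (simp add: derivation)
  then have "od (bracket M (d u) b) + od (bracket M u (d b)) = 0"
    using c by (simp flip: od_linear(1))
  moreover have "bracket M (d u) b - bracket M u (d b) \<in> kerd"
    by (rule kerd_I) (use u b in \<open>simp_all add: d_diff derivation\<close>)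
  then have "od (bracket M (d u) b) - od (bracket M u (d b)) = 0"
    using c by (simp add: od_kerd flip: od_diff)
  ultimately have sum: "od (bracket M (d u) b) + od (bracket M (d u) b) = 0" by simp
  show 1: "od (bracket M (d u) b) = 0"
  proof
    fix k
    have "2 * od (bracket M (d u) b) k = 0" using fun_cong[OF sum, of k] by simp
    then show "od (bracket M (d u) b) k = 0 k" by (simp add: two)
  qed
  show "od (bracket M b (d u)) = 0"
    using anti[of "d u" b] c 1 by (simp add: od_uminus)
qed

lemma ev_odd_bracket_kerd: "a \<in> kerdd \<Longrightarrow> k \<in> kerd \<Longrightarrow> ev (odd_bracket a k) = 0"
  using ev_bracket_image(2)[of k a] by (simp add: odd_bracket_def)

text \<open>As \<open>a\<close> is killed by \<open>d\<close> twice, applying \<open>d\<close> twice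
  to \<open>bracket M a w\<close> gives 2[da,dw] + [a,ddw]. Because 2 = -1, this exact element is
  minus the odd bracket of \<open>a\<close> and \<open>d w\<close>.\<close>

lemma ev_odd_bracket_image:
  assumes a: "a \<in> kerdd" and w: "w \<in> carrier M"
  shows "ev (odd_bracket a (d w)) = 0"
proof -
  have c: "a \<in> carrier M" "w \<in> carrier M" using a w by simp_all
  let ?p = "bracket M (d a) (d w)" and ?q = "bracket M a (d (d w))"
  have "ev (d (d (bracket M a w))) = 0" using c by simp
  moreover have "d (d (bracket M a w)) = ?p + ?p + ?q"
    using a w by (simp add: derivation d_add)
  ultimately have "ev ?p + ev ?p + ev ?q = 0" using c by (simp add: ev_linear)
  then have sum: "ev ?p k + ev ?p k + ev ?q k = 0" for k by (simp add: fun_eq_iff)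
  have "ev ?q k = ev ?p k" for k
  proof -
    have "2 * ev ?p k + ev ?q k = 0" using sum[of k] by simp
    then show ?thesis unfolding two using add_eq_0_iff[of "- ev ?p k" "ev ?q k"] by simp
  qed
  then have "ev ?p = ev ?q" by auto
  then show ?thesis unfolding odd_bracket_def using c by (simp add: ev_diff)
qed

text \<open>Replacing a representative by its canonical one changes the bracket by elements that
  \<open>ev\<close> kills. With the next two lemmas, this removes the Jordan basis from all later
  computations.\<close>

lemma ev_bracket:
  assumes a: "a \<in> kerd" and b: "b \<in> kerd"
  shows "bracket S (ev a) (ev b) = ev (bracket M a b)"
proof -
  from kerd_split[OF a] obtain u where u: "u \<in> carrier M" "a = heads (ev a) + d u" by (auto simp: heads_ev)
  from kerd_split[OF b] obtain w where w: "w \<in> carrier M" "b = heads (ev b) + d w" by (auto simp: heads_ev)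
  define a0 b0 where ab0: "a0 = heads (ev a)" "b0 = heads (ev b)"
  have k: "a0 \<in> kerd" "b0 \<in> kerd" by (auto simp: ab0 heads_ev intro!: kerd_I)
  have "bracket M a b = bracket M a0 b0 + bracket M a (d w) + bracket M (d u) b0"
    using u w unfolding ab0[symmetric] by (simp add: bracket_add_left bracket_add_right)
  then show ?thesis
    using a b k u(1) w(1) unfolding S_bracket_even_even ab0[symmetric] by (simp add: ev_linear ev_bracket_image)
qed

lemma od_bracket:
  assumes a: "a \<in> kerd" and b: "b \<in> kerdd"
  shows "bracket S (ev a) (od b) = od (bracket M a b)" "bracket S (od b) (ev a) = od (bracket M b a)"
proof -
  from kerd_split[OF a] obtain u where u: "u \<in> carrier M" "a = heads (ev a) + d u" by (auto simp: heads_ev)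
  from kerdd_split[OF b] obtain k w where w: "w \<in> carrier M" "k \<in> kerd" "b = heads (od b) + k + d w"
    by (auto simp: heads_od)
  define a0 b0 where ab0: "a0 = heads (ev a)" "b0 = heads (od b)"
  have k: "a0 \<in> kerd" "b0 \<in> kerdd" by (auto simp: ab0 heads_ev heads_od intro!: kerd_I kerdd_I)
  \<comment> \<open>\<open>a\<close> and its canonical representative both lie in the kernel of
    \<open>d\<close>, hence so does their difference \<open>d u\<close>;
    \<open>od_bracket_image\<close> needs this.\<close>
  have "d (d u) = 0" using arg_cong[OF u(2), of d] a k by (simp add: d_add flip: ab0)
  then have uk: "u \<in> kerdd" using u by (intro kerdd_I)
  have 0: "od (bracket M a (d w)) = 0" "od (bracket M (d w) a) = 0"
  proof -
    have "bracket M a (d w) = d (bracket M a w)" "bracket M (d w) a = d (bracket M w a)"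
      using a w by (simp_all add: derivation)
    then show "od (bracket M a (d w)) = 0" "od (bracket M (d w) a) = 0" using a w by simp_all
  qed
  have "bracket M a b = bracket M a0 b0 + bracket M a k + bracket M a (d w) + bracket M (d u) b0"
    using u w unfolding ab0[symmetric] by (simp add: bracket_add_left bracket_add_right add_ac)
  then show "bracket S (ev a) (od b) = od (bracket M a b)"
    using a b k u(1) w(1,2) 0 uk unfolding S_bracket_even_odd ab0[symmetric]
    by (simp add: od_linear od_bracket_image od_kerd)
  have "bracket M b a = bracket M b0 a0 + bracket M k a + bracket M (d w) a + bracket M b0 (d u)"
    using u w unfolding ab0[symmetric] by (simp add: bracket_add_left bracket_add_right add_ac)
  then show "bracket S (od b) (ev a) = od (bracket M b a)"
    using a b k u(1) w(1,2) 0 uk unfolding S_bracket_odd_even ab0[symmetric]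
    by (simp add: od_linear od_bracket_image od_kerd)
qed

lemma odd_bracket:
  assumes a: "a \<in> kerdd" and b: "b \<in> kerdd"
  shows "bracket S (od a) (od b) = ev (odd_bracket a b)"
proof -
  from kerdd_split[OF a] obtain l u where u: "u \<in> carrier M" "l \<in> kerd" "a = heads (od a) + l + d u"
    by (auto simp: heads_od)
  from kerdd_split[OF b] obtain k w where w: "w \<in> carrier M" "k \<in> kerd" "b = heads (od b) + k + d w"
    by (auto simp: heads_od)
  define a0 b0 where ab0: "a0 = heads (od a)" "b0 = heads (od b)"
  have k: "a0 \<in> kerdd" "b0 \<in> kerdd" by (auto simp: ab0 heads_od intro!: kerdd_I)
  have "odd_bracket a b = odd_bracket a0 b0 + odd_bracket a k + odd_bracket a (d w)
      + odd_bracket b0 l + odd_bracket b0 (d u)"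
    using u w k odd_bracket_commute[of b0 l] odd_bracket_commute[of b0 "d u"]
    unfolding ab0[symmetric] by (simp add: odd_bracket_linear add_ac)
  then show ?thesis
    using a b k u(1,2) w(1,2) unfolding S_bracket_odd_odd ab0[symmetric]
    by (simp add: ev_linear ev_odd_bracket_kerd ev_odd_bracket_image)
qed

lemma ev_zero [simp]: "ev 0 = 0" by (rule ev_linear)

lemma od_zero [simp]: "od 0 = 0" by (rule od_linear)

section \<open>The Lie superalgebra axioms for the semisimplification\<close>

lemma S_linear: "linear_superalgebra S"
proof (rule linear_superalgebra.intro)
  have add: "add S = (+)" and zero: "zero S = 0" by (auto simp: S_simps)
  show "add S = (+)" "zero S = 0" by (fact add zero)+
  show "subspace_of S (carrier S)" by (auto simp: subspace_of_def S_simps)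
  show "bracket S (x + y) z = bracket S x z + bracket S y z" for x y z
    by (auto simp: fun_eq_iff S_bracket algebra_simps sum.distrib)
  show "bracket S z (x + y) = bracket S z x + bracket S z y" for x y z
    by (auto simp: fun_eq_iff S_bracket algebra_simps sum.distrib)
  show "bracket S (scale S c x) y = scale S c (bracket S x y)" for c x y
    by (auto simp: fun_eq_iff S_simps S_bracket sum_distrib_left mult.assoc)
  show "bracket S x (scale S c y) = scale S c (bracket S x y)" for c x y
    by (auto simp: fun_eq_iff S_simps S_bracket sum_distrib_left mult_ac)
  show "bracket S x y \<in> carrier S" if "x \<in> carrier S" "y \<in> carrier S" for x y
    by (auto simp: S_simps S_bracket)
  show "vector_space (scale S)"
    by unfold_locales (auto simp: S_simps fun_eq_iff algebra_simps)
qed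

text \<open>The Jacobi identity for three odd elements holds only modulo the image of \<open>d\<close>, in characteristic 3.\<close>

lemma odd_jacobi:
  assumes x: "x \<in> kerdd" and y: "y \<in> kerdd" and z: "z \<in> kerdd"
  shows "od (bracket M x (odd_bracket y z)) - od (bracket M (odd_bracket x y) z) + od (bracket M y (odd_bracket x z)) = 0"
proof -
  have c: "x \<in> carrier M" "y \<in> carrier M" "z \<in> carrier M"
    "d x \<in> carrier M" "d y \<in> carrier M" "d z \<in> carrier M" using assms by simp_all
  let ?b = "bracket M"
  define X1 X2 Y1 Y2 Z1 Z2 where def: "X1 = ?b y (?b z (d x))" "X2 = ?b z (?b y (d x))"
    "Y1 = ?b z (?b x (d y))" "Y2 = ?b x (?b z (d y))" "Z1 = ?b x (?b y (d z))" "Z2 = ?b y (?b x (d z))"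
  have cc: "X1 \<in> carrier M" "X2 \<in> carrier M" "Y1 \<in> carrier M" "Y2 \<in> carrier M" "Z1 \<in> carrier M" "Z2 \<in> carrier M"
    using c by (simp_all add: def)
  have s: "?b (d x) z = - ?b z (d x)" "?b (d x) y = - ?b y (d x)" "?b (d y) z = - ?b z (d y)"
    "?b (d y) x = - ?b x (d y)" "?b (d z) x = - ?b x (d z)" "?b (d z) y = - ?b y (d z)"
    using c by (auto intro: anti)
  have a: "?b (?b u v) z = - ?b z (?b u v)" if "u \<in> carrier M" "v \<in> carrier M" for u v
    using anti[of z "?b u v"] c that by simp
  \<comment> \<open>Everything is expressed by the six double brackets in which one argument is
    differentiated and stands innermost.\<close>
  have J: "?b x (odd_bracket y z) - ?b (odd_bracket x y) z + ?b y (odd_bracket x z)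
      = - (X1 + X2 + Y1 + Y2 + Z1 + Z2)"
    using c by (simp add: odd_bracket_def bracket_diff bracket_minus a s def algebra_simps)
  have 1: "d (?b x (?b y z)) = X2 - X1 - Y2 + Z1"
    using c leibniz[of "d x" y z] by (simp add: derivation bracket_add_right bracket_diff bracket_minus a s def algebra_simps)
  have zx: "?b z x = - ?b x z" using c by (auto intro: anti)
  have h: "?b (d y) (?b z x) = Y2 - Y1"
    using c leibniz[of x z "d y"] anti[of "d y" "?b x z"] by (simp add: zx bracket_minus def algebra_simps)
  have 2: "d (?b y (?b z x)) = Y2 - Y1 - Z2 + X1"
    using c h
    by (simp add: derivation bracket_add_right bracket_diff bracket_minus s def algebra_simps)
  \<comment> \<open>The six terms add up to a difference of two exact elements, up to three times
    \<open>X1\<close> and three times \<open>Y2\<close>, which vanish.\<close>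
  have "- (X1 + X2 + Y1 + Y2 + Z1 + Z2) = d (?b y (?b z x)) - d (?b x (?b y z)) - (X1 + X1 + X1) - (Y2 + Y2 + Y2)"
    unfolding 1 2 by (simp add: algebra_simps)
  then have "?b x (odd_bracket y z) - ?b (odd_bracket x y) z + ?b y (odd_bracket x z)
      = d (?b y (?b z x)) - d (?b x (?b y z))"
    by (simp only: J triple) simp
  moreover have "od (d (?b y (?b z x)) - d (?b x (?b y z))) = 0"
    using c by (simp add: od_diff)
  ultimately show ?thesis using c by (simp flip: od_diff od_linear(1))
qed

lemma S_part_cases:
  assumes "x \<in> part S p"
  obtains (even) a where "p = 0" "a \<in> kerd" "x = ev a" | (odd) a where "p = 1" "a \<in> kerdd" "x = od a"
  using assms part_S_even part_S_odd by (cases "p = 0") auto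

lemma S_odd_cube:
  "x \<in> kerdd \<Longrightarrow> bracket S (od x) (bracket S (od x) (od x)) = od (bracket M x (odd_bracket x x))"
  by (simp add: odd_bracket od_bracket)

text \<open>With at most two odd arguments the identity already holds for representatives, by the
  Leibniz rule and the derivation property of \<open>d\<close>. Three odd arguments are the case of
  \<open>odd_jacobi\<close>.\<close>

lemma S_jacobi:
  assumes x: "x \<in> part S p" and y: "y \<in> part S q" and z: "z \<in> part S r"
  shows "bracket S x (bracket S y z) - bracket S (bracket S x y) z
        - scale S (koszul_sign p q) (bracket S y (bracket S x z)) = 0"
proof -
  have s1: "scale S 1 = (\<lambda>x. x)" and sm: "scale S (- 1) = (\<lambda>x. - x)" by (auto simp: S_simps fun_eq_iff)
  note L = leibniz bracket_diff bracket_add_left bracket_add_right derivation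
  note simps = od_bracket ev_bracket odd_bracket s1 sm koszul_sign_def
  from x show ?thesis
  proof (cases rule: S_part_cases)
    case x: (even a)
    from y show ?thesis
    proof (cases rule: S_part_cases)
      case y: (even b)
      from z show ?thesis
      proof (cases rule: S_part_cases)
        case z: (even c)
        then show ?thesis using x y leibniz[of a b c]
          by (simp add: simps ev_linear)
      next
        case z: (odd c)
        then show ?thesis using x y leibniz[of a b c]
          by (simp add: simps od_linear)
      qed
    next
      case y: (odd b)
      from z show ?thesis
      proof (cases rule: S_part_cases)
        case z: (even c)
        then show ?thesis using x y leibniz[of a b c]
          by (simp add: simps od_linear)
      next
        case z: (odd c)
        have "bracket M a (odd_bracket b c) = odd_bracket (bracket M a b) c + odd_bracket b (bracket M a c)"
          using x y z leibniz[of a "d b" c] leibniz[of a b "d c"]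
          by (simp add: odd_bracket_def bracket_diff derivation)
        then show ?thesis using x y z
          by (simp add: simps ev_linear)
      qed
    qed
  next
    case x: (odd a)
    from y show ?thesis
    proof (cases rule: S_part_cases)
      case y: (even b)
      from z show ?thesis
      proof (cases rule: S_part_cases)
        case z: (even c)
        then show ?thesis using x y leibniz[of a b c]
          by (simp add: simps od_linear)
      next
        case z: (odd c)
        have "odd_bracket a (bracket M b c) = odd_bracket (bracket M a b) c + bracket M b (odd_bracket a c)"
          using x y z leibniz[of "d a" b c] leibniz[of a b "d c"]
          by (simp add: odd_bracket_def bracket_diff derivation)
        then show ?thesis using x y z
          by (simp add: simps ev_linear)
      qed
    next
      case y: (odd b)
      from z show ?thesis
      proof (cases rule: S_part_cases)
        case z: (even c)
        have "odd_bracket a (bracket M b c) = bracket M (odd_bracket a b) c - odd_bracket b (bracket M a c)"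
          using x y z leibniz[of "d a" b c] leibniz[of a "d b" c]
          by (simp add: odd_bracket_def bracket_diff derivation algebra_simps)
        then show ?thesis using x y z
          by (simp add: simps ev_diff)
      next
        case z: (odd c)
        then show ?thesis using x y odd_jacobi[of a b c]
          by (simp add: simps)
      qed
    qed
  qed
qed

lemma S_antisymmetry:
  assumes x: "x \<in> part S p" and y: "y \<in> part S q"
  shows "bracket S x y + scale S (koszul_sign p q) (bracket S y x) = 0"
proof -
  have s1: "scale S 1 = (\<lambda>x. x)" and sm: "scale S (- 1) = (\<lambda>x. - x)" by (auto simp: S_simps fun_eq_iff)
  note simps = od_bracket ev_bracket odd_bracket s1 sm koszul_sign_def
  from x show ?thesis
  proof (cases rule: S_part_cases)
    case x: (even a)
    from y show ?thesis
      by (cases rule: S_part_cases) (use x anti[of a] in \<open>simp_all add: simps ev_uminus od_uminus\<close>)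
  next
    case x: (odd a)
    from y show ?thesis
      by (cases rule: S_part_cases) (use x anti[of a] odd_bracket_commute[of a] in \<open>simp_all add: simps od_uminus\<close>)
  qed
qed

text \<open>For an odd element the Jacobi identity only says that three times its cube is zero,
  which is empty in characteristic 3. The cube identity therefore remains a hypothesis until the
  grading is available.\<close>

lemma S_lie:
  assumes cube: "\<And>x. x \<in> kerdd \<Longrightarrow> od (bracket M x (odd_bracket x x)) = 0"
  shows "lie_superalgebra S"
proof -
  interpret S: linear_superalgebra S by (rule S_linear)
  show ?thesis
  proof
    show "subspace_of S (part S p)" for p
      by (auto simp: subspace_of_def S_simps) (metis add_0)
    show "\<exists>a\<in>part S 0. \<exists>b\<in>part S 1. x = a + b" if "x \<in> carrier S" for x
      by (rule bexI[of _ "\<lambda>k. if k < n1 then x k else 0"], rule bexI[of _ "\<lambda>k. if k < n1 then 0 else x k"])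
        (use that in \<open>auto simp: S_simps head_parity_def fun_eq_iff\<close>)
    show "x = 0" if "x \<in> part S 0" "x \<in> part S 1" for x
      using that by (auto simp: S_simps fun_eq_iff)
    show "bracket S x y \<in> part S (p + q)" if x: "x \<in> part S p" and y: "y \<in> part S q" for x y p q
      using x
    proof (cases rule: S_part_cases)
      case x: (even a)
      from y show ?thesis
        by (cases rule: S_part_cases) (use x in \<open>simp_all add: ev_bracket od_bracket part_S_even part_S_odd\<close>)
    next
      case x: (odd a)
      from y show ?thesis
        by (cases rule: S_part_cases) (use x in \<open>simp_all add: odd_bracket od_bracket part_S_even part_S_odd\<close>)
    qed
    show "bracket S x (bracket S x x) = 0" if "x \<in> part S 1" for x
      using that cube by (auto simp: part_S_odd S_odd_cube)
  qed (fact S_antisymmetry S_jacobi)+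
qed

end

section \<open>Existence of Jordan decompositions\<close>

context alpha3_lie
begin

lemma list_sum_eq_sum:
  assumes "distinct us"
  shows "list_sum us (\<lambda>i. g (us ! i)) = (\<Sum>v\<in>set us. scale M (g v) v)"
  unfolding list_sum_def
  using sum.reindex_bij_betw[OF bij_betw_nth[OF assms refl refl], of "\<lambda>v. scale M (g v) v"] .

lemma list_sum_independent:
  assumes "distinct us" "independent (set us)" "list_sum us c = 0" "i < length us"
  shows "c i = 0"
proof -
  define g where "g v = c (THE i. i < length us \<and> us ! i = v)" for v
  have g: "g (us ! i) = c i" if "i < length us" for i
    unfolding g_def by (rule arg_cong[of _ _ c], rule the_equality)
      (use that assms(1) in \<open>auto simp: nth_eq_iff_index_eq\<close>)
  have "list_sum us c = list_sum us (\<lambda>i. g (us ! i))" by (simp add: list_sum_def g)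
  then have "(\<Sum>v\<in>set us. scale M (g v) v) = 0" using assms list_sum_eq_sum[of us g] by simp
  then have "g (us ! i) = 0"
    using independentD[OF assms(2) finite_set subset_refl, of g "us ! i"] assms(4) by simp
  then show ?thesis using g assms(4) by simp
qed

lemma list_sum_span:
  assumes "distinct us" "v \<in> span (set us)"
  obtains c where "v = list_sum us c"
proof -
  from assms(2) obtain g where "v = (\<Sum>v\<in>set us. scale M (g v) v)"
    by (auto simp: span_finite)
  then have "v = list_sum us (\<lambda>i. g (us ! i))" using list_sum_eq_sum[OF assms(1)] by simp
  then show ?thesis by (rule that)
qed

lemma list_sum_append: "list_sum (us @ vs) c = list_sum us c + list_sum vs (\<lambda>i. c (length us + i))"
  unfolding list_sum_def by (rule sum_nth_append[of "\<lambda>i v. scale M (c i) v"])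

lemma list_sum_map_d: "list_sum (map d us) c = d (list_sum us c)"
  by (simp add: list_sum_def d_sum d_scale)

lemma list_sum_closed: "set us \<subseteq> carrier M \<Longrightarrow> list_sum us c \<in> carrier M"
  unfolding list_sum_def by (rule carrier_sum) (auto simp: subset_iff)

lemma list_sum_zero: "(\<And>i. i < length us \<Longrightarrow> a i = 0) \<Longrightarrow> list_sum us a = 0"
  by (simp add: list_sum_def)

text \<open>A Jordan basis grows from the bottoms of its blocks. A basis of the image of the square
  of \<open>d\<close> is extended to one of the exact vectors in the kernel, then to one of the
  whole kernel. The three layers of new vectors are the bottoms of blocks of size 3, 2 and 1, and
  chosen preimages are the heads.\<close>

lemma jordan_exists:
  assumes fin: "finite B" "carrier M \<subseteq> span B"
  shows "\<exists>xs ys zs. jordan_decomposition M d xs ys zs"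
proof -
  define W2 where "W2 = (\<lambda>v. d (d v)) ` carrier M"
  define W1 where "W1 = kerd \<inter> d ` carrier M"
  have W: "W2 \<subseteq> W1" "W1 \<subseteq> kerd" by (auto simp: W2_def W1_def d_cube intro!: kerd_I)
  have kc: "kerd \<subseteq> carrier M" by auto
  have sub: "subspace W2" "subspace W1" "subspace kerd"
  proof -
    show "subspace W2" unfolding subspace_def W2_def
    proof (intro conjI ballI allI)
      show "0 \<in> (\<lambda>v. d (d v)) ` carrier M" by (rule image_eqI[of _ _ 0]) simp_all
      fix x y assume "x \<in> (\<lambda>v. d (d v)) ` carrier M" "y \<in> (\<lambda>v. d (d v)) ` carrier M"
      then obtain u v where "u \<in> carrier M" "v \<in> carrier M" "x = d (d u)" "y = d (d v)" by blast
      then show "x + y \<in> (\<lambda>v. d (d v)) ` carrier M"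
        by (intro image_eqI[of _ _ "u + v"]) (simp_all add: d_add)
    next
      fix c x assume "x \<in> (\<lambda>v. d (d v)) ` carrier M"
      then obtain u where "u \<in> carrier M" "x = d (d u)" by blast
      then show "scale M c x \<in> (\<lambda>v. d (d v)) ` carrier M"
        by (intro image_eqI[of _ _ "scale M c u"]) (simp_all add: d_scale)
    qed
    show k: "subspace kerd" unfolding subspace_def
      by (intro conjI ballI allI kerd_I) (simp_all add: d_add d_scale)
    have "subspace (d ` carrier M)" unfolding subspace_def
    proof (intro conjI ballI allI)
      show "0 \<in> d ` carrier M" by (rule image_eqI[of _ _ 0]) simp_all
      fix x y assume "x \<in> d ` carrier M" "y \<in> d ` carrier M"
      then obtain u v where "u \<in> carrier M" "v \<in> carrier M" "x = d u" "y = d v" by blast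
      then show "x + y \<in> d ` carrier M" by (intro image_eqI[of _ _ "u + v"]) (simp_all add: d_add)
    next
      fix c x assume "x \<in> d ` carrier M"
      then obtain u where "u \<in> carrier M" "x = d u" by blast
      then show "scale M c x \<in> d ` carrier M" by (intro image_eqI[of _ _ "scale M c u"]) (simp_all add: d_scale)
    qed
    then show "subspace W1" unfolding W1_def by (rule subspace_inter[OF k])
  qed
  obtain B2 where B2: "B2 \<subseteq> W2" "independent B2" "W2 \<subseteq> span B2"
    using maximal_independent_subset[of W2] by blast
  obtain B1 where B1: "B2 \<subseteq> B1" "B1 \<subseteq> W1" "independent B1" "W1 \<subseteq> span B1"
    using maximal_independent_subset_extend[of B2 W1] B2 W by blast
  obtain B0 where B0: "B1 \<subseteq> B0" "B0 \<subseteq> kerd" "independent B0" "kerd \<subseteq> span B0"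
    using maximal_independent_subset_extend[of B1 kerd] B1 W by blast
  have "finite B0" using independent_span_bound[OF fin(1) B0(3)] B0(2) kc fin(2) by blast
  moreover from this have "finite B1" by (rule finite_subset[OF B0(1)])
  moreover from this have "finite B2" by (rule finite_subset[OF B1(1)])
  ultimately have fB: "finite B0" "finite B1" "finite B2" .
  obtain l2 where l2: "set l2 = B2" "distinct l2" using finite_distinct_list[OF fB(3)] by blast
  obtain l1 where l1: "set l1 = B1 - B2" "distinct l1" using fB finite_distinct_list[of "B1 - B2"] by blast
  obtain xs where xs: "set xs = B0 - B1" "distinct xs" using fB finite_distinct_list[of "B0 - B1"] by blast
  have "\<forall>w\<in>W2. \<exists>z\<in>carrier M. d (d z) = w" by (auto simp: W2_def)
  then obtain f2 where f2: "\<And>w. w \<in> W2 \<Longrightarrow> f2 w \<in> carrier M \<and> d (d (f2 w)) = w" by metis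
  have "\<forall>w\<in>W1. \<exists>y\<in>carrier M. d y = w" by (auto simp: W1_def)
  then obtain f1 where f1: "\<And>w. w \<in> W1 \<Longrightarrow> f1 w \<in> carrier M \<and> d (f1 w) = w" by metis
  define zs where "zs = map f2 l2"
  define ys where "ys = map f1 l1"
  have dz: "map d (map d zs) = l2"
    unfolding zs_def using f2 B2(1) l2 by (auto intro!: map_idI)
  have dy: "map d ys = l1"
    unfolding ys_def using f1 B1(2) l1 by (auto intro!: map_idI)
  have cx: "set xs \<subseteq> carrier M" "set ys \<subseteq> carrier M" "set zs \<subseteq> carrier M"
    using xs B0(2) kc f1 f2 B1(2) B2(1) l1 l2 by (auto simp: ys_def zs_def)
  have xk: "d x = 0" if "x \<in> set xs" for x using that xs B0(2) by auto
  have yk: "d (d y) = 0" if "y \<in> set ys" for y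
  proof -
    from that l1 obtain w where w: "w \<in> B1" "y = f1 w" by (auto simp: ys_def)
    then have "d y = w" "w \<in> kerd" using f1 B1(2) W(2) by blast+
    then show ?thesis by simp
  qed
  have len: "length l1 = length ys" "length l2 = length zs" by (simp_all add: ys_def zs_def)
  have dx0: "d (list_sum xs c) = 0" "d (d (list_sum ys c)) = 0" for c
    using xk yk by (simp_all add: list_sum_def d_sum d_scale)
  have eqs: "d (list_sum ys c) = list_sum l1 c" "d (d (list_sum zs c)) = list_sum l2 c" for c
    by (simp_all only: list_sum_map_d[symmetric] dy dz)
  have dis: "distinct (xs @ l1 @ l2)" "set (xs @ l1 @ l2) = B0"
    using xs l1 l2 B0(1) B1(1) by auto
  have dis1: "distinct (l1 @ l2)" "set (l1 @ l2) = B1"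
    using l1 l2 B1(1) by auto
  have ind2: "a i = 0" if "d (d (list_sum zs a)) = 0" "i < length zs" for a i
    using list_sum_independent[of l2 a i] that l2 B2 len eqs by simp
  have ind1: "(\<forall>i<length ys. a i = 0) \<and> (\<forall>i<length zs. b i = 0)"
    if "d (list_sum ys a) + d (d (list_sum zs b)) = 0" for a b
  proof -
    let ?c = "\<lambda>i. if i < length l1 then a i else b (i - length l1)"
    have "list_sum (l1 @ l2) ?c = 0" using that unfolding list_sum_append eqs by (simp add: list_sum_def)
    note 0 = this
    have "independent (set (l1 @ l2))" using B1 dis1(2) by simp
    then have c: "?c i = 0" if "i < length (l1 @ l2)" for i
      by (rule list_sum_independent[OF dis1(1) _ 0 that])
    show ?thesis
    proof (intro conjI allI impI)
      show "a i = 0" if "i < length ys" for i using c[of i] that len by simp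
      show "b i = 0" if "i < length zs" for i using c[of "length l1 + i"] that len by simp
    qed
  qed
  have ind0: "(\<forall>i<length xs. e i = 0) \<and> (\<forall>i<length ys. a i = 0) \<and> (\<forall>i<length zs. b i = 0)"
    if "list_sum xs e + d (list_sum ys a) + d (d (list_sum zs b)) = 0" for e a b
  proof -
    let ?c = "\<lambda>i. if i < length xs then e i else if i < length xs + length l1 then a (i - length xs)
        else b (i - length xs - length l1)"
    have "list_sum (xs @ l1 @ l2) ?c = 0"
      using that unfolding list_sum_append eqs by (simp add: list_sum_def add.assoc)
    note 0 = this
    have "independent (set (xs @ l1 @ l2))" using B0 dis(2) by simp
    then have c: "?c i = 0" if "i < length (xs @ l1 @ l2)" for i
      by (rule list_sum_independent[OF dis(1) _ 0 that])
    show ?thesis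
    proof (intro conjI allI impI)
      show "e i = 0" if "i < length xs" for i using c[of i] that len by simp
      show "a i = 0" if "i < length ys" for i using c[of "length xs + i"] that len by simp
      show "b i = 0" if "i < length zs" for i using c[of "length xs + length l1 + i"] that len by simp
    qed
  qed
  let ?jb = "jordan_basis d xs ys zs"
  have "is_basis M ?jb"
    unfolding is_basis_iff
  proof (intro conjI ballI allI impI)
    show "set ?jb \<subseteq> carrier M" using cx by (auto simp: jordan_basis_def)
  next
    fix v assume v: "v \<in> carrier M"
    \<comment> \<open>Peeling from the top: subtracting heads of size 3 makes \<open>d\<close>
      vanish twice, subtracting heads of size 2 and middles of size 3 makes \<open>d\<close> vanish,
      and what is left lies in the kernel, spanned by the bottoms.\<close>
    have "d (d v) \<in> span (set l2)" using v B2 l2 by (auto simp: W2_def)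
    then obtain e where e: "d (d v) = d (d (list_sum zs e))"
      using list_sum_span[OF l2(2)] eqs by metis
    define v1 where "v1 = v - list_sum zs e"
    have v1: "v1 \<in> carrier M" using v list_sum_closed[OF cx(3)] by (simp add: v1_def)
    have "d (d v1) = 0" by (simp add: v1_def d_diff e)
    then have "d v1 \<in> W1" using v1 by (auto simp: W1_def intro!: kerd_I)
    then have "d v1 \<in> span (set (l1 @ l2))" using B1 dis1 by auto
    then obtain g where "d v1 = list_sum (l1 @ l2) g" by (rule list_sum_span[OF dis1(1)])
    then obtain a b where ab: "d v1 = d (list_sum ys a) + d (d (list_sum zs b))"
      unfolding list_sum_append eqs by blast
    define v2 where "v2 = v1 - list_sum ys a - d (list_sum zs b)"
    have "v2 \<in> kerd"
    proof (rule kerd_I)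
      show "v2 \<in> carrier M" using v1 list_sum_closed[OF cx(2)] list_sum_closed[OF cx(3)] by (simp add: v2_def)
      show "d v2 = 0" by (simp add: v2_def d_diff ab)
    qed
    then have "v2 \<in> span (set (xs @ l1 @ l2))" using B0 dis by auto
    then obtain g where "v2 = list_sum (xs @ l1 @ l2) g" by (rule list_sum_span[OF dis(1)])
    then obtain p q r where pqr: "v2 = list_sum xs p + (d (list_sum ys q) + d (d (list_sum zs r)))"
      unfolding list_sum_append eqs by blast
    let ?n1 = "length xs" and ?n2 = "length ys" and ?n3 = "length zs"
    let ?c = "\<lambda>i. if i < ?n1 then p i else if i < ?n1 + ?n2 then a (i - ?n1)
       else if i < ?n1 + 2 * ?n2 then q (i - ?n1 - ?n2) else if i < ?n1 + 2 * ?n2 + ?n3 then e (i - ?n1 - 2 * ?n2)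
       else if i < ?n1 + 2 * ?n2 + 2 * ?n3 then b (i - ?n1 - 2 * ?n2 - ?n3) else r (i - ?n1 - 2 * ?n2 - 2 * ?n3)"
    have "v = list_sum xs p + list_sum ys a + d (list_sum ys q) + list_sum zs e + d (list_sum zs b)
        + d (d (list_sum zs r))"
      using pqr unfolding v2_def v1_def by (simp add: algebra_simps)
    also have "\<dots> = (\<Sum>i<length ?jb. scale M (?c i) (?jb ! i))"
      unfolding jordan_sum by (simp add: list_sum_def)
    finally show "\<exists>c. v = (\<Sum>i<length ?jb. scale M (c i) (?jb ! i))" by (intro exI[of _ ?c])
  next
    fix c i assume c: "(\<Sum>i<length ?jb. scale M (c i) (?jb ! i)) = 0" and i: "i < length ?jb"
    let ?n1 = "length xs" and ?n2 = "length ys" and ?n3 = "length zs"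
    let ?Z = "list_sum zs (\<lambda>i. c (?n1 + 2 * ?n2 + i))"
    have Zc: "list_sum zs a \<in> carrier M" "list_sum ys a \<in> carrier M" for a using list_sum_closed cx by blast+
    \<comment> \<open>Independence is read off in the same order: apply \<open>d\<close> twice to
      the relation, then once, then not at all, each time discarding the coefficients already known
      to vanish.\<close>
    have "d (d ?Z) = 0"
      using arg_cong[OF c[unfolded jordan_sum], of "\<lambda>v. d (d v)"] Zc by (simp add: d_add dx0 d_cube)
    then have z: "\<forall>i<?n3. c (?n1 + 2 * ?n2 + i) = 0" using ind2 by blast
    then have Z: "?Z = 0" by (intro list_sum_zero) simp
    have "d (list_sum ys (\<lambda>i. c (?n1 + i))) + d (d (list_sum zs (\<lambda>i. c (?n1 + 2 * ?n2 + ?n3 + i)))) = 0"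
      using arg_cong[OF c[unfolded jordan_sum Z], of d] Zc by (simp add: d_add dx0 d_cube)
    from ind1[OF this] have y: "\<forall>i<?n2. c (?n1 + i) = 0" "\<forall>i<?n3. c (?n1 + 2 * ?n2 + ?n3 + i) = 0" by auto
    then have Y: "list_sum ys (\<lambda>i. c (?n1 + i)) = 0" "list_sum zs (\<lambda>i. c (?n1 + 2 * ?n2 + ?n3 + i)) = 0"
      by (auto intro!: list_sum_zero)
    have "list_sum xs c + d (list_sum ys (\<lambda>i. c (?n1 + ?n2 + i))) + d (d (list_sum zs (\<lambda>i. c (?n1 + 2 * ?n2 + 2 * ?n3 + i)))) = 0"
      using c[unfolded jordan_sum Z Y] by simp
    from ind0[OF this] have x: "\<forall>i<?n1. c i = 0" "\<forall>i<?n2. c (?n1 + ?n2 + i) = 0"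
      "\<forall>i<?n3. c (?n1 + 2 * ?n2 + 2 * ?n3 + i) = 0" by auto
    have "i < ?n1 + 2 * ?n2 + 3 * ?n3" using i by (simp add: jordan_basis_def)
    then consider "i < ?n1" | j where "j < ?n2" "i = ?n1 + j" | j where "j < ?n2" "i = ?n1 + ?n2 + j"
      | j where "j < ?n3" "i = ?n1 + 2 * ?n2 + j" | j where "j < ?n3" "i = ?n1 + 2 * ?n2 + ?n3 + j"
      | j where "j < ?n3" "i = ?n1 + 2 * ?n2 + 2 * ?n3 + j"
    proof -
      assume i: "i < ?n1 + 2 * ?n2 + 3 * ?n3"
      have between: "\<exists>j<b. i = a + j" if "a \<le> i" "i < a + b" for a b
        using that by (intro exI[of _ "i - a"]) simp
      consider "i < ?n1" | "?n1 \<le> i" "i < ?n1 + ?n2" | "?n1 + ?n2 \<le> i" "i < ?n1 + ?n2 + ?n2"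
        | "?n1 + 2 * ?n2 \<le> i" "i < ?n1 + 2 * ?n2 + ?n3"
        | "?n1 + 2 * ?n2 + ?n3 \<le> i" "i < ?n1 + 2 * ?n2 + ?n3 + ?n3"
        | "?n1 + 2 * ?n2 + 2 * ?n3 \<le> i" "i < ?n1 + 2 * ?n2 + 2 * ?n3 + ?n3"
        using i by linarith
      then have "i < ?n1 \<or> (\<exists>j<?n2. i = ?n1 + j) \<or> (\<exists>j<?n2. i = ?n1 + ?n2 + j)
         \<or> (\<exists>j<?n3. i = ?n1 + 2 * ?n2 + j) \<or> (\<exists>j<?n3. i = ?n1 + 2 * ?n2 + ?n3 + j)
         \<or> (\<exists>j<?n3. i = ?n1 + 2 * ?n2 + 2 * ?n3 + j)"
        using between by cases blast+
      then show thesis using that by blast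
    qed
    then show "c i = 0" using x y z by cases auto
  qed
  then have "jordan_decomposition M d xs ys zs"
    using xk yk cx d_cube by (auto simp: jordan_decomposition_def)
  then show ?thesis by blast
qed

end


section \<open>Transport along isomorphisms\<close>

locale iso_pair =
  fixes A :: "('k::field, 'a) superalgebra" and M :: "('k, 'b) superalgebra" and \<phi> :: "'a \<Rightarrow> 'b"
    and e :: 'a and \<eta> :: 'b
  assumes iso: "superalgebra_morphism_iso A M \<phi>" and e: "e \<in> carrier A" "\<phi> e = \<eta>"
begin

lemma \<phi>_simps [simp]:
  "x \<in> carrier A \<Longrightarrow> y \<in> carrier A \<Longrightarrow> \<phi> (add A x y) = add M (\<phi> x) (\<phi> y)"
  "x \<in> carrier A \<Longrightarrow> \<phi> (scale A c x) = scale M c (\<phi> x)"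
  "x \<in> carrier A \<Longrightarrow> y \<in> carrier A \<Longrightarrow> \<phi> (bracket A x y) = bracket M (\<phi> x) (\<phi> y)"
  "\<phi> (zero A) = zero M" "zero A \<in> carrier A"
  "x \<in> carrier A \<Longrightarrow> y \<in> carrier A \<Longrightarrow> add A x y \<in> carrier A"
  "x \<in> carrier A \<Longrightarrow> y \<in> carrier A \<Longrightarrow> bracket A x y \<in> carrier A"
  "x \<in> carrier A \<Longrightarrow> scale A c x \<in> carrier A"
  using iso by (auto simp: superalgebra_morphism_iso_def superalgebra_iso_def)

lemma \<phi>_bij: "bij_betw \<phi> (carrier A) (carrier M)"
  using iso by (auto simp: superalgebra_morphism_iso_def superalgebra_iso_def)

lemma \<phi>_inj: "x \<in> carrier A \<Longrightarrow> y \<in> carrier A \<Longrightarrow> \<phi> x = \<phi> y \<longleftrightarrow> x = y"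
  using \<phi>_bij by (auto simp: bij_betw_def inj_on_def)

lemma \<phi>_closed [simp]: "x \<in> carrier A \<Longrightarrow> \<phi> x \<in> carrier M"
  using \<phi>_bij by (auto simp: bij_betw_def)

lemma \<phi>_surj: "y \<in> carrier M \<Longrightarrow> \<exists>x\<in>carrier A. y = \<phi> x"
  using \<phi>_bij by (auto simp: bij_betw_def)

lemma lincomb_transport:
  "set vs \<subseteq> carrier A \<Longrightarrow> lincomb A cs vs \<in> carrier A \<and> \<phi> (lincomb A cs vs) = lincomb M cs (map \<phi> vs)"
  by (induction vs arbitrary: cs) auto

lemma lincomb_iff: "set vs \<subseteq> carrier A \<Longrightarrow> v \<in> carrier A \<Longrightarrow>
    lincomb A cs vs = v \<longleftrightarrow> lincomb M cs (map \<phi> vs) = \<phi> v"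
  using lincomb_transport[of vs cs] \<phi>_inj[of "lincomb A cs vs" v] by auto

lemma basis_transport: "set vs \<subseteq> carrier A \<Longrightarrow> is_basis M (map \<phi> vs) \<longleftrightarrow> is_basis A vs"
  unfolding is_basis_def using lincomb_iff[of vs] \<phi>_surj
  by (auto simp: subset_iff) (metis (no_types, lifting) \<phi>_closed)+

lemma coordinate_transport: "set vs \<subseteq> carrier A \<Longrightarrow> v \<in> carrier A \<Longrightarrow>
    coordinate M (map \<phi> vs) (\<phi> v) k = coordinate A vs v k"
  by (simp add: coordinate_def lincomb_iff)

abbreviation "dA \<equiv> bracket A e"
abbreviation "dM \<equiv> bracket M \<eta>"

lemma dA [simp]: "x \<in> carrier A \<Longrightarrow> dA x \<in> carrier A" "x \<in> carrier A \<Longrightarrow> \<phi> (dA x) = dM (\<phi> x)"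
  using e by simp_all

lemma jordan_basis_transport:
  "set xs \<subseteq> carrier A \<Longrightarrow> set ys \<subseteq> carrier A \<Longrightarrow> set zs \<subseteq> carrier A \<Longrightarrow>
    jordan_basis dM (map \<phi> xs) (map \<phi> ys) (map \<phi> zs) = map \<phi> (jordan_basis dA xs ys zs)"
  by (auto simp: jordan_basis_def subset_iff)

lemma zero_iff: "x \<in> carrier A \<Longrightarrow> \<phi> x = zero M \<longleftrightarrow> x = zero A"
  using \<phi>_inj[of x "zero A"] by simp

lemma jordan_transport:
  assumes "set xs \<subseteq> carrier A" "set ys \<subseteq> carrier A" "set zs \<subseteq> carrier A"
  shows "jordan_decomposition M dM (map \<phi> xs) (map \<phi> ys) (map \<phi> zs) \<longleftrightarrow> jordan_decomposition A dA xs ys zs"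
proof -
  have c: "set (jordan_basis dA xs ys zs) \<subseteq> carrier A" using assms by (auto simp: jordan_basis_def)
  have "dM (\<phi> x) = zero M \<longleftrightarrow> dA x = zero A" if "x \<in> carrier A" for x
    using zero_iff[of "dA x"] that by simp
  then have 1: "(\<forall>x\<in>\<phi> ` set xs. dM x = zero M) \<longleftrightarrow> (\<forall>x\<in>set xs. dA x = zero A)"
    using assms(1) by (auto simp: subset_iff)
  have "dM (dM (\<phi> x)) = zero M \<longleftrightarrow> dA (dA x) = zero A" if "x \<in> carrier A" for x
    using zero_iff[of "dA (dA x)"] that by simp
  then have 2: "(\<forall>x\<in>\<phi> ` set ys. dM (dM x) = zero M) \<longleftrightarrow> (\<forall>x\<in>set ys. dA (dA x) = zero A)"
    using assms(2) by (auto simp: subset_iff)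
  have "dM (dM (dM (\<phi> x))) = zero M \<longleftrightarrow> dA (dA (dA x)) = zero A" if "x \<in> carrier A" for x
    using zero_iff[of "dA (dA (dA x))"] that by simp
  then have 3: "(\<forall>x\<in>\<phi> ` set zs. dM (dM (dM x)) = zero M) \<longleftrightarrow> (\<forall>x\<in>set zs. dA (dA (dA x)) = zero A)"
    using assms(3) by (auto simp: subset_iff)
  show ?thesis
    unfolding jordan_decomposition_def jordan_basis_transport[OF assms] basis_transport[OF c] set_map 1 2 3 ..
qed

text \<open>An equality and not merely an isomorphism: the elements are coefficient functions, and
  the structure constants are invariants of the Jordan basis.\<close>

lemma semisimplification_transport:
  assumes c: "set xs \<subseteq> carrier A" "set ys \<subseteq> carrier A" "set zs \<subseteq> carrier A"
  shows "semisimplification M dM (map \<phi> xs) (map \<phi> ys) (map \<phi> zs) = semisimplification A dA xs ys zs"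
proof -
  let ?N = "length xs + length ys"
  have jb: "set (jordan_basis dA xs ys zs) \<subseteq> carrier A" using c by (auto simp: jordan_basis_def)
  have nth: "(xs @ ys) ! i \<in> carrier A" "(map \<phi> xs @ map \<phi> ys) ! i = \<phi> ((xs @ ys) ! i)" if "i < ?N" for i
    using that c nth_mem[of i "xs @ ys"] nth_map[of i "xs @ ys" \<phi>] by auto
  have hp: "head_parity (map \<phi> xs) = head_parity xs" by (auto simp: head_parity_def fun_eq_iff)
  have sc: "structure_const M dM (map \<phi> xs) (map \<phi> ys) (map \<phi> zs) i j k = structure_const A dA xs ys zs i j k"
    if i: "i < ?N" and j: "j < ?N" for i j k
  proof -
    note n = nth[OF i] nth[OF j]
    have 1: "coordinate M (map \<phi> (jordan_basis dA xs ys zs)) (bracket M (\<phi> ((xs @ ys) ! i)) (\<phi> ((xs @ ys) ! j))) k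
       = coordinate A (jordan_basis dA xs ys zs) (bracket A ((xs @ ys) ! i) ((xs @ ys) ! j)) k"
      using coordinate_transport[OF jb, of "bracket A ((xs @ ys) ! i) ((xs @ ys) ! j)"] n by simp
    have 2: "coordinate M (map \<phi> (jordan_basis dA xs ys zs))
         (add M (scale M (- 1) (bracket M (\<phi> ((xs @ ys) ! i)) (dM (\<phi> ((xs @ ys) ! j)))))
           (bracket M (dM (\<phi> ((xs @ ys) ! i))) (\<phi> ((xs @ ys) ! j)))) k
       = coordinate A (jordan_basis dA xs ys zs)
         (add A (scale A (- 1) (bracket A ((xs @ ys) ! i) (dA ((xs @ ys) ! j))))
           (bracket A (dA ((xs @ ys) ! i)) ((xs @ ys) ! j))) k"
      using coordinate_transport[OF jb, of "add A (scale A (- 1) (bracket A ((xs @ ys) ! i) (dA ((xs @ ys) ! j))))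
           (bracket A (dA ((xs @ ys) ! i)) ((xs @ ys) ! j))"] n by simp
    show ?thesis
      unfolding structure_const_def Let_def hp jordan_basis_transport[OF c] n(2) n(4) 1 2 ..
  qed
  have "(\<Sum>i<?N. \<Sum>j<?N. a i * b j * structure_const M dM (map \<phi> xs) (map \<phi> ys) (map \<phi> zs) i j k)
     = (\<Sum>i<?N. \<Sum>j<?N. a i * b j * structure_const A dA xs ys zs i j k)" for a b :: "nat \<Rightarrow> 'k" and k
    by (intro sum.cong refl) (simp add: sc)
  then show ?thesis by (simp add: semisimplification_def Let_def hp fun_eq_iff)
qed

lemma alpha3_transport:
  assumes part: "part A 0 = carrier A" and M: "alpha3_algebra M dM"
  shows "alpha3_algebra A dA"
  unfolding alpha3_algebra_def
proof (intro conjI ballI allI)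
  show "part A 0 = carrier A" by fact
  from M obtain vs where vs: "is_basis M vs" by (auto simp: alpha3_algebra_def)
  then have vc: "set vs \<subseteq> carrier M" by (auto simp: is_basis_def)
  have "\<forall>v\<in>set vs. \<exists>x\<in>carrier A. v = \<phi> x" using vc \<phi>_surj by blast
  then obtain g where g: "\<And>v. v \<in> set vs \<Longrightarrow> g v \<in> carrier A \<and> \<phi> (g v) = v" by metis
  then have "map \<phi> (map g vs) = vs" by (auto intro: map_idI)
  then show "\<exists>vs. is_basis A vs"
    using basis_transport[of "map g vs"] vs g by (metis (no_types, lifting) image_subsetI list.set_map)
  fix x y c assume x: "x \<in> carrier A"
  show "dA x \<in> carrier A" using x by simp
  have "\<phi> (dA (scale A c x)) = \<phi> (scale A c (dA x))"
    using x M by (simp add: alpha3_algebra_def)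
  then show "dA (scale A c x) = scale A c (dA x)" using x by (intro \<phi>_inj[THEN iffD1]) simp_all
  have "\<phi> (dA (dA (dA x))) = \<phi> (zero A)"
    using x M by (simp add: alpha3_algebra_def)
  then show "dA (dA (dA x)) = zero A" using x by (intro \<phi>_inj[THEN iffD1]) simp_all
  assume y: "y \<in> carrier A"
  have "\<phi> (dA (add A x y)) = \<phi> (add A (dA x) (dA y))"
    using x y M by (simp add: alpha3_algebra_def)
  then show "dA (add A x y) = add A (dA x) (dA y)" using x y by (intro \<phi>_inj[THEN iffD1]) simp_all
  have "\<phi> (dA (bracket A x y)) = \<phi> (add A (bracket A (dA x) y) (bracket A x (dA y)))"
    using x y M by (simp add: alpha3_algebra_def)
  then show "dA (bracket A x y) = add A (bracket A (dA x) y) (bracket A x (dA y))" using x y by (intro \<phi>_inj[THEN iffD1]) simp_all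
qed

lemma jordan_exists_transport:
  assumes "jordan_decomposition M dM xs ys zs"
  shows "\<exists>xs ys zs. jordan_decomposition A dA xs ys zs"
proof -
  have c: "set xs \<subseteq> carrier M" "set ys \<subseteq> carrier M" "set zs \<subseteq> carrier M"
    using assms by (auto simp: jordan_decomposition_def is_basis_def jordan_basis_def)
  have "\<exists>us. set us \<subseteq> carrier A \<and> map \<phi> us = vs" if "set vs \<subseteq> carrier M" for vs
    using that
  proof (induction vs)
    case (Cons v vs)
    then obtain us x where "set us \<subseteq> carrier A" "map \<phi> us = vs" "x \<in> carrier A" "v = \<phi> x"
      using \<phi>_surj[of v] by auto
    then show ?case by (intro exI[of _ "x # us"]) auto
  qed simp
  then obtain xs' ys' zs' where "set xs' \<subseteq> carrier A" "map \<phi> xs' = xs" "set ys' \<subseteq> carrier A" "map \<phi> ys' = ys"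
    "set zs' \<subseteq> carrier A" "map \<phi> zs' = zs" using c by metis
  then show ?thesis using jordan_transport assms by blast
qed

end

lemma superalgebra_iso_sym:
  assumes iso: "superalgebra_morphism_iso A M \<phi>" and pA: "\<And>p. part A p \<subseteq> carrier A"
  shows "superalgebra_isomorphic M A"
proof -
  have I: "superalgebra_iso A M \<phi>" and b: "bij_betw \<phi> (carrier A) (carrier M)"
    using iso by (auto simp: superalgebra_morphism_iso_def superalgebra_iso_def)
  let ?\<psi> = "inv_into (carrier A) \<phi>"
  have r: "\<phi> (?\<psi> y) = y" "?\<psi> y \<in> carrier A" if "y \<in> carrier M" for y
    using that b by (auto simp: bij_betw_def f_inv_into_f inv_into_into)
  have l: "?\<psi> (\<phi> x) = x" if "x \<in> carrier A" for x
    using that b by (auto simp: bij_betw_def inv_into_f_f)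
  have "superalgebra_iso M A ?\<psi>"
    unfolding superalgebra_iso_def
  proof (intro conjI ballI allI)
    show "bij_betw ?\<psi> (carrier M) (carrier A)" using b by (rule bij_betw_inv_into)
    fix x y c assume x: "x \<in> carrier M"
    note X = r[OF x]
    have "\<phi> (scale A c (?\<psi> x)) = scale M c x" "scale A c (?\<psi> x) \<in> carrier A"
      using iso X by (auto simp: superalgebra_morphism_iso_def superalgebra_iso_def)
    then show "?\<psi> (scale M c x) = scale A c (?\<psi> x)" using l by metis
    assume y: "y \<in> carrier M"
    note Y = r[OF y]
    have "\<phi> (add A (?\<psi> x) (?\<psi> y)) = add M x y" "add A (?\<psi> x) (?\<psi> y) \<in> carrier A"
      "\<phi> (bracket A (?\<psi> x) (?\<psi> y)) = bracket M x y" "bracket A (?\<psi> x) (?\<psi> y) \<in> carrier A"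
      using iso X Y by (auto simp: superalgebra_morphism_iso_def superalgebra_iso_def)
    then show "?\<psi> (add M x y) = add A (?\<psi> x) (?\<psi> y)" "?\<psi> (bracket M x y) = bracket A (?\<psi> x) (?\<psi> y)"
      using l by metis+
  next
    fix p
    have "part M p = \<phi> ` part A p" using I by (simp add: superalgebra_iso_def)
    then show "?\<psi> ` part M p = part A p" using l pA[of p] by (force simp: image_image)
  qed
  then show ?thesis by (auto simp: superalgebra_isomorphic_def)
qed

section \<open>Integer vectors of lengths 8 and 4\<close>

text \<open>Tuples on which integer computations can be carried out by rewriting;
  \<open>vec8\<close> and \<open>vec4\<close> connect them with vectors.\<close>

datatype oct = Oct int int int int int int int int

datatype quad = Quad int int int int

fun oct_add :: "oct \<Rightarrow> oct \<Rightarrow> oct" where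
  "oct_add (Oct a1 a2 a3 a4 a5 a6 a7 a8) (Oct b1 b2 b3 b4 b5 b6 b7 b8) =
     Oct (a1 + b1) (a2 + b2) (a3 + b3) (a4 + b4) (a5 + b5) (a6 + b6) (a7 + b7) (a8 + b8)"

fun oct_scale :: "int \<Rightarrow> oct \<Rightarrow> oct" where
  "oct_scale c (Oct a1 a2 a3 a4 a5 a6 a7 a8) =
     Oct (c * a1) (c * a2) (c * a3) (c * a4) (c * a5) (c * a6) (c * a7) (c * a8)"

fun oct_cform :: "oct \<Rightarrow> oct \<Rightarrow> int" where
  "oct_cform (Oct a1 a2 a3 a4 a5 a6 a7 a8) (Oct b1 b2 b3 b4 b5 b6 b7 b8) =
     a1 * (b1 - b3) + a2 * (b2 - b4) + a3 * (b3 - b4) + a4 * (b4 - b5) + a5 * (b5 - b6)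
       + a6 * (b6 - b7) + a7 * (b7 - b8) + a8 * b8"

definition oct_form :: "oct \<Rightarrow> oct \<Rightarrow> int" where
  "oct_form x y = oct_cform x y + oct_cform y x"

definition oct_sign :: "oct \<Rightarrow> oct \<Rightarrow> int" where
  "oct_sign x y = (if oct_cform x y mod 2 = 0 then 1 else - 1)"

fun oct_degree :: "oct \<Rightarrow> quad" where
  "oct_degree (Oct a1 a2 a3 a4 a5 a6 a7 a8) = Quad a3 a4 a5 a7"

fun quad_add :: "quad \<Rightarrow> quad \<Rightarrow> quad" where
  "quad_add (Quad a1 a2 a3 a4) (Quad b1 b2 b3 b4) = Quad (a1 + b1) (a2 + b2) (a3 + b3) (a4 + b4)"

fun quad_scale :: "int \<Rightarrow> quad \<Rightarrow> quad" where
  "quad_scale c (Quad a1 a2 a3 a4) = Quad (c * a1) (c * a2) (c * a3) (c * a4)"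

text \<open>The lowest root of a given degree, if there is one. A root of nonzero degree has inner
  products -1, 0 or 1 with the simple roots 1, 2, 6, 8, so twice its coefficient there differs by at
  most 1 from the sum of the coefficients at the neighbouring nodes 3; 4; 5 and 7; 7. Rounding down
  half of that sum gives the least solution.\<close>

fun quad_base :: "quad \<Rightarrow> oct" where
  "quad_base (Quad a b c e) = Oct (a div 2) (b div 2) a b c ((c + e) div 2) e (e div 2)"

lemma exhaust_8: "x = 1 \<or> x = 2 \<or> x = 3 \<or> x = 4 \<or> x = 5 \<or> x = 6 \<or> x = 7 \<or> x = 8" for x :: 8
proof (induct x)
  case (of_int z)
  then have "0 \<le> z" and "z < 8" by simp_all
  then have "z = 0 \<or> z = 1 \<or> z = 2 \<or> z = 3 \<or> z = 4 \<or> z = 5 \<or> z = 6 \<or> z = 7" by arith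
  then show ?case by auto
qed

lemma forall_8: "(\<forall>i::8. P i) \<longleftrightarrow> P 1 \<and> P 2 \<and> P 3 \<and> P 4 \<and> P 5 \<and> P 6 \<and> P 7 \<and> P 8"
  by (metis exhaust_8)

lemma UNIV_8: "(UNIV :: 8 set) = {1, 2, 3, 4, 5, 6, 7, 8}"
  using exhaust_8 by auto

lemma sum_8: "sum f (UNIV :: 8 set) = f 1 + f 2 + f 3 + f 4 + f 5 + f 6 + f 7 + f 8"
  unfolding UNIV_8 by (simp add: ac_simps)

fun vec8 :: "oct \<Rightarrow> int ^ 8" where
  "vec8 (Oct a1 a2 a3 a4 a5 a6 a7 a8) = (\<chi> i. if i = 1 then a1 else if i = 2 then a2 else if i = 3 then a3
     else if i = 4 then a4 else if i = 5 then a5 else if i = 6 then a6 else if i = 7 then a7 else a8)"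

definition oct_of :: "int ^ 8 \<Rightarrow> oct" where
  "oct_of v = Oct (v $ 1) (v $ 2) (v $ 3) (v $ 4) (v $ 5) (v $ 6) (v $ 7) (v $ 8)"

lemma oct_of_vec8 [simp]: "oct_of (vec8 x) = x"
  by (cases x) (simp add: oct_of_def)

lemma vec8_oct_of [simp]: "vec8 (oct_of v) = v"
  by (simp add: oct_of_def vec_eq_iff forall_8)

lemma vec8_inj [simp]: "vec8 x = vec8 y \<longleftrightarrow> x = y"
  by (metis oct_of_vec8)

lemma vec8_add: "vec8 (oct_add x y) = vec8 x + vec8 y"
  by (cases x; cases y) (simp add: vec_eq_iff)

lemma vec8_scale: "vec8 (oct_scale c x) $ i = c * vec8 x $ i"
  by (cases x) simp

lemma vec8_uminus: "vec8 (oct_scale (- 1) x) = - vec8 x"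
  by (simp add: vec_eq_iff vec8_scale)

lemma vec8_axis:
  "vec8 (Oct 1 0 0 0 0 0 0 0) = axis 1 1" "vec8 (Oct 0 1 0 0 0 0 0 0) = axis 2 1"
  "vec8 (Oct 0 0 1 0 0 0 0 0) = axis 3 1" "vec8 (Oct 0 0 0 1 0 0 0 0) = axis 4 1"
  "vec8 (Oct 0 0 0 0 1 0 0 0) = axis 5 1" "vec8 (Oct 0 0 0 0 0 1 0 0) = axis 6 1"
  "vec8 (Oct 0 0 0 0 0 0 1 0) = axis 7 1" "vec8 (Oct 0 0 0 0 0 0 0 1) = axis 8 1"
  by (simp_all add: vec_eq_iff forall_8 axis_def)

text \<open>Each edge of the Dynkin diagram is entered in one direction only. This orientation
  determines the signs of the root algebra.\<close>

definition e8_half :: "int ^ 8 ^ 8" where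
  "e8_half = (\<chi> i j. if i = j then 1
     else if (i, j) \<in> {(1, 3), (3, 4), (2, 4), (4, 5), (5, 6), (6, 7), (7, 8)} then - 1 else 0)"

lemma e8_half_sum: "(\<Sum>i\<in>UNIV. \<Sum>j\<in>UNIV. vec8 x $ i * vec8 y $ j * e8_half $ i $ j) = oct_cform x y"
  by (cases x; cases y) (simp add: sum_8 e8_half_def, simp add: algebra_simps)

lemma vector_8:
  fixes a1 a2 a3 a4 a5 a6 a7 a8 :: "'a::zero"
  defines "v \<equiv> vector [a1, a2, a3, a4, a5, a6, a7, a8] :: 'a ^ 8"
  shows "v $ 1 = a1" "v $ 2 = a2" "v $ 3 = a3" "v $ 4 = a4" "v $ 5 = a5" "v $ 6 = a6" "v $ 7 = a7" "v $ 8 = a8"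
  by (simp_all add: v_def vector_def)

lemma e8_matrix_half: "e8_matrix $ i $ j = e8_half $ i $ j + e8_half $ j $ i"
proof -
  have "\<forall>i j. e8_matrix $ i $ j = e8_half $ i $ j + e8_half $ j $ i"
    unfolding forall_8 by (simp add: e8_matrix_def e8_half_def vector_8)
  then show ?thesis by blast
qed

text \<open>Completing the squares along the three arms of the Dynkin diagram.\<close>

lemma oct_cform_squares:
  "120 * oct_cform (Oct a1 a2 a3 a4 a5 a6 a7 a8) (Oct a1 a2 a3 a4 a5 a6 a7 a8)
     = 30 * (2 * a1 - a3)\<^sup>2 + 10 * (3 * a3 - 2 * a4)\<^sup>2 + 30 * (2 * a2 - a4)\<^sup>2 + 30 * (2 * a8 - a7)\<^sup>2
       + 10 * (3 * a7 - 2 * a6)\<^sup>2 + 5 * (4 * a6 - 3 * a5)\<^sup>2 + 3 * (5 * a5 - 4 * a4)\<^sup>2 + 2 * a4\<^sup>2"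
  by (simp add: power2_eq_square algebra_simps)

lemma abs_le_of_square_le: "(n::int)\<^sup>2 \<le> 63 \<Longrightarrow> \<bar>n\<bar> \<le> 7"
  using abs_le_square_iff[of 8 n] by (cases "\<bar>n\<bar> \<le> 7") auto

text \<open>The weighted squares sum up to at most 120 with weights at least 2, so each square is at
  most 60, below 64, and each linear form is bounded by 7. The forms with two variables have the
  shape m x - (m - 1) y, so a bound 7 for \<open>y\<close> gives the bound 7 for \<open>x\<close>;
  starting from \<open>a4\<close>, it spreads along the diagram.\<close>

lemma oct_cform_bounds:
  assumes "oct_cform (Oct a1 a2 a3 a4 a5 a6 a7 a8) (Oct a1 a2 a3 a4 a5 a6 a7 a8) \<le> 1"
  shows "{a1, a2, a3, a4, a5, a6, a7, a8} \<subseteq> {- 7..7}"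
proof -
  have key: "p1 \<le> 63 \<and> p2 \<le> 63 \<and> p3 \<le> 63 \<and> p4 \<le> 63 \<and> p5 \<le> 63 \<and> p6 \<le> 63 \<and> p7 \<le> 63 \<and> p8 \<le> 63"
    if "30 * p1 + 10 * p2 + 30 * p3 + 30 * p4 + 10 * p5 + 5 * p6 + 3 * p7 + 2 * p8 \<le> 120"
      "0 \<le> p1" "0 \<le> p2" "0 \<le> p3" "0 \<le> p4" "0 \<le> p5" "0 \<le> p6" "0 \<le> p7" "0 \<le> p8"
    for p1 p2 p3 p4 p5 p6 p7 p8 :: int
    using that by linarith
  have s: "30 * (2 * a1 - a3)\<^sup>2 + 10 * (3 * a3 - 2 * a4)\<^sup>2 + 30 * (2 * a2 - a4)\<^sup>2 + 30 * (2 * a8 - a7)\<^sup>2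
       + 10 * (3 * a7 - 2 * a6)\<^sup>2 + 5 * (4 * a6 - 3 * a5)\<^sup>2 + 3 * (5 * a5 - 4 * a4)\<^sup>2 + 2 * a4\<^sup>2 \<le> 120"
    unfolding oct_cform_squares[symmetric] using assms by simp
  have "(2 * a1 - a3)\<^sup>2 \<le> 63 \<and> (3 * a3 - 2 * a4)\<^sup>2 \<le> 63 \<and> (2 * a2 - a4)\<^sup>2 \<le> 63 \<and> (2 * a8 - a7)\<^sup>2 \<le> 63
      \<and> (3 * a7 - 2 * a6)\<^sup>2 \<le> 63 \<and> (4 * a6 - 3 * a5)\<^sup>2 \<le> 63 \<and> (5 * a5 - 4 * a4)\<^sup>2 \<le> 63 \<and> a4\<^sup>2 \<le> 63"
    by (rule key[OF s]) (rule zero_le_power2)+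
  then have b: "\<bar>a4\<bar> \<le> 7" "\<bar>5 * a5 - 4 * a4\<bar> \<le> 7" "\<bar>4 * a6 - 3 * a5\<bar> \<le> 7" "\<bar>3 * a7 - 2 * a6\<bar> \<le> 7"
    "\<bar>2 * a8 - a7\<bar> \<le> 7" "\<bar>2 * a2 - a4\<bar> \<le> 7" "\<bar>3 * a3 - 2 * a4\<bar> \<le> 7" "\<bar>2 * a1 - a3\<bar> \<le> 7"
    by (auto intro: abs_le_of_square_le)
  have "- 7 \<le> a4 \<and> a4 \<le> 7" using b(1) by linarith
  moreover from this have "- 7 \<le> a5 \<and> a5 \<le> 7" using b(2) by linarith
  moreover from this have "- 7 \<le> a6 \<and> a6 \<le> 7" using b(3) by linarith
  moreover from this have "- 7 \<le> a7 \<and> a7 \<le> 7" using b(4) by linarith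
  moreover from this have "- 7 \<le> a8 \<and> a8 \<le> 7" using b(5) by linarith
  moreover have "- 7 \<le> a2 \<and> a2 \<le> 7" using b(1,6) by linarith
  moreover have "- 7 \<le> a3 \<and> a3 \<le> 7" using b(1,7) by linarith
  moreover from this have "- 7 \<le> a1 \<and> a1 \<le> 7" using b(8) by linarith
  ultimately show ?thesis by simp
qed

lemma oct_cform_pos:
  assumes "oct_cform x x \<le> 0"
  shows "vec8 x = 0"
proof (cases x)
  case (Oct a1 a2 a3 a4 a5 a6 a7 a8)
  have key: "p1 = 0 \<and> p2 = 0 \<and> p3 = 0 \<and> p4 = 0 \<and> p5 = 0 \<and> p6 = 0 \<and> p7 = 0 \<and> p8 = 0"
    if "30 * p1 + 10 * p2 + 30 * p3 + 30 * p4 + 10 * p5 + 5 * p6 + 3 * p7 + 2 * p8 \<le> 0"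
      "0 \<le> p1" "0 \<le> p2" "0 \<le> p3" "0 \<le> p4" "0 \<le> p5" "0 \<le> p6" "0 \<le> p7" "0 \<le> p8"
    for p1 p2 p3 p4 p5 p6 p7 p8 :: int
    using that by linarith
  have s: "30 * (2 * a1 - a3)\<^sup>2 + 10 * (3 * a3 - 2 * a4)\<^sup>2 + 30 * (2 * a2 - a4)\<^sup>2 + 30 * (2 * a8 - a7)\<^sup>2
       + 10 * (3 * a7 - 2 * a6)\<^sup>2 + 5 * (4 * a6 - 3 * a5)\<^sup>2 + 3 * (5 * a5 - 4 * a4)\<^sup>2 + 2 * a4\<^sup>2 \<le> 0"
    unfolding oct_cform_squares[symmetric] using assms Oct by simp
  have "(2 * a1 - a3)\<^sup>2 = 0 \<and> (3 * a3 - 2 * a4)\<^sup>2 = 0 \<and> (2 * a2 - a4)\<^sup>2 = 0 \<and> (2 * a8 - a7)\<^sup>2 = 0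
      \<and> (3 * a7 - 2 * a6)\<^sup>2 = 0 \<and> (4 * a6 - 3 * a5)\<^sup>2 = 0 \<and> (5 * a5 - 4 * a4)\<^sup>2 = 0 \<and> a4\<^sup>2 = 0"
    by (rule key[OF s]) (rule zero_le_power2)+
  then show ?thesis by (simp add: Oct vec_eq_iff)
qed

lemma e8_simply_laced:
  assumes "realization sc e8_matrix h \<alpha>"
  shows "simply_laced sc e8_matrix h \<alpha> e8_half"
proof -
  interpret realization sc e8_matrix h \<alpha> by fact
  show ?thesis
  proof
    show "e8_matrix $ i $ j = e8_half $ i $ j + e8_half $ j $ i" for i j by (rule e8_matrix_half)
    show "e8_matrix $ i $ i = 2" for i by (simp add: e8_matrix_half e8_half_def)
    show "e8_matrix $ i $ j \<le> 0" if "i \<noteq> j" for i j using that by (simp add: e8_matrix_half e8_half_def)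
    show "0 < (\<Sum>i\<in>UNIV. \<Sum>j\<in>UNIV. x $ i * x $ j * e8_half $ i $ j)" if "x \<noteq> 0" for x
      using e8_half_sum[of "oct_of x" "oct_of x"] oct_cform_pos[of "oct_of x"] that by force
    show "finite {g. (\<Sum>i\<in>UNIV. \<Sum>j\<in>UNIV. g $ i * g $ j * e8_half $ i $ j) = 1}"
    proof (rule finite_subset)
      let ?I = "{- 7..7 :: int}"
      let ?f = "\<lambda>(a1, a2, a3, a4, a5, a6, a7, a8). vec8 (Oct a1 a2 a3 a4 a5 a6 a7 a8)"
      show "{g. (\<Sum>i\<in>UNIV. \<Sum>j\<in>UNIV. g $ i * g $ j * e8_half $ i $ j) = 1}
          \<subseteq> ?f ` (?I \<times> ?I \<times> ?I \<times> ?I \<times> ?I \<times> ?I \<times> ?I \<times> ?I)"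
      proof
        fix g assume "g \<in> {g. (\<Sum>i\<in>UNIV. \<Sum>j\<in>UNIV. g $ i * g $ j * e8_half $ i $ j) = 1}"
        then have 1: "oct_cform (oct_of g) (oct_of g) \<le> 1" using e8_half_sum[of "oct_of g" "oct_of g"] by simp
        have "{g $ 1, g $ 2, g $ 3, g $ 4, g $ 5, g $ 6, g $ 7, g $ 8} \<subseteq> ?I"
          by (rule oct_cform_bounds) (use 1 in \<open>simp only: oct_of_def\<close>)
        moreover have "g = ?f (g $ 1, g $ 2, g $ 3, g $ 4, g $ 5, g $ 6, g $ 7, g $ 8)"
          using vec8_oct_of[of g] by (simp add: oct_of_def)
        ultimately show "g \<in> ?f ` (?I \<times> ?I \<times> ?I \<times> ?I \<times> ?I \<times> ?I \<times> ?I \<times> ?I)" by blast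
      qed
    qed (intro finite_imageI finite_cartesian_product finite_atLeastAtMost_int)
  qed
qed

section \<open>The nilpotent element and its adjoint action\<close>

locale e8_realization = realization sc e8_matrix h \<alpha>
  for sc :: "'k::field \<Rightarrow> 'v::ab_group_add \<Rightarrow> 'v" and h :: "8 \<Rightarrow> 'v" and \<alpha> :: "8 \<Rightarrow> 'v \<Rightarrow> 'k" +
  assumes char_three: "CHAR('k) = 3"
begin

sublocale simply_laced sc e8_matrix h \<alpha> e8_half
  by (rule e8_simply_laced) (rule realization_axioms)

interpretation smult: vector_space smult
  by (rule smult_vector_space)

lemma cform_vec8: "cform (vec8 x) (vec8 y) = oct_cform x y"
  unfolding cform_def by (rule e8_half_sum)

lemma form_vec8: "form (vec8 x) (vec8 y) = oct_form x y"
  by (simp add: form_def oct_form_def cform_vec8)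

lemma cocycle_vec8: "cocycle (vec8 x) (vec8 y) = of_int (oct_sign x y)"
  by (simp add: cocycle_def oct_sign_def cform_vec8 even_iff_mod_2_eq_zero)

lemma root_vec8: "vec8 x \<in> roots \<longleftrightarrow> oct_cform x x = 1"
  by (simp add: roots_cform cform_vec8)

abbreviation nil_nodes :: "8 set" where
  "nil_nodes \<equiv> {1, 2, 6, 8}"

lemma nil_orthogonal: "i \<in> nil_nodes \<Longrightarrow> j \<in> nil_nodes \<Longrightarrow> i \<noteq> j \<Longrightarrow> form (simple i) (simple j) = 0"
proof -
  have "form (simple i) (simple j) = e8_half $ i $ j + e8_half $ j $ i"
    by (simp only: form_simple) (rule e8_matrix_half)
  then show "i \<in> nil_nodes \<Longrightarrow> j \<in> nil_nodes \<Longrightarrow> i \<noteq> j \<Longrightarrow> form (simple i) (simple j) = 0"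
    unfolding insert_iff empty_iff by (elim disjE) (simp_all only: e8_half_def, simp_all)
qed

definition nilp :: "'v \<times> (int ^ 8 \<Rightarrow> 'k)" where
  "nilp = rvec (simple 1) + rvec (simple 2) + rvec (simple 6) + rvec (simple 8)"

definition dd :: "'v \<times> (int ^ 8 \<Rightarrow> 'k) \<Rightarrow> 'v \<times> (int ^ 8 \<Rightarrow> 'k)" where
  "dd = root_bracket nilp"

definition cubic_nil :: "(('v \<times> (int ^ 8 \<Rightarrow> 'k)) \<Rightarrow> ('v \<times> (int ^ 8 \<Rightarrow> 'k))) \<Rightarrow> bool" where
  "cubic_nil P \<longleftrightarrow> (\<forall>x\<in>carrier root_algebra. P x \<in> carrier root_algebra \<and> P (P (P x)) = 0)
     \<and> (\<forall>x y. P (x + y) = P x + P y)"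

lemma char3_triple: "x + x + x = (0 :: 'v \<times> (int ^ 8 \<Rightarrow> 'k))"
proof -
  have "x + x + x = smult (1 + 1 + 1) x" by (simp only: smult.scale_left_distrib smult.scale_one)
  also have "1 + 1 + 1 = (0 :: 'k)" using of_nat_CHAR[where 'a = 'k] unfolding char_three by simp
  finally show ?thesis by simp
qed

text \<open>For commuting operators the mixed terms of the cube of a sum have coefficient 3.\<close>

lemma cubic_nil_add:
  assumes P: "cubic_nil P" and Q: "cubic_nil Q"
    and comm: "\<And>x. x \<in> carrier root_algebra \<Longrightarrow> P (Q x) = Q (P x)"
  shows "cubic_nil (\<lambda>x. P x + Q x)"
proof -
  have c: "P x \<in> carrier root_algebra" "Q x \<in> carrier root_algebra" "P (P (P x)) = 0" "Q (Q (Q x)) = 0"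
    if "x \<in> carrier root_algebra" for x using that P Q by (auto simp: cubic_nil_def)
  have lin: "P (x + y) = P x + P y" "Q (x + y) = Q x + Q y" for x y using P Q unfolding cubic_nil_def by blast+
  have "P (P (P x + Q x) + Q (P x + Q x)) + Q (P (P x + Q x) + Q (P x + Q x)) = 0"
    if x: "x \<in> carrier root_algebra" for x
  proof -
    let ?a = "P (P (Q x))" and ?b = "P (Q (Q x))"
    have "P (P (P x + Q x) + Q (P x + Q x)) + Q (P (P x + Q x) + Q (P x + Q x))
        = (?a + ?a + ?a) + (?b + ?b + ?b)"
      using x by (simp add: lin c comm[symmetric] add_ac)
    then show ?thesis by (simp only: char3_triple) simp
  qed
  then show ?thesis unfolding cubic_nil_def using c by (auto simp: lin)
qed

text \<open>The root string through a root in the direction of a simple root has at most two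
  members, except for the string from the negative simple root through the Cartan subalgebra to the
  simple root, which has three steps to zero.\<close>

lemma ad_simple_cube: "cubic_nil (root_bracket (rvec (simple i)))"
  unfolding cubic_nil_def
proof (intro conjI ballI allI)
  fix x assume x: "x \<in> carrier root_algebra"
  show "root_bracket (rvec (simple i)) x \<in> carrier root_algebra" using L.bracket_closed x by simp
  let ?D = "root_bracket (rvec (simple i))"
  show "?D (?D (?D x)) = 0"
    using x
  proof (induction rule: root_algebra_induct)
    case (cartan v)
    have "?D (rvec (simple i)) = 0" by (simp add: bracket_rr_zero root_self)
    then show ?case by (simp add: root_bracket_bilinear)
  next
    case (root g)
    have D0: "?D (rvec (simple i)) = 0" by (simp add: bracket_rr_zero root_self)
    consider "form (simple i) g = - 1" | "g = - simple i" | "?D (rvec g) = 0"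
      using bracket_rr[OF simple_root root] by fastforce
    then show ?case
    proof cases
      case 1
      then have r: "simple i + g \<in> roots" using add_root_iff root by simp
      have "form (simple i) (simple i + g) = 1" using 1 by (simp add: form_bilinear root_self)
      then have "?D (rvec (simple i + g)) = 0" using r by (simp add: bracket_rr_zero)
      then show ?thesis using 1 root by (simp add: bracket_rr_add root_bracket_bilinear)
    next
      case 2
      then show ?thesis using D0 by (simp add: bracket_rr_opposite bracket_rc root_bracket_bilinear L.bracket_minus)
    next
      case 3 then show ?thesis by simp
    qed
  next
    case (add x y) then show ?case by (simp add: root_bracket_bilinear)
  next
    case (scale c x) then show ?case by (simp add: root_bracket_bilinear)
  qed
qed (simp add: root_bracket_bilinear)

lemma ad_simple_commute:
  assumes "i \<in> nil_nodes" "j \<in> nil_nodes" "x \<in> carrier root_algebra"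
  shows "root_bracket (rvec (simple i)) (root_bracket (rvec (simple j)) x)
       = root_bracket (rvec (simple j)) (root_bracket (rvec (simple i)) x)"
proof (cases "i = j")
  case False
  interpret lie_superalgebra root_algebra by (rule lie_root_algebra)
  have "root_bracket (rvec (simple i)) (rvec (simple j)) = 0"
    using nil_orthogonal[OF assms(1,2) False] by (simp add: bracket_rr_zero)
  then show ?thesis
    using jacobi[of "rvec (simple i)" 0 "rvec (simple j)" 0 x 0] assms by (simp add: koszul_sign_def)
qed simp

sublocale d: alpha3_lie root_algebra dd
proof -
  interpret lie_superalgebra root_algebra by (rule lie_root_algebra)
  let ?D = "\<lambda>i x. root_bracket (rvec (simple i)) x"
  have "cubic_nil (\<lambda>x. ?D 1 x + ?D 2 x)"
    by (intro cubic_nil_add ad_simple_cube ad_simple_commute) auto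
  then have "cubic_nil (\<lambda>x. (?D 1 x + ?D 2 x) + ?D 6 x)"
    by (rule cubic_nil_add) (auto intro!: ad_simple_cube simp: root_bracket_bilinear ad_simple_commute)
  then have "cubic_nil (\<lambda>x. ((?D 1 x + ?D 2 x) + ?D 6 x) + ?D 8 x)"
    by (rule cubic_nil_add) (auto intro!: ad_simple_cube simp: root_bracket_bilinear ad_simple_commute)
  moreover have "dd = (\<lambda>x. ((?D 1 x + ?D 2 x) + ?D 6 x) + ?D 8 x)"
    by (rule ext) (simp add: dd_def nilp_def root_bracket_bilinear)
  ultimately have cube: "cubic_nil dd" by simp
  have n: "nilp \<in> carrier root_algebra" by (simp add: nilp_def)
  show "alpha3_lie root_algebra dd"
  proof
    show "CHAR('k) = 3" by (rule char_three)
    show "part root_algebra 0 = carrier root_algebra" by simp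
    show "dd (x + y) = dd x + dd y" for x y by (simp add: dd_def root_bracket_bilinear)
    show "dd (scale root_algebra c x) = scale root_algebra c (dd x)" for c x by (simp add: dd_def root_bracket_bilinear)
    show "dd x \<in> carrier root_algebra" if "x \<in> carrier root_algebra" for x
      using that n L.bracket_closed by (simp add: dd_def)
    show "dd (bracket root_algebra x y) = bracket root_algebra (dd x) y + bracket root_algebra x (dd y)"
      if "x \<in> carrier root_algebra" "y \<in> carrier root_algebra" for x y
      using jacobi[of nilp 0 x 0 y 0] that n by (simp add: dd_def koszul_sign_def algebra_simps)
    show "dd (dd (dd x)) = 0" if "x \<in> carrier root_algebra" for x
      using cube that by (simp add: cubic_nil_def)
  qed
qed

end

section \<open>The grading by the quotient of the root lattice\<close>

definition qdeg :: "int ^ 8 \<Rightarrow> int ^ 4" where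
  "qdeg g = (\<chi> j. if j = 1 then g $ 3 else if j = 2 then g $ 4 else if j = 3 then g $ 5 else g $ 7)"

lemma qdeg_simps [simp]: "qdeg (x + y) = qdeg x + qdeg y" "qdeg (x - y) = qdeg x - qdeg y" "qdeg (- x) = - qdeg x"
    "qdeg 0 = 0"
  by (simp_all add: qdeg_def vec_eq_iff)

lemma qdeg_nil: "l \<in> {1, 2, 6, 8} \<Longrightarrow> qdeg (axis l 1) = 0"
  by (auto simp: qdeg_def vec_eq_iff axis_def)

context e8_realization
begin

interpretation smult: vector_space smult
  by (rule smult_vector_space)

definition gr :: "int ^ 4 \<Rightarrow> ('v \<times> (int ^ 8 \<Rightarrow> 'k)) set" where
  "gr q = {x \<in> carrier root_algebra. (q \<noteq> 0 \<longrightarrow> fst x = 0) \<and> (\<forall>g. qdeg g \<noteq> q \<longrightarrow> snd x g = 0)}"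

text \<open>The projection onto a degree commutes with \<open>dd\<close>, so that exactness and
  membership in kernels can be tested degree by degree.\<close>

definition pr :: "int ^ 4 \<Rightarrow> ('v \<times> (int ^ 8 \<Rightarrow> 'k)) \<Rightarrow> ('v \<times> (int ^ 8 \<Rightarrow> 'k))" where
  "pr q x = (if q = 0 then fst x else 0, \<lambda>g. if qdeg g = q then snd x g else 0)"

lemma gr_carrier: "x \<in> gr q \<Longrightarrow> x \<in> carrier root_algebra"
  by (simp add: gr_def)

lemma gr_subspace: "smult.subspace (gr q)"
  by (auto simp: smult.subspace_def gr_def in_carrier smult_def)

lemma gr_closed: "0 \<in> gr q" "x \<in> gr q \<Longrightarrow> y \<in> gr q \<Longrightarrow> x + y \<in> gr q" "x \<in> gr q \<Longrightarrow> smult c x \<in> gr q"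
    "x \<in> gr q \<Longrightarrow> y \<in> gr q \<Longrightarrow> x - y \<in> gr q" "x \<in> gr q \<Longrightarrow> - x \<in> gr q"
  using gr_subspace[of q]
  by (auto intro: smult.subspace_0 smult.subspace_add smult.subspace_scale smult.subspace_diff smult.subspace_neg)

lemma gr_sum: "(\<And>i. i \<in> I \<Longrightarrow> f i \<in> gr q) \<Longrightarrow> (\<Sum>i\<in>I. f i) \<in> gr q"
  by (rule smult.subspace_sum[OF gr_subspace])

lemma cvec_gr: "cvec v \<in> gr 0"
  by (simp add: gr_def in_carrier)

lemma rvec_gr: "g \<in> roots \<Longrightarrow> rvec g \<in> gr (qdeg g)"
  by (auto simp: gr_def in_carrier)

lemma pr_gr: "x \<in> carrier root_algebra \<Longrightarrow> pr q x \<in> gr q"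
  by (auto simp: gr_def pr_def in_carrier)

lemma pr_id: "x \<in> gr q \<Longrightarrow> pr q x = x"
  by (auto simp: gr_def pr_def prod_eq_iff fun_eq_iff)

lemma pr_other: "x \<in> gr p \<Longrightarrow> p \<noteq> q \<Longrightarrow> pr q x = 0"
  by (auto simp: gr_def pr_def prod_eq_iff fun_eq_iff)

lemma pr_linear: "pr q (x + y) = pr q x + pr q y" "pr q (smult c x) = smult c (pr q x)" "pr q 0 = 0"
  by (auto simp: pr_def smult_def prod_eq_iff fun_eq_iff)

lemma pr_sum: "pr q (\<Sum>i\<in>I. f i) = (\<Sum>i\<in>I. pr q (f i))"
  by (induction I rule: infinite_finite_induct) (auto simp: pr_linear)

lemma gr_bracket:
  assumes x: "x \<in> gr p" and y: "y \<in> gr q"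
  shows "root_bracket x y \<in> gr (p + q)"
proof -
  have "root_bracket x y \<in> carrier root_algebra"
    using L.bracket_closed[OF gr_carrier[OF x] gr_carrier[OF y]] by simp
  moreover have "fst (root_bracket x y) = 0" if "p + q \<noteq> 0"
  proof -
    have "snd x g * snd y (- g) = 0" for g
    proof (rule ccontr)
      assume "\<not> ?thesis"
      then have "qdeg g = p" "qdeg (- g) = q" using x y by (auto simp: gr_def simp del: qdeg_simps)
      then have "p + q = 0" by auto
      then show False using that by simp
    qed
    then have "(\<Sum>g\<in>roots. sc (snd x g * snd y (- g)) (coroot g)) = 0"
      by (intro sum.neutral ballI) (simp only: scale_zero_left)
    then show ?thesis by (simp add: root_bracket_def)
  qed
  moreover have "qdeg h = p + q" if "snd (root_bracket x y) h \<noteq> 0" for h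
  proof (rule ccontr)
    assume n: "qdeg h \<noteq> p + q"
    have 1: "weight h (fst x) * snd y h = 0"
      using x y n by (cases "p = 0"; cases "snd y h = 0") (auto simp: gr_def)
    have 2: "weight h (fst y) * snd x h = 0"
      using x y n by (cases "q = 0"; cases "snd x h = 0") (auto simp: gr_def)
    have 3: "snd x g * snd y (h - g) = 0" for g
    proof (rule ccontr)
      assume "\<not> ?thesis"
      then have "qdeg g = p" "qdeg (h - g) = q" using x y by (auto simp: gr_def simp del: qdeg_simps)
      then have "qdeg h = p + q" by (simp add: diff_eq_eq add.commute)
      then show False using n by simp
    qed
    have "(\<Sum>g\<in>roots. if h - g \<in> roots then cocycle g (h - g) * snd x g * snd y (h - g) else 0) = 0"
      by (rule sum.neutral) (use 3 in \<open>auto simp: mult.assoc\<close>)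
    then have "snd (root_bracket x y) h = 0"
      unfolding root_bracket_def using 1 2 by auto
    then show False using that by simp
  qed
  ultimately show ?thesis unfolding gr_def by blast
qed

lemma nilp_gr: "nilp \<in> gr 0"
  unfolding nilp_def using rvec_gr[of "simple 1"] rvec_gr[of "simple 2"] rvec_gr[of "simple 6"] rvec_gr[of "simple 8"]
  by (simp add: qdeg_nil gr_closed)

lemma dd_gr: "x \<in> gr q \<Longrightarrow> dd x \<in> gr q"
  using gr_bracket[OF nilp_gr, of x q] by (simp add: dd_def)

lemma dd_linear: "dd (x + y) = dd x + dd y" "dd (smult c x) = smult c (dd x)" "dd 0 = 0" "dd (x - y) = dd x - dd y"
    "dd (- x) = - dd x"
  using d.d_add d.d_scale d.d_zero d.d_diff d.d_minus by auto

lemma pr_dd: "x \<in> carrier root_algebra \<Longrightarrow> pr q (dd x) = dd (pr q x)"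
proof (induction rule: root_algebra_induct)
  case (cartan v)
  show ?case using cvec_gr[of v] dd_gr[OF cvec_gr, of v]
    by (cases "q = 0") (auto simp: pr_id pr_other dd_linear)
next
  case (root g)
  show ?case using rvec_gr[OF root] dd_gr[OF rvec_gr[OF root]]
    by (cases "qdeg g = q") (auto simp: pr_id pr_other dd_linear)
qed (auto simp: pr_linear dd_linear)

lemma dd_snd:
  assumes x: "fst x = 0" and r: "r \<in> roots"
  shows "snd (dd x) r = (\<Sum>l\<in>nil_nodes. if r - simple l \<in> roots then cocycle (simple l) (r - simple l) * snd x (r - simple l) else 0)"
proof -
  let ?t = "\<lambda>g. if r - g \<in> roots then cocycle g (r - g) * snd x (r - g) else 0"
  have one: "snd (root_bracket (rvec (simple l)) x) r = ?t (simple l)" for l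
  proof -
    have "(\<Sum>g\<in>roots. if r - g \<in> roots then cocycle g (r - g) * snd (rvec (simple l)) g * snd x (r - g) else 0)
       = (\<Sum>g\<in>roots. if g = simple l then ?t (simple l) else 0)"
      by (rule sum.cong) auto
    then show ?thesis using r x finite_roots by (simp add: root_bracket_def)
  qed
  have "snd (dd x) r = ?t (simple 1) + ?t (simple 2) + ?t (simple 6) + ?t (simple 8)"
    unfolding dd_def nilp_def root_bracket_bilinear(1) one[symmetric] by simp
  then show ?thesis by (simp add: add.assoc)
qed

end

text \<open>
  The roots of a given nonzero degree are obtained from the lowest one, \<open>g\<close>, by adding sums of
  distinct simple roots with indices in \<open>K\<close>, so the corresponding graded piece is a tensor
  power of \<open>J\<^sub>2\<close>, realized as a space of functions on the subsets of \<open>K\<close>.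
\<close>

locale e8_fibre = e8_realization sc h \<alpha>
  for sc :: "'k::field \<Rightarrow> 'v::ab_group_add \<Rightarrow> 'v" and h :: "8 \<Rightarrow> 'v" and \<alpha> :: "8 \<Rightarrow> 'v \<Rightarrow> 'k" +
  fixes g :: "int ^ 8" and K :: "8 set" and q :: "int ^ 4"
  assumes root: "g \<in> roots" and K: "K \<subseteq> nil_nodes"
    and form_K: "l \<in> K \<Longrightarrow> form (simple l) g = - 1"
    and form_nil: "l \<in> nil_nodes \<Longrightarrow> l \<notin> K \<Longrightarrow> form (simple l) g = 0"
    and deg: "qdeg g = q" and deg_nonzero: "q \<noteq> 0"
    and complete: "o' \<in> roots \<Longrightarrow> qdeg o' = q \<Longrightarrow> \<exists>T\<subseteq>K. o' = g + (\<Sum>l\<in>T. simple l)"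
begin

interpretation smult: vector_space smult
  by (rule smult_vector_space)

definition rt :: "8 set \<Rightarrow> int ^ 8" where
  "rt T = g + (\<Sum>l\<in>T. simple l)"

text \<open>The signs that turn the action of \<open>dd\<close> into the sign-free operator
  \<open>del\<close> on coordinates.\<close>

definition sg :: "8 set \<Rightarrow> 'k" where
  "sg T = (\<Prod>l\<in>T. cocycle (simple l) g)"

definition co :: "('v \<times> (int ^ 8 \<Rightarrow> 'k)) \<Rightarrow> 8 set \<Rightarrow> 'k" where
  "co x T = sg T * snd x (rt T)"

definition el :: "(8 set \<Rightarrow> 'k) \<Rightarrow> ('v \<times> (int ^ 8 \<Rightarrow> 'k))" where
  "el f = (\<Sum>T\<in>Pow K. smult (sg T * f T) (rvec (rt T)))"

text \<open>The action of t on a tensor power of J_2 with factors indexed by \<open>K\<close>. The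
  subset \<open>T\<close> records in which factors t v replaces the generator v, so the value at
  \<open>T\<close> collects the values at all sets with one element fewer.\<close>

definition del :: "(8 set \<Rightarrow> 'k) \<Rightarrow> 8 set \<Rightarrow> 'k" where
  "del f T = (\<Sum>l\<in>T. f (T - {l}))"

lemma finite_K: "finite T" for T :: "8 set"
  by simp

lemma sg_square [simp]: "sg T * sg T = 1" "sg T * (sg T * c) = c"
proof -
  show 1: "sg T * sg T = 1" unfolding sg_def by (simp flip: prod.distrib)
  then show "sg T * (sg T * c) = c" by (simp flip: mult.assoc)
qed

lemma sg_nonzero [simp]: "sg T \<noteq> 0"
  by (simp add: sg_def)

lemma sum_simple_component: "(\<Sum>l\<in>T. simple l) $ i = (if i \<in> T then 1 else 0)" for T :: "8 set"
  by (simp add: axis_component)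

lemma rt_inj: "rt T = rt U \<longleftrightarrow> T = U"
proof
  assume "rt T = rt U"
  then have "(\<Sum>l\<in>T. simple l) $ i = (\<Sum>l\<in>U. simple l) $ i" for i by (simp add: rt_def)
  then have "i \<in> T \<longleftrightarrow> i \<in> U" for i
    unfolding sum_simple_component by (metis zero_neq_one)
  then show "T = U" by blast
qed simp

lemma rt_insert: "l \<in> T \<Longrightarrow> rt T = rt (T - {l}) + simple l"
  by (simp add: rt_def sum.remove add_ac)

lemma form_sum: "form x (\<Sum>l\<in>T. f l) = (\<Sum>l\<in>T. form x (f l))" for T :: "8 set"
  by (induction T rule: infinite_finite_induct) (auto simp: form_bilinear)

lemma form_simple_rt: "l \<in> nil_nodes \<Longrightarrow> T \<subseteq> K \<Longrightarrow> form (simple l) (rt T) = form (simple l) g + (if l \<in> T then 2 else 0)"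
proof -
  assume l: "l \<in> nil_nodes" and T: "T \<subseteq> K"
  have "(\<Sum>m\<in>T. form (simple l) (simple m)) = (\<Sum>m\<in>T. if m = l then 2 else 0)"
    by (rule sum.cong) (use l T K nil_orthogonal[of l] root_self[of "simple l"] in auto)
  then show ?thesis by (simp add: rt_def form_bilinear form_sum)
qed

lemma rt_root: "T \<subseteq> K \<Longrightarrow> rt T \<in> roots"
proof (induction T rule: infinite_finite_induct)
  case empty then show ?case by (simp add: rt_def root)
next
  case (insert l T)
  then have "form (simple l) (rt T) = - 1" using form_simple_rt[of l T] form_K K by auto
  then have "simple l + rt T \<in> roots" using insert by (subst add_root_iff) auto
  moreover have "rt (insert l T) = simple l + rt T" using insert by (simp add: rt_def add_ac)
  ultimately show ?case by simp
qed simp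

lemma rt_minus_simple: "l \<in> nil_nodes \<Longrightarrow> T \<subseteq> K \<Longrightarrow> rt T - simple l \<in> roots \<longleftrightarrow> l \<in> T"
proof -
  assume l: "l \<in> nil_nodes" and T: "T \<subseteq> K"
  have "rt T - simple l \<in> roots \<longleftrightarrow> form (rt T) (- simple l) = - 1"
    using add_root_iff[of "rt T" "- simple l"] rt_root[OF T] by simp
  also have "\<dots> \<longleftrightarrow> form (simple l) (rt T) = 1" by (simp add: form_bilinear form_commute)
  also have "\<dots> \<longleftrightarrow> l \<in> T"
    using form_simple_rt[OF l T] form_K[of l] form_nil[OF l] T by (cases "l \<in> K") auto
  finally show ?thesis .
qed

lemma cocycle_nil: "l \<in> nil_nodes \<Longrightarrow> m \<in> nil_nodes \<Longrightarrow> l \<noteq> m \<Longrightarrow> cocycle (simple l) (simple m) = 1"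
  unfolding cocycle_def cform_simple insert_iff empty_iff
  by (elim disjE) (simp_all only: e8_half_def, simp_all)

lemma cocycle_rt: "l \<in> K \<Longrightarrow> T \<subseteq> K \<Longrightarrow> l \<notin> T \<Longrightarrow> cocycle (simple l) (rt T) = cocycle (simple l) g"
proof (induction T rule: infinite_finite_induct)
  case empty then show ?case by (simp add: rt_def)
next
  case (insert m T)
  have "rt (insert m T) = simple m + rt T" using insert by (simp add: rt_def add_ac)
  then show ?case using insert cocycle_nil[of l m] K by (auto simp: cocycle_bimult)
qed simp

lemma gr_eqI:
  assumes "x \<in> gr q" "y \<in> gr q" "\<And>T. T \<subseteq> K \<Longrightarrow> co x T = co y T"
  shows "x = y"
proof -
  have "snd x o' = snd y o'" for o'
  proof (cases "o' \<in> roots \<and> qdeg o' = q")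
    case True
    then obtain T where T: "T \<subseteq> K" "o' = rt T" using complete by (auto simp: rt_def)
    have "sg T * (sg T * snd x (rt T)) = sg T * (sg T * snd y (rt T))"
      using assms(3)[OF T(1)] by (simp add: co_def)
    then show ?thesis by (simp add: T)
  next
    case False
    then show ?thesis using assms(1,2) by (auto simp: gr_def in_carrier)
  qed
  moreover have "fst x = 0" "fst y = 0" using assms deg_nonzero by (auto simp: gr_def)
  ultimately show ?thesis by (simp add: prod_eq_iff fun_eq_iff)
qed

lemma rt_gr: "T \<subseteq> K \<Longrightarrow> rvec (rt T) \<in> gr q"
proof -
  assume T: "T \<subseteq> K"
  have "qdeg (\<Sum>l\<in>T. simple l) = 0"
  proof -
    have "qdeg (\<Sum>l\<in>U. simple l) = (\<Sum>l\<in>U. qdeg (simple l))" for U :: "8 set"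
      by (induction U rule: infinite_finite_induct) auto
    then show ?thesis using T K qdeg_nil by (simp add: subset_iff)
  qed
  then show ?thesis using rvec_gr[OF rt_root[OF T]] deg by (simp add: rt_def)
qed

lemma el_gr: "el f \<in> gr q"
  unfolding el_def by (rule gr_sum) (auto intro: gr_closed rt_gr)

lemma co_el: "T \<subseteq> K \<Longrightarrow> co (el f) T = f T"
proof -
  assume T: "T \<subseteq> K"
  have "snd (el f) (rt T) = (\<Sum>U\<in>Pow K. if U = T then sg T * f T else 0)"
    unfolding el_def snd_sum sum_fun_apply by (rule sum.cong) (auto simp: smult_def rt_inj)
  then show ?thesis using T by (simp add: co_def)
qed

lemma co_linear: "co (x + y) T = co x T + co y T" "co (smult c x) T = c * co x T" "co (x - y) T = co x T - co y T"
    "co 0 T = 0"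
  by (simp_all add: co_def smult_def algebra_simps)

lemma el_co: "x \<in> gr q \<Longrightarrow> el (co x) = x"
  by (rule gr_eqI) (auto simp: el_gr co_el)

text \<open>Subtracting the simple root of a node from the root of \<open>T\<close> leaves a root
  precisely for nodes in \<open>T\<close>. The cocycle of such a step depends on \<open>g\<close>
  alone, as the nodes are pairwise not adjacent, and it is absorbed by \<open>sg\<close>.\<close>

lemma co_dd: "x \<in> gr q \<Longrightarrow> T \<subseteq> K \<Longrightarrow> co (dd x) T = del (co x) T"
proof -
  assume x: "x \<in> gr q" and T: "T \<subseteq> K"
  have "fst x = 0" using x deg_nonzero by (simp add: gr_def)
  then have "snd (dd x) (rt T) = (\<Sum>l\<in>nil_nodes. if rt T - simple l \<in> roots
      then cocycle (simple l) (rt T - simple l) * snd x (rt T - simple l) else 0)"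
    by (rule dd_snd) (rule rt_root[OF T])
  also have "\<dots> = (\<Sum>l\<in>nil_nodes. if l \<in> T then cocycle (simple l) (rt T - simple l) * snd x (rt T - simple l) else 0)"
    by (intro sum.cong if_cong) (use rt_minus_simple T in auto)
  also have "\<dots> = (\<Sum>l\<in>T. cocycle (simple l) (rt T - simple l) * snd x (rt T - simple l))"
  proof -
    have "nil_nodes \<inter> T = T" using T K by blast
    then show ?thesis by (simp only: sum.inter_restrict[symmetric] finite_K)
  qed
  also have "\<dots> = (\<Sum>l\<in>T. cocycle (simple l) g * snd x (rt (T - {l})))"
  proof (rule sum.cong[OF refl])
    fix l assume l: "l \<in> T"
    then have "rt T - simple l = rt (T - {l})" by (simp add: rt_insert)
    moreover have "cocycle (simple l) (rt (T - {l})) = cocycle (simple l) g"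
      by (rule cocycle_rt) (use l T in auto)
    ultimately show "cocycle (simple l) (rt T - simple l) * snd x (rt T - simple l)
        = cocycle (simple l) g * snd x (rt (T - {l}))" by simp
  qed
  finally have "co (dd x) T = (\<Sum>l\<in>T. sg T * (cocycle (simple l) g * snd x (rt (T - {l}))))"
    by (simp add: co_def sum_distrib_left)
  also have "\<dots> = (\<Sum>l\<in>T. sg (T - {l}) * snd x (rt (T - {l})))"
  proof (rule sum.cong[OF refl])
    fix l assume "l \<in> T"
    then have "sg T = cocycle (simple l) g * sg (T - {l})" by (simp add: sg_def prod.remove)
    then show "sg T * (cocycle (simple l) g * snd x (rt (T - {l}))) = sg (T - {l}) * snd x (rt (T - {l}))"
      by (simp add: mult_ac)
  qed
  finally show ?thesis by (simp add: del_def co_def)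
qed

lemma dd_el: "dd (el f) = el (del f)"
proof (rule gr_eqI)
  show "co (dd (el f)) T = co (el (del f)) T" if "T \<subseteq> K" for T
  proof -
    have "del (co (el f)) T = del f T"
      unfolding del_def by (rule sum.cong) (use that in \<open>auto intro: co_el\<close>)
    then show ?thesis using that by (simp add: co_dd el_gr co_el)
  qed
qed (auto intro: el_gr dd_gr)

lemma el_zero_iff: "el f = 0 \<longleftrightarrow> (\<forall>T\<subseteq>K. f T = 0)"
proof
  assume "el f = 0"
  then show "\<forall>T\<subseteq>K. f T = 0" using co_el[of _ f] by (auto simp: co_linear)
next
  assume "\<forall>T\<subseteq>K. f T = 0"
  then show "el f = 0" by (intro gr_eqI) (auto simp: el_gr gr_closed co_el co_linear)
qed

lemma el_eq_iff: "el f = el f' \<longleftrightarrow> (\<forall>T\<subseteq>K. f T = f' T)"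
  using gr_eqI[OF el_gr el_gr, of f f'] co_el by metis

lemma el_linear: "el (\<lambda>T. f T + f' T) = el f + el f'" "el (\<lambda>T. c * f T) = smult c (el f)"
    "el (\<lambda>T. f T - f' T) = el f - el f'"
  by (rule gr_eqI; simp add: el_gr gr_closed co_linear co_el)+

end

text \<open>
  Up to negligible summands, the tensor power of \<open>J\<^sub>2\<close> indexed by \<open>K\<close> is \<open>J\<^sub>1\<close> or \<open>J\<^sub>2\<close>
  according to the parity of the cardinality of \<open>K\<close>; \<open>bfun\<close> is its generator, and \<open>pfun\<close> is
  the coordinate of an element with respect to it.
\<close>

fun bfun :: "8 list \<Rightarrow> 8 set \<Rightarrow> 'k::field" where
  "bfun (i # j # K) T = (if T = {i} then 1 else if T = {j} then - 1 else 0)"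
| "bfun K T = (if T = {} then 1 else 0)"

fun pfun :: "8 list \<Rightarrow> (8 set \<Rightarrow> 'k::field) \<Rightarrow> 'k" where
  "pfun [] f = f {}"
| "pfun [i] f = f {}"
| "pfun [i, j] f = f {i}"
| "pfun (i # j # K) f = f {j} - f {i}"

section \<open>Classes of a graded piece in the semisimplification\<close>

locale e8_jordan_fibre = e8_fibre sc h \<alpha> g K q + J: jordan_lie root_algebra dd xs ys zs
  for sc :: "'k::field \<Rightarrow> 'v::ab_group_add \<Rightarrow> 'v" and h :: "8 \<Rightarrow> 'v" and \<alpha> :: "8 \<Rightarrow> 'v \<Rightarrow> 'k"
    and g :: "int ^ 8" and K :: "8 set" and q :: "int ^ 4"
    and xs ys zs :: "('v \<times> (int ^ 8 \<Rightarrow> 'k)) list"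
begin

interpretation smult: vector_space smult
  by (rule smult_vector_space)

lemma kerd_el: "el f \<in> d.kerd \<longleftrightarrow> (\<forall>T\<subseteq>K. del f T = 0)"
  using gr_carrier[OF el_gr[of f]] unfolding d.kerd_def by (simp add: dd_el el_zero_iff)

lemma kerdd_el: "el f \<in> d.kerdd \<longleftrightarrow> (\<forall>T\<subseteq>K. del (del f) T = 0)"
  using gr_carrier[OF el_gr[of f]] unfolding d.kerdd_def by (simp add: dd_el el_zero_iff)

lemma ev_elI:
  assumes "\<forall>T\<subseteq>K. f T = c * b T + del u T"
  shows "J.ev (el f) = (\<lambda>k. c * J.ev (el b) k)"
proof -
  have "el f = el (\<lambda>T. c * b T + del u T)" using assms by (simp add: el_eq_iff)
  also have "\<dots> = smult c (el b) + dd (el u)" by (simp add: el_linear dd_el)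
  finally show ?thesis
    using gr_carrier[OF gr_closed(3)[OF el_gr], of c b] J.ev_linear(1)[of "smult c (el b)" "dd (el u)"] J.ev_linear(2)[of "el b" c] gr_carrier[OF el_gr] by simp
qed

lemma od_elI:
  assumes "\<forall>T\<subseteq>K. f T = c * b T + (k T + del u T)" and "\<forall>T\<subseteq>K. del k T = 0"
  shows "J.od (el f) = (\<lambda>k. c * J.od (el b) k)"
proof -
  have "el f = el (\<lambda>T. c * b T + (k T + del u T))" using assms by (simp add: el_eq_iff)
  also have "\<dots> = smult c (el b) + (el k + dd (el u))" by (simp add: el_linear dd_el)
  finally show ?thesis
    using gr_carrier[OF gr_closed(3)[OF el_gr], of c b] J.od_linear(1)[of "smult c (el b)" "el k + dd (el u)"] J.od_linear(2)[of "el b" c]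
      J.od_linear(1)[of "el k" "dd (el u)"] gr_carrier[OF el_gr] J.od_kerd[of "el k"] assms(2)
    by (simp add: kerd_el)
qed

text \<open>A primitive of \<open>el f\<close> could involve other degrees; its projection to degree
  \<open>q\<close> is a primitive inside the fibre, where the second assumption applies.\<close>

lemma ev_el_nonzero:
  assumes "\<forall>T\<subseteq>K. del f T = 0" and "\<And>u. \<forall>T\<subseteq>K. f T = del u T \<Longrightarrow> False"
  shows "J.ev (el f) \<noteq> 0"
proof
  assume "J.ev (el f) = 0"
  then obtain u where u: "u \<in> carrier root_algebra" "el f = dd u"
    using J.ev_zero_kerd[of "el f"] assms(1) by (auto simp: kerd_el)
  have "el f = pr q (el f)" by (simp add: pr_id el_gr)
  also have "\<dots> = dd (el (co (pr q u)))" using u by (simp add: pr_dd el_co pr_gr)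
  finally have "\<forall>T\<subseteq>K. f T = del (co (pr q u)) T" by (simp add: dd_el el_eq_iff)
  then show False by (rule assms(2))
qed

lemma od_el_nonzero:
  assumes "\<forall>T\<subseteq>K. del (del f) T = 0"
    and "\<And>k u. \<forall>T\<subseteq>K. del k T = 0 \<Longrightarrow> \<forall>T\<subseteq>K. f T = k T + del u T \<Longrightarrow> False"
  shows "J.od (el f) \<noteq> 0"
proof
  assume "J.od (el f) = 0"
  then obtain k u where u: "k \<in> d.kerd" "u \<in> carrier root_algebra" "el f = k + dd u"
    using J.od_zero_kerdd[of "el f"] assms(1) by (auto simp: kerdd_el)
  have kc: "k \<in> carrier root_algebra" "dd k = 0" using u(1) by simp_all
  have "el f = pr q (el f)" by (simp add: pr_id el_gr)
  also have "\<dots> = el (co (pr q k)) + dd (el (co (pr q u)))" using u kc by (simp add: pr_dd el_co pr_gr pr_linear)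
  finally have "\<forall>T\<subseteq>K. f T = co (pr q k) T + del (co (pr q u)) T"
    unfolding dd_el el_linear(1)[symmetric] el_eq_iff .
  moreover have "dd (el (co (pr q k))) = 0" using kc by (simp add: el_co pr_gr pr_linear flip: pr_dd)
  then have "\<forall>T\<subseteq>K. del (co (pr q k)) T = 0" by (simp add: dd_el el_zero_iff)
  ultimately show False using assms(2) by blast
qed

lemma subsets_insert: "(\<forall>T\<subseteq>insert i A. P T) \<longleftrightarrow> (\<forall>T\<subseteq>A. P T) \<and> (\<forall>T\<subseteq>A. P (insert i T))"
  for P :: "8 set \<Rightarrow> bool"
proof -
  have "(\<forall>T\<in>Pow (insert i A). P T) \<longleftrightarrow> (\<forall>T\<in>Pow A. P T) \<and> (\<forall>T\<in>Pow A. P (insert i T))"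
    unfolding Pow_insert by blast
  then show ?thesis unfolding Ball_def Pow_iff .
qed

lemma subsets_cases:
  "(\<forall>T\<subseteq>{}. P T) \<longleftrightarrow> P {}"
  "(\<forall>T\<subseteq>{i}. P T) \<longleftrightarrow> P {} \<and> P {i}"
  "(\<forall>T\<subseteq>{i, j}. P T) \<longleftrightarrow> P {} \<and> P {i} \<and> P {j} \<and> P {i, j}"
  "(\<forall>T\<subseteq>{i, j, l}. P T) \<longleftrightarrow> P {} \<and> P {i} \<and> P {j} \<and> P {l} \<and> P {i, j} \<and> P {i, l} \<and> P {j, l} \<and> P {i, j, l}"
  for P :: "8 set \<Rightarrow> bool"
proof -
  have 0: "(\<forall>T\<subseteq>{}. P T) \<longleftrightarrow> P {}" for P :: "8 set \<Rightarrow> bool" by simp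
  show "(\<forall>T\<subseteq>{}. P T) \<longleftrightarrow> P {}" by simp
  show "(\<forall>T\<subseteq>{i}. P T) \<longleftrightarrow> P {} \<and> P {i}" unfolding subsets_insert 0 ..
  show "(\<forall>T\<subseteq>{i, j}. P T) \<longleftrightarrow> P {} \<and> P {i} \<and> P {j} \<and> P {i, j}"
    unfolding subsets_insert 0 by blast
  show "(\<forall>T\<subseteq>{i, j, l}. P T) \<longleftrightarrow> P {} \<and> P {i} \<and> P {j} \<and> P {l} \<and> P {i, j} \<and> P {i, l} \<and> P {j, l} \<and> P {i, j, l}"
    unfolding subsets_insert 0 by blast
qed

lemma del_simps:
  "del f {} = 0" "del f {i} = f {}"
  "i \<noteq> j \<Longrightarrow> del f {i, j} = f {j} + f {i}"
  "i \<noteq> j \<Longrightarrow> i \<noteq> l \<Longrightarrow> j \<noteq> l \<Longrightarrow> del f {i, j, l} = f {j, l} + f {i, l} + f {i, j}"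
  by (simp_all add: del_def insert_Diff_if add.assoc)

lemma char2: "(2 :: 'k) \<noteq> 0" "x + x = - x" "x = - x \<Longrightarrow> x = 0" for x :: 'k
proof -
  show t: "(2 :: 'k) \<noteq> 0" by (simp add: d.two)
  show "x + x = - x" using mult_2[of x] by (simp add: d.two)
  assume "x = - x"
  then have "2 * x = 0" by (metis add.right_inverse mult_2)
  then show "x = 0" using t by simp
qed

lemma fibre_0:
  assumes K: "K = {}"
  shows "J.ev (el (bfun [])) \<noteq> 0" "el (bfun []) \<in> d.kerd"
    "el f \<in> d.kerd \<Longrightarrow> J.ev (el f) = (\<lambda>k. pfun [] f * J.ev (el (bfun [])) k)"
    "J.od (el f) = 0"
proof -
  show "J.ev (el (bfun [])) \<noteq> 0"
    by (rule ev_el_nonzero) (simp_all add: K del_simps)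
  show "el (bfun []) \<in> d.kerd" unfolding kerd_el by (simp add: K del_simps)
  show "J.ev (el f) = (\<lambda>k. pfun [] f * J.ev (el (bfun [])) k)"
    by (rule ev_elI[where u = "\<lambda>_. 0"]) (simp add: K del_simps)
  show "J.od (el f) = 0" by (rule J.od_kerd, unfold kerd_el) (simp add: K del_simps)
qed

lemma fibre_1:
  assumes K: "K = {i}"
  shows "J.od (el (bfun [i])) \<noteq> 0" "el (bfun [i]) \<in> d.kerdd"
    "el f \<in> d.kerdd \<Longrightarrow> J.od (el f) = (\<lambda>k. pfun [i] f * J.od (el (bfun [i])) k)"
    "el f \<in> d.kerd \<Longrightarrow> J.ev (el f) = 0"
proof -
  show "J.od (el (bfun [i])) \<noteq> 0"
    by (rule od_el_nonzero) (auto simp: K subsets_cases del_simps)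
  show "el (bfun [i]) \<in> d.kerdd" unfolding kerdd_el by (simp add: K subsets_cases del_simps)
  show "J.od (el f) = (\<lambda>k. pfun [i] f * J.od (el (bfun [i])) k)"
    by (rule od_elI[where u = "\<lambda>_. 0" and k = "\<lambda>T. if T = {} then 0 else f T"])
      (auto simp: K subsets_cases del_simps)
  assume "el f \<in> d.kerd"
  then show "J.ev (el f) = 0"
    using ev_elI[where f = f and c = 0 and b = "\<lambda>_. 0" and u = "\<lambda>T. f {i}"]
    unfolding kerd_el by (auto simp: K subsets_cases del_simps fun_eq_iff)
qed

text \<open>In J_2 tensor J_2 the antisymmetric vector spans the summand J_1, and v tensor v
  generates the complement J_3.\<close>

lemma fibre_2:
  assumes K: "K = {i, j}" and ij: "i \<noteq> j"
  shows "J.ev (el (bfun [i, j])) \<noteq> 0" "el (bfun [i, j]) \<in> d.kerd"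
    "el f \<in> d.kerd \<Longrightarrow> J.ev (el f) = (\<lambda>k. pfun [i, j] f * J.ev (el (bfun [i, j])) k)"
    "el f \<in> d.kerdd \<Longrightarrow> J.od (el f) = 0"
proof -
  note s = K ij ij[symmetric] subsets_cases del_simps insert_eq_iff doubleton_eq_iff
  show "J.ev (el (bfun [i, j])) \<noteq> 0"
  proof (rule ev_el_nonzero)
    show "\<forall>T\<subseteq>K. del (bfun [i, j]) T = 0" using ij by (simp add: s)
    fix u :: "8 set \<Rightarrow> 'k" assume "\<forall>T\<subseteq>K. bfun [i, j] T = del u T"
    then have "u {} = 1" "u {} = - 1" using ij by (auto simp: s)
    then show False using char2(3)[of "1 :: 'k"] by simp
  qed
  show "el (bfun [i, j]) \<in> d.kerd" unfolding kerd_el using ij by (simp add: s)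
  show "J.ev (el f) = (\<lambda>k. pfun [i, j] f * J.ev (el (bfun [i, j])) k)" if "el f \<in> d.kerd"
  proof (rule ev_elI[where u = "\<lambda>T. if T = {i} then f {i, j} else 0"])
    have "f {} = 0" "f {j} = - f {i}" using that ij unfolding kerd_el by (auto simp: s add_eq_0_iff)
    then show "\<forall>T\<subseteq>K. f T = pfun [i, j] f * bfun [i, j] T + del (\<lambda>T. if T = {i} then f {i, j} else 0) T"
      using ij by (auto simp: s)
  qed
  assume "el f \<in> d.kerdd"
  then have "f {} + f {} = 0" using ij unfolding kerdd_el by (auto simp: s)
  then have f0: "f {} = 0" by (simp add: char2(2))
  have "J.od (el f) = (\<lambda>k. 0 * J.od (el (\<lambda>_. 0)) k)"
  \<comment> \<open>The singletons are split into an antisymmetric part, which lies in the kernel,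
    and a symmetric part, which is exact. One half is -1 here, which explains the
    coefficients.\<close>
  proof (rule od_elI[where u = "\<lambda>T. if T = {} then - f {i} - f {j} else 0"
        and k = "\<lambda>T. if T = {i} then f {j} - f {i} else if T = {j} then f {i} - f {j} else if T = {i, j} then f {i, j} else 0"])
    have "f {i} + f {i} = - f {i}" "f {j} + f {j} = - f {j}" by (rule char2)+
    then have e: "f {i} = f {j} - f {i} + (- f {i} - f {j})" "f {j} = f {i} - f {j} + (- f {i} - f {j})"
      by (simp_all add: algebra_simps)
    show "\<forall>T\<subseteq>K. f T = 0 * 0 + ((if T = {i} then f {j} - f {i} else if T = {j} then f {i} - f {j} else if T = {i, j} then f {i, j} else 0)
        + del (\<lambda>T. if T = {} then - f {i} - f {j} else 0) T)"
      using ij f0 e by (simp add: s)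
    show "\<forall>T\<subseteq>K. del (\<lambda>T. if T = {i} then f {j} - f {i} else if T = {j} then f {i} - f {j} else if T = {i, j} then f {i, j} else 0) T = 0"
      using ij by (simp add: s)
  qed
  then show "J.od (el f) = 0" by (simp add: fun_eq_iff)
qed

text \<open>The singletons carry the J_2 summand: an element of \<open>kerdd\<close> has coordinates
  with sum zero there, and modulo constants, which are exact, only one parameter remains. All
  coordinates on pairs are exact.\<close>

lemma fibre_3:
  assumes K: "K = {i, j, l}" and ij: "i \<noteq> j" "i \<noteq> l" "j \<noteq> l"
  shows "J.od (el (bfun [i, j, l])) \<noteq> 0" "el (bfun [i, j, l]) \<in> d.kerdd"
    "el f \<in> d.kerdd \<Longrightarrow> J.od (el f) = (\<lambda>k. pfun [i, j, l] f * J.od (el (bfun [i, j, l])) k)"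
    "el f \<in> d.kerd \<Longrightarrow> J.ev (el f) = 0"
proof -
  have ne: "{i, j} \<noteq> {i, l}" "{i, j} \<noteq> {j, l}" "{i, l} \<noteq> {j, l}" "{i, j, l} \<noteq> {i, j}" "{i, j, l} \<noteq> {i, l}" "{i, j, l} \<noteq> {j, l}"
    "{i, j, l} \<noteq> {i}" "{i, j, l} \<noteq> {j}" "{i, j, l} \<noteq> {l}" "{i, j} \<noteq> {i}" "{i, j} \<noteq> {j}" "{i, j} \<noteq> {l}"
    "{i, l} \<noteq> {i}" "{i, l} \<noteq> {j}" "{i, l} \<noteq> {l}" "{j, l} \<noteq> {i}" "{j, l} \<noteq> {j}" "{j, l} \<noteq> {l}"
    using ij by auto
  note s = K ij ij[symmetric] ne ne[symmetric] subsets_cases del_simps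
  \<comment> \<open>On singletons this inverts the system x_i + x_j = f {i, j} of the three pairs
    over characteristic 3. The value at the empty set makes \<open>del\<close> equal to
    \<open>f {l}\<close> on all singletons.\<close>
  define U where "U f T = (if T = {} then f {l} else if T = {i} then f {j, l} - f {i, j} - f {i, l}
      else if T = {j} then f {i, l} - f {i, j} - f {j, l} else if T = {l} then f {i, j} - f {i, l} - f {j, l} else 0)"
    for f :: "8 set \<Rightarrow> 'k" and T
  have U: "del (U f) {} = 0" "del (U f) {i} = f {l}" "del (U f) {j} = f {l}" "del (U f) {l} = f {l}"
    "del (U f) {i, j} = f {i, j}" "del (U f) {i, l} = f {i, l}" "del (U f) {j, l} = f {j, l}" "del (U f) {i, j, l} = 0"
    for f
    using char2(2)[of "f {i, j}"] char2(2)[of "f {i, l}"] char2(2)[of "f {j, l}"]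
    by (simp_all add: s U_def algebra_simps)
  have kd: "k {} = 0 \<and> k {i} = 0 \<and> k {j} = 0 \<and> k {l} = 0 \<and> k {j, l} + k {i, l} + k {i, j} = 0"
    if "\<forall>T\<subseteq>K. del k T = 0" for k :: "8 set \<Rightarrow> 'k"
  proof -
    have k: "k {} = 0" "k {j} + k {i} = 0" "k {l} + k {i} = 0" "k {l} + k {j} = 0"
      "k {j, l} + k {i, l} + k {i, j} = 0" using that by (simp_all add: s)
    then have ji: "k {j} = - k {i}" "k {l} = - k {i}" by (simp_all add: add_eq_0_iff2)
    then have "- (k {i} + k {i}) = 0" using k(4) by simp
    then have "k {i} = 0" by (simp add: char2(2))
    then show ?thesis using k ji by simp
  qed
  show "J.od (el (bfun [i, j, l])) \<noteq> 0"
  proof (rule od_el_nonzero)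
    show "\<forall>T\<subseteq>K. del (del (bfun [i, j, l])) T = 0" by (simp add: s)
    fix k u :: "8 set \<Rightarrow> 'k" assume k: "\<forall>T\<subseteq>K. del k T = 0" and "\<forall>T\<subseteq>K. bfun [i, j, l] T = k T + del u T"
    then have "u {} = 1" "u {} = - 1" using kd[OF k] by (simp_all add: s)
    then show False using char2(3)[of "1 :: 'k"] by simp
  qed
  show "el (bfun [i, j, l]) \<in> d.kerdd" unfolding kerdd_el by (simp add: s)
  show "J.od (el f) = (\<lambda>k. pfun [i, j, l] f * J.od (el (bfun [i, j, l])) k)" if "el f \<in> d.kerdd"
  proof (rule od_elI[where u = "U f" and k = "\<lambda>T. if T = {i, j, l} then f T else 0"])
    \<comment> \<open>The first condition comes from the pairs, the second from the triple; the
      latter is twice the sum of the three singleton coordinates.\<close>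
    have k: "f {} + f {} = 0" "(f {l} + f {j}) + (f {l} + f {i}) + (f {j} + f {i}) = 0"
      using that unfolding kerdd_el by (simp_all add: s)
    have f0: "f {} = 0" using k(1) by (simp add: char2(2))
    have "(f {l} + f {j}) + (f {l} + f {i}) + (f {j} + f {i}) = (f {l} + f {l}) + (f {i} + f {i}) + (f {j} + f {j})"
      by (simp add: algebra_simps)
    then have "- f {l} + - f {i} + - f {j} = 0" by (simp only: k(2) char2(2))
    then have "f {l} = f {l} + (- f {l} + - f {i} + - f {j})" by simp
    also have "\<dots> = - f {i} - f {j}" by simp
    finally have "f {l} = - f {i} - f {j}" .
    then have "f {j} - f {i} + f {l} = - (f {i} + f {i})" "- (f {j} - f {i}) + f {l} = - (f {j} + f {j})"
      by simp_all
    then have e: "f {i} = f {j} - f {i} + f {l}" "f {j} = - (f {j} - f {i}) + f {l}"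
      by (simp_all only: char2(2) minus_minus)
    show "\<forall>T\<subseteq>K. f T = pfun [i, j, l] f * bfun [i, j, l] T + ((if T = {i, j, l} then f T else 0) + del (U f) T)"
      using f0 e unfolding K subsets_cases U by (simp add: ij ij[symmetric] ne ne[symmetric])
    show "\<forall>T\<subseteq>K. del (\<lambda>T. if T = {i, j, l} then f T else 0) T = 0" by (simp add: s)
  qed
  assume "el f \<in> d.kerd"
  then have k: "\<forall>T\<subseteq>K. del f T = 0" by (simp add: kerd_el)
  have "J.ev (el f) = (\<lambda>k. 0 * J.ev (el (\<lambda>_. 0)) k)"
  proof (rule ev_elI[where u = "\<lambda>T. U f T + (if T = {i, j} then f {i, j, l} else 0)"])
    have "del (\<lambda>T. U f T + (if T = {i, j} then f {i, j, l} else 0)) T = del (U f) T + del (\<lambda>T. if T = {i, j} then f {i, j, l} else 0) T" for T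
      by (simp add: del_def sum.distrib)
    then show "\<forall>T\<subseteq>K. f T = 0 * 0 + del (\<lambda>T. U f T + (if T = {i, j} then f {i, j, l} else 0)) T"
      using kd[OF k] unfolding K subsets_cases by (simp only: U) (simp add: s)
  qed
  then show "J.ev (el f) = 0" by (simp add: fun_eq_iff)
qed

end

section \<open>Sparse computations in the root algebra\<close>

text \<open>A list of integer multiples of root vectors. Repeated roots are not merged;
  \<open>coef\<close> adds them up.\<close>

type_synonym sparse = "(int \<times> oct) list"

fun root_part1 :: "int \<Rightarrow> oct \<Rightarrow> sparse \<Rightarrow> sparse" where
  "root_part1 c x [] = []"
| "root_part1 c x ((e, y) # l) = (if oct_form x y = - 1
     then (c * e * oct_sign x y, oct_add x y) # root_part1 c x l else root_part1 c x l)"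

fun root_part :: "sparse \<Rightarrow> sparse \<Rightarrow> sparse" where
  "root_part [] l' = []"
| "root_part ((c, x) # l) l' = root_part1 c x l' @ root_part l l'"

fun cartan_part1 :: "int \<Rightarrow> oct \<Rightarrow> sparse \<Rightarrow> oct" where
  "cartan_part1 c x [] = Oct 0 0 0 0 0 0 0 0"
| "cartan_part1 c x ((e, y) # l) = (if oct_form x y = - 2
     then oct_add (oct_scale (- (c * e)) x) (cartan_part1 c x l) else cartan_part1 c x l)"

fun cartan_part :: "sparse \<Rightarrow> sparse \<Rightarrow> oct" where
  "cartan_part [] l' = Oct 0 0 0 0 0 0 0 0"
| "cartan_part ((c, x) # l) l' = oct_add (cartan_part1 c x l') (cartan_part l l')"

fun coef :: "sparse \<Rightarrow> oct \<Rightarrow> int" where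
  "coef [] y = 0"
| "coef ((c, x) # l) y = (if x = y then c else 0) + coef l y"

fun sparse_neg :: "sparse \<Rightarrow> sparse" where
  "sparse_neg [] = []"
| "sparse_neg ((c, x) # l) = (- c, x) # sparse_neg l"

definition nil_sparse :: sparse where
  "nil_sparse = [(1, Oct 1 0 0 0 0 0 0 0), (1, Oct 0 1 0 0 0 0 0 0), (1, Oct 0 0 0 0 0 1 0 0), (1, Oct 0 0 0 0 0 0 0 1)]"

datatype node = N1 | N2 | N6 | N8

fun node_oct :: "node \<Rightarrow> oct" where
  "node_oct N1 = Oct 1 0 0 0 0 0 0 0" | "node_oct N2 = Oct 0 1 0 0 0 0 0 0"
| "node_oct N6 = Oct 0 0 0 0 0 1 0 0" | "node_oct N8 = Oct 0 0 0 0 0 0 0 1"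

fun node_index :: "node \<Rightarrow> 8" where
  "node_index N1 = 1" | "node_index N2 = 2" | "node_index N6 = 6" | "node_index N8 = 8"

fun quad_nodes :: "quad \<Rightarrow> node list" where
  "quad_nodes (Quad a b c e) = (if odd a then [N1] else []) @ (if odd b then [N2] else [])
     @ (if odd (c + e) then [N6] else []) @ (if odd e then [N8] else [])"

fun quad_odd :: "quad \<Rightarrow> bool" where
  "quad_odd (Quad a b c e) = odd (a + b + c)"

text \<open>The generator \<open>bfun\<close> of a fibre written in root vectors, where every
  coordinate acquires its sign \<open>sg\<close>. In the same way, \<open>coord_nodes\<close> is
  \<open>pfun\<close>.\<close>

fun head_nodes :: "oct \<Rightarrow> node list \<Rightarrow> sparse" where
  "head_nodes g (i # j # K) = [(oct_sign (node_oct i) g, oct_add g (node_oct i)), (- oct_sign (node_oct j) g, oct_add g (node_oct j))]"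
| "head_nodes g K = [(1, g)]"

definition head_sparse :: "quad \<Rightarrow> sparse" where
  "head_sparse q = head_nodes (quad_base q) (quad_nodes q)"

fun coord_nodes :: "oct \<Rightarrow> node list \<Rightarrow> sparse \<Rightarrow> int" where
  "coord_nodes g [] l = coef l g"
| "coord_nodes g [i] l = coef l g"
| "coord_nodes g [i, j] l = oct_sign (node_oct i) g * coef l (oct_add g (node_oct i))"
| "coord_nodes g (i # j # k # K) l = oct_sign (node_oct j) g * coef l (oct_add g (node_oct j))
     - oct_sign (node_oct i) g * coef l (oct_add g (node_oct i))"

definition coord_sparse :: "quad \<Rightarrow> sparse \<Rightarrow> int" where
  "coord_sparse q l = coord_nodes (quad_base q) (quad_nodes q) l"

definition super_bracket :: "quad \<Rightarrow> quad \<Rightarrow> sparse" where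
  "super_bracket p q = (if quad_odd p \<and> quad_odd q
     then root_part (root_part nil_sparse (head_sparse p)) (head_sparse q)
       @ sparse_neg (root_part (head_sparse p) (root_part nil_sparse (head_sparse q)))
     else root_part (head_sparse p) (head_sparse q))"

section \<open>The finite checks on degrees\<close>

definition degree_quad :: "quad \<Rightarrow> bool" where
  "degree_quad q \<longleftrightarrow> oct_cform (quad_base q) (quad_base q) = 1 \<and> q \<noteq> Quad 0 0 0 0"

definition super_nonzero :: "quad \<Rightarrow> quad \<Rightarrow> bool" where
  "super_nonzero p q \<longleftrightarrow> coord_sparse (quad_add p q) (super_bracket p q) mod 3 \<noteq> 0"

fun quad_unit :: "nat \<Rightarrow> int \<Rightarrow> quad" where
  "quad_unit i s = (if i = 0 then Quad s 0 0 0 else if i = 1 then Quad 0 s 0 0 else if i = 2 then Quad 0 0 s 0 else Quad 0 0 0 s)"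

fun quad_height :: "quad \<Rightarrow> int" where
  "quad_height (Quad a b c e) = \<bar>a\<bar> + \<bar>b\<bar> + \<bar>c\<bar> + \<bar>e\<bar>"

text \<open>
  A degree \<open>s q\<close> with \<open>s = \<plusminus>1\<close>, accompanied by the positions of simple degrees by which it can be
  reached from below, and from which it can be lowered.
\<close>

fun check_at :: "int \<Rightarrow> nat \<Rightarrow> nat \<Rightarrow> quad \<Rightarrow> quad \<Rightarrow> quad \<Rightarrow> bool" where
  "check_at s i j q p r \<longleftrightarrow> degree_quad p \<and> quad_height p < quad_height q \<and> super_nonzero (quad_unit i s) p \<and>
     degree_quad q \<and> degree_quad r \<and> quad_height r < quad_height q \<and> super_nonzero (quad_unit j (- s)) q"

fun check_degree :: "int \<Rightarrow> quad \<times> nat \<times> nat \<Rightarrow> bool" where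
  "check_degree s (q, i, j) \<longleftrightarrow> i < 4 \<and> j < 4 \<and> check_at s i j (quad_scale s q)
     (quad_add (quad_scale s q) (quad_unit i (- s))) (quad_add (quad_scale s q) (quad_unit j (- s)))"

text \<open>The degrees of the positive roots, except for 0 and the four simple degrees, by
  increasing height; the last is that of the highest root. The numbers count the simple degrees from
  0. In every row both coincide, so the same neighbour below serves for reaching the degree and for
  lowering it.\<close>

definition degree_table :: "(quad \<times> nat \<times> nat) list" where
  "degree_table = [(Quad 0 0 1 1, 2, 2),
   (Quad 0 1 1 0, 1, 1),
   (Quad 1 1 0 0, 0, 0),
   (Quad 0 1 1 1, 1, 1),
   (Quad 1 1 1 0, 0, 0),
   (Quad 1 1 1 1, 0, 0),
   (Quad 1 2 1 0, 1, 1),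
   (Quad 1 2 1 1, 1, 1),
   (Quad 1 2 2 0, 2, 2),
   (Quad 2 2 1 0, 0, 0),
   (Quad 1 2 2 1, 2, 2),
   (Quad 2 2 1 1, 0, 0),
   (Quad 2 2 2 0, 0, 0),
   (Quad 1 2 2 2, 3, 3),
   (Quad 2 2 2 1, 0, 0),
   (Quad 2 3 2 0, 1, 1),
   (Quad 2 2 2 2, 0, 0),
   (Quad 2 3 2 1, 1, 1),
   (Quad 2 3 2 2, 1, 1),
   (Quad 2 3 3 1, 2, 2),
   (Quad 2 3 3 2, 2, 2),
   (Quad 2 4 3 1, 1, 1),
   (Quad 2 4 3 2, 1, 1),
   (Quad 3 4 3 1, 0, 0),
   (Quad 2 4 4 2, 2, 2),
   (Quad 3 4 3 2, 0, 0),
   (Quad 3 4 4 2, 0, 0),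
   (Quad 3 5 4 2, 1, 1),
   (Quad 4 5 4 2, 0, 0),
   (Quad 4 6 4 2, 1, 1),
   (Quad 4 6 5 2, 2, 2),
   (Quad 4 6 5 3, 3, 3)]"

definition quad_units :: "quad list" where
  "quad_units = [Quad 1 0 0 0, Quad 0 1 0 0, Quad 0 0 1 0, Quad 0 0 0 1]"

definition positive_degrees :: "quad list" where
  "positive_degrees = quad_units @ map fst degree_table"

definition known_degree :: "quad \<Rightarrow> bool" where
  "known_degree q \<longleftrightarrow> q \<in> set positive_degrees \<or> quad_scale (- 1) q \<in> set positive_degrees"

definition closed_at :: "quad \<Rightarrow> bool" where
  "closed_at q \<longleftrightarrow> (degree_quad q \<longrightarrow> known_degree q)"

lemmas sparse_simps = degree_quad_def super_nonzero_def super_bracket_def coord_sparse_def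
  head_sparse_def nil_sparse_def oct_form_def oct_sign_def

lemma check_positive: "list_all (check_degree 1) degree_table"
  by (simp add: degree_table_def sparse_simps)

text \<open>A separate computation: since \<open>quad_base\<close> rounds down, the head in the
  opposite degree is not the negative of the head.\<close>

lemma check_negative: "list_all (check_degree (- 1)) degree_table"
  by (simp add: degree_table_def sparse_simps)

text \<open>As roots are connected to zero by simple roots, closure of the table under neighbours
  will show that it contains every degree.\<close>

lemma check_closed:
  "list_all (\<lambda>q. list_all (\<lambda>u. closed_at (quad_add q u) \<and> closed_at (quad_add q (quad_scale (- 1) u))) quad_units) positive_degrees"
  by (simp add: closed_at_def degree_quad_def known_degree_def positive_degrees_def quad_units_def degree_table_def)

text \<open>This is the source of the cube identity for odd elements.\<close>

lemma check_triple: "list_all (\<lambda>q. \<not> degree_quad (quad_scale 3 q) \<and> \<not> degree_quad (quad_scale (- 3) q)) positive_degrees"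
  by (simp add: degree_quad_def positive_degrees_def quad_units_def degree_table_def)

lemma check_units: "list_all (\<lambda>q. degree_quad q \<and> degree_quad (quad_scale (- 1) q)) quad_units"
  by (simp add: degree_quad_def quad_units_def)

text \<open>The Cartan elements \<open>[E\<^sub>i, F\<^sub>i]\<close>, up to sign.\<close>

definition super_cartan :: "quad \<Rightarrow> quad \<Rightarrow> oct" where
  "super_cartan p q = (if quad_odd p \<and> quad_odd q
     then oct_add (cartan_part (root_part nil_sparse (head_sparse p)) (head_sparse q))
       (oct_scale (- 1) (cartan_part (head_sparse p) (root_part nil_sparse (head_sparse q))))
     else cartan_part (head_sparse p) (head_sparse q))"

lemma super_cartan_units:
  "super_cartan (Quad 1 0 0 0) (Quad (- 1) 0 0 0) = Oct 1 0 2 0 0 0 0 0"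
  "super_cartan (Quad 0 1 0 0) (Quad 0 (- 1) 0 0) = Oct 0 1 0 2 0 0 0 0"
  "super_cartan (Quad 0 0 1 0) (Quad 0 0 (- 1) 0) = Oct 0 0 0 0 (- 2) (- 1) 0 0"
  "super_cartan (Quad 0 0 0 1) (Quad 0 0 0 (- 1)) = Oct 0 0 0 0 0 1 2 1"
  "super_bracket (Quad 1 0 0 0) (Quad (- 1) 0 0 0) = []"
  "super_bracket (Quad 0 1 0 0) (Quad 0 (- 1) 0 0) = []"
  "super_bracket (Quad 0 0 1 0) (Quad 0 0 (- 1) 0) = []"
  "super_bracket (Quad 0 0 0 1) (Quad 0 0 0 (- 1)) = []"
  by (simp_all add: super_cartan_def sparse_simps)

section \<open>Interpretation of the sparse computations\<close>

fun vec4 :: "quad \<Rightarrow> int ^ 4" where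
  "vec4 (Quad a b c e) = (\<chi> j. if j = 1 then a else if j = 2 then b else if j = 3 then c else e)"

lemma forall_4: "(\<forall>i::4. P i) \<longleftrightarrow> P 1 \<and> P 2 \<and> P 3 \<and> P 4"
  by (metis exhaust_4)

lemma vec4_inj [simp]: "vec4 p = vec4 q \<longleftrightarrow> p = q"
  by (cases p; cases q) (auto simp: vec_eq_iff forall_4)

lemma vec4_add: "vec4 (quad_add p q) = vec4 p + vec4 q"
  by (cases p; cases q) (simp add: vec_eq_iff)

lemma vec4_scale: "vec4 (quad_scale c q) $ i = c * vec4 q $ i"
  by (cases q) simp

lemma vec4_uminus: "vec4 (quad_scale (- 1) q) = - vec4 q"
  by (simp add: vec_eq_iff vec4_scale)

lemma vec4_zero: "vec4 q = 0 \<longleftrightarrow> q = Quad 0 0 0 0"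
  by (cases q) (auto simp: vec_eq_iff forall_4)

lemma vec4_surj: "\<exists>q. v = vec4 q"
  by (intro exI[of _ "Quad (v $ 1) (v $ 2) (v $ 3) (v $ 4)"]) (simp add: vec_eq_iff forall_4)

lemma qdeg_vec8: "qdeg (vec8 x) = vec4 (oct_degree x)"
  by (cases x) (simp add: qdeg_def vec_eq_iff)

declare vec8.simps [simp del] vec4.simps [simp del]

lemma oct_degree_base: "oct_degree (quad_base q) = q"
  by (cases q) simp

lemma vec8_node: "vec8 (node_oct n) = axis (node_index n) 1"
  by (cases n) (simp_all add: vec8_axis)

lemma node_index_nil: "node_index n \<in> {1, 2, 6, 8}"
  by (cases n) simp_all

lemma node_index_inj: "node_index m = node_index n \<longleftrightarrow> m = n"
  by (cases m; cases n) simp_all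

lemma quad_nodes_distinct: "distinct (quad_nodes q)"
  by (cases q) simp

lemma quad_nodes_length: "length (quad_nodes q) \<le> 4" "odd (length (quad_nodes q)) \<longleftrightarrow> quad_odd q"
  by (cases q; simp; blast?)+

lemma quad_odd_add: "quad_odd (quad_add p q) \<longleftrightarrow> quad_odd p \<noteq> quad_odd q"
  by (cases p; cases q; simp; blast?)

definition node_set :: "quad \<Rightarrow> 8 set" where
  "node_set q = node_index ` set (quad_nodes q)"

lemma node_set_iff:
  "1 \<in> node_set (Quad a b c e) \<longleftrightarrow> odd a" "2 \<in> node_set (Quad a b c e) \<longleftrightarrow> odd b"
  "6 \<in> node_set (Quad a b c e) \<longleftrightarrow> odd (c + e)" "8 \<in> node_set (Quad a b c e) \<longleftrightarrow> odd e"
  "node_set q \<subseteq> {1, 2, 6, 8}"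
  unfolding node_set_def using node_index_nil by auto

context e8_realization
begin

interpretation smult: vector_space smult
  by (rule smult_vector_space)

lemma form_nil_vec8:
  "form (simple 1) (vec8 (Oct a1 a2 a3 a4 a5 a6 a7 a8)) = 2 * a1 - a3"
  "form (simple 2) (vec8 (Oct a1 a2 a3 a4 a5 a6 a7 a8)) = 2 * a2 - a4"
  "form (simple 6) (vec8 (Oct a1 a2 a3 a4 a5 a6 a7 a8)) = 2 * a6 - (a5 + a7)"
  "form (simple 8) (vec8 (Oct a1 a2 a3 a4 a5 a6 a7 a8)) = 2 * a8 - a7"
  unfolding vec8_axis[symmetric] form_vec8 by (simp_all add: oct_form_def)

lemma form_nil_base: "l \<in> nil_nodes \<Longrightarrow> form (simple l) (vec8 (quad_base q)) = (if l \<in> node_set q then - 1 else 0)"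
proof (cases q)
  case (Quad a b c e)
  assume "l \<in> nil_nodes"
  moreover have "2 * (x div 2) - x = (if odd x then - 1 else 0)" for x :: int by (simp add: minus_mod_eq_mult_div [symmetric] odd_iff_mod_2_eq_one)
  ultimately show ?thesis
    unfolding insert_iff empty_iff Quad quad_base.simps
    by (elim disjE) (simp_all only: form_nil_vec8 node_set_iff)
qed

text \<open>A root of nonzero degree is neither equal nor opposite to a simple root of the nodes 1,
  2, 6, 8, so its inner products with them are at most 1 in absolute value. This leaves one or two
  values for each of the four free coefficients, and exactly two where the parity is odd.\<close>

lemma e8_fibre_quad:
  assumes "degree_quad q"
  shows "e8_fibre sc h \<alpha> (vec8 (quad_base q)) (node_set q) (vec4 q)"
proof
  show "vec8 (quad_base q) \<in> roots" using assms by (simp add: degree_quad_def root_vec8)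
  show "node_set q \<subseteq> nil_nodes" by (rule node_set_iff)
  show "form (simple l) (vec8 (quad_base q)) = - 1" if "l \<in> node_set q" for l
    using form_nil_base[of l q] that node_set_iff(5)[of q] by auto
  show "form (simple l) (vec8 (quad_base q)) = 0" if "l \<in> nil_nodes" "l \<notin> node_set q" for l
    using form_nil_base[OF that(1), of q] that by simp
  show "qdeg (vec8 (quad_base q)) = vec4 q" by (simp add: qdeg_vec8 oct_degree_base)
  show nz: "vec4 q \<noteq> 0" using assms by (simp add: degree_quad_def vec4_zero)
  fix o' assume r: "o' \<in> roots" and dg: "qdeg o' = vec4 q"
  obtain a b c e where q: "q = Quad a b c e" by (cases q)
  obtain a1 a2 a3 a4 a5 a6 a7 a8 where o: "o' = vec8 (Oct a1 a2 a3 a4 a5 a6 a7 a8)"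
    using vec8_oct_of[of o'] by (metis oct.exhaust)
  have c: "a3 = a" "a4 = b" "a5 = c" "a7 = e" using dg by (simp_all add: o q qdeg_vec8)
  have bound: "\<bar>form (simple l) o'\<bar> \<le> 1" if "l \<in> nil_nodes" for l
  proof -
    have "qdeg (simple l) = 0" using that by (rule qdeg_nil)
    then have "o' \<noteq> simple l" "o' \<noteq> - simple l" using dg nz by auto
    then show ?thesis using form_upper[OF simple_root r, of l] form_lower[OF simple_root r, of l] by linarith
  qed
  have b: "\<bar>2 * a1 - a\<bar> \<le> 1" "\<bar>2 * a2 - b\<bar> \<le> 1" "\<bar>2 * a6 - (c + e)\<bar> \<le> 1" "\<bar>2 * a8 - e\<bar> \<le> 1"
    using bound[of 1] bound[of 2] bound[of 6] bound[of 8] unfolding o form_nil_vec8 c by auto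
  have split: "x = y div 2 \<or> odd y \<and> x = y div 2 + 1" if "\<bar>2 * x - y\<bar> \<le> 1" for x y :: int
    using that by presburger
  let ?g = "quad_base q"
  define T where "T = {l \<in> nil_nodes. o' $ l \<noteq> vec8 ?g $ l}"
  have s: "o' $ 1 = vec8 ?g $ 1 \<or> 1 \<in> node_set q \<and> o' $ 1 = vec8 ?g $ 1 + 1"
    "o' $ 2 = vec8 ?g $ 2 \<or> 2 \<in> node_set q \<and> o' $ 2 = vec8 ?g $ 2 + 1"
    "o' $ 6 = vec8 ?g $ 6 \<or> 6 \<in> node_set q \<and> o' $ 6 = vec8 ?g $ 6 + 1"
    "o' $ 8 = vec8 ?g $ 8 \<or> 8 \<in> node_set q \<and> o' $ 8 = vec8 ?g $ 8 + 1"
    using split[OF b(1)] split[OF b(2)] split[OF b(3)] split[OF b(4)]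
    by (simp_all only: o q node_set_iff quad_base.simps vec8.simps) simp_all
  have step: "o' $ l = vec8 ?g $ l \<or> l \<in> node_set q \<and> o' $ l = vec8 ?g $ l + 1" if l: "l \<in> nil_nodes" for l
  proof -
    consider "l = 1" | "l = 2" | "l = 6" | "l = 8" using l by auto
    then show ?thesis by cases (simp_all only: s)
  qed
  have "o' $ i = (vec8 ?g + (\<Sum>l\<in>T. simple l)) $ i" for i
  proof (cases "i \<in> nil_nodes")
    case True
    then show ?thesis using step[OF True] by (auto simp: T_def axis_component)
  next
    case False
    then have "i = 3 \<or> i = 4 \<or> i = 5 \<or> i = 7" using exhaust_8[of i] by auto
    moreover have "i \<notin> T" using False by (auto simp: T_def)
    ultimately show ?thesis by (auto simp: axis_component o q c vec8.simps)
  qed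
  then have "o' = vec8 ?g + (\<Sum>l\<in>T. simple l)" by (simp add: vec_eq_iff)
  moreover have "T \<subseteq> node_set q" using step by (auto simp: T_def)
  ultimately show "\<exists>T\<subseteq>node_set q. o' = vec8 ?g + (\<Sum>l\<in>T. simple l)" by blast
qed

text \<open>With four nodes the highest root of the fibre would have inner product 2 - 4 = -2 with
  the lowest one and hence be its negative. But both have the same degree, which would have to be
  zero.\<close>

lemma degree_nodes_le_3:
  assumes "degree_quad q"
  shows "length (quad_nodes q) \<le> 3"
proof (rule ccontr)
  interpret F: e8_fibre sc h \<alpha> "vec8 (quad_base q)" "node_set q" "vec4 q" by (rule e8_fibre_quad[OF assms])
  assume "\<not> ?thesis"
  then have "node_set q = nil_nodes" by (cases q) (auto simp: node_set_def split: if_splits)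
  then have K: "nil_nodes \<subseteq> node_set q" by simp
  then have r: "F.rt nil_nodes \<in> roots" by (intro F.rt_root)
  have "form (vec8 (quad_base q)) (F.rt nil_nodes) = - 2"
  proof -
    have "form (vec8 (quad_base q)) (simple l) = - 1" if "l \<in> nil_nodes" for l
      using F.form_K[of l] K that form_commute[of "vec8 (quad_base q)" "simple l"] by auto
    then have "(\<Sum>l\<in>nil_nodes. form (vec8 (quad_base q)) (simple l)) = - 4" by simp
    then show ?thesis by (simp only: F.rt_def form_bilinear(2) F.form_sum root_self[OF F.root])
  qed
  then have "F.rt nil_nodes = - vec8 (quad_base q)" using form_lower(2)[OF F.root r] by simp
  then have "qdeg (F.rt nil_nodes) = - vec4 q" using F.deg by simp
  moreover have "qdeg (F.rt nil_nodes) = vec4 q" using F.deg by (simp add: F.rt_def qdeg_nil)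
  ultimately have "vec4 q = - vec4 q" by simp
  then have "vec4 q = 0" by (simp add: vec_eq_iff)
  then show False using F.deg_nonzero by simp
qed

text \<open>The roots of one degree have the same norm as the base of the degree, which makes
  \<open>degree_quad\<close> a complete test.\<close>

lemma degree_of_root: "x \<in> roots \<Longrightarrow> qdeg x \<noteq> 0 \<Longrightarrow> \<exists>q. qdeg x = vec4 q \<and> degree_quad q"
proof -
  assume r: "x \<in> roots" and nz: "qdeg x \<noteq> 0"
  obtain a1 a2 a3 a4 a5 a6 a7 a8 where x: "x = vec8 (Oct a1 a2 a3 a4 a5 a6 a7 a8)"
    using vec8_oct_of[of x] by (metis oct.exhaust)
  let ?q = "Quad a3 a4 a5 a7"
  have q: "qdeg x = vec4 ?q" by (simp add: x qdeg_vec8)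
  have bound: "\<bar>form (simple l) x\<bar> \<le> 1" if "l \<in> nil_nodes" for l
  proof -
    have "qdeg (simple l) = 0" using that by (rule qdeg_nil)
    then have "x \<noteq> simple l" "x \<noteq> - simple l" using nz by auto
    then show ?thesis using form_upper[OF simple_root r, of l] form_lower[OF simple_root r, of l] by linarith
  qed
  have b: "\<bar>2 * a1 - a3\<bar> \<le> 1" "\<bar>2 * a2 - a4\<bar> \<le> 1" "\<bar>2 * a6 - (a5 + a7)\<bar> \<le> 1" "\<bar>2 * a8 - a7\<bar> \<le> 1"
    using bound[of 1] bound[of 2] bound[of 6] bound[of 8] unfolding x form_nil_vec8 by auto
  \<comment> \<open>The norm depends on a free coefficient \<open>u\<close> through u u - u v with
    \<open>v\<close> the sum of the adjacent coefficients, and this is the same at both integers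
    nearest to v/2.\<close>
  have red: "u * u - u * v = (v div 2) * (v div 2) - (v div 2) * v" if "\<bar>2 * u - v\<bar> \<le> 1" for u v :: int
  proof -
    have "u = v div 2 \<or> odd v \<and> u = v div 2 + 1" using that by presburger
    then show ?thesis
    proof
      assume "odd v \<and> u = v div 2 + 1"
      moreover from this have "v = 2 * (v div 2) + 1" by simp
      then obtain w where "v = 2 * w + 1" ..
      ultimately show ?thesis by (simp add: algebra_simps)
    qed simp
  qed
  have "oct_cform (Oct a1 a2 a3 a4 a5 a6 a7 a8) (Oct a1 a2 a3 a4 a5 a6 a7 a8) = oct_cform (quad_base ?q) (quad_base ?q)"
    using red[OF b(1)] red[OF b(2)] red[OF b(3)] red[OF b(4)] by (simp add: algebra_simps)
  then have "degree_quad ?q" using r nz q by (simp add: degree_quad_def x root_vec8 vec4_zero)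
  then show ?thesis using q by blast
qed

lemma gr_zero_unless: "q \<noteq> Quad 0 0 0 0 \<Longrightarrow> \<not> degree_quad q \<Longrightarrow> x \<in> gr (vec4 q) \<Longrightarrow> x = 0"
proof -
  assume q: "q \<noteq> Quad 0 0 0 0" "\<not> degree_quad q" and x: "x \<in> gr (vec4 q)"
  have nz: "vec4 q \<noteq> 0" using q by (simp add: vec4_zero)
  have "snd x g = 0" for g
  proof (rule ccontr)
    assume g: "snd x g \<noteq> 0"
    then have "qdeg g = vec4 q" using x by (auto simp: gr_def)
    moreover have "g \<in> roots" using x g by (auto simp: gr_def in_carrier)
    ultimately show False using degree_of_root[of g] q nz by auto
  qed
  moreover have "fst x = 0" using x nz by (simp add: gr_def)
  ultimately show "x = 0" by (simp add: prod_eq_iff fun_eq_iff)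
qed

text \<open>Every root is joined to a simple root or its negative by roots of decreasing
  \<open>abs_height\<close>. A step changes the degree by nothing or by a simple degree, and the
  table together with degree 0 is closed under this.\<close>

lemma known_degree: "degree_quad q \<Longrightarrow> known_degree q"
proof -
  have closed: "closed_at (quad_add q u) \<and> closed_at (quad_add q (quad_scale (- 1) u))"
    if q: "known_degree q" and u: "u \<in> set quad_units" for q u
  proof -
    have pos: "closed_at (quad_add q u) \<and> closed_at (quad_add q (quad_scale (- 1) u))" if "q \<in> set positive_degrees" for q
      using check_closed that u by (simp add: list_all_iff)
    have neg_neg: "quad_scale (- 1) (quad_scale (- 1) r) = r" for r by (cases r) simp
    have neg_add: "quad_scale (- 1) (quad_add r s) = quad_add (quad_scale (- 1) r) (quad_scale (- 1) s)" for r s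
      by (cases r; cases s) simp
    \<comment> \<open>The base of the opposite degree is in general not the negative of the base, so
      this passes through the root system.\<close>
    have degree_neg: "degree_quad r \<Longrightarrow> degree_quad (quad_scale (- 1) r)" for r
    proof -
      assume r: "degree_quad r"
      interpret F: e8_fibre sc h \<alpha> "vec8 (quad_base r)" "node_set r" "vec4 r" by (rule e8_fibre_quad[OF r])
      have "- vec8 (quad_base r) \<in> roots" using F.root by simp
      moreover have "qdeg (- vec8 (quad_base r)) = vec4 (quad_scale (- 1) r)" using F.deg by (simp add: vec4_uminus)
      ultimately obtain q where "vec4 (quad_scale (- 1) r) = vec4 q" "degree_quad q"
        using degree_of_root[of "- vec8 (quad_base r)"] F.deg F.deg_nonzero by (metis neg_equal_0_iff_equal vec4_uminus)
      then show ?thesis by simp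
    qed
    have known_neg: "known_degree (quad_scale (- 1) r) \<longleftrightarrow> known_degree r" for r
      by (auto simp: known_degree_def neg_neg)
    have closed_neg: "closed_at (quad_scale (- 1) r) \<Longrightarrow> closed_at r" for r
      using degree_neg[of r] known_neg[of r] by (auto simp: closed_at_def)
    show ?thesis
    proof (cases "q \<in> set positive_degrees")
      case False
      then have "quad_scale (- 1) q \<in> set positive_degrees" using q by (simp add: known_degree_def)
      note c = pos[OF this]
      show ?thesis
      proof
        show "closed_at (quad_add q u)" by (rule closed_neg) (use c in \<open>simp only: neg_add\<close>)
        show "closed_at (quad_add q (quad_scale (- 1) u))"
          by (rule closed_neg) (use c in \<open>simp only: neg_add neg_neg\<close>)
      qed
    qed (rule pos)
  qed
  \<comment> \<open>Degree 0 is not in the table, so the steps leaving it are treated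
    separately.\<close>
  have units: "closed_at (quad_add (Quad 0 0 0 0) u) \<and> closed_at (quad_add (Quad 0 0 0 0) (quad_scale (- 1) u))"
    if "u \<in> set quad_units" for u
    using that by (auto simp: closed_at_def known_degree_def positive_degrees_def quad_units_def)
  have main: "\<exists>q. qdeg g = vec4 q \<and> (q = Quad 0 0 0 0 \<or> known_degree q)" if "g \<in> roots" for g
    using that
  proof (induction "abs_height g" arbitrary: g rule: less_induct)
    case less
    have unit: "qdeg (simple i) = 0 \<or> (\<exists>u\<in>set quad_units. qdeg (simple i) = vec4 u)" for i
    proof -
      have "i \<in> nil_nodes \<or> i = 3 \<or> i = 4 \<or> i = 5 \<or> i = 7" using exhaust_8[of i] by auto
      moreover have "qdeg (axis 3 1) = vec4 (Quad 1 0 0 0)" "qdeg (axis 4 1) = vec4 (Quad 0 1 0 0)"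
        "qdeg (axis 5 1) = vec4 (Quad 0 0 1 0)" "qdeg (axis 7 1) = vec4 (Quad 0 0 0 1)"
        unfolding vec8_axis[symmetric] qdeg_vec8 by simp_all
      ultimately show ?thesis using qdeg_nil[of i] by (auto simp: quad_units_def)
    qed
    have conclude: "\<exists>q. qdeg g = vec4 q \<and> (q = Quad 0 0 0 0 \<or> known_degree q)"
      if "closed_at r" "qdeg g = vec4 r" for r
    proof (cases "r = Quad 0 0 0 0")
      case False
      then have "qdeg g \<noteq> 0" using that by (simp add: vec4_zero)
      then obtain q where "qdeg g = vec4 q" "degree_quad q"
        using degree_of_root[OF less.prems] by blast
      then have "degree_quad r" using that by simp
      then show ?thesis using that by (auto simp: closed_at_def)
    qed (use that in auto)
    from root_descent[OF less.prems] obtain i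
      where "0 < g $ i \<and> 0 < form g (simple i) \<or> g $ i < 0 \<and> form g (simple i) < 0" ..
    then have "\<exists>q. (q = Quad 0 0 0 0 \<or> known_degree q) \<and> (qdeg g = vec4 q + qdeg (simple i) \<or> qdeg g = vec4 q - qdeg (simple i))"
    proof (elim disjE conjE)
      assume i: "0 < g $ i" "0 < form g (simple i)"
      show ?thesis
      proof (cases "g = simple i")
        case True
        have "vec4 (Quad 0 0 0 0) = 0" by (simp add: vec4_zero)
        then show ?thesis using True by (intro exI[of _ "Quad 0 0 0 0"]) simp
      next
        case False
        then have "g - simple i \<in> roots" using descent_down(2)[OF less.prems i] by blast
        from less.hyps[OF abs_height_diff[OF i(1)] this] show ?thesis by (auto simp: algebra_simps)
      qed
    next
      assume i: "g $ i < 0" "form g (simple i) < 0"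
      show ?thesis
      proof (cases "g = - simple i")
        case True
        have "vec4 (Quad 0 0 0 0) = 0" by (simp add: vec4_zero)
        then show ?thesis using True by (intro exI[of _ "Quad 0 0 0 0"]) simp
      next
        case False
        then have "g + simple i \<in> roots" using descent_up(2)[OF less.prems i] by blast
        from less.hyps[OF abs_height_add[OF i(1)] this] show ?thesis by (auto simp: algebra_simps)
      qed
    qed
    then obtain q where q: "q = Quad 0 0 0 0 \<or> known_degree q"
      "qdeg g = vec4 q + qdeg (simple i) \<or> qdeg g = vec4 q - qdeg (simple i)" by blast
    show ?case
    proof (cases "qdeg (simple i) = 0")
      case True then show ?thesis using q by auto
    next
      case False
      then obtain u where u: "u \<in> set quad_units" "qdeg (simple i) = vec4 u" using unit by blast
      have "closed_at (quad_add q u)" "closed_at (quad_add q (quad_scale (- 1) u))"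
        using q(1) closed[OF _ u(1)] units[OF u(1)] by auto
      moreover have "qdeg g = vec4 (quad_add q u) \<or> qdeg g = vec4 (quad_add q (quad_scale (- 1) u))"
        using q(2) u by (simp add: vec4_add vec4_uminus)
      ultimately show ?thesis using conclude by blast
    qed
  qed
  assume q: "degree_quad q"
  interpret F: e8_fibre sc h \<alpha> "vec8 (quad_base q)" "node_set q" "vec4 q" by (rule e8_fibre_quad[OF q])
  show "known_degree q" using main[OF F.root] F.deg q by (auto simp: degree_quad_def)
qed


section \<open>Sparse lists as elements of the root algebra\<close>

fun sem :: "sparse \<Rightarrow> 'v \<times> (int ^ 8 \<Rightarrow> 'k)" where
  "sem [] = 0"
| "sem ((c, x) # l) = smult (of_int c) (rvec (vec8 x)) + sem l"

definition valid :: "sparse \<Rightarrow> bool" where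
  "valid l \<longleftrightarrow> (\<forall>(c, x)\<in>set l. oct_cform x x = 1)"

lemma valid_simps [simp]: "valid []" "valid ((c, x) # l) \<longleftrightarrow> oct_cform x x = 1 \<and> valid l"
    "valid (l @ l') \<longleftrightarrow> valid l \<and> valid l'"
  by (auto simp: valid_def)

lemma sem_append: "sem (l @ l') = sem l + sem l'"
  by (induction l) (auto simp: add.assoc)

lemma sem_neg: "sem (sparse_neg l) = - sem l" "valid (sparse_neg l) \<longleftrightarrow> valid l"
  by (induction l rule: sparse_neg.induct) (auto simp: smult.scale_minus_left)

lemma fst_sem: "fst (sem l) = 0"
  by (induction l rule: sem.induct) (auto simp: smult_def)

lemma snd_sem: "snd (sem l) (vec8 y) = of_int (coef l y)"
  by (induction l rule: sem.induct) (auto simp: smult_def)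

text \<open>Inner product -1 contributes a root vector and -2 a coroot; for two roots all other
  values give bracket zero. The two kinds of contribution are accumulated separately.\<close>

lemma sem_bracket1:
  assumes "oct_cform x x = 1" "valid l"
  shows "root_bracket (smult (of_int c) (rvec (vec8 x))) (sem l)
      = cvec (coroot (vec8 (cartan_part1 c x l))) + sem (root_part1 c x l) \<and> valid (root_part1 c x l)"
  using assms(2)
proof (induction l)
  case Nil
  have "vec8 (Oct 0 0 0 0 0 0 0 0) = 0" by (simp add: vec_eq_iff vec8.simps)
  then show ?case by (simp add: root_bracket_bilinear L.bracket_zero[simplified])
next
  case (Cons p l)
  obtain e y where p: "p = (e, y)" by (cases p)
  note 2 = Cons[unfolded p]
  have x: "vec8 x \<in> roots" and y: "vec8 y \<in> roots" using assms(1) 2 by (simp_all add: root_vec8)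
  have IH: "root_bracket (smult (of_int c) (rvec (vec8 x))) (sem l)
      = cvec (coroot (vec8 (cartan_part1 c x l))) + sem (root_part1 c x l) \<and> valid (root_part1 c x l)"
    using 2 by simp
  have b: "root_bracket (smult (of_int c) (rvec (vec8 x))) (smult (of_int e) (rvec (vec8 y)))
     = smult (of_int (c * e)) (root_bracket (rvec (vec8 x)) (rvec (vec8 y)))"
    by (simp add: root_bracket_bilinear)
  have coroot_scale: "coroot (vec8 (oct_scale k x)) = sc (of_int k) (coroot (vec8 x))" for k
    by (simp add: coroot_def vec8_scale scale_sum_right)
  consider "oct_form x y = - 1" | "oct_form x y = - 2" | "oct_form x y \<noteq> - 1" "oct_form x y \<noteq> - 2" by blast
  then show ?case
  proof cases
    case 1
    then have f: "form (vec8 x) (vec8 y) = - 1" by (simp add: form_vec8)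
    then have "vec8 x + vec8 y \<in> roots" using add_root_iff x y by blast
    then have "oct_cform (oct_add x y) (oct_add x y) = 1" by (simp add: root_vec8 flip: vec8_add)
    then show ?thesis unfolding p using IH 1 f x y
      by (simp add: root_bracket_bilinear(2) b bracket_rr_add vec8_add cocycle_vec8 add_ac)
  next
    case 2
    then have f: "form (vec8 x) (vec8 y) = - 2" by (simp add: form_vec8)
    then have y': "vec8 y = - vec8 x" using form_lower(2) x y by blast
    have "cvec (coroot (vec8 (oct_scale (- (c * e)) x))) = smult (of_int c * of_int e) (cvec (- coroot (vec8 x)))"
      unfolding coroot_scale by (simp add: smult.scale_minus_right)
    moreover have "root_bracket (smult (of_int c) (rvec (vec8 x))) (smult (of_int e) (rvec (vec8 y)))
      = smult (of_int c * of_int e) (cvec (- coroot (vec8 x)))"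
      unfolding b y' using x by (simp add: bracket_rr_opposite)
    ultimately have r: "root_bracket (smult (of_int c) (rvec (vec8 x))) (smult (of_int e) (rvec (vec8 y)))
      = cvec (coroot (vec8 (oct_scale (- (c * e)) x)))" by simp
    then show ?thesis unfolding p using IH 2 x
      by (simp add: root_bracket_bilinear(2) vec8_add add_ac)
  next
    case 3
    then have "root_bracket (rvec (vec8 x)) (rvec (vec8 y)) = 0" using x y by (simp add: bracket_rr_zero form_vec8)
    then show ?thesis unfolding p using IH 3 by (simp add: root_bracket_bilinear(2) b)
  qed
qed

lemma sem_bracket:
  assumes "valid l" "valid l'"
  shows "root_bracket (sem l) (sem l') = cvec (coroot (vec8 (cartan_part l l'))) + sem (root_part l l')
      \<and> valid (root_part l l')"
  using assms(1)
proof (induction l)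
  case Nil
  have "vec8 (Oct 0 0 0 0 0 0 0 0) = 0" by (simp add: vec_eq_iff vec8.simps)
  then show ?case by (simp add: L.bracket_zero[simplified])
next
  case (Cons p l)
  then show ?case using sem_bracket1[of "snd p" l' "fst p"] assms(2) by (cases p) (simp add: root_bracket_bilinear(1) vec8_add sem_append add_ac)
qed

lemma sem_nil: "sem nil_sparse = nilp" "valid nil_sparse"
  by (simp_all add: nil_sparse_def nilp_def vec8_axis add.assoc)

lemma head_sparse_valid: "degree_quad q \<Longrightarrow> valid (head_sparse q)"
proof -
  assume q: "degree_quad q"
  interpret F: e8_fibre sc h \<alpha> "vec8 (quad_base q)" "node_set q" "vec4 q" by (rule e8_fibre_quad[OF q])
  have one: "oct_cform (oct_add (quad_base q) (node_oct n)) (oct_add (quad_base q) (node_oct n)) = 1" if "n \<in> set (quad_nodes q)" for n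
  proof -
    have "F.rt {node_index n} \<in> roots" by (rule F.rt_root) (use that in \<open>simp add: node_set_def\<close>)
    then show ?thesis unfolding root_vec8[symmetric] by (simp add: F.rt_def vec8_add vec8_node)
  qed
  obtain K where K: "quad_nodes q = K" by simp
  have base: "oct_cform (quad_base q) (quad_base q) = 1" using q by (simp add: degree_quad_def)
  show ?thesis
    using one base by (cases "quad_nodes q" rule: list.exhaust; cases "tl (quad_nodes q)" rule: list.exhaust)
      (auto simp: head_sparse_def)
qed

lemma smult_rvec_zero_fst: "x \<in> gr q \<Longrightarrow> q \<noteq> 0 \<Longrightarrow> x = cvec v + sem l \<Longrightarrow> x = sem l"
proof -
  assume x: "x \<in> gr q" "q \<noteq> 0" "x = cvec v + sem l"
  then have "fst x = v" by (simp add: fst_sem)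
  moreover have "fst x = 0" using x by (simp add: gr_def)
  ultimately show "x = sem l" using x(3) by simp
qed

end

section \<open>The graded pieces of the semisimplification\<close>

locale e8_jordan = e8_realization sc h \<alpha> + J: jordan_lie root_algebra dd xs ys zs
  for sc :: "'k::field \<Rightarrow> 'v::ab_group_add \<Rightarrow> 'v" and h :: "8 \<Rightarrow> 'v" and \<alpha> :: "8 \<Rightarrow> 'v \<Rightarrow> 'k"
    and xs ys zs :: "('v \<times> (int ^ 8 \<Rightarrow> 'k)) list"
begin

interpretation smult: vector_space smult
  by (rule smult_vector_space)

lemma jordan_fibre: "degree_quad q \<Longrightarrow>
    e8_jordan_fibre sc h \<alpha> (vec8 (quad_base q)) (node_set q) (vec4 q) xs ys zs"
  by (intro e8_jordan_fibre.intro e8_fibre_quad J.jordan_lie_axioms)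

definition head :: "quad \<Rightarrow> 'v \<times> (int ^ 8 \<Rightarrow> 'k)" where
  "head q = sem (head_sparse q)"

definition shead :: "quad \<Rightarrow> nat \<Rightarrow> 'k" where
  "shead q = (if quad_odd q then J.od (head q) else J.ev (head q))"

text \<open>The four fibre lemmas in a form independent of the number of nodes. The coordinate
  functional \<open>\<pi>\<close> is specified only on sparse lists, where it can be
  computed.\<close>

lemma degree_summary:
  assumes q: "degree_quad q"
  shows "shead q \<noteq> 0 \<and> head q \<in> gr (vec4 q) \<and> (\<exists>\<pi>. (\<forall>l. \<pi> (sem l) = of_int (coord_sparse q l)) \<and>
    (if quad_odd q then head q \<in> d.kerdd \<and> (\<forall>x\<in>gr (vec4 q) \<inter> d.kerdd. J.od x = (\<lambda>k. \<pi> x * shead q k))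
       \<and> (\<forall>x\<in>gr (vec4 q) \<inter> d.kerd. J.ev x = 0)
     else head q \<in> d.kerd \<and> (\<forall>x\<in>gr (vec4 q) \<inter> d.kerd. J.ev x = (\<lambda>k. \<pi> x * shead q k))
       \<and> (\<forall>x\<in>gr (vec4 q) \<inter> d.kerdd. J.od x = 0)))"
proof -
  interpret F: e8_jordan_fibre sc h \<alpha> "vec8 (quad_base q)" "node_set q" "vec4 q" xs ys zs
    by (rule jordan_fibre[OF q])
  let ?ns = "map node_index (quad_nodes q)"
  have inj: "x \<in> set (quad_nodes q) \<Longrightarrow> {node_index x} \<subseteq> node_set q" for x by (simp add: node_set_def)
  have rt: "F.rt {node_index n} = vec8 (oct_add (quad_base q) (node_oct n))" for n
    by (simp add: F.rt_def vec8_add vec8_node)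
  have sg: "F.sg {node_index n} = of_int (oct_sign (node_oct n) (quad_base q))" for n
    unfolding F.sg_def by (simp add: cocycle_vec8 flip: vec8_node)
  have rt0: "F.rt {} = vec8 (quad_base q)" and sg0: "F.sg {} = 1" by (simp_all add: F.rt_def F.sg_def)
  have co1: "F.co (sem l) {node_index n} = of_int (oct_sign (node_oct n) (quad_base q) * coef l (oct_add (quad_base q) (node_oct n)))" for l n
    unfolding F.co_def rt sg snd_sem by simp
  have co0: "F.co (sem l) {} = of_int (coef l (quad_base q))" for l
    unfolding F.co_def rt0 sg0 snd_sem by simp
  have pfun: "pfun ?ns (F.co (sem l)) = of_int (coord_sparse q l)" for l
  proof (cases "(quad_base q, quad_nodes q, l)" rule: coord_nodes.cases)
    case (1 g l')
    then have q': "quad_base q = g" "quad_nodes q = []" by simp_all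
    show ?thesis unfolding coord_sparse_def q' by (simp add: co0[unfolded q'])
  next
    case (2 g i l')
    then have q': "quad_base q = g" "quad_nodes q = [i]" by simp_all
    show ?thesis unfolding coord_sparse_def q' by (simp add: co0[unfolded q'])
  next
    case (3 g i j l')
    then have q': "quad_base q = g" "quad_nodes q = [i, j]" by simp_all
    show ?thesis unfolding coord_sparse_def q' by (simp add: co1[unfolded q'])
  next
    case (4 g i j k K l')
    then have q': "quad_base q = g" "quad_nodes q = i # j # k # K" by simp_all
    show ?thesis unfolding coord_sparse_def q' by (simp add: co1[unfolded q'])
  qed
  have co_r: "F.co (smult c (rvec (F.rt U))) T = (if T = U then F.sg T * c else 0)" for c U T
    by (simp add: F.co_def smult_def F.rt_inj)
  have both: "head q \<in> gr (vec4 q) \<and> (\<forall>T. T \<subseteq> node_set q \<longrightarrow> F.co (head q) T = bfun ?ns T)"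
  proof (cases "(quad_base q, quad_nodes q)" rule: head_nodes.cases)
    case (1 g i j K)
    then have q': "quad_base q = g" "quad_nodes q = i # j # K" by simp_all
    then have ij: "node_index i \<noteq> node_index j" using quad_nodes_distinct[of q] by (simp add: node_index_inj)
    have "smult (- F.sg {node_index j}) (rvec (F.rt {node_index j}))
      = - smult (of_int (oct_sign (node_oct j) (quad_base q))) (rvec (vec8 (oct_add (quad_base q) (node_oct j))))"
      by (simp add: rt sg smult.scale_minus_left)
    then have e: "head q = smult (F.sg {node_index i}) (rvec (F.rt {node_index i}))
        + smult (- F.sg {node_index j}) (rvec (F.rt {node_index j}))"
      unfolding head_def head_sparse_def q' by (simp add: rt[unfolded q'] sg[unfolded q'] smult.scale_minus_left)
    have "{node_index i} \<subseteq> node_set q" "{node_index j} \<subseteq> node_set q" by (simp_all add: node_set_def q')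
    then have "head q \<in> gr (vec4 q)" unfolding e by (intro gr_closed(2,3) F.rt_gr)
    moreover have "F.co (head q) T = bfun ?ns T" for T
    proof -
      have b: "bfun ?ns T = (if T = {node_index i} then 1 else if T = {node_index j} then - 1 else (0 :: 'k))"
        by (simp add: q')
      show ?thesis unfolding e F.co_linear(1) co_r b using ij by (simp add: F.sg_def)
    qed
    ultimately show ?thesis by blast
  next
    case ("2_1" g)
    then have q': "quad_base q = g" "quad_nodes q = []" by simp_all
    have e: "head q = smult 1 (rvec (F.rt {}))" unfolding head_def head_sparse_def q' by (simp add: rt0[unfolded q'])
    have "head q \<in> gr (vec4 q)" unfolding e by (intro gr_closed(3) F.rt_gr) simp
    moreover have "F.co (head q) T = bfun ?ns T" for T
    proof -
      have b: "bfun ?ns T = (if T = {} then 1 else (0 :: 'k))" by (simp add: q')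
      show ?thesis unfolding e co_r b by (simp add: sg0)
    qed
    ultimately show ?thesis by blast
  next
    case ("2_2" g v)
    then have q': "quad_base q = g" "quad_nodes q = [v]" by simp_all
    have e: "head q = smult 1 (rvec (F.rt {}))" unfolding head_def head_sparse_def q' by (simp add: rt0[unfolded q'])
    have "head q \<in> gr (vec4 q)" unfolding e by (intro gr_closed(3) F.rt_gr) simp
    moreover have "F.co (head q) T = bfun ?ns T" for T
    proof -
      have b: "bfun ?ns T = (if T = {} then 1 else (0 :: 'k))" by (simp add: q')
      show ?thesis unfolding e co_r b by (simp add: sg0)
    qed
    ultimately show ?thesis by blast
  qed
  then have co_head: "F.co (head q) T = bfun ?ns T" if "T \<subseteq> node_set q" for T
    using that by blast
  have gr: "head q \<in> gr (vec4 q)" using both ..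
  have head: "head q = F.el (bfun ?ns)"
    using F.el_co[OF gr] co_head by (metis F.el_eq_iff)
  have el: "x = F.el (F.co x)" if "x \<in> gr (vec4 q)" for x using F.el_co[OF that] by simp
  have K: "node_set q = set ?ns" by (simp add: node_set_def)
  have odd: "quad_odd q \<longleftrightarrow> odd (length ?ns)" using quad_nodes_length(2)[of q] by simp
  have len: "length ?ns \<le> 3" using degree_nodes_le_3[OF q] by simp
  have dis: "distinct ?ns" using quad_nodes_distinct[of q] by (simp add: distinct_map inj_on_def node_index_inj)
  define \<pi> where "\<pi> x = pfun ?ns (F.co x)" for x
  have \<pi>: "\<forall>l. \<pi> (sem l) = of_int (coord_sparse q l)" by (simp add: \<pi>_def pfun)
  consider "?ns = []" | i where "?ns = [i]" | i j where "?ns = [i, j]" | i j l where "?ns = [i, j, l]"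
  proof -
    have "ns = [] \<or> (\<exists>i. ns = [i]) \<or> (\<exists>i j. ns = [i, j]) \<or> (\<exists>i j l. ns = [i, j, l])"
      if "length ns \<le> 3" for ns :: "8 list"
      using that by (auto simp: le_Suc_eq length_Suc_conv numeral_eq_Suc)
    from this[OF len] show thesis by (elim disjE exE) (erule that)+
  qed
  then have "shead q \<noteq> 0 \<and>
    (if quad_odd q then head q \<in> d.kerdd \<and> (\<forall>x\<in>gr (vec4 q) \<inter> d.kerdd. J.od x = (\<lambda>k. \<pi> x * shead q k))
       \<and> (\<forall>x\<in>gr (vec4 q) \<inter> d.kerd. J.ev x = 0)
     else head q \<in> d.kerd \<and> (\<forall>x\<in>gr (vec4 q) \<inter> d.kerd. J.ev x = (\<lambda>k. \<pi> x * shead q k))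
       \<and> (\<forall>x\<in>gr (vec4 q) \<inter> d.kerdd. J.od x = 0))"
  proof cases
    case 1
    then have "node_set q = {}" using K by simp
    note f = F.fibre_0[OF this]
    have o: "\<not> quad_odd q" using odd 1 by simp
    have a: "J.ev x = (\<lambda>k. pfun [] (F.co x) * J.ev (F.el (bfun [])) k)" if x: "x \<in> gr (vec4 q)" "x \<in> d.kerd" for x
      using f(3)[of "F.co x"] unfolding F.el_co[OF x(1)] using x by blast
    have b: "J.od x = 0" if x: "x \<in> gr (vec4 q)" "x \<in> d.kerdd" for x
      using f(4)[of "F.co x"] unfolding F.el_co[OF x(1)] using x by blast
    show ?thesis unfolding shead_def head 1 \<pi>_def if_not_P[OF o]
      using f(1,2) a b by blast
  next
    case (2 i)
    then have "node_set q = {i}" using K by simp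
    note f = F.fibre_1[OF this]
    have o: "quad_odd q" using odd 2 by simp
    have a: "J.od x = (\<lambda>k. pfun [i] (F.co x) * J.od (F.el (bfun [i])) k)" if x: "x \<in> gr (vec4 q)" "x \<in> d.kerdd" for x
      using f(3)[of "F.co x"] unfolding F.el_co[OF x(1)] using x by blast
    have b: "J.ev x = 0" if x: "x \<in> gr (vec4 q)" "x \<in> d.kerd" for x
      using f(4)[of "F.co x"] unfolding F.el_co[OF x(1)] using x by blast
    show ?thesis unfolding shead_def head 2 \<pi>_def if_P[OF o]
      using f(1,2) a b by blast
  next
    case (3 i j)
    then have "node_set q = {i, j}" "i \<noteq> j" using K dis by simp_all
    note f = F.fibre_2[OF this]
    have o: "\<not> quad_odd q" using odd 3 by simp
    have a: "J.ev x = (\<lambda>k. pfun [i, j] (F.co x) * J.ev (F.el (bfun [i, j])) k)" if x: "x \<in> gr (vec4 q)" "x \<in> d.kerd" for x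
      using f(3)[of "F.co x"] unfolding F.el_co[OF x(1)] using x by blast
    have b: "J.od x = 0" if x: "x \<in> gr (vec4 q)" "x \<in> d.kerdd" for x
      using f(4)[of "F.co x"] unfolding F.el_co[OF x(1)] using x by blast
    show ?thesis unfolding shead_def head 3 \<pi>_def if_not_P[OF o]
      using f(1,2) a b by blast
  next
    case (4 i j l)
    then have "node_set q = {i, j, l}" "i \<noteq> j" "i \<noteq> l" "j \<noteq> l" using K dis by simp_all
    note f = F.fibre_3[OF this]
    have o: "quad_odd q" using odd 4 by simp
    have a: "J.od x = (\<lambda>k. pfun [i, j, l] (F.co x) * J.od (F.el (bfun [i, j, l])) k)" if x: "x \<in> gr (vec4 q)" "x \<in> d.kerdd" for x
      using f(3)[of "F.co x"] unfolding F.el_co[OF x(1)] using x by blast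
    have b: "J.ev x = 0" if x: "x \<in> gr (vec4 q)" "x \<in> d.kerd" for x
      using f(4)[of "F.co x"] unfolding F.el_co[OF x(1)] using x by blast
    show ?thesis unfolding shead_def head 4 \<pi>_def if_P[OF o]
      using f(1,2) a b by blast
  qed
  then show ?thesis using gr \<pi> by blast
qed

lemma shead_nonzero: "degree_quad q \<Longrightarrow> shead q \<noteq> 0"
  using degree_summary by blast

lemma head_gr: "degree_quad q \<Longrightarrow> head q \<in> gr (vec4 q)"
  using degree_summary by blast

lemma head_kerdd: "degree_quad q \<Longrightarrow> quad_odd q \<Longrightarrow> head q \<in> d.kerdd"
  using degree_summary[of q] by auto

lemma head_kerd: "degree_quad q \<Longrightarrow> \<not> quad_odd q \<Longrightarrow> head q \<in> d.kerd"
  using degree_summary[of q] by auto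

section \<open>The induced grading and the brackets of its lines\<close>

definition G :: "int ^ 4 \<Rightarrow> (nat \<Rightarrow> 'k) set" where
  "G q = {J.ev a + J.od b | a b. a \<in> gr q \<inter> d.kerd \<and> b \<in> gr q \<inter> d.kerdd}"

lemma zero_ker: "0 \<in> d.kerd" "0 \<in> d.kerdd"
  by (auto intro!: d.kerd_I d.kerdd_I simp: dd_linear)

lemma G_ev: "a \<in> gr q \<Longrightarrow> a \<in> d.kerd \<Longrightarrow> J.ev a \<in> G q"
  unfolding G_def using zero_ker gr_closed(1)[of q] by (intro CollectI exI[of _ a] exI[of _ 0]) simp

lemma G_od: "b \<in> gr q \<Longrightarrow> b \<in> d.kerdd \<Longrightarrow> J.od b \<in> G q"
  unfolding G_def using zero_ker gr_closed(1)[of q] by (intro CollectI exI[of _ 0] exI[of _ b]) simp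

lemma shead_G: "degree_quad q \<Longrightarrow> shead q \<in> G (vec4 q)"
  unfolding shead_def using G_ev G_od head_gr head_kerd head_kerdd by auto

lemma G_degree: "degree_quad q \<Longrightarrow> x \<in> G (vec4 q) \<Longrightarrow> \<exists>c. x = (\<lambda>k. c * shead q k)"
proof -
  assume q: "degree_quad q" and "x \<in> G (vec4 q)"
  then obtain a b where ab: "a \<in> gr (vec4 q) \<inter> d.kerd" "b \<in> gr (vec4 q) \<inter> d.kerdd" "x = J.ev a + J.od b"
    by (auto simp: G_def)
  from degree_summary[OF q] obtain \<pi> where
    "if quad_odd q then head q \<in> d.kerdd \<and> (\<forall>x\<in>gr (vec4 q) \<inter> d.kerdd. J.od x = (\<lambda>k. \<pi> x * shead q k))
       \<and> (\<forall>x\<in>gr (vec4 q) \<inter> d.kerd. J.ev x = 0)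
     else head q \<in> d.kerd \<and> (\<forall>x\<in>gr (vec4 q) \<inter> d.kerd. J.ev x = (\<lambda>k. \<pi> x * shead q k))
       \<and> (\<forall>x\<in>gr (vec4 q) \<inter> d.kerdd. J.od x = 0)" by blast
  then show ?thesis using ab by (cases "quad_odd q") auto
qed

lemma G_not_degree: "q \<noteq> Quad 0 0 0 0 \<Longrightarrow> \<not> degree_quad q \<Longrightarrow> x \<in> G (vec4 q) \<Longrightarrow> x = 0"
proof -
  assume q: "q \<noteq> Quad 0 0 0 0" "\<not> degree_quad q" and "x \<in> G (vec4 q)"
  then obtain a b where ab: "a \<in> gr (vec4 q)" "b \<in> gr (vec4 q)" "x = J.ev a + J.od b" by (auto simp: G_def)
  have "a = 0" "b = 0" using gr_zero_unless[OF q] ab by auto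
  then show "x = 0" using ab by simp
qed

lemma sem_super:
  assumes p: "degree_quad p" and q: "degree_quad q"
  shows "(if quad_odd p \<and> quad_odd q then d.odd_bracket (head p) (head q) else root_bracket (head p) (head q))
      = cvec (coroot (vec8 (super_cartan p q))) + sem (super_bracket p q)"
proof -
  note v = head_sparse_valid[OF p] head_sparse_valid[OF q]
  \<comment> \<open>The derivative of a head has nonzero degree, hence no Cartan component, and is
    again given by a valid sparse list; \<open>sem_bracket\<close> then evaluates the odd
    bracket.\<close>
  have dd: "dd (head r) = sem (root_part nil_sparse (head_sparse r))" and
    dv: "valid (root_part nil_sparse (head_sparse r))" if r: "degree_quad r" for r
  proof -
    have *: "dd (head r) = cvec (coroot (vec8 (cartan_part nil_sparse (head_sparse r)))) + sem (root_part nil_sparse (head_sparse r))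
       \<and> valid (root_part nil_sparse (head_sparse r))"
      using sem_bracket[OF sem_nil(2) head_sparse_valid[OF r]] by (simp add: dd_def head_def sem_nil)
    then show "valid (root_part nil_sparse (head_sparse r))" by simp
    show "dd (head r) = sem (root_part nil_sparse (head_sparse r))"
      using * smult_rvec_zero_fst[OF dd_gr[OF head_gr[OF r]]] r by (auto simp: degree_quad_def vec4_zero)
  qed
  show ?thesis
  proof (cases "quad_odd p \<and> quad_odd q")
    case True
    let ?a = "root_part nil_sparse (head_sparse p)" and ?b = "root_part nil_sparse (head_sparse q)"
    have "d.odd_bracket (head p) (head q)
       = cvec (coroot (vec8 (cartan_part ?a (head_sparse q)))) + sem (root_part ?a (head_sparse q))
         - (cvec (coroot (vec8 (cartan_part (head_sparse p) ?b))) + sem (root_part (head_sparse p) ?b))"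
      unfolding d.odd_bracket_def root_algebra_simps dd[OF p] dd[OF q] unfolding head_def
      using sem_bracket[OF dv[OF p] v(2)] sem_bracket[OF v(1) dv[OF q]] by simp
    then show ?thesis using True
      by (simp add: super_cartan_def super_bracket_def vec8_add vec8_uminus sem_append sem_neg)
  next
    case False
    show ?thesis unfolding super_cartan_def super_bracket_def head_def if_not_P[OF False]
      using sem_bracket[OF v] by simp
  qed
qed

lemma S_bracket_shead:
  assumes p: "degree_quad p" and q: "degree_quad q"
  shows "bracket J.S (shead p) (shead q) = (if quad_odd p = quad_odd q then J.ev else J.od)
     (cvec (coroot (vec8 (super_cartan p q))) + sem (super_bracket p q))"
    and "cvec (coroot (vec8 (super_cartan p q))) + sem (super_bracket p q) \<in> gr (vec4 (quad_add p q))"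
    and "cvec (coroot (vec8 (super_cartan p q))) + sem (super_bracket p q)
      \<in> (if quad_odd p = quad_odd q then d.kerd else d.kerdd)"
proof -
  note k = head_kerd[OF p] head_kerd[OF q] head_kerdd[OF p] head_kerdd[OF q]
  have br: "bracket root_algebra = root_bracket" by simp
  show "bracket J.S (shead p) (shead q) = (if quad_odd p = quad_odd q then J.ev else J.od)
     (cvec (coroot (vec8 (super_cartan p q))) + sem (super_bracket p q))"
    unfolding sem_super[OF p q, symmetric] shead_def
    using k J.ev_bracket[of "head p" "head q"] J.odd_bracket[of "head p" "head q"]
      J.od_bracket[of "head p" "head q"] J.od_bracket[of "head q" "head p"] unfolding br by auto
  show "cvec (coroot (vec8 (super_cartan p q))) + sem (super_bracket p q) \<in> gr (vec4 (quad_add p q))"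
    unfolding sem_super[OF p q, symmetric] vec4_add d.odd_bracket_def br
    using gr_bracket head_gr[OF p] head_gr[OF q] dd_gr gr_closed(4) by auto
  show "cvec (coroot (vec8 (super_cartan p q))) + sem (super_bracket p q)
      \<in> (if quad_odd p = quad_odd q then d.kerd else d.kerdd)"
    unfolding sem_super[OF p q, symmetric]
    using k d.bracket_kerd[of "head p" "head q"] d.odd_bracket_kerd[of "head p" "head q"]
      d.bracket_kerd_kerdd[of "head p" "head q"] d.bracket_kerd_kerdd[of "head q" "head p"] unfolding br by auto
qed

text \<open>The heads and their brackets have integer coefficients, so a scalar vanishes in the
  field precisely if the computed integer is divisible by 3.\<close>

lemma super_nonzero_bracket:
  assumes p: "degree_quad p" and q: "degree_quad q" and r: "degree_quad (quad_add p q)" and nz: "super_nonzero p q"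
  shows "\<exists>c. c \<noteq> 0 \<and> bracket J.S (shead p) (shead q) = (\<lambda>k. c * shead (quad_add p q) k)"
proof -
  let ?r = "quad_add p q" and ?X = "cvec (coroot (vec8 (super_cartan p q))) + sem (super_bracket p q)"
  have X: "?X = sem (super_bracket p q)"
    using smult_rvec_zero_fst[OF S_bracket_shead(2)[OF p q]] r by (auto simp: degree_quad_def vec4_zero)
  note S = S_bracket_shead[OF p q, unfolded X]
  have odd: "quad_odd ?r \<longleftrightarrow> quad_odd p \<noteq> quad_odd q" by (rule quad_odd_add)
  from degree_summary[OF r] obtain \<pi> where \<pi>: "\<forall>l. \<pi> (sem l) = of_int (coord_sparse ?r l)"
    "if quad_odd ?r then head ?r \<in> d.kerdd \<and> (\<forall>x\<in>gr (vec4 ?r) \<inter> d.kerdd. J.od x = (\<lambda>k. \<pi> x * shead ?r k))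
       \<and> (\<forall>x\<in>gr (vec4 ?r) \<inter> d.kerd. J.ev x = 0)
     else head ?r \<in> d.kerd \<and> (\<forall>x\<in>gr (vec4 ?r) \<inter> d.kerd. J.ev x = (\<lambda>k. \<pi> x * shead ?r k))
       \<and> (\<forall>x\<in>gr (vec4 ?r) \<inter> d.kerdd. J.od x = 0)" by blast
  have "bracket J.S (shead p) (shead q) = (\<lambda>k. \<pi> (sem (super_bracket p q)) * shead ?r k)"
    using S \<pi>(2) odd by (cases "quad_odd p = quad_odd q") auto
  moreover have "(of_int z :: 'k) \<noteq> 0" if "z mod 3 \<noteq> 0" for z
    using that of_int_eq_0_iff_char_dvd[of z, where 'a = 'k] unfolding char_three by auto
  then have "\<pi> (sem (super_bracket p q)) \<noteq> 0" using nz \<pi>(1) by (simp add: super_nonzero_def)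
  ultimately show ?thesis by blast
qed

lemma dd_cvec: "dd (cvec v) = - (smult (\<alpha> 1 v) (rvec (simple 1)) + smult (\<alpha> 2 v) (rvec (simple 2))
    + smult (\<alpha> 6 v) (rvec (simple 6)) + smult (\<alpha> 8 v) (rvec (simple 8)))"
  by (simp add: dd_def nilp_def root_bracket_bilinear smult.scale_minus_left)

lemma dd_simple: "l \<in> nil_nodes \<Longrightarrow> dd (rvec (simple l)) = 0"
proof -
  assume l: "l \<in> nil_nodes"
  have "root_bracket (rvec (simple m)) (rvec (simple l)) = 0" if "m \<in> nil_nodes" for m
    using nil_orthogonal[OF that l] by (cases "m = l") (simp_all add: bracket_rr_zero root_self)
  then show ?thesis by (simp add: dd_def nilp_def root_bracket_bilinear)
qed

lemma dd_neg_simple: "l \<in> nil_nodes \<Longrightarrow> dd (rvec (- simple l)) = - cvec (h l)"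
proof -
  assume l: "l \<in> nil_nodes"
  have *: "root_bracket (rvec (simple m)) (rvec (- simple l)) = (if m = l then - cvec (h l) else 0)" if "m \<in> nil_nodes" for m
    using nil_orthogonal[OF that l] by (simp add: bracket_rr_opposite bracket_rr_zero form_bilinear)
  then show ?thesis using l unfolding dd_def nilp_def root_bracket_bilinear by auto
qed

lemma gr_zero_expand:
  assumes x: "x \<in> gr 0"
  shows "\<exists>v a b. x = cvec v + (\<Sum>l\<in>nil_nodes. smult (a l) (rvec (simple l))) + (\<Sum>l\<in>nil_nodes. smult (b l) (rvec (- simple l)))"
proof -
  \<comment> \<open>In degree 0 a descent index must be one of the nodes 1, 2, 6, 8. The inner
    product there is twice the coefficient, thus 2 or -2, and the root is plus or minus that simple
    root.\<close>
  have roots0: "\<exists>l\<in>nil_nodes. g = simple l \<or> g = - simple l" if "g \<in> roots" "qdeg g = 0" for g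
  proof -
    obtain a1 a2 a3 a4 a5 a6 a7 a8 where g: "g = vec8 (Oct a1 a2 a3 a4 a5 a6 a7 a8)"
      using vec8_oct_of[of g] by (metis oct.exhaust)
    have z: "a3 = 0" "a4 = 0" "a5 = 0" "a7 = 0" using that by (simp_all add: g qdeg_vec8 vec4_zero)
    have n: "a1 * a1 + a2 * a2 + a6 * a6 + a8 * a8 = 1" using that by (simp add: g root_vec8 z)
    from root_descent[OF that(1)] obtain i where i: "0 < g $ i \<and> 0 < form g (simple i) \<or> g $ i < 0 \<and> form g (simple i) < 0" ..
    have i_nil: "i \<in> nil_nodes"
    proof (rule ccontr)
      assume "i \<notin> nil_nodes"
      then have "i = 3 \<or> i = 4 \<or> i = 5 \<or> i = 7" using exhaust_8[of i] by auto
      then have "g $ i = 0" by (auto simp: g z vec8.simps)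
      then show False using i by simp
    qed
    have f: "form g (simple i) = 2 * g $ i"
      unfolding form_commute[of g] using i_nil by (auto simp: g z form_nil_vec8) (simp_all add: vec8.simps)
    then have "form g (simple i) = 2 \<or> form g (simple i) = - 2"
      using i form_upper(1)[OF that(1) simple_root, of i] form_lower(1)[OF that(1) simple_root, of i] by linarith
    then show ?thesis using form_upper(2)[OF that(1) simple_root, of i] form_lower(2)[OF that(1) simple_root, of i] i_nil
      by (metis minus_minus)
  qed
  have ne: "simple l \<noteq> - simple m" for l m :: 8
    by (simp add: vec_eq_iff axis_component) (metis zero_neq_one one_neq_neg_one neg_equal_0_iff_equal)
  have sx: "simple l = simple m \<longleftrightarrow> l = m" for l m :: 8 by (simp add: axis_eq_axis)
  let ?y = "cvec (fst x) + (\<Sum>l\<in>nil_nodes. smult (snd x (simple l)) (rvec (simple l)))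
     + (\<Sum>l\<in>nil_nodes. smult (snd x (- simple l)) (rvec (- simple l)))"
  have snd: "snd x g = snd ?y g" for g
  proof (cases "g \<in> roots \<and> qdeg g = 0")
    case True
    then obtain l where l: "l \<in> nil_nodes" "g = simple l \<or> g = - simple l" using roots0 by blast
    have y: "snd ?y g = (\<Sum>m\<in>nil_nodes. snd x (simple m) * (if g = simple m then 1 else 0))
       + (\<Sum>m\<in>nil_nodes. snd x (- simple m) * (if g = - simple m then 1 else 0))"
      unfolding snd_add plus_fun_apply snd_sum sum_fun_apply
      by (simp add: smult_def del: sum.insert insert_iff)
    have del: "(\<Sum>m\<in>nil_nodes. f m * (if l = m then 1 else 0)) = f l" for f :: "8 \<Rightarrow> 'k"
      using l(1) by auto
    show ?thesis using l(2)
    proof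
      assume g: "g = simple l"
      show ?thesis unfolding y unfolding g by (simp only: sx ne if_False mult_zero_right sum.neutral_const add_0_right del[of "\<lambda>m. snd x (simple m)"])
    next
      assume g: "g = - simple l"
      show ?thesis unfolding y unfolding g
        by (simp only: sx ne[symmetric] neg_equal_iff_equal if_False mult_zero_right sum.neutral_const add_0_left del[of "\<lambda>m. snd x (- simple m)"])
    qed
  next
    case False
    then have "snd x g = 0" using x by (auto simp: gr_def in_carrier)
    moreover have "snd ?y g = 0"
    proof -
      have r: "rvec (simple l) \<in> gr 0" "rvec (- simple l) \<in> gr 0" if "l \<in> nil_nodes" for l
        using rvec_gr[OF simple_root, of l] rvec_gr[of "- simple l"] qdeg_nil[OF that] by simp_all
      have "?y \<in> gr 0"
        by (intro gr_closed(2) cvec_gr gr_sum gr_closed(3) r)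
      then show ?thesis using False by (auto simp: gr_def in_carrier)
    qed
    ultimately show ?thesis by simp
  qed
  have "fst x = fst ?y" by (simp add: fst_sum smult_def)
  then have "x = ?y" by (intro prod_eqI ext snd)
  then show ?thesis
    by (intro exI[of _ "fst x"] exI[of _ "\<lambda>l. snd x (simple l)"] exI[of _ "\<lambda>l. snd x (- simple l)"])
qed

end

section \<open>Realizations of invertible matrices\<close>

context realization
begin

lemma inj_h: "inj h"
proof (rule injI, rule ccontr)
  fix i j assume e: "h i = h j" and ne: "i \<noteq> j"
  have d: "sc (if P then 1 else 0) x = (if P then x else 0)" for P x by simp
  have "(\<Sum>l\<in>UNIV. sc ((if l = i then 1 else 0) - (if l = j then 1 else 0)) (h l)) = h i - h j"
    by (simp add: scale_left_diff_distrib sum_subtractf d)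
  then have "(if i = i then 1 else 0) - (if i = j then 1 else (0::'k)) = 0"
    using e by (intro h_independent[of "\<lambda>l. (if l = i then 1 else 0) - (if l = j then 1 else 0)"]) simp
  then show False using ne by simp
qed

lemma independent_h: "independent (range h)"
proof (rule independent_if_scalars_zero)
  fix f x assume s: "(\<Sum>x\<in>range h. sc (f x) x) = 0" and "x \<in> range h"
  then obtain i where x: "x = h i" by blast
  have "(\<Sum>i\<in>UNIV. sc (f (h i)) (h i)) = 0" using s by (simp add: sum.reindex[OF inj_h])
  then show "f x = 0" using h_independent[of "\<lambda>i. f (h i)" i] x by simp
qed simp

text \<open>Invertibility over the field makes the rank \<open>CARD('n)\<close>, so the dimension
  condition reads 2n - n = n and the independent \<open>h i\<close> form a basis.\<close>

lemma span_h:
  fixes B :: "int ^ 'n ^ 'n"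
  assumes B: "\<And>i j. (of_int ((B ** A) $ i $ j) :: 'k) = (if i = j then 1 else 0)"
  shows "span (range h) = UNIV"
proof -
  let ?A = "(\<chi> i j. of_int (A $ i $ j)) :: 'k ^ 'n ^ 'n"
  have "(\<chi> i j. of_int (B $ i $ j)) ** ?A = mat 1"
    using B by (simp add: vec_eq_iff matrix_matrix_mult_def mat_def)
  then have "vec.span (rows ?A) = UNIV" using matrix_left_invertible_span_rows_gen by blast
  then have "rank ?A = CARD('n)"
    unfolding row_rank_def_gen using vec.dim_span[of "rows ?A"] vec_dim_card[where 'a = 'k and 'n = 'n] by metis
  then have dim: "dim UNIV = CARD('n)" using dim_cartan by simp
  obtain C where C: "independent C" "UNIV \<subseteq> span C" "card C = CARD('n)"
    using basis_exists[of UNIV] dim by metis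
  then have fin: "finite C" using card_ge_0_finite[of C] by simp
  show ?thesis
  proof (rule ccontr)
    assume "span (range h) \<noteq> UNIV"
    then obtain v where v: "v \<notin> span (range h)" by blast
    then have "independent (insert v (range h))" by (rule independent_insertI) (rule independent_h)
    then have "card (insert v (range h)) \<le> CARD('n)"
      using independent_span_bound[OF fin, of "insert v (range h)"] C(2,3) by auto
    moreover have "v \<notin> range h" using v by (metis span_base)
    ultimately show False using card_image[OF inj_h] by simp
  qed
qed

lemma h_expand:
  assumes "span (range h) = UNIV"
  shows "\<exists>c. v = (\<Sum>i\<in>UNIV. sc (c i) (h i))"
proof -
  have "v \<in> range (\<lambda>u. \<Sum>x\<in>range h. sc (u x) x)"
    using assms span_finite[of "range h"] by auto
  then obtain u where "v = (\<Sum>x\<in>range h. sc (u x) x)" by blast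
  then show ?thesis by (intro exI[of _ "\<lambda>i. u (h i)"]) (simp add: sum.reindex[OF inj_h])
qed

end

definition e8_inverse :: "int ^ 8 ^ 8" where
  "e8_inverse = vector
     [vector [4, 5, 7, 10, 8, 6, 4, 2],
      vector [5, 8, 10, 15, 12, 9, 6, 3],
      vector [7, 10, 14, 20, 16, 12, 8, 4],
      vector [10, 15, 20, 30, 24, 18, 12, 6],
      vector [8, 12, 16, 24, 20, 15, 10, 5],
      vector [6, 9, 12, 18, 15, 12, 8, 4],
      vector [4, 6, 8, 12, 10, 8, 6, 3],
      vector [2, 3, 4, 6, 5, 4, 3, 2]]"

lemma e8_inverse: "e8_inverse ** e8_matrix = mat 1"
  by (simp add: vec_eq_iff forall_8 matrix_matrix_mult_def sum_8 mat_def e8_inverse_def e8_matrix_def vector_8)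

text \<open>The determinant of \<open>g36_matrix\<close> is 2. This is -2 times the rational
  inverse, so that the product reduces to the identity modulo 3.\<close>

definition g36_inverse :: "int ^ 4 ^ 4" where
  "g36_inverse = vector
     [vector [2, 2, - 2, - 2],
      vector [2, 0, 0, 0],
      vector [- 2, 0, 2, 2],
      vector [- 1, 0, 1, 0]]"

lemma vector_4:
  "(vector [a, b, c, e] :: 'a::zero ^ 4) $ 1 = a" "(vector [a, b, c, e] :: 'a ^ 4) $ 2 = b"
  "(vector [a, b, c, e] :: 'a ^ 4) $ 3 = c" "(vector [a, b, c, e] :: 'a ^ 4) $ 4 = e"
  unfolding vector_def by simp_all

lemma g36_inverse: "(g36_inverse ** g36_matrix) $ i $ j = (if i = j then - 2 else 0)"
proof -
  have "\<forall>i j. (g36_inverse ** g36_matrix) $ i $ j = (if i = j then - 2 else 0)"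
    by (simp add: forall_4 matrix_matrix_mult_def sum_4 g36_inverse_def g36_matrix_def vector_4)
  then show ?thesis by blast
qed

context e8_realization
begin

interpretation smult: vector_space smult
  by (rule smult_vector_space)

lemma cartan_expand: "\<exists>c. v = (\<Sum>i\<in>UNIV. sc (c i) (h i))"
  by (rule h_expand, rule span_h[of e8_inverse]) (simp add: e8_inverse mat_def)

lemma cvec_sum: "cvec (\<Sum>i\<in>I. f i) = (\<Sum>i\<in>I. cvec (f i))"
  by (induction I rule: infinite_finite_induct) auto

lemma jordan_decomposition_exists: "\<exists>xs ys zs. jordan_decomposition root_algebra dd xs ys zs"
proof -
  let ?B = "cvec ` range h \<union> rvec ` roots"
  have "x \<in> smult.span ?B" if "x \<in> carrier root_algebra" for x
    using that
  proof (induction rule: root_algebra_induct)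
    case (cartan v)
    obtain c where "v = (\<Sum>i\<in>UNIV. sc (c i) (h i))" using cartan_expand by blast
    then have "cvec v = (\<Sum>i\<in>UNIV. smult (c i) (cvec (h i)))" by (simp add: cvec_sum)
    then show ?case by (auto intro!: smult.span_sum smult.span_scale intro: smult.span_base)
  qed (auto intro: smult.span_base smult.span_add smult.span_scale)
  then show ?thesis using finite_roots by (intro d.jordan_exists[of ?B]) auto
qed

end

section \<open>The degree zero part\<close>

context e8_jordan
begin

interpretation smult: vector_space smult
  by (rule smult_vector_space)

definition nil_roots :: "(8 \<Rightarrow> 'k) \<Rightarrow> 'v \<times> (int ^ 8 \<Rightarrow> 'k)" where
  "nil_roots a = (\<Sum>l\<in>nil_nodes. smult (a l) (rvec (simple l)))"

definition nil_duals :: "(8 \<Rightarrow> 'k) \<Rightarrow> 'v \<times> (int ^ 8 \<Rightarrow> 'k)" where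
  "nil_duals b = (\<Sum>l\<in>nil_nodes. smult (b l) (rvec (- simple l)))"

definition nil_cartan :: "(8 \<Rightarrow> 'k) \<Rightarrow> 'v" where
  "nil_cartan b = (\<Sum>l\<in>nil_nodes. sc (b l) (h l))"

lemma nil_cong: "(\<And>l. l \<in> nil_nodes \<Longrightarrow> a l = b l) \<Longrightarrow> nil_roots a = nil_roots b"
    "(\<And>l. l \<in> nil_nodes \<Longrightarrow> a l = b l) \<Longrightarrow> nil_duals a = nil_duals b"
    "(\<And>l. l \<in> nil_nodes \<Longrightarrow> a l = b l) \<Longrightarrow> nil_cartan a = nil_cartan b"
  by (simp_all add: nil_roots_def nil_duals_def nil_cartan_def)

lemma nil_zero: "nil_roots (\<lambda>_. 0) = 0" "nil_duals (\<lambda>_. 0) = 0" "nil_cartan (\<lambda>_. 0) = 0"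
  by (simp_all add: nil_roots_def nil_duals_def nil_cartan_def)

lemma nil_carrier [simp]: "nil_roots a \<in> carrier root_algebra" "nil_duals b \<in> carrier root_algebra"
  unfolding nil_roots_def nil_duals_def by (rule L.carrier_sum, rule L.carrier_closed(3)[unfolded root_algebra_simps], simp)+

lemma nil_roots_coefficients: "fst (nil_roots a) = 0" "m \<in> nil_nodes \<Longrightarrow> snd (nil_roots a) (simple m) = a m"
  by (auto simp: nil_roots_def smult_def axis_eq_axis)

lemma \<alpha>_nil: "l \<in> nil_nodes \<Longrightarrow> m \<in> nil_nodes \<Longrightarrow> \<alpha> m (h l) = (if l = m then - 1 else 0)"
  using nil_orthogonal[of l m] root_self[OF simple_root, of l] \<alpha>_h[of m l] d.two
  unfolding form_simple by (cases "l = m") auto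

lemma \<alpha>_nil_cartan: "m \<in> nil_nodes \<Longrightarrow> \<alpha> m (nil_cartan b) = - b m"
proof -
  assume m: "m \<in> nil_nodes"
  have "\<alpha> m (nil_cartan b) = (\<Sum>l\<in>nil_nodes. b l * (if l = m then - 1 else 0))"
    unfolding nil_cartan_def \<alpha>_sum by (rule sum.cong) (simp_all only: \<alpha>_simps \<alpha>_nil[OF _ m])
  also have "\<dots> = - b m" using m by auto
  finally show ?thesis .
qed

lemma nil_cartan_independent: "nil_cartan b = 0 \<Longrightarrow> m \<in> nil_nodes \<Longrightarrow> b m = 0"
  using \<alpha>_nil_cartan[of m b] by (simp add: \<alpha>_simps)

text \<open>Up to sign, each of the four nodes gives a chain from the negative root vector through
  the coroot to the simple root vector. These are blocks of size 3; the common kernel of the four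
  simple roots in the Cartan subalgebra is the complement.\<close>

lemma dd_nil:
  "dd (nil_roots a) = 0" "dd (nil_duals b) = - cvec (nil_cartan b)"
  "dd (cvec v) = - nil_roots (\<lambda>l. \<alpha> l v)" "dd (cvec (nil_cartan b)) = nil_roots b"
proof -
  have s: "dd (\<Sum>l\<in>nil_nodes. smult (c l) (g l)) = (\<Sum>l\<in>nil_nodes. smult (c l) (dd (g l)))" for c g
    unfolding d.d_sum dd_linear(2) ..
  show "dd (nil_roots a) = 0" unfolding nil_roots_def s by (intro sum.neutral ballI) (simp add: dd_simple)
  show "dd (nil_duals b) = - cvec (nil_cartan b)"
    unfolding nil_duals_def nil_cartan_def s cvec_sum sum_negf[symmetric]
    by (rule sum.cong[OF refl]) (simp only: dd_neg_simple cvec_simps smult.scale_minus_right)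
  show v: "dd (cvec v) = - nil_roots (\<lambda>l. \<alpha> l v)" for v
    unfolding dd_cvec nil_roots_def by (simp add: add_ac)
  have "nil_roots (\<lambda>l. \<alpha> l (nil_cartan b)) = nil_roots (\<lambda>l. - b l)" by (rule nil_cong) (rule \<alpha>_nil_cartan)
  then show "dd (cvec (nil_cartan b)) = nil_roots b"
    unfolding v by (simp add: nil_roots_def smult.scale_minus_left sum_negf del: sum.insert)
qed

lemma gr_zero_cases:
  assumes "x \<in> gr 0"
  obtains v a b where "x = cvec v + nil_roots a + nil_duals b"
  using gr_zero_expand[OF assms] unfolding nil_roots_def[symmetric] nil_duals_def[symmetric] by blast

lemma zero_kerd:
  assumes x: "x \<in> gr 0" "x \<in> d.kerd"
  obtains v where "\<And>l. l \<in> nil_nodes \<Longrightarrow> \<alpha> l v = 0" "J.ev x = J.ev (cvec v)"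
proof -
  obtain v a b where e: "x = cvec v + nil_roots a + nil_duals b" using gr_zero_cases x(1) .
  have 0: "- nil_roots (\<lambda>l. \<alpha> l v) - cvec (nil_cartan b) = 0"
    using d.kerd_D(2)[OF x(2)] by (simp add: e dd_linear dd_nil)
  have "nil_cartan b = 0" using arg_cong[OF 0, of fst] by (simp add: nil_roots_coefficients)
  then have "nil_duals b = 0" using nil_cartan_independent nil_cong(2)[of b "\<lambda>_. 0"] nil_zero by metis
  then have "x = cvec v + dd (cvec (nil_cartan a))" by (simp add: e dd_nil(4))
  then have "J.ev x = J.ev (cvec v)" by (simp add: J.ev_linear)
  moreover have "\<alpha> l v = 0" if "l \<in> nil_nodes" for l
    using arg_cong[OF 0, of "\<lambda>x. snd x (simple l)"] nil_roots_coefficients(2)[OF that, of "\<lambda>l. \<alpha> l v"] by simp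
  ultimately show ?thesis using that by blast
qed

lemma zero_kerdd:
  assumes x: "x \<in> gr 0" "x \<in> d.kerdd"
  shows "J.od x = 0"
proof -
  obtain v a b where e: "x = cvec v + nil_roots a + nil_duals b" using gr_zero_cases x(1) .
  have "dd x = - nil_roots (\<lambda>l. \<alpha> l v) - cvec (nil_cartan b)" by (simp add: e dd_linear dd_nil(1,2) dd_nil(3)[of v])
  then have 0: "nil_roots b = 0" using d.kerdd_D(2)[OF x(2)] by (simp add: dd_linear dd_nil(1,4))
  have "b l = 0" if "l \<in> nil_nodes" for l
    using arg_cong[OF 0, of "\<lambda>x. snd x (simple l)"] nil_roots_coefficients(2)[OF that, of b] by simp
  then have b: "nil_duals b = 0" using nil_cong(2)[of b "\<lambda>_. 0"] nil_zero by metis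
  \<comment> \<open>Adding this combination of the four coroots moves \<open>v\<close> into the
    common kernel, since each root takes the value 2 = -1 on its coroot. The correction is exact, so
    \<open>od\<close> does not see it.\<close>
  let ?c = "\<lambda>l. \<alpha> l v" and ?k = "cvec v + cvec (nil_cartan (\<lambda>l. \<alpha> l v))"
  have k: "?k \<in> d.kerd" by (rule d.kerd_I) (simp_all add: dd_linear dd_nil(3)[of v] dd_nil(4))
  have "cvec (nil_cartan ?c) = - dd (nil_duals ?c)" by (simp add: dd_nil)
  then have c: "J.od (cvec (nil_cartan ?c)) = 0" by (simp add: J.od_uminus)
  have "J.od ?k = J.od (cvec v) + J.od (cvec (nil_cartan ?c))" by (simp add: J.od_linear)
  then have "J.od (cvec v) = 0" using J.od_kerd[OF k] c by simp
  moreover have "J.od x = J.od (cvec v) + J.od (dd (cvec (nil_cartan a)))"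
    by (simp add: e b dd_nil(4) J.od_linear)
  ultimately show ?thesis by simp
qed

lemma cartan_kerd: "(\<And>l. l \<in> nil_nodes \<Longrightarrow> \<alpha> l v = 0) \<Longrightarrow> cvec v \<in> d.kerd"
  using nil_cong(1)[of "\<lambda>l. \<alpha> l v" "\<lambda>_. 0"] by (intro d.kerd_I) (simp_all add: dd_nil(3) nil_zero)

text \<open>An exact Cartan element lies in the span of the four coroots, on which the four simple
  roots have no common zero except 0.\<close>

lemma cartan_ev_inj:
  assumes v: "\<And>l. l \<in> nil_nodes \<Longrightarrow> \<alpha> l v = 0" and 0: "J.ev (cvec v) = 0"
  shows "v = 0"
proof -
  obtain u where u: "u \<in> carrier root_algebra" "cvec v = dd u"
    using J.ev_zero_kerd[OF cartan_kerd[OF v] 0] by blast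
  obtain v' a b where e: "pr 0 u = cvec v' + nil_roots a + nil_duals b" using gr_zero_cases pr_gr[OF u(1)] .
  have "cvec v = dd (pr 0 u)" using pr_dd[OF u(1), of 0] pr_id[OF cvec_gr, of v] u(2) by simp
  then have *: "cvec v = - nil_roots (\<lambda>l. \<alpha> l v') - cvec (nil_cartan b)" by (simp add: e dd_linear dd_nil)
  have v': "v = - nil_cartan b" using arg_cong[OF *, of fst] by (simp add: nil_roots_coefficients)
  have "b l = 0" if "l \<in> nil_nodes" for l
    using v[OF that] \<alpha>_nil_cartan[OF that, of b] by (simp add: v' \<alpha>_simps)
  then show ?thesis using nil_cong(3)[of b "\<lambda>_. 0"] nil_zero v' by (metis minus_zero)
qed

section \<open>The Lie superalgebra structure\<close>

definition degrees :: "(int ^ 4) set" where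
  "degrees = insert 0 (qdeg ` roots)"

lemma finite_degrees: "finite degrees"
  by (simp add: degrees_def finite_roots)

lemma pr_decompose:
  assumes x: "x \<in> carrier root_algebra"
  shows "x = (\<Sum>q\<in>degrees. pr q x)"
proof (intro prod_eqI ext)
  show "fst x = fst (\<Sum>q\<in>degrees. pr q x)"
    using finite_degrees by (simp add: fst_sum pr_def) (simp add: degrees_def)
  show "snd x g = snd (\<Sum>q\<in>degrees. pr q x) g" for g
  proof -
    have "snd (\<Sum>q\<in>degrees. pr q x) g = (if qdeg g \<in> degrees then snd x g else 0)"
      using finite_degrees by (simp add: snd_sum pr_def)
    then show ?thesis using x by (auto simp: in_carrier degrees_def)
  qed
qed

lemma pr_kerd: "x \<in> d.kerd \<Longrightarrow> pr q x \<in> d.kerd"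
  using pr_gr[of x q] gr_carrier pr_dd[of x q] by (intro d.kerd_I) (auto simp: pr_linear)

lemma pr_kerdd: "x \<in> d.kerdd \<Longrightarrow> pr q x \<in> d.kerdd"
  using pr_gr[of x q] gr_carrier pr_dd[of x q] pr_dd[of "dd x" q] by (intro d.kerdd_I) (auto simp: pr_linear)

lemma ker_closed: "x \<in> d.kerd \<Longrightarrow> y \<in> d.kerd \<Longrightarrow> x + y \<in> d.kerd" "x \<in> d.kerdd \<Longrightarrow> y \<in> d.kerdd \<Longrightarrow> x + y \<in> d.kerdd"
    "x \<in> d.kerd \<Longrightarrow> smult c x \<in> d.kerd" "x \<in> d.kerdd \<Longrightarrow> smult c x \<in> d.kerdd"
  using L.carrier_closed(3)[unfolded root_algebra_simps, of x c]
  by (auto intro!: d.kerd_I d.kerdd_I simp: dd_linear)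

lemma ker_sum: "(\<And>i. i \<in> I \<Longrightarrow> f i \<in> d.kerd) \<Longrightarrow> (\<Sum>i\<in>I. f i) \<in> d.kerd"
    "(\<And>i. i \<in> I \<Longrightarrow> f i \<in> d.kerdd) \<Longrightarrow> (\<Sum>i\<in>I. f i) \<in> d.kerdd"
  by (induction I rule: infinite_finite_induct) (auto simp: zero_ker intro: ker_closed)

lemma ev_sum: "(\<And>i. i \<in> I \<Longrightarrow> f i \<in> carrier root_algebra) \<Longrightarrow> J.ev (\<Sum>i\<in>I. f i) = (\<Sum>i\<in>I. J.ev (f i))"
    "(\<And>i. i \<in> I \<Longrightarrow> f i \<in> carrier root_algebra) \<Longrightarrow> J.od (\<Sum>i\<in>I. f i) = (\<Sum>i\<in>I. J.od (f i))"
  by (induction I rule: infinite_finite_induct) (auto simp: J.ev_linear J.od_linear)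

definition cube :: "'v \<times> (int ^ 8 \<Rightarrow> 'k) \<Rightarrow> nat \<Rightarrow> 'k" where
  "cube x = J.od (root_bracket x (d.odd_bracket x x))"

text \<open>Additivity is the Jacobi identity together with \<open>3 = 0\<close>.\<close>

lemma cube_add:
  assumes x: "x \<in> d.kerdd" and y: "y \<in> d.kerdd"
  shows "cube (x + y) = cube x + cube y"
proof -
  have c: "x \<in> carrier root_algebra" "y \<in> carrier root_algebra" using x y by simp_all
  define T where "T u v w = J.od (root_bracket u (d.odd_bracket v w))" for u v w
  have br: "bracket root_algebra = root_bracket" by simp
  have m: "J.od (root_bracket (d.odd_bracket u u) w) = - T w u u" if "u \<in> carrier root_algebra" "w \<in> carrier root_algebra" for u w
  proof -
    have "root_bracket (d.odd_bracket u u) w = - root_bracket w (d.odd_bracket u u)"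
      using d.anti[of w "d.odd_bracket u u"] that J.odd_bracket_carrier unfolding br by auto
    then show ?thesis using that L.carrier_closed(6)[of w "d.odd_bracket u u"] J.odd_bracket_carrier
      by (simp add: T_def J.od_uminus)
  qed
  have com: "d.odd_bracket y x = d.odd_bracket x y" by (rule J.odd_bracket_commute[OF c])
  have P: "T x x y + T y x x + T x x y = 0"
    using J.odd_jacobi[OF x x y] m[OF c] unfolding br by (simp add: T_def)
  have Q: "T y x y + T x y y + T y x y = 0"
    using J.odd_jacobi[OF y y x] m[OF c(2,1)] unfolding br com by (simp add: T_def com)
  have add: "T (u + u') v w = T u v w + T u' v w" "T u (v + v') w = T u v w + T u v' w" "T u v (w + w') = T u v w + T u v w'"
    if "u \<in> carrier root_algebra" "u' \<in> carrier root_algebra" "v \<in> carrier root_algebra" "v' \<in> carrier root_algebra"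
      "w \<in> carrier root_algebra" "w' \<in> carrier root_algebra" for u u' v v' w w'
    using that L.carrier_closed(6)[unfolded br] J.odd_bracket_carrier
    by (simp_all add: T_def root_bracket_bilinear J.odd_bracket_linear J.od_linear)
  have xy: "x + y \<in> carrier root_algebra" using c by simp
  have "T (x + y) (x + y) (x + y) = T x x x + T x x y + (T x y x + T x y y) + (T y x x + T y x y + (T y y x + T y y y))"
    using c xy by (simp add: add)
  also have "\<dots> = T x x x + T y y y + (T x x y + T y x x + T x x y) + (T y x y + T x y y + T y x y)"
    by (simp add: T_def com add_ac)
  finally show ?thesis unfolding P Q by (simp add: cube_def T_def)
qed

text \<open>The cube has three times the degree of \<open>x\<close>, where the root algebra vanishes
  by \<open>check_triple\<close>. In degree 0 the odd part is already zero.\<close>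

lemma cube_gr:
  assumes x: "x \<in> gr q" "x \<in> d.kerdd"
  shows "cube x = 0"
proof (cases "q = 0")
  case True
  then have "J.od x = 0" using zero_kerdd x by blast
  then show ?thesis unfolding cube_def using J.S_odd_cube[OF x(2)]
      linear_superalgebra.bracket_zero(1)[OF J.S_linear] by simp
next
  case False
  obtain p where q: "q = vec4 p" using vec4_surj by blast
  show ?thesis
  proof (cases "degree_quad p")
    case True
    then have "known_degree p" by (rule known_degree)
    moreover have "quad_scale (- 3) (quad_scale (- 1) p) = quad_scale 3 p" by (cases p) simp
    ultimately have "\<not> degree_quad (quad_scale 3 p)"
      using check_triple unfolding known_degree_def list_all_iff by metis
    moreover have "quad_scale 3 p \<noteq> Quad 0 0 0 0" using False unfolding q vec4_zero by (cases p) auto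
    moreover have "root_bracket x (d.odd_bracket x x) \<in> gr (vec4 (quad_scale 3 p))"
    proof -
      have "quad_scale 3 p = quad_add p (quad_add p p)" by (cases p) simp
      then have e: "vec4 (quad_scale 3 p) = q + (q + q)" by (simp add: vec4_add q)
      have "d.odd_bracket x x \<in> gr (q + q)" unfolding d.odd_bracket_def root_algebra_simps
        using gr_bracket[OF x(1) dd_gr[OF x(1)]] gr_bracket[OF dd_gr[OF x(1)] x(1)] gr_closed(4) by blast
      then show ?thesis unfolding e using gr_bracket x(1) by blast
    qed
    ultimately have "root_bracket x (d.odd_bracket x x) = 0" using gr_zero_unless by blast
    then show ?thesis by (simp add: cube_def)
  next
    case notdeg: False
    have "p \<noteq> Quad 0 0 0 0" using False by (simp add: q vec4_zero)
    then have "x = 0" using gr_zero_unless notdeg x(1) unfolding q by blast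
    then show ?thesis by (simp add: cube_def L.bracket_zero[simplified])
  qed
qed

text \<open>Additivity reduces the cube, which is not linear by its definition, to the homogeneous
  components.\<close>

lemma cube_zero:
  assumes x: "x \<in> d.kerdd"
  shows "cube x = 0"
proof -
  have "cube (\<Sum>q\<in>Q. pr q x) = 0" for Q
  proof (induction Q rule: infinite_finite_induct)
    case (insert q Q)
    have "pr q x \<in> d.kerdd" "(\<Sum>q\<in>Q. pr q x) \<in> d.kerdd" using x by (auto intro: pr_kerdd ker_sum)
    then show ?case using insert cube_gr[of "pr q x" q] pr_gr[of x q] x by (simp add: cube_add)
  qed (use cube_gr[of 0 0] gr_closed(1) zero_ker in auto)
  then show ?thesis using pr_decompose[of x] x by (metis d.kerdd_D(1))
qed

section \<open>The graded Lie superalgebra structure\<close>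

sublocale S: lie_superalgebra J.S
  by (rule J.S_lie) (use cube_zero in \<open>simp add: cube_def\<close>)

lemma G_cases:
  assumes "x \<in> G q"
  obtains a b where "a \<in> gr q" "a \<in> d.kerd" "b \<in> gr q" "b \<in> d.kerdd" "x = J.ev a + J.od b"
  using assms by (auto simp: G_def)

lemma G_I: "a \<in> gr q \<Longrightarrow> a \<in> d.kerd \<Longrightarrow> b \<in> gr q \<Longrightarrow> b \<in> d.kerdd \<Longrightarrow> J.ev a + J.od b \<in> G q"
  unfolding G_def by blast

lemma G_subspace: "S.subspace (G q)"
proof (rule S.subspaceI)
  show "0 \<in> G q" using G_ev[of 0 q] gr_closed(1) zero_ker by simp
  fix x y assume "x \<in> G q" "y \<in> G q"
  then obtain a b a' b' where *: "a \<in> gr q" "a \<in> d.kerd" "b \<in> gr q" "b \<in> d.kerdd" "x = J.ev a + J.od b"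
    "a' \<in> gr q" "a' \<in> d.kerd" "b' \<in> gr q" "b' \<in> d.kerdd" "y = J.ev a' + J.od b'"
    by (elim G_cases)
  then have "x + y = J.ev (a + a') + J.od (b + b')" by (simp add: J.ev_linear J.od_linear)
  then show "x + y \<in> G q" using * by (simp add: G_I gr_closed ker_closed)
next
  fix c x assume "x \<in> G q"
  then obtain a b where *: "a \<in> gr q" "a \<in> d.kerd" "b \<in> gr q" "b \<in> d.kerdd" "x = J.ev a + J.od b"
    by (elim G_cases)
  have "scale J.S c x = J.ev (smult c a) + J.od (smult c b)"
    using * J.ev_linear(2)[of a c] J.od_linear(2)[of b c] by (simp add: J.S_simps fun_eq_iff algebra_simps)
  then show "scale J.S c x \<in> G q" using * by (simp add: G_I gr_closed ker_closed)
qed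

lemma G_bracket:
  assumes "x \<in> G p" "y \<in> G q"
  shows "bracket J.S x y \<in> G (p + q)"
proof -
  obtain a b where x: "a \<in> gr p" "a \<in> d.kerd" "b \<in> gr p" "b \<in> d.kerdd" "x = J.ev a + J.od b"
    using assms(1) by (elim G_cases)
  obtain a' b' where y: "a' \<in> gr q" "a' \<in> d.kerd" "b' \<in> gr q" "b' \<in> d.kerdd" "y = J.ev a' + J.od b'"
    using assms(2) by (elim G_cases)
  have br: "bracket root_algebra = root_bracket" by simp
  have "J.ev (root_bracket a a') \<in> G (p + q)" "J.od (root_bracket a b') \<in> G (p + q)" "J.od (root_bracket b a') \<in> G (p + q)"
    using x y d.bracket_kerd[of a a'] d.bracket_kerd_kerdd[of a b'] d.bracket_kerd_kerdd[of a' b]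
    unfolding br by (auto intro!: G_ev G_od gr_bracket)
  moreover have "J.ev (d.odd_bracket b b') \<in> G (p + q)"
    using gr_bracket[OF dd_gr[OF x(3)] y(3)] gr_bracket[OF x(3) dd_gr[OF y(3)]] d.odd_bracket_kerd[OF x(4) y(4)]
    unfolding d.odd_bracket_def br by (intro G_ev gr_closed(4))
  moreover have "bracket J.S x y = J.ev (root_bracket a a') + J.od (root_bracket a b')
      + (J.od (root_bracket b a') + J.ev (d.odd_bracket b b'))"
    unfolding x(5) y(5) S.bracket_add_left S.bracket_add_right
    using J.ev_bracket[OF x(2) y(2)] J.od_bracket(1)[OF x(2) y(4)] J.od_bracket(2)[OF y(2) x(4)] J.odd_bracket[OF x(4) y(4)]
    unfolding br by simp
  ultimately show ?thesis using S.subspace_add[OF G_subspace] by metis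
qed

lemma ev_od_zero: "J.ev a + J.od b = 0 \<Longrightarrow> J.ev a = 0 \<and> J.od b = 0"
proof -
  assume s: "J.ev a + J.od b = 0"
  have "J.ev a k = 0 \<and> J.od b k = 0" for k
    using fun_cong[OF s, of k] by (cases "k < J.n1") (simp_all add: J.ev_def J.od_def)
  then show ?thesis by (simp add: fun_eq_iff)
qed

text \<open>A vanishing sum of classes yields a single primitive, for the odd part up to a kernel
  element. Projecting these witnesses to degree \<open>p\<close> shows that the class in that degree
  vanishes.\<close>

lemma G_independent:
  assumes fin: "finite Q" and g: "\<And>q. q \<in> Q \<Longrightarrow> g q \<in> G q" and sum: "(\<Sum>q\<in>Q. g q) = 0" and p: "p \<in> Q"
  shows "g p = 0"
proof -
  have "\<forall>q. \<exists>a b. q \<in> Q \<longrightarrow> a \<in> gr q \<and> a \<in> d.kerd \<and> b \<in> gr q \<and> b \<in> d.kerdd \<and> g q = J.ev a + J.od b"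
    using G_cases[OF g] by metis
  then obtain a b where ab: "\<And>q. q \<in> Q \<Longrightarrow> a q \<in> gr q" "\<And>q. q \<in> Q \<Longrightarrow> a q \<in> d.kerd" "\<And>q. q \<in> Q \<Longrightarrow> b q \<in> gr q"
    "\<And>q. q \<in> Q \<Longrightarrow> b q \<in> d.kerdd" "\<And>q. q \<in> Q \<Longrightarrow> g q = J.ev (a q) + J.od (b q)" by metis
  have "J.ev (\<Sum>q\<in>Q. a q) + J.od (\<Sum>q\<in>Q. b q) = 0"
    using sum ab by (simp add: ev_sum sum.distrib[symmetric])
  then have z: "J.ev (\<Sum>q\<in>Q. a q) = 0" "J.od (\<Sum>q\<in>Q. b q) = 0" using ev_od_zero by blast+
  have pr: "pr p (\<Sum>q\<in>Q. f q) = f p" if f: "\<And>q. q \<in> Q \<Longrightarrow> f q \<in> gr q" for f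
  proof -
    have "pr p (\<Sum>q\<in>Q. f q) = (\<Sum>q\<in>Q. if q = p then f p else 0)"
      unfolding pr_sum by (rule sum.cong[OF refl]) (simp add: pr_id[OF f] pr_other[OF f] p)
    then show ?thesis using fin p by simp
  qed
  obtain u where u: "u \<in> carrier root_algebra" "(\<Sum>q\<in>Q. a q) = dd u"
    using J.ev_zero_kerd[OF _ z(1)] ker_sum(1) ab(2) by blast
  have "a p = dd (pr p u)" using pr[of a] ab(1) u pr_dd by metis
  then have A: "J.ev (a p) = 0" using pr_gr[OF u(1)] gr_carrier by (metis J.ev_d)
  obtain k w where w: "k \<in> d.kerd" "w \<in> carrier root_algebra" "(\<Sum>q\<in>Q. b q) = k + dd w"
    using J.od_zero_kerdd[OF _ z(2)] ker_sum(2) ab(4) by blast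
  have "b p = pr p k + dd (pr p w)" using pr[of b] ab(3) w pr_dd by (simp add: pr_linear)
  moreover have "pr p w \<in> carrier root_algebra" using pr_gr[OF w(2)] gr_carrier by blast
  ultimately have "J.od (b p) = 0" using J.od_kerd[OF pr_kerd[OF w(1), of p]] pr_kerd[OF w(1), of p]
    by (simp add: J.od_linear)
  then show ?thesis using ab(5)[OF p] A by simp
qed

lemma G_zero:
  assumes "x \<in> G 0"
  obtains v where "\<And>l. l \<in> nil_nodes \<Longrightarrow> \<alpha> l v = 0" "x = J.ev (cvec v)"
proof -
  obtain a b where ab: "a \<in> gr 0" "a \<in> d.kerd" "b \<in> gr 0" "b \<in> d.kerdd" "x = J.ev a + J.od b"
    using assms by (elim G_cases)
  obtain v where v: "\<And>l. l \<in> nil_nodes \<Longrightarrow> \<alpha> l v = 0" "J.ev a = J.ev (cvec v)" using zero_kerd[OF ab(1,2)] by blast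
  then show ?thesis using zero_kerdd[OF ab(3,4)] that[OF v(1)] ab(5) by simp
qed

lemma carrier_G:
  assumes T: "S.subspace T" and G: "\<And>q. G q \<subseteq> T"
  shows "carrier J.S \<subseteq> T"
proof
  fix x assume "x \<in> carrier J.S"
  then obtain u v where uv: "u \<in> part J.S 0" "v \<in> part J.S 1" "x = u + v" using S.part_decomp by blast
  then obtain a b where ab: "a \<in> d.kerd" "u = J.ev a" "b \<in> d.kerdd" "v = J.od b"
    unfolding J.part_S_even J.part_S_odd by blast
  have c: "a \<in> carrier root_algebra" "b \<in> carrier root_algebra" using ab by simp_all
  have "J.ev (pr q a) \<in> T" "J.od (pr q b) \<in> T" for q
    using G_ev[OF pr_gr[OF c(1)] pr_kerd[OF ab(1)], of q] G_od[OF pr_gr[OF c(2)] pr_kerdd[OF ab(3)], of q] G by blast+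
  then have "J.ev (\<Sum>q\<in>degrees. pr q a) \<in> T" "J.od (\<Sum>q\<in>degrees. pr q b) \<in> T"
    using gr_carrier[OF pr_gr[OF c(1)]] gr_carrier[OF pr_gr[OF c(2)]]
    by (simp_all add: ev_sum) (rule S.subspace_sum[OF T], blast)+
  then have "J.ev a \<in> T" "J.od b \<in> T" using pr_decompose[OF c(1)] pr_decompose[OF c(2)] by simp_all
  then show "x \<in> T" unfolding uv(3) ab using S.subspace_add[OF T] by metis
qed

end

section \<open>The model of g(3,6)\<close>

definition unit4 :: "4 \<Rightarrow> quad" where
  "unit4 i = (if i = 1 then Quad 1 0 0 0 else if i = 2 then Quad 0 1 0 0 else if i = 3 then Quad 0 0 1 0 else Quad 0 0 0 1)"

text \<open>The signs put into the lowering generators so that the computed coroots yield the rows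
  of \<open>g36_matrix\<close> and not their negatives.\<close>

definition sign4 :: "4 \<Rightarrow> int" where
  "sign4 i = (if i = 1 \<or> i = 2 then - 1 else 1)"

definition cartan4 :: "4 \<Rightarrow> oct" where
  "cartan4 i = (if i = 1 then Oct 1 0 2 0 0 0 0 0 else if i = 2 then Oct 0 1 0 2 0 0 0 0
     else if i = 3 then Oct 0 0 0 0 (- 2) (- 1) 0 0 else Oct 0 0 0 0 0 1 2 1)"

definition index8 :: "4 \<Rightarrow> 8" where
  "index8 i = (if i = 1 then 3 else if i = 2 then 4 else if i = 3 then 5 else 7)"

definition oct4 :: "4 \<Rightarrow> oct" where
  "oct4 i = (if i = 1 then Oct 0 0 1 0 0 0 0 0 else if i = 2 then Oct 0 0 0 1 0 0 0 0
     else if i = 3 then Oct 0 0 0 0 1 0 0 0 else Oct 0 0 0 0 0 0 1 0)"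

lemma vec8_oct4: "vec8 (oct4 i) = axis (index8 i) 1"
  using exhaust_4[of i] by (auto simp: oct4_def index8_def vec8_axis)

lemma sign4_square: "sign4 i * sign4 i = 1"
  by (simp add: sign4_def)

lemma vec4_unit: "vec4 (unit4 i) = axis i 1"
  using exhaust_4[of i] by (auto simp: unit4_def vec_eq_iff forall_4 axis_def vec4.simps)

lemma unit4_quad_units: "unit4 i \<in> set quad_units"
  by (auto simp: unit4_def quad_units_def)

lemma quad_units_unit4: "q \<in> set quad_units \<Longrightarrow> \<exists>i. q = unit4 i"
proof -
  assume "q \<in> set quad_units"
  moreover have "unit4 1 = Quad 1 0 0 0" "unit4 2 = Quad 0 1 0 0" "unit4 3 = Quad 0 0 1 0" "unit4 4 = Quad 0 0 0 1"
    by (simp_all add: unit4_def)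
  ultimately show ?thesis unfolding quad_units_def by (auto dest: sym)
qed

lemma quad_unit_unit4: "n < 4 \<Longrightarrow> \<exists>i. \<forall>s. quad_unit n s = quad_scale s (unit4 i)"
proof -
  assume "n < 4"
  then consider "n = 0" | "n = 1" | "n = 2" | "n = 3" by linarith
  then show ?thesis
  proof cases
    case 1 then show ?thesis by (intro exI[of _ 1]) (simp add: unit4_def)
  next
    case 2 then show ?thesis by (intro exI[of _ 2]) (simp add: unit4_def)
  next
    case 3 then show ?thesis by (intro exI[of _ 3]) (simp add: unit4_def)
  next
    case 4 then show ?thesis by (intro exI[of _ 4]) (simp add: unit4_def)
  qed
qed

lemma degree_unit4: "degree_quad (unit4 i)" "degree_quad (quad_scale (- 1) (unit4 i))"
  using check_units unit4_quad_units[of i] unfolding list_all_iff by blast+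

lemma degree_unit4_difference: "i \<noteq> j \<Longrightarrow> \<not> degree_quad (quad_add (unit4 i) (quad_scale (- 1) (unit4 j)))
    \<and> quad_add (unit4 i) (quad_scale (- 1) (unit4 j)) \<noteq> Quad 0 0 0 0"
proof -
  have "\<forall>i j. i \<noteq> j \<longrightarrow> \<not> degree_quad (quad_add (unit4 i) (quad_scale (- 1) (unit4 j)))
    \<and> quad_add (unit4 i) (quad_scale (- 1) (unit4 j)) \<noteq> Quad 0 0 0 0"
    unfolding forall_4 by (simp add: unit4_def degree_quad_def)
  then show "i \<noteq> j \<Longrightarrow> ?thesis" by blast
qed

lemma quad_odd_uminus: "quad_odd (quad_scale (- 1) q) = quad_odd q"
  by (cases q) auto

lemma quad_odd_unit4: "g36_parity i = (if quad_odd (unit4 i) then 1 else 0)"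
  using exhaust_4[of i] by (auto simp: g36_parity_def unit4_def)

lemma super_cartan_unit4:
  "super_cartan (unit4 i) (quad_scale (- 1) (unit4 i)) = cartan4 i"
  "super_bracket (unit4 i) (quad_scale (- 1) (unit4 i)) = []"
  using exhaust_4[of i] by (auto simp: unit4_def cartan4_def super_cartan_units)

lemma cartan4_entries: "3 dvd sign4 i * oct_form (oct4 j) (cartan4 i) - g36_matrix $ i $ j"
proof -
  have "\<forall>i j. 3 dvd sign4 i * oct_form (oct4 j) (cartan4 i) - g36_matrix $ i $ j"
    unfolding forall_4 by (simp add: sign4_def oct4_def cartan4_def oct_form_def g36_matrix_def vector_4)
  then show ?thesis by blast
qed

lemma abs_height_vec4: "abs_height (vec4 q) = nat (quad_height q)"
  by (cases q) (simp add: abs_height_def sum_4 vec4.simps nat_add_distrib)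

lemma quad_height_nonneg: "quad_height q \<ge> 0"
  by (cases q) simp

locale e8_g36 = e8_jordan sc h \<alpha> xs ys zs + R: realization sc4 g36_matrix h4 \<alpha>4
  for sc :: "'k::field \<Rightarrow> 'v::ab_group_add \<Rightarrow> 'v" and h :: "8 \<Rightarrow> 'v" and \<alpha> :: "8 \<Rightarrow> 'v \<Rightarrow> 'k"
    and xs ys zs :: "('v \<times> (int ^ 8 \<Rightarrow> 'k)) list"
    and sc4 :: "'k \<Rightarrow> 'w::ab_group_add \<Rightarrow> 'w" and h4 :: "4 \<Rightarrow> 'w" and \<alpha>4 :: "4 \<Rightarrow> 'w \<Rightarrow> 'k"
begin

interpretation smult: vector_space smult
  by (rule smult_vector_space)

text \<open>The elements [E_i, F_i], lifted to the Cartan subalgebra of e8. Reduced modulo 3 they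
  are the combinations in \<open>t_simps\<close>.\<close>

definition t :: "4 \<Rightarrow> 'v" where
  "t i = sc (of_int (sign4 i)) (coroot (vec8 (cartan4 i)))"

lemma \<alpha>_coroot: "\<alpha> l (coroot g) = of_int (form (simple l) g)"
  using weight_coroot[of "simple l" g] by simp

lemma \<alpha>_nil_t: "l \<in> nil_nodes \<Longrightarrow> \<alpha> l (t i) = 0"
proof -
  assume l: "l \<in> nil_nodes"
  have "form (simple l) (vec8 (cartan4 i)) = 0"
    using l exhaust_4[of i] by (auto simp: cartan4_def form_nil_vec8)
  then show ?thesis by (simp add: t_def \<alpha>_simps \<alpha>_coroot)
qed

lemma \<alpha>_t: "\<alpha> (index8 j) (t i) = of_int (g36_matrix $ i $ j)"
proof -
  have "\<alpha> (index8 j) (t i) = of_int (sign4 i * oct_form (oct4 j) (cartan4 i))"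
    unfolding t_def \<alpha>_simps \<alpha>_coroot vec8_oct4[symmetric] form_vec8 by simp
  moreover have "(of_int (sign4 i * oct_form (oct4 j) (cartan4 i) - g36_matrix $ i $ j) :: 'k) = 0"
    unfolding of_int_eq_0_iff_char_dvd char_three using cartan4_entries by simp
  ultimately show ?thesis by simp
qed

lemma t_simps: "t 1 = h 3 - h 1" "t 2 = h 4 - h 2" "t 3 = h 5 - h 6" "t 4 = h 6 - h 7 + h 8"
  by (simp_all add: t_def sign4_def cartan4_def coroot_def sum_8 vec8.simps d.two)

lemma h4_expand: "\<exists>c. w = (\<Sum>i\<in>UNIV. sc4 (c i) (h4 i))"
  by (rule R.h_expand, rule R.span_h[of g36_inverse]) (simp add: g36_inverse d.two)

lemma tau_exists: "\<exists>\<tau>. Vector_Spaces.linear sc4 sc \<tau> \<and> (\<forall>i. \<tau> (h4 i) = t i)"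
proof -
  interpret vp: vector_space_pair sc4 sc ..
  obtain g where g: "Vector_Spaces.linear sc4 sc g" "\<forall>x\<in>range h4. g x = t (inv h4 x)"
    using vp.linear_independent_extend[where f = "\<lambda>x. t (inv h4 x)", OF R.independent_h] by blast
  then have "g (h4 i) = t i" for i by (simp add: inv_f_f[OF R.inj_h])
  then show ?thesis using g(1) by blast
qed

text \<open>It identifies the Cartan subalgebra of the given realization of g(3,6) with the common
  kernel of the simple roots 1, 2, 6, 8; the roots 3, 4, 5, 7 restrict to its simple roots.\<close>

definition \<tau> :: "'w \<Rightarrow> 'v" where
  "\<tau> = (SOME \<tau>. Vector_Spaces.linear sc4 sc \<tau> \<and> (\<forall>i. \<tau> (h4 i) = t i))"

lemma tau: "Vector_Spaces.linear sc4 sc \<tau>" "\<tau> (h4 i) = t i"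
  using someI_ex[OF tau_exists] unfolding \<tau>_def by blast+

interpretation tau: Vector_Spaces.linear sc4 sc \<tau>
  by (rule tau)

lemma tau_sum: "\<tau> (\<Sum>i\<in>UNIV. sc4 (c i) (h4 i)) = (\<Sum>i\<in>UNIV. sc (c i) (t i))"
  by (simp add: tau.sum tau.scale tau(2))

lemma \<alpha>4_sum: "\<alpha>4 j (\<Sum>i\<in>UNIV. sc4 (c i) (h4 i)) = (\<Sum>i\<in>UNIV. c i * of_int (g36_matrix $ i $ j))"
proof -
  interpret l: Vector_Spaces.linear sc4 "(*)" "\<alpha>4 j" by (rule R.\<alpha>_linear)
  show ?thesis by (simp add: l.sum l.scale R.\<alpha>_h)
qed

lemma \<alpha>_tau: "\<alpha> (index8 j) (\<tau> w) = \<alpha>4 j w"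
  using h4_expand[of w] by (auto simp: tau_sum \<alpha>4_sum \<alpha>_sum \<alpha>_simps \<alpha>_t)

lemma \<alpha>_nil_tau: "l \<in> nil_nodes \<Longrightarrow> \<alpha> l (\<tau> w) = 0"
proof -
  assume l: "l \<in> nil_nodes"
  obtain c where "w = (\<Sum>i\<in>UNIV. sc4 (c i) (h4 i))" using h4_expand by blast
  then show ?thesis by (simp only: tau_sum \<alpha>_sum \<alpha>_simps \<alpha>_nil_t[OF l]) simp
qed

lemma tau_inj: "\<tau> w = 0 \<Longrightarrow> w = 0"
proof -
  assume 0: "\<tau> w = 0"
  obtain c where w: "w = (\<Sum>i\<in>UNIV. sc4 (c i) (h4 i))" using h4_expand by blast
  have e: "(\<Sum>i\<in>UNIV. c i * of_int (g36_matrix $ i $ j)) = 0" for j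
    using \<alpha>_tau[of j w] unfolding 0 \<alpha>_simps by (simp add: w \<alpha>4_sum)
  have "c 2 = 0" using e[of 1] by (simp add: sum_4 g36_matrix_def vector_4)
  moreover have "c 4 = 0" using e[of 3] \<open>c 2 = 0\<close> by (simp add: sum_4 g36_matrix_def vector_4)
  moreover have "c 3 = 0" using e[of 4] \<open>c 4 = 0\<close> by (simp add: sum_4 g36_matrix_def vector_4 d.two)
  moreover have "c 1 = 0" using e[of 2] \<open>c 3 = 0\<close> by (simp add: sum_4 g36_matrix_def vector_4)
  ultimately show "w = 0" by (simp add: w sum_4)
qed

lemma tau_surj: "(\<And>l. l \<in> nil_nodes \<Longrightarrow> \<alpha> l v = 0) \<Longrightarrow> v \<in> range \<tau>"
proof -
  assume nil: "\<And>l. l \<in> nil_nodes \<Longrightarrow> \<alpha> l v = 0"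
  obtain a where v: "v = (\<Sum>i\<in>UNIV. sc (a i) (h i))" using cartan_expand by blast
  have e: "(\<Sum>i\<in>UNIV. a i * of_int (e8_matrix $ i $ l)) = 0" if "l \<in> nil_nodes" for l
    using nil[OF that] by (simp add: v \<alpha>_sum \<alpha>_simps \<alpha>_h)
  have a3: "a 3 = - a 1" using e[of 1] by (simp add: sum_8 e8_matrix_def vector_8 d.two eq_neg_iff_add_eq_0 add.commute)
  have a4: "a 4 = - a 2" using e[of 2] by (simp add: sum_8 e8_matrix_def vector_8 d.two eq_neg_iff_add_eq_0 add.commute)
  have "- a 6 = a 5 + a 7" using e[of 6] by (simp add: sum_8 e8_matrix_def vector_8 d.two algebra_simps)
  from arg_cong[OF this, of uminus] have a6: "a 6 = - a 5 - a 7" by simp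
  have a8: "a 8 = - a 7" using e[of 8] by (simp add: sum_8 e8_matrix_def vector_8 d.two eq_neg_iff_add_eq_0 add.commute)
  \<comment> \<open>The four kernel equations express the coefficients at nodes 3, 4, 6, 8 by those
    at 1, 2, 5, 7, and each of the latter occurs in exactly one \<open>t i\<close>.\<close>
  define c :: "4 \<Rightarrow> 'k" where "c i = (if i = 1 then - a 1 else if i = 2 then - a 2 else if i = 3 then a 5 else - a 7)" for i
  have "\<tau> (\<Sum>i\<in>UNIV. sc4 (c i) (h4 i)) = v"
    unfolding tau_sum v
    by (simp add: sum_4 sum_8 c_def t_simps a3 a4 a6 a8 scale_right_distrib scale_right_diff_distrib scale_left_diff_distrib)
  then show ?thesis by blast
qed

section \<open>Chevalley generators of the semisimplification\<close>

definition E4 :: "4 \<Rightarrow> nat \<Rightarrow> 'k" where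
  "E4 i = shead (unit4 i)"

definition F4 :: "4 \<Rightarrow> nat \<Rightarrow> 'k" where
  "F4 i = scale J.S (of_int (sign4 i)) (shead (quad_scale (- 1) (unit4 i)))"

definition H4 :: "'w \<Rightarrow> nat \<Rightarrow> 'k" where
  "H4 w = J.ev (cvec (\<tau> w))"

lemma H4_kerd: "cvec (\<tau> w) \<in> d.kerd"
  by (rule cartan_kerd) (rule \<alpha>_nil_tau)

lemma scaleS: "scale J.S c x = (\<lambda>k. c * x k)"
  by (simp add: J.S_simps)

lemma sign4_cancel: "(of_int (sign4 i) :: 'k) * of_int (sign4 i) = 1"
  using sign4_square[of i] by (metis of_int_1 of_int_mult)

lemma shead_neg: "shead (quad_scale (- 1) (unit4 i)) = scale J.S (of_int (sign4 i)) (F4 i)"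
  by (simp add: F4_def sign4_cancel)

lemma EF4: "bracket J.S (E4 i) (F4 i) = H4 (h4 i)"
proof -
  have "bracket J.S (E4 i) (F4 i) = scale J.S (of_int (sign4 i)) (J.ev (cvec (coroot (vec8 (cartan4 i)))))"
    unfolding E4_def F4_def S.bracket_scale_right S_bracket_shead(1)[OF degree_unit4] super_cartan_unit4
    by (simp add: quad_odd_uminus)
  also have "\<dots> = J.ev (smult (of_int (sign4 i)) (cvec (coroot (vec8 (cartan4 i)))))"
    using J.ev_linear(2)[of "cvec (coroot (vec8 (cartan4 i)))" "of_int (sign4 i)"] by (simp add: scaleS)
  also have "smult (of_int (sign4 i)) (cvec (coroot (vec8 (cartan4 i)))) = cvec (\<tau> (h4 i))"
    by (simp add: tau(2) t_def)
  finally show ?thesis by (simp add: H4_def)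
qed

lemma H4_inj: "H4 w = 0 \<Longrightarrow> w = 0"
  unfolding H4_def using cartan_ev_inj[of "\<tau> w"] \<alpha>_nil_tau tau_inj by blast

lemma h4_nonzero: "h4 i \<noteq> 0"
  using R.independent_h R.dependent_zero[of "range h4"] by (metis rangeI)

text \<open>On the common kernel of the four simple roots a weight depends on the degree alone, so
  Cartan elements act on a whole graded piece by one scalar.\<close>

lemma weight_nil:
  assumes v: "\<And>l. l \<in> nil_nodes \<Longrightarrow> \<alpha> l v = 0"
  shows "weight g v = (\<Sum>j\<in>UNIV. of_int (qdeg g $ j) * \<alpha> (index8 j) v)"
  using v[of 1] v[of 2] v[of 6] v[of 8] by (simp add: weight_def sum_8 sum_4 index8_def qdeg_def)

lemma bracket_cvec: "x \<in> carrier root_algebra \<Longrightarrow> root_bracket (cvec v) x = (0, \<lambda>g. weight g v * snd x g)"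
proof (induction rule: root_algebra_induct)
  case (cartan u)
  then show ?case by (simp add: prod_eq_iff fun_eq_iff)
next
  case (root g)
  then show ?case by (auto simp: prod_eq_iff fun_eq_iff smult_def)
next
  case (add x y)
  then show ?case by (simp add: root_bracket_bilinear prod_eq_iff fun_eq_iff algebra_simps)
next
  case (scale c x)
  then have IH: "root_bracket (cvec v) x = (0, \<lambda>g. weight g v * snd x g)" by blast
  show ?case unfolding root_bracket_bilinear IH by (simp add: smult_def fun_eq_iff)
qed

lemma cartan_shead:
  assumes v: "\<And>l. l \<in> nil_nodes \<Longrightarrow> \<alpha> l v = 0" and q: "degree_quad q"
  shows "bracket J.S (J.ev (cvec v)) (shead q)
    = scale J.S (\<Sum>j\<in>UNIV. of_int (vec4 q $ j) * \<alpha> (index8 j) v) (shead q)"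
proof -
  let ?c = "\<Sum>j\<in>UNIV. of_int (vec4 q $ j) * \<alpha> (index8 j) v"
  have g: "head q \<in> gr (vec4 q)" and c: "head q \<in> carrier root_algebra"
    using head_gr[OF q] gr_carrier by blast+
  have nz: "vec4 q \<noteq> 0" using q by (simp add: degree_quad_def vec4_zero)
  have k: "cvec v \<in> d.kerd" by (rule cartan_kerd) (rule v)
  have wt: "weight g v = (\<Sum>j\<in>UNIV. of_int (qdeg g $ j) * \<alpha> (index8 j) v)" for g
    by (rule weight_nil) (rule v)
  have "weight g v * snd (head q) g = ?c * snd (head q) g" for g
    using g by (cases "qdeg g = vec4 q") (simp_all add: wt gr_def)
  then have b: "root_bracket (cvec v) (head q) = smult ?c (head q)"
    using g nz unfolding bracket_cvec[OF c] by (simp add: smult_def prod_eq_iff fun_eq_iff gr_def)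
  have br: "bracket root_algebra = root_bracket" "scale root_algebra = smult" by simp_all
  show ?thesis
  proof (cases "quad_odd q")
    case True
    then show ?thesis using J.od_bracket(1)[OF k head_kerdd[OF q]] J.od_linear(2)[OF c, of ?c]
      unfolding br b by (simp add: shead_def scaleS)
  next
    case False
    then show ?thesis using J.ev_bracket[OF k head_kerd[OF q]] J.ev_linear(2)[OF c, of ?c]
      unfolding br b by (simp add: shead_def scaleS)
  qed
qed

lemma H4_shead: "degree_quad q \<Longrightarrow> bracket J.S (J.ev (cvec (\<tau> w))) (shead q)
    = scale J.S (\<Sum>j\<in>UNIV. of_int (vec4 q $ j) * \<alpha>4 j w) (shead q)"
  unfolding \<alpha>_tau[symmetric] by (rule cartan_shead) (rule \<alpha>_nil_tau)

lemma HE4: "bracket J.S (H4 w) (E4 i) = scale J.S (\<alpha>4 i w) (E4 i)"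
  unfolding H4_def E4_def H4_shead[OF degree_unit4(1)] vec4_unit
  by (simp add: axis_def if_distrib[of of_int] if_distrib[of "\<lambda>x. x * _"] cong: if_cong)

lemma HF4: "bracket J.S (H4 w) (F4 i) = - scale J.S (\<alpha>4 i w) (F4 i)"
proof -
  have "(\<Sum>j\<in>UNIV. of_int (vec4 (quad_scale (- 1) (unit4 i)) $ j) * \<alpha>4 j w) = - \<alpha>4 i w"
    unfolding vec4_uminus vec4_unit
    by (simp add: axis_def sum_negf if_distrib[of of_int] if_distrib[of "\<lambda>x. x * _"] cong: if_cong)
  then show ?thesis
    unfolding H4_def F4_def S.bracket_scale_right H4_shead[OF degree_unit4(2)]
    by (simp add: S.scale_left_commute)
qed

lemma shead_part: "degree_quad q \<Longrightarrow> shead q \<in> part J.S (if quad_odd q then 1 else 0)"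
  using head_kerd[of q] head_kerdd[of q] unfolding shead_def
  by (cases "quad_odd q") (simp_all add: J.part_S_even J.part_S_odd)

text \<open>The bracket is, up to sign, the image of \<open>h4 i\<close>, which is nonzero as
  \<open>H4\<close> is injective. This covers the simple degrees, which are absent from the
  table.\<close>

lemma shead_opposite: "bracket J.S (shead (unit4 i)) (shead (quad_scale (- 1) (unit4 i))) \<noteq> 0"
    "bracket J.S (shead (quad_scale (- 1) (unit4 i))) (shead (unit4 i)) \<noteq> 0"
proof -
  show 1: "bracket J.S (shead (unit4 i)) (shead (quad_scale (- 1) (unit4 i))) \<noteq> 0"
  proof
    assume "bracket J.S (shead (unit4 i)) (shead (quad_scale (- 1) (unit4 i))) = 0"
    then have "H4 (h4 i) = 0" unfolding EF4[symmetric] by (simp add: E4_def F4_def S.bracket_scale_right)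
    then show False using H4_inj h4_nonzero by blast
  qed
  show "bracket J.S (shead (quad_scale (- 1) (unit4 i))) (shead (unit4 i)) \<noteq> 0"
  proof
    assume "bracket J.S (shead (quad_scale (- 1) (unit4 i))) (shead (unit4 i)) = 0"
    then show False using S.antisymmetry[OF shead_part[OF degree_unit4(1)] shead_part[OF degree_unit4(2)], of i i] 1 by simp
  qed
qed

text \<open>The table in a form that treats both signs at once: \<open>p\<close> is a neighbour from
  which \<open>q\<close> is reached, and \<open>j\<close> a simple degree by which \<open>q\<close>
  can be lowered.\<close>

lemma degree_cases:
  assumes q: "degree_quad q"
  obtains (unit) i s where "s = 1 \<or> s = - 1" "q = quad_scale s (unit4 i)"
    | (step) i j s p where "s = 1 \<or> s = - 1" "degree_quad p" "quad_height p < quad_height q"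
      "super_nonzero (quad_scale s (unit4 i)) p" "quad_add (quad_scale s (unit4 i)) p = q"
      "degree_quad (quad_add (quad_scale (- s) (unit4 j)) q)" "quad_height (quad_add (quad_scale (- s) (unit4 j)) q) < quad_height q"
      "super_nonzero (quad_scale (- s) (unit4 j)) q"
proof -
  have com: "quad_add x y = quad_add y x" for x y by (cases x; cases y) simp
  have inv: "quad_add (quad_scale s u) (quad_add x (quad_scale (- s) u)) = x" for s u x by (cases x; cases u) simp
  have one: "quad_scale 1 x = x" "quad_scale (- 1) (quad_scale (- 1) x) = x" for x by (cases x; simp)+
  obtain s q' where s: "s = 1 \<or> s = - 1" "q = quad_scale s q'" "q' \<in> set positive_degrees"
    using known_degree[OF q] one unfolding known_degree_def by metis
  then consider "q' \<in> set quad_units" | i j where "(q', i, j) \<in> set degree_table"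
    unfolding positive_degrees_def by auto
  then show thesis
  proof cases
    case 1
    then show thesis using unit s quad_units_unit4 by blast
  next
    case (2 i j)
    then have c: "check_degree s (q', i, j)"
      using s(1) check_positive check_negative unfolding list_all_iff by blast
    then obtain a b where a: "\<And>s. quad_unit i s = quad_scale s (unit4 a)" and b: "\<And>s. quad_unit j s = quad_scale s (unit4 b)"
      using quad_unit_unit4[of i] quad_unit_unit4[of j] unfolding check_degree.simps by blast
    show thesis
      using c unfolding check_degree.simps check_at.simps a b s(2)[symmetric]
      by (intro step[of s "quad_add q (quad_scale (- s) (unit4 a))" a b]) (use s(1) in \<open>simp_all add: inv com[of "quad_scale (- s) (unit4 b)" q]\<close>)
  qed
qed

lemma unit4_scale:
  assumes "s = 1 \<or> s = - 1"
  shows "degree_quad (quad_scale s (unit4 i))"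
proof -
  have "quad_scale 1 (unit4 i) = unit4 i" by (cases "unit4 i") simp
  then show ?thesis using assms degree_unit4[of i] by auto
qed

text \<open>Induction on the height. The bracket of a simple line with the line below is a nonzero
  multiple of \<open>shead q\<close>, so the scalar can be inverted.\<close>

lemma shead_generated:
  assumes T: "S.subspace T" and closed: "\<And>x y. x \<in> T \<Longrightarrow> y \<in> T \<Longrightarrow> bracket J.S x y \<in> T"
    and E: "range E4 \<subseteq> T" and F: "range F4 \<subseteq> T"
  shows "degree_quad q \<Longrightarrow> shead q \<in> T"
proof (induction "nat (quad_height q)" arbitrary: q rule: less_induct)
  case less
  have u: "shead (quad_scale s (unit4 i)) \<in> T" if "s = 1 \<or> s = - 1" for s i
  proof -
    have "quad_scale 1 (unit4 i) = unit4 i" by (cases "unit4 i") simp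
    moreover have "shead (unit4 i) \<in> T" using E by (auto simp: E4_def)
    moreover have "shead (quad_scale (- 1) (unit4 i)) \<in> T"
      unfolding shead_neg using F S.subspace_scale[OF T] by blast
    ultimately show ?thesis using that by auto
  qed
  from less.prems show ?case
  proof (cases rule: degree_cases)
    case (unit i s)
    then show ?thesis using u by simp
  next
    case (step i j s p)
    have "nat (quad_height p) < nat (quad_height q)" using step(3) quad_height_nonneg[of p] by simp
    then have "shead p \<in> T" using less.hyps step(2) by blast
    then have b: "bracket J.S (shead (quad_scale s (unit4 i))) (shead p) \<in> T" using closed u step(1) by blast
    obtain c where c: "c \<noteq> 0" "bracket J.S (shead (quad_scale s (unit4 i))) (shead p) = (\<lambda>k. c * shead q k)"
      using super_nonzero_bracket[OF unit4_scale[OF step(1)] step(2) _ step(4)] less.prems unfolding step(5) by blast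
    have "shead q = scale J.S (inverse c) (\<lambda>k. c * shead q k)" using c(1) by (simp add: scaleS mult.assoc[symmetric])
    then show ?thesis using b unfolding c(2) using S.subspace_scale[OF T] by metis
  qed
qed

text \<open>Lowering a simple degree leads to degree 0 and uses \<open>shead_opposite\<close>; in
  all other degrees the second half of the table applies.\<close>

lemma shead_descent:
  assumes q: "degree_quad q"
  shows "\<exists>i s. (s = 1 \<or> s = - 1) \<and> bracket J.S (shead (quad_scale s (unit4 i))) (shead q) \<noteq> 0 \<and>
    quad_height (quad_add (quad_scale s (unit4 i)) q) < quad_height q"
  using q
proof (cases rule: degree_cases)
  case (unit i s)
  have 1: "quad_scale 1 (unit4 i) = unit4 i" by (cases "unit4 i") simp
  have "quad_height (quad_add (quad_scale (- s) (unit4 i)) q) < quad_height q"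
    using unit exhaust_4[of i] by (auto simp: unit4_def)
  moreover have "bracket J.S (shead (quad_scale (- s) (unit4 i))) (shead q) \<noteq> 0"
    using unit shead_opposite[of i] 1 by auto
  ultimately show ?thesis using unit(1) by (intro exI[of _ i] exI[of _ "- s"]) auto
next
  case (step i j s p)
  have s: "- s = 1 \<or> - s = - 1" using step(1) by auto
  obtain c where c: "c \<noteq> 0" "bracket J.S (shead (quad_scale (- s) (unit4 j))) (shead q)
      = (\<lambda>k. c * shead (quad_add (quad_scale (- s) (unit4 j)) q) k)"
    using super_nonzero_bracket[OF unit4_scale[OF s] q step(6) step(8)] by blast
  have "(\<lambda>k. c * shead (quad_add (quad_scale (- s) (unit4 j)) q) k) \<noteq> 0"
    using shead_nonzero[OF step(6)] c(1) by (auto simp: fun_eq_iff)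
  then show ?thesis using c(2) s step(7) by (intro exI[of _ j] exI[of _ "- s"]) auto
qed

lemma G_nonzero_cases:
  assumes x: "x \<in> G q" and q: "q \<noteq> 0"
  obtains "x = 0" | p c where "q = vec4 p" "degree_quad p" "x = scale J.S c (shead p)"
proof -
  obtain p where p: "q = vec4 p" using vec4_surj by blast
  then have nz: "p \<noteq> Quad 0 0 0 0" using q by (simp add: vec4_zero)
  show thesis
  proof (cases "degree_quad p")
    case True
    then show thesis using G_degree[OF True] x that(2)[OF p True] unfolding p scaleS by blast
  next
    case False
    then show thesis using G_not_degree[OF nz False] x that(1) unfolding p by blast
  qed
qed

lemma G_descent:
  assumes x: "x \<in> G q" "x \<noteq> 0" "q \<noteq> 0"
  shows "\<exists>i. bracket J.S (E4 i) x \<noteq> 0 \<and> abs_height (q + axis i 1) < abs_height q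
    \<or> bracket J.S (F4 i) x \<noteq> 0 \<and> abs_height (q - axis i 1) < abs_height q"
  using x(1,3)
proof (cases rule: G_nonzero_cases)
  case 1
  then show ?thesis using x by simp
next
  case (2 p c)
  have c: "c \<noteq> 0" using x(2) 2(3) by auto
  obtain i s where s: "s = 1 \<or> s = - 1" and b: "bracket J.S (shead (quad_scale s (unit4 i))) (shead p) \<noteq> 0"
    and ht: "quad_height (quad_add (quad_scale s (unit4 i)) p) < quad_height p"
    using shead_descent[OF 2(2)] by blast
  have 1: "quad_scale 1 (unit4 i) = unit4 i" by (cases "unit4 i") simp
  have a: "abs_height (vec4 (quad_scale s (unit4 i)) + q) < abs_height q"
    unfolding 2(1) vec4_add[symmetric] abs_height_vec4
    using ht quad_height_nonneg[of "quad_add (quad_scale s (unit4 i)) p"] by simp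
  have bx: "bracket J.S (shead (quad_scale s (unit4 i))) x \<noteq> 0"
    using b c by (simp add: 2(3) S.bracket_scale_right)
  from s show ?thesis
  proof
    assume s: "s = 1"
    show ?thesis using a bx unfolding s 1 vec4_unit by (intro exI[of _ i]) (simp add: E4_def add.commute)
  next
    assume s: "s = - 1"
    have "bracket J.S (F4 i) x \<noteq> 0"
      using bx unfolding s shead_neg by (auto simp: S.bracket_scale_left)
    then show ?thesis using a unfolding s vec4_uminus vec4_unit by (intro exI[of _ i]) (simp add: add.commute)
  qed
qed

lemma G_subset:
  assumes T: "S.subspace T" and closed: "\<And>x y. x \<in> T \<Longrightarrow> y \<in> T \<Longrightarrow> bracket J.S x y \<in> T"
    and E: "range E4 \<subseteq> T" and F: "range F4 \<subseteq> T" and H: "range H4 \<subseteq> T"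
  shows "G q \<subseteq> T"
proof
  fix x assume x: "x \<in> G q"
  show "x \<in> T"
  proof (cases "q = 0")
    case True
    then obtain v where v: "\<And>l. l \<in> nil_nodes \<Longrightarrow> \<alpha> l v = 0" "x = J.ev (cvec v)" using x G_zero by blast
    then obtain w where "v = \<tau> w" using tau_surj by blast
    then show ?thesis using v(2) H by (auto simp: H4_def)
  next
    case False
    from x False show ?thesis
    proof (cases rule: G_nonzero_cases)
      case 1
      then show ?thesis using S.subspace_0[OF T] by simp
    next
      case (2 p c)
      then show ?thesis using shead_generated[OF T closed E F 2(2)] S.subspace_scale[OF T] by simp
    qed
  qed
qed

lemma scale_part: "x \<in> part J.S p \<Longrightarrow> scale J.S c x \<in> part J.S p"
  using S.part_subspace[of p] unfolding subspace_of_def by blast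

theorem g36_model: "contragredient_model J.S g36_parity sc4 h4 \<alpha>4 E4 F4 H4 G"
proof (intro contragredient_model.intro contragredient_model_axioms.intro S.lie_superalgebra_axioms)
  show "H4 (u + v) = H4 u + H4 v" for u v by (simp add: H4_def tau.add J.ev_linear)
  show "H4 (sc4 c v) = scale J.S c (H4 v)" for c v
    using J.ev_linear(2)[of "cvec (\<tau> v)" c] by (simp add: H4_def tau.scale scaleS)
  show "H4 v = 0 \<Longrightarrow> v = 0" for v by (rule H4_inj)
  show "E4 i \<in> part J.S (g36_parity i)" for i
    unfolding E4_def quad_odd_unit4 by (rule shead_part[OF degree_unit4(1)])
  show "F4 i \<in> part J.S (g36_parity i)" for i
    unfolding F4_def quad_odd_unit4 using scale_part shead_part[OF degree_unit4(2), of i] unfolding quad_odd_uminus by blast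
  show "H4 v \<in> part J.S 0" for v unfolding H4_def J.part_S_even using H4_kerd by blast
  show "bracket J.S (E4 i) (F4 i) = H4 (h4 i)" for i by (rule EF4)
  show "bracket J.S (E4 i) (F4 j) = 0" if "i \<noteq> j" for i j
  proof -
    \<comment> \<open>The difference of two distinct simple degrees is nonzero and not the degree of
      a root, so the bracket lands in a zero piece.\<close>
    have "bracket J.S (shead (unit4 i)) (shead (quad_scale (- 1) (unit4 j))) \<in> G (vec4 (quad_add (unit4 i) (quad_scale (- 1) (unit4 j))))"
      unfolding vec4_add by (intro G_bracket shead_G degree_unit4)
    then have "bracket J.S (shead (unit4 i)) (shead (quad_scale (- 1) (unit4 j))) = 0"
      using G_not_degree degree_unit4_difference[OF that] by blast
    then show ?thesis by (simp add: E4_def F4_def S.bracket_scale_right)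
  qed
  show "bracket J.S (H4 v) (E4 i) = scale J.S (\<alpha>4 i v) (E4 i)" for i v by (rule HE4)
  show "bracket J.S (H4 v) (F4 i) = - scale J.S (\<alpha>4 i v) (F4 i)" for i v by (rule HF4)
  show "bracket J.S (H4 u) (H4 v) = 0" for u v
    using J.ev_bracket[OF H4_kerd H4_kerd, of u v] by (simp add: H4_def)
  show "S.subspace (G q)" for q by (rule G_subspace)
  show "E4 i \<in> G (axis i 1)" for i using shead_G[OF degree_unit4(1), of i] by (simp add: E4_def vec4_unit)
  show "F4 i \<in> G (- axis i 1)" for i
    using S.subspace_scale[OF G_subspace shead_G[OF degree_unit4(2), of i]] by (simp add: F4_def vec4_uminus vec4_unit)
  show "H4 v \<in> G 0" for v unfolding H4_def by (rule G_ev[OF cvec_gr H4_kerd])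
  show "x \<in> G p \<Longrightarrow> y \<in> G q \<Longrightarrow> bracket J.S x y \<in> G (p + q)" for x y p q by (rule G_bracket)
  show "finite Q \<Longrightarrow> (\<And>q. q \<in> Q \<Longrightarrow> g q \<in> G q) \<Longrightarrow> (\<Sum>q\<in>Q. g q) = 0 \<Longrightarrow> q \<in> Q \<Longrightarrow> g q = 0" for Q g q
    by (rule G_independent)
  show "G 0 \<subseteq> range H4"
  proof
    fix x assume "x \<in> G 0"
    then obtain v where v: "\<And>l. l \<in> nil_nodes \<Longrightarrow> \<alpha> l v = 0" "x = J.ev (cvec v)" using G_zero by blast
    then obtain w where "v = \<tau> w" using tau_surj by blast
    then show "x \<in> range H4" using v(2) by (auto simp: H4_def)
  qed
  show "carrier J.S \<subseteq> T" if "S.subspace T" "\<And>x y. x \<in> T \<Longrightarrow> y \<in> T \<Longrightarrow> bracket J.S x y \<in> T"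
      "range E4 \<subseteq> T" "range F4 \<subseteq> T" "range H4 \<subseteq> T" for T
    by (rule carrier_G[OF that(1)]) (rule G_subset[OF that])
  show "x \<in> G q \<Longrightarrow> x \<noteq> 0 \<Longrightarrow> q \<noteq> 0 \<Longrightarrow> \<exists>i. bracket J.S (E4 i) x \<noteq> 0 \<and> abs_height (q + axis i 1) < abs_height q
    \<or> bracket J.S (F4 i) x \<noteq> 0 \<and> abs_height (q - axis i 1) < abs_height q" for x q
    by (rule G_descent)
qed

end

section \<open>Assembly of the isomorphism\<close>

lemma part_contragredient: "part (contragredient par sc h \<alpha>) p \<subseteq> carrier (contragredient par sc h \<alpha>)"
  by (auto simp: contragredient_def gtilde_def quotient_def free_superalgebra_def)

context e8_realization
begin

lemma bracket_nilp: "bracket root_algebra nilp = dd"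
  by (simp add: fun_eq_iff dd_def)

lemma alpha3_root_algebra: "alpha3_algebra root_algebra dd"
proof -
  have "\<exists>vs. is_basis root_algebra vs"
    using jordan_decomposition_exists unfolding jordan_decomposition_def by blast
  then show ?thesis
    unfolding alpha3_algebra_def using d.even d.d_closed d.d_add d.d_scale d.derivation d.d_cube
    by (simp only: L.add_M L.zero_M) blast
qed

end

theorem theorem4p6p4:
  fixes sc8 :: "'k::alg_closed_field \<Rightarrow> 'v::ab_group_add \<Rightarrow> 'v"
    and h8 :: "8 \<Rightarrow> 'v" and \<alpha>8 :: "8 \<Rightarrow> 'v \<Rightarrow> 'k"
    and sc4 :: "'k \<Rightarrow> 'w::ab_group_add \<Rightarrow> 'w"
    and h4 :: "4 \<Rightarrow> 'w" and \<alpha>4 :: "4 \<Rightarrow> 'w \<Rightarrow> 'k"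
  assumes "CHAR('k) = 3"
    and "realization sc8 e8_matrix h8 \<alpha>8"
    and "realization sc4 g36_matrix h4 \<alpha>4"
  shows "let e8 = contragredient e8_parity sc8 h8 \<alpha>8;
             g36 = contragredient g36_parity sc4 h4 \<alpha>4;
             e = e_gen e8_parity sc8 h8 \<alpha>8;
             d = bracket e8 (e 1 \<oplus>\<^bsub>e8\<^esub> e 2 \<oplus>\<^bsub>e8\<^esub> e 6 \<oplus>\<^bsub>e8\<^esub> e 8)
         in alpha3_algebra e8 d \<and>
            (\<exists>xs ys zs. jordan_decomposition e8 d xs ys zs) \<and>
            (\<forall>xs ys zs. jordan_decomposition e8 d xs ys zs \<longrightarrow>
               superalgebra_isomorphic (semisimplification e8 d xs ys zs) g36)"
proof -
  interpret R: e8_realization sc8 h8 \<alpha>8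
    using assms by (simp add: e8_realization_def e8_realization_axioms_def)
  have par: "(\<lambda>_. 0) = e8_parity" by (simp add: fun_eq_iff e8_parity_def)
  define A where "A = contragredient e8_parity sc8 h8 \<alpha>8"
  define B where "B = contragredient g36_parity sc4 h4 \<alpha>4"
  define E where "E = e_gen e8_parity sc8 h8 \<alpha>8"
  obtain \<phi> where \<phi>: "superalgebra_morphism_iso A R.root_algebra \<phi>"
    and E: "\<And>i. E i \<in> carrier A" "\<And>i. \<phi> (E i) = R.rvec (axis i 1)"
    using contragredient_model.contragredient_iso[OF R.root_model] unfolding par A_def E_def by blast
  let ?e = "E 1 \<oplus>\<^bsub>A\<^esub> E 2 \<oplus>\<^bsub>A\<^esub> E 6 \<oplus>\<^bsub>A\<^esub> E 8"
  have add: "x \<oplus>\<^bsub>A\<^esub> y \<in> carrier A" "\<phi> (x \<oplus>\<^bsub>A\<^esub> y) = \<phi> x + \<phi> y"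
    if "x \<in> carrier A" "y \<in> carrier A" for x y
    using \<phi> that by (auto simp: superalgebra_morphism_iso_def superalgebra_iso_def)
  interpret T: iso_pair A R.root_algebra \<phi> ?e R.nilp
  proof
    show "superalgebra_morphism_iso A R.root_algebra \<phi>" by (rule \<phi>)
    show "?e \<in> carrier A" "\<phi> ?e = R.nilp" by (simp_all add: add E R.nilp_def add.assoc)
  qed
  let ?d = "bracket A ?e"
  have part: "part A 0 = carrier A"
  proof -
    \<comment> \<open>That the contragredient algebra is purely even is read off from the root
      algebra through the parity-preserving isomorphism.\<close>
    have "\<phi> ` part A 0 = part R.root_algebra 0" "\<phi> ` carrier A = carrier R.root_algebra" "inj_on \<phi> (carrier A)"
      using \<phi> by (auto simp: superalgebra_morphism_iso_def superalgebra_iso_def bij_betw_def)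
    then show ?thesis
      using R.d.even part_contragredient[of e8_parity sc8 h8 \<alpha>8 0]
        inj_on_image_eq_iff[of \<phi> "carrier A" "part A 0" "carrier A"] by (simp add: A_def)
  qed
  have alpha3: "alpha3_algebra A ?d"
    by (rule T.alpha3_transport[OF part]) (simp only: R.bracket_nilp R.alpha3_root_algebra)
  have exists: "\<exists>xs ys zs. jordan_decomposition A ?d xs ys zs"
    using R.jordan_decomposition_exists T.jordan_exists_transport unfolding R.bracket_nilp by blast
  have iso: "superalgebra_isomorphic (semisimplification A ?d xs ys zs) B"
    if J: "jordan_decomposition A ?d xs ys zs" for xs ys zs
  proof -
    have c: "set xs \<subseteq> carrier A" "set ys \<subseteq> carrier A" "set zs \<subseteq> carrier A"
      using J by (auto simp: jordan_decomposition_def is_basis_def jordan_basis_def)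
    \<comment> \<open>The arbitrary decomposition is carried over to the root algebra, and the model
      of g(3,6) is built on its image.\<close>
    have J': "jordan_decomposition R.root_algebra R.dd (map \<phi> xs) (map \<phi> ys) (map \<phi> zs)"
      using T.jordan_transport[OF c] J unfolding R.bracket_nilp by blast
    interpret M: e8_g36 sc8 h8 \<alpha>8 "map \<phi> xs" "map \<phi> ys" "map \<phi> zs" sc4 h4 \<alpha>4
      by (intro e8_g36.intro e8_jordan.intro R.e8_realization_axioms jordan_lie.intro
          R.d.alpha3_lie_axioms jordan_lie_axioms.intro J' assms(3))
    obtain \<psi> where "superalgebra_morphism_iso B M.J.S \<psi>"
      using contragredient_model.contragredient_iso[OF M.g36_model] unfolding B_def by blast
    then have "superalgebra_isomorphic M.J.S B"
      by (rule superalgebra_iso_sym) (simp add: B_def part_contragredient)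
    \<comment> \<open>Both decompositions have literally the same semisimplification, so no further
      isomorphism has to be composed.\<close>
    then show ?thesis using T.semisimplification_transport[OF c] unfolding R.bracket_nilp by simp
  qed
  show ?thesis
    unfolding Let_def A_def[symmetric] B_def[symmetric] E_def[symmetric]
    using alpha3 exists iso by blast
qed

end
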